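(* Let $1<p<\infty$ and let $\omega,\nu$ be radial weights such that either $\omega\in\widehat{\mathcal{D}}$ or $\nu\in\widehat{\mathcal{D}}$. Then $P^+_\omega:L^p_\nu\to L^p_\nu$ is bounded if and only if $M_p(\omega,\nu)<\infty$ and $\omega,\nu\in\mathcal{D}$. Moreover, $$M_p(\omega,\nu)\lesssim\|P^+_\omega\|_{L^p_\nu\to L^p_\nu}\lesssim M_p^{2-\frac1p}(\omega,\nu).$$
   Context: $\mathbb{D}$ is the open unit disc of $\mathbb{C}$ and $dA(z)=\frac{dx\,dy}{\pi}$. A radial weight is a nonnegative function $\omega\in L^1([0,1))$ extended to $\mathbb{D}$ by $\omega(z)=\omega(|z|)$; it is assumed throughout that $\widehat{\omega}(z)=\int_{|z|}^1\omega(s)\,ds>0$ for all $z\in\mathbb{D}$ (likewise for $\nu$). Write $\omega_x=\int_0^1r^x\omega(r)\,dr$ for $x\ge0$. Classes of radial weights: $\omega\in\widehat{\mathcal{D}}$ if there is a constant $C=C(\omega)\ge1$ with $\widehat{\omega}(r)\le C\widehat{\omega}\left(\frac{1+r}{2}\right)$ for all $0\le r<1$; $\omega\in\check{\mathcal{D}}$ if there are constants $K=K(\omega)>1$ and $C=C(\omega)>1$ with $\widehat{\omega}(r)\ge C\widehat{\omega}\left(1-\frac{1-r}{K}\right)$ for all $0\le r<1$; $\mathcal{D}=\widehat{\mathcal{D}}\cap\check{\mathcal{D}}$. $L^p_\nu$ is the space of measurable functions $f$ on $\mathbb{D}$ with $\|f\|_{L^p_\nu}^p=\int_{\mathbb{D}}|f(z)|^p\nu(z)\,dA(z)<\infty$.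 The maximal Bergman projection is $P^+_\omega(f)(z)=\int_{\mathbb{D}}f(\zeta)|B^\omega_z(\zeta)|\,\omega(\zeta)\,dA(\zeta)$, where $B^\omega_z(\zeta)=\sum_{n=0}^\infty\frac{(\overline{z}\zeta)^n}{2\omega_{2n+1}}$ are the reproducing kernels of the weighted Bergman space $A^2_\omega$ of analytic functions in $L^2_\omega$. $p'$ is the conjugate exponent, $\frac1p+\frac1{p'}=1$. Let $\sigma(r)=\sigma_{p,\omega,\nu}(r)=r\left(\frac{\omega(r)}{\nu(r)^{1/p}}\right)^{p'}$ for $0\le r<1$, $\widehat{\sigma}(r)=\int_r^1\sigma(s)\,ds$, and $$M_p(\omega,\nu)=\sup_{0<r<1}\left(\int_0^r\frac{\nu(s)}{\widehat{\omega}(s)^p}\,s\,ds+1\right)^{\frac1p}\widehat{\sigma}(r)^{\frac1{p'}}.$$ The notation $a\lesssim b$ means that there exists a constant $C>0$ such that $a\le Cb$. *)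

theory Defs
  imports "HOL-Analysis.Analysis"
begin

text \<open>A radial weight is represented by its profile on \<open>[0,1)\<close>; the values of the profile outside
  \<open>[0,1)\<close> are never used, and the weight on the disc is \<open>z \<mapsto> \<omega> (cmod z)\<close>.\<close>

definition tail :: "(real \<Rightarrow> real) \<Rightarrow> real \<Rightarrow> real" where
  "tail \<omega> r = (LINT s:{r..<1}|lebesgue. \<omega> s)"

definition radial_weight :: "(real \<Rightarrow> real) \<Rightarrow> bool" where
  "radial_weight \<omega> \<longleftrightarrow>
     (\<forall>r\<in>{0..<1}. 0 \<le> \<omega> r) \<and> set_integrable lebesgue {0..<1} \<omega> \<and> (\<forall>r\<in>{0..<1}. 0 < tail \<omega> r)"

definition moment :: "(real \<Rightarrow> real) \<Rightarrow> real \<Rightarrow> real" where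
  "moment \<omega> x = (LINT r:{0..<1}|lebesgue. r powr x * \<omega> r)"

definition upper_doubling_with :: "real \<Rightarrow> (real \<Rightarrow> real) \<Rightarrow> bool" where
  "upper_doubling_with C \<omega> \<longleftrightarrow> 1 \<le> C \<and> (\<forall>r\<in>{0..<1}. tail \<omega> r \<le> C * tail \<omega> ((1 + r) / 2))"

definition lower_doubling_with :: "real \<Rightarrow> real \<Rightarrow> (real \<Rightarrow> real) \<Rightarrow> bool" where
  "lower_doubling_with K C \<omega> \<longleftrightarrow>
     1 < K \<and> 1 < C \<and> (\<forall>r\<in>{0..<1}. C * tail \<omega> (1 - (1 - r) / K) \<le> tail \<omega> r)"

definition D_hat :: "(real \<Rightarrow> real) set" where
  "D_hat = {\<omega>. radial_weight \<omega> \<and> (\<exists>C. upper_doubling_with C \<omega>)}"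

definition D_check :: "(real \<Rightarrow> real) set" where
  "D_check = {\<omega>. radial_weight \<omega> \<and> (\<exists>K C. lower_doubling_with K C \<omega>)}"

definition D_class :: "(real \<Rightarrow> real) set" where
  "D_class = D_hat \<inter> D_check"

definition disc_area :: "complex measure" where
  "disc_area = scale_measure (ennreal (1 / pi)) (lebesgue_on (ball 0 1))"

text \<open>Powers of extended nonnegative reals, meant for exponents \<open>a > 0\<close>.\<close>

definition epowr :: "ennreal \<Rightarrow> real \<Rightarrow> ennreal" where
  "epowr x a = (if x = top then top else ennreal (enn2real x powr a))"

definition Lp_norm :: "real \<Rightarrow> (real \<Rightarrow> real) \<Rightarrow> (complex \<Rightarrow> complex) \<Rightarrow> ennreal" where
  "Lp_norm p \<nu> f = epowr (\<integral>\<^sup>+z. ennreal (cmod (f z) powr p * \<nu> (cmod z)) \<partial>disc_area) (1 / p)"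

definition Lp_space :: "real \<Rightarrow> (real \<Rightarrow> real) \<Rightarrow> (complex \<Rightarrow> complex) set" where
  "Lp_space p \<nu> = {f \<in> borel_measurable disc_area. Lp_norm p \<nu> f < top}"

definition bergman_kernel :: "(real \<Rightarrow> real) \<Rightarrow> complex \<Rightarrow> complex \<Rightarrow> complex" where
  "bergman_kernel \<omega> z \<zeta> = (\<Sum>n. (cnj z * \<zeta>) ^ n / of_real (2 * moment \<omega> (2 * real n + 1)))"

definition max_bergman_integrand ::
    "(real \<Rightarrow> real) \<Rightarrow> (complex \<Rightarrow> complex) \<Rightarrow> complex \<Rightarrow> complex \<Rightarrow> complex" where
  "max_bergman_integrand \<omega> f z \<zeta> = f \<zeta> * of_real (cmod (bergman_kernel \<omega> z \<zeta>) * \<omega> (cmod \<zeta>))"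

definition max_bergman :: "(real \<Rightarrow> real) \<Rightarrow> (complex \<Rightarrow> complex) \<Rightarrow> complex \<Rightarrow> complex" where
  "max_bergman \<omega> f z = (\<integral>\<zeta>. max_bergman_integrand \<omega> f z \<zeta> \<partial>disc_area)"

text \<open>The Bochner integral of a non-integrable function is \<open>0\<close>, so convergence of the defining
  integral, for almost every \<open>z\<close> with respect to \<open>\<nu> dA\<close>, has to be part of boundedness.\<close>

definition max_bergman_bounded_by ::
    "real \<Rightarrow> (real \<Rightarrow> real) \<Rightarrow> (real \<Rightarrow> real) \<Rightarrow> real \<Rightarrow> bool" where
  "max_bergman_bounded_by p \<omega> \<nu> C \<longleftrightarrow>
     0 \<le> C \<and>
     (\<forall>f\<in>Lp_space p \<nu>.
        (AE z in disc_area. 0 < \<nu> (cmod z) \<longrightarrow> integrable disc_area (max_bergman_integrand \<omega> f z)) \<and>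
        max_bergman \<omega> f \<in> Lp_space p \<nu> \<and>
        Lp_norm p \<nu> (max_bergman \<omega> f) \<le> ennreal C * Lp_norm p \<nu> f)"

definition max_bergman_bounded :: "real \<Rightarrow> (real \<Rightarrow> real) \<Rightarrow> (real \<Rightarrow> real) \<Rightarrow> bool" where
  "max_bergman_bounded p \<omega> \<nu> \<longleftrightarrow> (\<exists>C. max_bergman_bounded_by p \<omega> \<nu> C)"

text \<open>The operator norm; it is \<open>top\<close> (infimum of the empty set) if the operator is unbounded.\<close>

definition max_bergman_norm :: "real \<Rightarrow> (real \<Rightarrow> real) \<Rightarrow> (real \<Rightarrow> real) \<Rightarrow> ennreal" where
  "max_bergman_norm p \<omega> \<nu> = (INF C\<in>{C. max_bergman_bounded_by p \<omega> \<nu> C}. ennreal C)"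

definition conj_exp :: "real \<Rightarrow> real" where
  "conj_exp p = p / (p - 1)"

text \<open>The quotient is taken in \<open>ennreal\<close>, since \<open>\<nu>\<close> may vanish: there \<open>a / 0 = top\<close> for \<open>a > 0\<close>
  and \<open>0 / 0 = 0\<close>, whereas real division would give \<open>\<omega> / 0 = 0\<close>.\<close>

definition sigma_wt :: "real \<Rightarrow> (real \<Rightarrow> real) \<Rightarrow> (real \<Rightarrow> real) \<Rightarrow> real \<Rightarrow> ennreal" where
  "sigma_wt p \<omega> \<nu> r =
     ennreal r * epowr (ennreal (\<omega> r) / ennreal (\<nu> r powr (1 / p))) (conj_exp p)"

definition sigma_tail :: "real \<Rightarrow> (real \<Rightarrow> real) \<Rightarrow> (real \<Rightarrow> real) \<Rightarrow> real \<Rightarrow> ennreal" where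
  "sigma_tail p \<omega> \<nu> r = (\<integral>\<^sup>+s\<in>{r..<1}. sigma_wt p \<omega> \<nu> s \<partial>lebesgue)"

definition M_const :: "real \<Rightarrow> (real \<Rightarrow> real) \<Rightarrow> (real \<Rightarrow> real) \<Rightarrow> ennreal" where
  "M_const p \<omega> \<nu> =
     (SUP r\<in>{0<..<1}.
        epowr ((\<integral>\<^sup>+s\<in>{0..r}. ennreal (\<nu> s / tail \<omega> s powr p * s) \<partial>lebesgue) + 1) (1 / p)
        * epowr (sigma_tail p \<omega> \<nu> r) (1 / conj_exp p))"

text \<open>\<open>\<omega> \<in> D_class\<close> with prescribed constants and prescribed \<open>tail \<omega> 0\<close>. The implied constants in
  the norm estimate depend on the weights only through these data. A dependence on the
  masses cannot be avoided: multiplying \<open>\<omega>\<close> by a scalar does not change the operator, but it changes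
  \<open>M_const\<close>, because of the summand \<open>1\<close>.\<close>

definition D_class_with :: "real \<Rightarrow> real \<Rightarrow> real \<Rightarrow> real \<Rightarrow> (real \<Rightarrow> real) \<Rightarrow> bool" where
  "D_class_with C K L m \<omega> \<longleftrightarrow>
     radial_weight \<omega> \<and> upper_doubling_with C \<omega> \<and> lower_doubling_with K L \<omega> \<and> tail \<omega> 0 = m"

end

theory Submission
  imports Defs "HOL-Real_Asymp.Real_Asymp"
begin

text \<open>Averaging over rotations turns the maximal projection on radial functions into an integral
  operator on \<open>[0,1)\<close> whose kernel is the mean \<open>k\<close> of the modulus of
  \<open>F(u) = (\<Sum>n. u ^ n / (2 \<omega>\<^bsub>2 n + 1\<^esub>))\<close> over the circle of radius \<open>r s\<close>. If \<open>\<omega>\<close> is upper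
  doubling, then \<open>k x\<close> dominates \<open>1 / tail \<omega> x\<close>, since it dominates each term of the series. If
  \<open>\<omega>\<close> is lower doubling as well, then \<open>k x\<close> is comparable to \<open>1 / tail \<omega> x\<close>: the coefficients of
  \<open>(1 - u) F'(u)\<close> are controlled by those of \<open>F\<close>, so Parseval's identity and the
  arithmetic-geometric mean inequality bound the mean of \<open>F'\<close>, which is then integrated.

  Necessity is obtained by testing on radial functions. Indicators of annuli, together with
  Hardy's inequality \<open>(\<Sum>n. a\<^sub>n x ^ n / (n + 1)) \<le> \<pi> k(x)\<close>, give the doubling conditions, and
  \<open>(\<omega> / \<nu>) powr (1 / (p - 1))\<close> on \<open>{r..<1}\<close> gives \<open>M \<lesssim> N\<close>
  for \<open>M = M_const p \<omega> \<nu>\<close> and the operator norm \<open>N\<close>.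

  For sufficiency the operator is split according to \<open>|\<zeta>| \<ge> |z|\<close> and \<open>|\<zeta>| < |z|\<close>. Each half is
  treated by the Schur test with a radial weight, a power of the tail of \<open>\<sigma>\<close> in the first case and a product
  of powers of the tails of \<open>\<omega>\<close> and \<open>\<nu>\<close> in the second. This gives the bound \<open>N \<lesssim> M\<close>, and since \<open>M\<close> is
  bounded below in terms of the data of the weights, \<open>M \<lesssim> M powr (2 - 1 / p)\<close>.\<close>

subsection \<open>Area measure in polar coordinates\<close>

text \<open>Lower doubling of \<omega> is the delicate necessary condition. A single Taylor
  coefficient only shows that \<open>kernel_mean\<close> is at least of order 1 / tail, which says
  nothing about how fast the tail decreases. If the tail hardly decreases over many dyadic scales,
  the coefficients hardly increase there, and Hardy's inequality collects one contribution per
  scale: the mean exceeds 1 / tail by a factor proportional to the number of scales, which the norm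
  has to dominate. Weights are only Lebesgue measurable and may vanish on large sets. Composition
  with \<open>cmod\<close> therefore needs that null sets of radii have null preimages, and the fact
  that \<omega> vanishes almost everywhere where \<nu> does must be derived: from boundedness in one
  direction, from finiteness of the constant in the other. Powers of tails are integrated by
  counting level sets instead of differentiating the tails. The norm estimate is uniform over all
  weights with the same data, hence the form \<exists>c. \<forall>\<omega> of the auxiliary
  estimates. Inadmissible data, such as an upper doubling constant below 1, make them
  vacuous.\<close>

lemma lborel_distr_orthogonal:
  fixes T :: "real^'n::{finite,wellorder} \<Rightarrow> real^'n::_"
  assumes T: "orthogonal_transformation T"
  shows "distr lborel borel T = lborel"
proof (rule lborel_eqI[symmetric])
  fix l u :: "real^'n::{finite,wellorder}" assume le: "\<And>b. b \<in> Basis \<Longrightarrow> l \<bullet> b \<le> u \<bullet> b"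
  have lin: "linear T" and T': "orthogonal_transformation (inv T)" and bij: "bij T"
    using T by (auto simp: orthogonal_transformation_linear orthogonal_transformation_inv orthogonal_transformation_bij)
  have meas: "T \<in> borel_measurable borel"
    using lin by (intro borel_measurable_continuous_onI linear_continuous_on) (simp add: linear_linear)
  \<comment> \<open>The preimage of a box is its image under the inverse map, and orthogonal images
    preserve Lebesgue measure.\<close>
  have eq: "T -` box l u = inv T ` box l u"
    using bij by (simp add: bij_vimage_eq_inv_image)
  have S: "box l u \<in> lmeasurable" by simp
  have "emeasure lborel (T -` box l u) = emeasure lebesgue (T -` box l u)"
    using measurable_sets[OF meas, of "box l u"] by simp
  also have "\<dots> = emeasure lebesgue (box l u)"
    using measurable_orthogonal_image[OF T' S] measure_orthogonal_image[OF T' S] S unfolding eq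
    by (metis emeasure_eq_measure2)
  finally show "emeasure (distr lborel borel T) (box l u) = ennreal (\<Prod>b\<in>Basis. (u - l) \<bullet> b)"
    using meas le by (simp add: emeasure_distr emeasure_lborel_box_eq)
qed simp

text \<open>Orthogonal invariance lives on \<open>real^'n\<close>; this identification of
  coordinates carries it over to the complex plane.\<close>

lemma lborel_distr_Complex:
  "distr lborel borel (\<lambda>v::real^2. Complex (v$1) (v$2)) = lborel"
proof (rule lborel_eqI[symmetric])
  fix l u :: complex assume le: "\<And>b. b \<in> Basis \<Longrightarrow> l \<bullet> b \<le> u \<bullet> b"
  let ?f = "\<lambda>v::real^2. Complex (v$1) (v$2)"
  let ?g = "\<lambda>z. (vector [Re z, Im z] :: real^2)"
  have meas: "?f \<in> borel_measurable borel"
    unfolding complex_eq_iff Complex_eq by (intro borel_measurable_continuous_onI continuous_intros)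
  have eq: "?f -` box l u = box (?g l) (?g u)"
    by (auto simp: box_def Basis_complex_def Basis_vec_def cart_eq_inner_axis[symmetric] forall_2
        inner_axis)
  have B: "(Basis::(real^2) set) = (\<lambda>i. axis i 1) ` UNIV"
    by (auto simp: Basis_vec_def)
  have P: "(\<Prod>b\<in>Basis. (?g u - ?g l) \<bullet> b) = (Re u - Re l) * (Im u - Im l)"
    unfolding B by (subst prod.reindex) (auto simp: inj_on_def axis_eq_axis UNIV_2 inner_axis)
  have "Re l \<le> Re u" "Im l \<le> Im u"
    using le[of 1] le[of \<i>] by (auto simp: Basis_complex_def)
  then have le': "(\<forall>b\<in>Basis. ?g l \<bullet> b \<le> ?g u \<bullet> b)"
    unfolding B by (auto simp: inner_axis UNIV_2)
  have Q: "(\<Prod>b\<in>Basis. (u - l) \<bullet> b) = (Re u - Re l) * (Im u - Im l)"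
    by (simp add: Basis_complex_def)
  show "emeasure (distr lborel borel ?f) (box l u) = ennreal (\<Prod>b\<in>Basis. (u - l) \<bullet> b)"
    using le' by (simp add: emeasure_distr meas eq emeasure_lborel_box_eq P Q)
qed simp

text \<open>In coordinates, multiplication by c multiplies inner products by |c|^2 = 1, so it is
  orthogonal; the relation \<open>f (T v) = c * f v\<close> transports the invariance.\<close>

lemma lborel_distr_mult_complex:
  fixes c :: complex
  assumes c: "cmod c = 1"
  shows "distr lborel borel ((*) c) = lborel"
proof -
  define f where "f v = Complex (v$1) (v$2)" for v :: "real^2"
  define T where "T v = (vector [Re (c * f v), Im (c * f v)] :: real^2)" for v
  have meas_f: "f \<in> borel_measurable borel"
    unfolding f_def Complex_eq by (intro borel_measurable_continuous_onI continuous_intros)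
  have inner_eq: "v \<bullet> w = v$1 * w$1 + v$2 * w$2" for v w :: "real^2"
    by (simp add: inner_vec_def sum_2)
  have c2: "(Re c)\<^sup>2 + (Im c)\<^sup>2 = 1" using c by (simp add: cmod_def)
  have "T v \<bullet> T w = ((Re c)\<^sup>2 + (Im c)\<^sup>2) * (v \<bullet> w)" for v w
    by (simp add: inner_eq T_def f_def algebra_simps power2_eq_square)
  moreover have "linear T"
    by (intro linearI) (auto simp: vec_eq_iff forall_2 T_def f_def algebra_simps)
  ultimately have T: "orthogonal_transformation T"
    by (simp add: orthogonal_transformation_def c2)
  have meas_T: "T \<in> borel_measurable borel"
    using orthogonal_transformation_linear[OF T]
    by (intro borel_measurable_continuous_onI linear_continuous_on) (simp add: linear_linear)
  have fT: "f (T v) = c * f v" for v by (simp add: f_def T_def complex_eq_iff)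
  have lf: "distr lborel borel f = lborel"
    unfolding f_def by (rule lborel_distr_Complex)
  have "distr lborel borel ((*) c) = distr (distr lborel borel f) borel ((*) c)"
    by (simp add: lf)
  also have "\<dots> = distr lborel borel (f \<circ> T)"
    using meas_f by (subst distr_distr) (auto simp: fT o_def)
  also have "\<dots> = distr (distr lborel borel T) borel f"
    using meas_f meas_T by (subst distr_distr) auto
  finally show ?thesis by (simp add: lborel_distr_orthogonal[OF T] lf)
qed

lemma space_disc_area [simp]: "space disc_area = ball 0 1"
  by (simp add: disc_area_def space_scale_measure space_restrict_space)

lemma sets_disc_area [measurable_cong]: "sets disc_area = sets (lebesgue_on (ball 0 1))"
  by (simp add: disc_area_def)

lemma borel_measurable_disc_area_iff:
  "f \<in> borel_measurable disc_area \<longleftrightarrow> f \<in> borel_measurable (lebesgue_on (ball 0 1))"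
  by (simp add: measurable_cong_sets[OF sets_disc_area refl])

lemma borel_measurable_disc_areaI:
  "f \<in> borel_measurable borel \<Longrightarrow> f \<in> borel_measurable disc_area"
  unfolding borel_measurable_disc_area_iff
  by (intro measurable_restrict_space1 measurable_completion) auto

lemma nn_integral_disc_area:
  assumes "F \<in> borel_measurable disc_area"
  shows "(\<integral>\<^sup>+z. F z \<partial>disc_area) = ennreal (1 / pi) * (\<integral>\<^sup>+z. F z * indicator (ball 0 1) z \<partial>lborel)"
  unfolding disc_area_def
  by (subst nn_integral_scale_measure) (use assms in \<open>simp_all add: borel_measurable_disc_area_iff nn_integral_restrict_space nn_integral_completion\<close>)

lemma emeasure_disc_area_UNIV: "emeasure disc_area (space disc_area) = 1"
proof -
  have "emeasure disc_area (space disc_area) = ennreal (1/pi) * emeasure lborel (ball (0::complex) 1)"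
    unfolding space_disc_area by (simp add: disc_area_def emeasure_restrict_space)
  also have "\<dots> = 1"
    by (subst emeasure_ball) (auto simp: unit_ball_vol_2 ennreal_mult[symmetric])
  finally show ?thesis .
qed

lemma nn_integral_disc_area_rotate:
  assumes F: "F \<in> borel_measurable borel" and c: "cmod c = 1"
  shows "(\<integral>\<^sup>+z. F (c * z) \<partial>disc_area) = (\<integral>\<^sup>+z. F z \<partial>disc_area)"
proof -
  have m: "(*) c \<in> borel_measurable borel" by measurable
  have "(\<integral>\<^sup>+z. F z * indicator (ball 0 1) z \<partial>lborel)
      = (\<integral>\<^sup>+z. F z * indicator (ball 0 1) z \<partial>distr lborel borel ((*) c))"
    by (simp add: lborel_distr_mult_complex[OF c])
  also have "\<dots> = (\<integral>\<^sup>+z. F (c * z) * indicator (ball 0 1) (c * z) \<partial>lborel)"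
    using F by (subst nn_integral_distr) (auto intro!: borel_measurable_times_ennreal borel_measurable_indicator)
  also have "\<dots> = (\<integral>\<^sup>+z. F (c * z) * indicator (ball 0 1) z \<partial>lborel)"
    by (intro nn_integral_cong) (auto simp: norm_mult c split: split_indicator)
  finally show ?thesis
    using F m by (simp add: nn_integral_disc_area borel_measurable_disc_areaI)
qed

section \<open>The law of the modulus\<close>

text \<open>The push-forward of \<open>disc_area\<close> under \<open>cmod\<close>: with area
  normalised by 1 / \<pi>, the circle of radius r carries the density 2 r.\<close>

definition radial_measure :: "real measure" where
  "radial_measure = density (lebesgue_on {0..<1}) (\<lambda>r. ennreal (2 * r))"

lemma space_radial [simp]: "space radial_measure = {0..<1}"
  by (simp add: radial_measure_def space_restrict_space)

lemma sets_radial [measurable_cong]: "sets radial_measure = sets (lebesgue_on {0..<1})"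
  by (simp add: radial_measure_def)

lemma borel_measurable_radialI:
  "f \<in> borel_measurable borel \<Longrightarrow> f \<in> borel_measurable radial_measure"
  unfolding measurable_cong_sets[OF sets_radial refl]
  by (intro measurable_restrict_space1 measurable_completion) auto

lemma nn_integral_radial:
  assumes "F \<in> borel_measurable radial_measure"
  shows "(\<integral>\<^sup>+r. F r \<partial>radial_measure) = (\<integral>\<^sup>+r\<in>{0..<1}. (F r * ennreal (2 * r)) \<partial>lebesgue)"
proof -
  have F: "F \<in> borel_measurable (lebesgue_on {0..<1})"
    using assms by (simp add: measurable_cong_sets[OF sets_radial refl])
  have id: "(\<lambda>r. ennreal (2 * r)) \<in> borel_measurable (lebesgue_on {0..<1})"
    by (intro measurable_restrict_space1 measurable_completion) auto
  show ?thesis using F id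
    by (simp add: radial_measure_def nn_integral_density nn_integral_restrict_space mult.commute)
qed

text \<open>The half-lines {a<..} determine both measures. For 0 \<le> a < 1 the annulus a < |z| < 1
  has normalised area 1 - a^2, which is also the integral of 2 r from a to 1.\<close>

lemma distr_disc_area_borel:
  "distr disc_area borel cmod = density lborel (\<lambda>r. ennreal (2 * r) * indicator {0..<1} r)"
  (is "?M = ?N")
proof (rule measure_eqI_lessThan)
  have cm: "cmod \<in> borel_measurable disc_area" by (intro borel_measurable_disc_areaI) auto
  have int: "(\<integral>\<^sup>+r. ennreal (2 * r) * indicator {0..<1} r * indicator {a<..} r \<partial>lborel) = ennreal (1 - a\<^sup>2)"
    if a: "0 \<le> a" "a \<le> 1" for a :: real
  proof -
    have "(\<integral>\<^sup>+r. ennreal (2 * r) * indicator {0..<1} r * indicator {a<..} r \<partial>lborel)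
        = (\<integral>\<^sup>+r. ennreal (2 * r) * indicator {a..1} r \<partial>lborel)"
    proof (rule nn_integral_cong_AE)
      have "AE r in lborel. r \<noteq> a \<and> r \<noteq> (1::real)"
        by (intro AE_conjI AE_lborel_singleton)
      then show "AE r in lborel. ennreal (2 * r) * indicator {0..<1} r * indicator {a<..} r
          = ennreal (2 * r) * indicator {a..1} r"
        by eventually_elim (use a in \<open>auto split: split_indicator\<close>)
    qed
    also have "\<dots> = ennreal (1\<^sup>2 - a\<^sup>2)"
      using a by (intro nn_integral_FTC_Icc[where F = "\<lambda>r. r\<^sup>2"]) (auto intro!: derivative_eq_intros)
    finally show ?thesis by simp
  qed
  have M: "emeasure ?M {a<..} = ennreal (1 - (max a 0)\<^sup>2)" if "a < 1" for a
  proof (cases "a < 0")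
    case True
    then have "cmod -` {a<..} \<inter> space disc_area = space disc_area"
      by (auto intro: less_le_trans[OF _ norm_ge_zero])
    then show ?thesis using True emeasure_disc_area_UNIV
      by (simp add: emeasure_distr cm)
  next
    case False
    then have "cmod -` {a<..} \<inter> space disc_area = ball 0 1 - cball 0 a" by auto
    then have "emeasure ?M {a<..} = ennreal (1/pi) * emeasure lebesgue (ball (0::complex) 1 - cball 0 a)"
      by (simp add: emeasure_distr cm) (simp add: disc_area_def emeasure_restrict_space)
    also have "emeasure lebesgue (ball (0::complex) 1 - cball 0 a) = ennreal (pi - pi * a\<^sup>2)"
    proof -
      have "emeasure lborel (ball (0::complex) 1 - cball 0 a)
          = emeasure lborel (ball (0::complex) 1) - emeasure lborel (cball (0::complex) a)"
        using that emeasure_cball[of a "0::complex"] False by (intro emeasure_Diff) (auto)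
      then show ?thesis using False
        by (simp add: emeasure_ball emeasure_cball unit_ball_vol_2 ennreal_minus)
    qed
    finally show ?thesis using False that
      by (simp add: ennreal_mult'[symmetric] diff_divide_distrib max_def)
  qed
  have N: "emeasure ?N {a<..} = ennreal (1 - (max a 0)\<^sup>2)" if "a < 1" for a
  proof -
    have "emeasure ?N {a<..} = (\<integral>\<^sup>+r. ennreal (2 * r) * indicator {0..<1} r * indicator {a<..} r \<partial>lborel)"
      by (subst emeasure_density) auto
    also have "\<dots> = (\<integral>\<^sup>+r. ennreal (2 * r) * indicator {0..<1} r * indicator {max a 0<..} r \<partial>lborel)"
      by (intro nn_integral_cong) (auto split: split_indicator simp: max_def)
    also have "\<dots> = ennreal (1 - (max a 0)\<^sup>2)" using that by (intro int) auto
    finally show ?thesis .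
  qed
  fix a :: real
  show "emeasure ?M {a<..} = emeasure ?N {a<..}"
  proof (cases "a < 1")
    case True then show ?thesis using M N by simp
  next
    case False
    have e: "cmod -` {a<..} \<inter> space disc_area = {}" using False by auto
    have "emeasure ?N {a<..} = (\<integral>\<^sup>+r. ennreal (2 * r) * indicator {0..<1} r * indicator {a<..} r \<partial>lborel)"
      by (subst emeasure_density) auto
    also have "\<dots> = (\<integral>\<^sup>+r. 0 \<partial>(lborel::real measure))"
      by (intro nn_integral_cong) (use False in \<open>auto split: split_indicator\<close>)
    finally show ?thesis using e by (simp add: emeasure_distr cm)
  qed
  show "emeasure ?M {a<..} < \<infinity>"
  proof (rule le_less_trans)
    show "emeasure ?M {a<..} \<le> 1"
      using emeasure_space[of disc_area] emeasure_disc_area_UNIV by (simp add: emeasure_distr cm)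
  qed simp
qed simp_all

lemma cmod_measurable_borel: "cmod \<in> disc_area \<rightarrow>\<^sub>M borel"
  by (intro borel_measurable_disc_areaI) auto

text \<open>Since the law of \<open>cmod\<close> has a density, null sets of radii pull back to null
  sets of the disc. Without this, a Lebesgue measurable profile composed with \<open>cmod\<close>
  would be out of control.\<close>

lemma vimage_cmod_null:
  assumes "N \<in> null_sets lborel"
  shows "cmod -` N \<inter> ball 0 1 \<in> null_sets disc_area"
proof -
  have N: "N \<in> sets borel" "emeasure lborel N = 0" using assms by auto
  have "emeasure disc_area (cmod -` N \<inter> space disc_area) = emeasure (distr disc_area borel cmod) N"
    using N cmod_measurable_borel by (simp add: emeasure_distr)
  also have "\<dots> = (\<integral>\<^sup>+r. ennreal (2 * r) * indicator {0..<1} r * indicator N r \<partial>lborel)"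
    unfolding distr_disc_area_borel using N by (subst emeasure_density) auto
  also have "\<dots> = 0" using assms by (rule nn_integral_null_set)
  finally show ?thesis
    using measurable_sets[OF cmod_measurable_borel, of N] N by (auto simp: null_sets_def)
qed

text \<open>Completeness of Lebesgue measure survives restriction and scaling by the positive number
  1 / \<pi>. It allows functions to be altered on null sets without losing measurability.\<close>

lemma complete_disc_area:
  assumes "B \<in> null_sets disc_area" "A \<subseteq> B"
  shows "A \<in> null_sets disc_area"
proof -
  have eq: "X \<in> null_sets disc_area \<longleftrightarrow> X \<in> null_sets lebesgue \<and> X \<subseteq> ball 0 1" for X
  proof -
    have "X \<in> null_sets disc_area \<longleftrightarrow> X \<in> null_sets (lebesgue_on (ball 0 1))"
      by (simp add: disc_area_def null_sets_def ennreal_eq_0_iff linorder_not_le[THEN iffD2, OF pi_gt_zero])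
    then show ?thesis by (auto simp: null_sets_restrict_space)
  qed
  have "A \<in> null_sets lebesgue"
    using assms(1) eq[of B] completion.complete2[OF assms(2), of lborel] by simp
  moreover have "A \<subseteq> ball 0 1" using assms eq[of B] by auto
  ultimately show ?thesis by (simp only: eq)
qed

lemma AE_disc_area_radial:
  assumes "AE r in radial_measure. P r"
  shows "AE z in disc_area. P (cmod z)"
proof -
  have id: "(\<lambda>r. ennreal (2 * r)) \<in> borel_measurable (lebesgue_on {0..<1})"
    by (intro measurable_restrict_space1 measurable_completion) auto
  have "AE r in lebesgue_on {0..<1}. 0 < ennreal (2 * r) \<longrightarrow> P r"
    using assms id unfolding radial_measure_def by (simp add: AE_density)
  then have "AE r in lebesgue. r \<in> {0..<1} \<longrightarrow> 0 < ennreal (2 * r) \<longrightarrow> P r"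
    by (subst (asm) AE_restrict_space_iff) auto
  then have "AE r in lborel. r \<in> {0..<1} \<longrightarrow> 0 < ennreal (2 * r) \<longrightarrow> P r"
    by (simp add: AE_completion_iff)
  then obtain N where N': "{r \<in> space lborel. \<not> (r \<in> {0..<1} \<longrightarrow> 0 < ennreal (2 * r) \<longrightarrow> P r)} \<subseteq> N"
      "emeasure lborel N = 0" "N \<in> sets lborel"
    by (rule AE_E)
  then have N: "N \<in> null_sets lborel" "\<And>r. 0 < r \<Longrightarrow> r < 1 \<Longrightarrow> \<not> P r \<Longrightarrow> r \<in> N"
    by (auto simp: null_sets_def)
  \<comment> \<open>The density 2 r vanishes at 0, so the hypothesis says nothing about the radius
    0; this point is added to the null set.\<close>
  have "N \<union> {0} \<in> null_sets lborel" using N(1) by (intro null_sets.Un) (auto simp: null_sets_def)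
  then have "cmod -` (N \<union> {0}) \<inter> ball 0 1 \<in> null_sets disc_area" by (rule vimage_cmod_null)
  moreover have "{z \<in> space disc_area. \<not> P (cmod z)} \<subseteq> cmod -` (N \<union> {0}) \<inter> ball 0 1"
  proof
    fix z assume "z \<in> {z \<in> space disc_area. \<not> P (cmod z)}"
    then show "z \<in> cmod -` (N \<union> {0}) \<inter> ball 0 1"
      using N(2)[of "cmod z"] by (cases "z = 0") auto
  qed
  ultimately show ?thesis by (rule AE_I')
qed

text \<open>Fubini and push-forward arguments need Borel functions. Extending F by 0 and taking a
  Borel version of the result provides one.\<close>

lemma borel_representative_radial:
  fixes F :: "real \<Rightarrow> ennreal"
  assumes F: "F \<in> borel_measurable radial_measure"
  obtains G where "G \<in> borel_measurable borel" "AE r in radial_measure. F r = G r"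
proof -
  have F': "F \<in> borel_measurable (lebesgue_on {0..<1})"
    using assms by (simp add: measurable_cong_sets[OF sets_radial refl])
  then have "(\<lambda>r. F r * indicator {0..<1} r) \<in> borel_measurable lebesgue"
    by (subst (asm) borel_measurable_restrict_space_iff_ennreal) auto
  from completion_ex_borel_measurable[OF this]
  obtain G where G: "G \<in> borel_measurable lborel" "AE r in lborel. F r * indicator {0..<1} r = G r" by blast
  have id: "(\<lambda>r. ennreal (2 * r)) \<in> borel_measurable (lebesgue_on {0..<1})"
    by (intro measurable_restrict_space1 measurable_completion) auto
  have "AE r in lebesgue. F r * indicator {0..<1} r = G r" using G(2) by (rule AE_completion)
  then have "AE r in lebesgue. r \<in> {0..<1} \<longrightarrow> 0 < ennreal (2 * r) \<longrightarrow> F r = G r"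
    by eventually_elim auto
  then have "AE r in radial_measure. F r = G r"
    using id unfolding radial_measure_def by (simp add: AE_density AE_restrict_space_iff)
  then show thesis using G(1) by (intro that[of G]) auto
qed

lemma borel_measurable_AE_disc_area:
  fixes f g :: "complex \<Rightarrow> ennreal"
  assumes g: "g \<in> borel_measurable disc_area" and ae: "AE z in disc_area. f z = g z"
  shows "f \<in> borel_measurable disc_area"
proof (rule measurableI)
  fix A :: "ennreal set" assume A: "A \<in> sets borel"
  from ae obtain N where N: "{z \<in> space disc_area. f z \<noteq> g z} \<subseteq> N"
      "emeasure disc_area N = 0" "N \<in> sets disc_area"
    by (rule AE_E)
  then have N0: "N \<in> null_sets disc_area" by (simp add: null_sets_def)
  have n: "X \<inter> N \<in> sets disc_area" for X
    using complete_disc_area[OF N0, of "X \<inter> N"] by (simp add: null_sets_def)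
  have "f -` A \<inter> space disc_area = ((g -` A \<inter> space disc_area) - N) \<union> ((f -` A \<inter> space disc_area) \<inter> N)"
    using N(1) by auto
  moreover have "\<dots> \<in> sets disc_area"
    by (intro sets.Un sets.Diff measurable_sets[OF g A] N(3) n)
  ultimately show "f -` A \<inter> space disc_area \<in> sets disc_area" by (simp only:)
qed simp

lemma borel_measurable_radial_cmod:
  fixes F :: "real \<Rightarrow> ennreal"
  assumes F: "F \<in> borel_measurable radial_measure"
  shows "(\<lambda>z. F (cmod z)) \<in> borel_measurable disc_area"
proof -
  obtain G where G: "G \<in> borel_measurable borel" "AE r in radial_measure. F r = G r"
    by (rule borel_representative_radial[OF F])
  show ?thesis
    by (rule borel_measurable_AE_disc_area[OF _ AE_disc_area_radial[OF G(2)]])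
      (rule measurable_compose[OF cmod_measurable_borel G(1)])
qed

lemma measurable_cmod: "cmod \<in> disc_area \<rightarrow>\<^sub>M radial_measure"
proof (rule measurableI)
  fix A assume A: "A \<in> sets radial_measure"
  have "(\<lambda>z. indicator A (cmod z) :: ennreal) \<in> borel_measurable disc_area"
    using A by (intro borel_measurable_radial_cmod) auto
  then have "(\<lambda>z. indicator A (cmod z) :: ennreal) -` {1} \<inter> space disc_area \<in> sets disc_area"
    by (rule measurable_sets) auto
  moreover have "(\<lambda>z. indicator A (cmod z) :: ennreal) -` {1} \<inter> space disc_area = cmod -` A \<inter> space disc_area"
    by (auto simp: indicator_def split: if_splits)
  ultimately show "cmod -` A \<inter> space disc_area \<in> sets disc_area" by simp
qed auto

text \<open>Polar coordinates for a radial integrand: pass to a Borel version, push forward under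
  \<open>cmod\<close>, and return to F.\<close>

lemma nn_integral_disc_area_radial:
  assumes F: "F \<in> borel_measurable radial_measure"
  shows "(\<integral>\<^sup>+z. F (cmod z) \<partial>disc_area) = (\<integral>\<^sup>+r. F r \<partial>radial_measure)"
proof -
  obtain G where G: "G \<in> borel_measurable borel" "AE r in radial_measure. F r = G r"
    by (rule borel_representative_radial[OF F])
  have "(\<integral>\<^sup>+z. F (cmod z) \<partial>disc_area) = (\<integral>\<^sup>+z. G (cmod z) \<partial>disc_area)"
    by (intro nn_integral_cong_AE AE_disc_area_radial[OF G(2)])
  also have "\<dots> = (\<integral>\<^sup>+r. G r \<partial>distr disc_area borel cmod)"
    using G by (intro nn_integral_distr[symmetric] cmod_measurable_borel) auto
  also have "\<dots> = (\<integral>\<^sup>+r. ennreal (2 * r) * indicator {0..<1} r * G r \<partial>lborel)"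
    unfolding distr_disc_area_borel using G by (intro nn_integral_density) auto
  also have "\<dots> = (\<integral>\<^sup>+r. ennreal (2 * r) * indicator {0..<1} r * G r \<partial>lebesgue)"
    by (simp add: nn_integral_completion)
  also have "\<dots> = (\<integral>\<^sup>+r. G r \<partial>radial_measure)"
    by (subst nn_integral_radial) (auto intro!: nn_integral_cong borel_measurable_radialI G simp: ac_simps)
  also have "\<dots> = (\<integral>\<^sup>+r. F r \<partial>radial_measure)"
    using G(2) by (intro nn_integral_cong_AE) auto
  finally show ?thesis .
qed

subsection \<open>Tails and moments of radial weights\<close>

text \<open>With this measure tails are masses of {r..<1} and moments are integrals of powers, so
  monotonicity and additivity come from measure theory.\<close>

definition weight_measure :: "(real \<Rightarrow> real) \<Rightarrow> real measure" where
  "weight_measure \<omega> = density (lebesgue_on {0..<1}) (\<lambda>r. ennreal (\<omega> r))"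

lemma space_weight_measure [simp]: "space (weight_measure \<omega>) = {0..<1}"
  by (simp add: weight_measure_def space_restrict_space)

lemma sets_weight_measure [measurable_cong]: "sets (weight_measure \<omega>) = sets (lebesgue_on {0..<1})"
  by (simp add: weight_measure_def)

lemma borel_measurable_lebesgue_onI:
  "f \<in> borel_measurable borel \<Longrightarrow> f \<in> borel_measurable (lebesgue_on (S::real set))"
  by (intro measurable_restrict_space1 measurable_completion) auto

lemma borel_measurable_weight_measureI:
  "f \<in> borel_measurable borel \<Longrightarrow> f \<in> borel_measurable (weight_measure \<omega>)"
  by (simp add: measurable_cong_sets[OF sets_weight_measure refl] borel_measurable_lebesgue_onI)

lemma radial_weight_nonneg: "radial_weight \<omega> \<Longrightarrow> 0 \<le> r \<Longrightarrow> r < 1 \<Longrightarrow> 0 \<le> \<omega> r"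
  by (simp add: radial_weight_def)

lemma radial_weight_measurable:
  assumes "radial_weight \<omega>"
  shows "\<omega> \<in> borel_measurable (lebesgue_on {0..<1})"
proof -
  have "set_integrable lebesgue {0..<1} \<omega>" using assms by (simp add: radial_weight_def)
  then have "integrable (lebesgue_on {0..<1}) \<omega>"
    by (simp add: set_integrable_def integrable_restrict_space)
  then show ?thesis by (rule borel_measurable_integrable)
qed

lemma integrable_weight_measure:
  assumes "radial_weight \<omega>" and f: "f \<in> borel_measurable borel"
    and b: "\<And>r. 0 \<le> r \<Longrightarrow> r < 1 \<Longrightarrow> \<bar>f r\<bar> \<le> (B::real)"
  shows "integrable (lebesgue_on {0..<1}) (\<lambda>r. f r * \<omega> r)"
proof -
  have i: "integrable (lebesgue_on {0..<1}) (\<lambda>r. B * \<omega> r)"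
    using assms(1) by (simp add: radial_weight_def set_integrable_def integrable_restrict_space)
  show ?thesis
  proof (rule Bochner_Integration.integrable_bound[OF i])
    show "(\<lambda>r. f r * \<omega> r) \<in> borel_measurable (lebesgue_on {0..<1})"
      using f radial_weight_measurable[OF assms(1)] by (intro borel_measurable_times[OF borel_measurable_lebesgue_onI])
    show "AE r in lebesgue_on {0..<1}. norm (f r * \<omega> r) \<le> norm (B * \<omega> r)"
    proof (rule AE_I2)
      fix r assume "r \<in> space (lebesgue_on {0..<1::real})"
      then have r: "0 \<le> r" "r < 1" by (auto simp: space_restrict_space)
      then show "norm (f r * \<omega> r) \<le> norm (B * \<omega> r)"
        using b[OF r] by (auto simp: abs_mult intro!: mult_right_mono)
    qed
  qed
qed

lemma integral_weight_measure:
  assumes "radial_weight \<omega>" and f: "f \<in> borel_measurable borel"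
    and b: "\<And>r. 0 \<le> r \<Longrightarrow> r < 1 \<Longrightarrow> 0 \<le> f r \<and> f r \<le> (B::real)"
  shows "ennreal (LINT r:{0..<1}|lebesgue. f r * \<omega> r) = (\<integral>\<^sup>+r. ennreal (f r) \<partial>weight_measure \<omega>)"
proof -
  note m = radial_weight_measurable[OF assms(1)]
  have "(LINT r:{0..<1}|lebesgue. f r * \<omega> r) = (\<integral>r. f r * \<omega> r \<partial>lebesgue_on {0..<1})"
    by (simp add: set_lebesgue_integral_def integral_restrict_space)
  also have "ennreal \<dots> = (\<integral>\<^sup>+r. ennreal (f r * \<omega> r) \<partial>lebesgue_on {0..<1})"
    using b radial_weight_nonneg[OF assms(1)]
    by (intro nn_integral_eq_integral[symmetric] integrable_weight_measure[OF assms(1) f, where B = B] AE_I2)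
       (auto simp: space_restrict_space)
  also have "\<dots> = (\<integral>\<^sup>+r. ennreal (\<omega> r) * ennreal (f r) \<partial>lebesgue_on {0..<1})"
    using b radial_weight_nonneg[OF assms(1)]
    by (intro nn_integral_cong) (auto simp: space_restrict_space ennreal_mult mult.commute)
  also have "\<dots> = (\<integral>\<^sup>+r. ennreal (f r) \<partial>weight_measure \<omega>)"
    unfolding weight_measure_def using m f
    by (subst nn_integral_density) (auto intro!: borel_measurable_lebesgue_onI)
  finally show ?thesis .
qed

lemma emeasure_weight_measure:
  assumes "radial_weight \<omega>" "0 \<le> r" "r < 1"
  shows "emeasure (weight_measure \<omega>) {r..<1} = ennreal (tail \<omega> r)"
proof -
  have "tail \<omega> r = (LINT s:{0..<1}|lebesgue. indicator {r..<1} s * \<omega> s)"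
    unfolding tail_def set_lebesgue_integral_def using assms
    by (intro Bochner_Integration.integral_cong) (auto split: split_indicator)
  also have "ennreal \<dots> = (\<integral>\<^sup>+s. ennreal (indicator {r..<1} s) \<partial>weight_measure \<omega>)"
    by (rule integral_weight_measure[OF assms(1), where B = 1]) (auto split: split_indicator)
  also have "\<dots> = emeasure (weight_measure \<omega>) {r..<1}"
    using assms by (simp add: ennreal_indicator sets_weight_measure sets_restrict_space_iff)
  finally show ?thesis ..
qed

lemma finite_weight_measure:
  assumes "radial_weight \<omega>" shows "finite_measure (weight_measure \<omega>)"
  using emeasure_weight_measure[OF assms, of 0] by (intro finite_measureI) simp

lemma tail_eq_measure:
  assumes "radial_weight \<omega>" "0 \<le> r" "r < 1"
  shows "tail \<omega> r = measure (weight_measure \<omega>) {r..<1}"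
proof -
  have "tail \<omega> r > 0" using assms by (simp add: radial_weight_def)
  then show ?thesis using emeasure_weight_measure[OF assms] by (simp add: measure_def)
qed

lemma tail_pos: "radial_weight \<omega> \<Longrightarrow> 0 \<le> r \<Longrightarrow> r < 1 \<Longrightarrow> 0 < tail \<omega> r"
  by (simp add: radial_weight_def)

lemma Ico_sets_weight_measure: "0 \<le> r \<Longrightarrow> t \<le> 1 \<Longrightarrow> {r..<t} \<in> sets (weight_measure \<omega>)"
  by (auto simp: sets_weight_measure sets_restrict_space_iff)

lemma tail_diff:
  assumes "radial_weight \<omega>" "0 \<le> r" "r \<le> t" "t < 1"
  shows "tail \<omega> r = measure (weight_measure \<omega>) {r..<t} + tail \<omega> t"
proof -
  interpret finite_measure "weight_measure \<omega>" by (rule finite_weight_measure[OF assms(1)])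
  have "{r..<1} = {r..<t} \<union> {t..<1}" using assms by auto
  then show ?thesis using assms
    by (simp add: tail_eq_measure finite_measure_Union Ico_sets_weight_measure)
qed

lemma tail_antimono:
  assumes "radial_weight \<omega>" "0 \<le> r" "r \<le> t" "t < 1"
  shows "tail \<omega> t \<le> tail \<omega> r"
  using tail_diff[OF assms] by simp

lemma moment_eq:
  assumes "radial_weight \<omega>" "0 \<le> x"
  shows "ennreal (moment \<omega> x) = (\<integral>\<^sup>+r. ennreal (r powr x) \<partial>weight_measure \<omega>)"
  unfolding moment_def
  by (rule integral_weight_measure[OF assms(1), where B = 1])
     (auto intro: powr_le1 assms)

lemma moment_nonneg:
  assumes "radial_weight \<omega>" shows "0 \<le> moment \<omega> x"
  unfolding moment_def set_lebesgue_integral_def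
  using radial_weight_nonneg[OF assms] by (intro Bochner_Integration.integral_nonneg) (auto split: split_indicator)

lemma moment_antimono:
  assumes "radial_weight \<omega>" "0 \<le> x" "x \<le> y"
  shows "moment \<omega> y \<le> moment \<omega> x"
proof -
  have "ennreal (moment \<omega> y) \<le> ennreal (moment \<omega> x)"
    using assms by (simp add: moment_eq) (intro nn_integral_mono ennreal_leI, auto intro: powr_mono')
  then show ?thesis using moment_nonneg[OF assms(1)] by simp
qed

text \<open>Only the integral over {r..<1} is kept, where s powr x is at least r powr x.\<close>

lemma moment_ge:
  assumes "radial_weight \<omega>" "0 \<le> x" "0 \<le> r" "r < 1"
  shows "r powr x * tail \<omega> r \<le> moment \<omega> x"
proof -
  have "ennreal (r powr x * tail \<omega> r) = (\<integral>\<^sup>+s. ennreal (r powr x) * indicator {r..<1} s \<partial>weight_measure \<omega>)"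
    using assms tail_pos[OF assms(1,3,4)]
    by (simp add: nn_integral_cmult_indicator Ico_sets_weight_measure emeasure_weight_measure ennreal_mult)
  also have "\<dots> \<le> ennreal (moment \<omega> x)"
    using assms by (auto simp: moment_eq intro!: nn_integral_mono ennreal_leI powr_mono2 split: split_indicator)
  finally show ?thesis using moment_nonneg[OF assms(1)] by simp
qed

lemma moment_pos:
  assumes "radial_weight \<omega>" "0 \<le> x" shows "0 < moment \<omega> x"
proof -
  have "0 < (1/2) powr x * tail \<omega> (1/2)" using tail_pos[OF assms(1)] by simp
  also have "\<dots> \<le> moment \<omega> x" using assms by (intro moment_ge) auto
  finally show ?thesis .
qed

lemma moment_le_tail_0:
  assumes "radial_weight \<omega>" "0 \<le> x" shows "moment \<omega> x \<le> tail \<omega> 0"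
proof -
  have "ennreal (moment \<omega> x) \<le> (\<integral>\<^sup>+s. indicator {0..<1} s \<partial>weight_measure \<omega>)"
    using assms by (auto simp: moment_eq intro!: nn_integral_mono powr_le1 split: split_indicator)
  also have "\<dots> = ennreal (tail \<omega> 0)"
    using assms by (simp add: Ico_sets_weight_measure emeasure_weight_measure)
  finally show ?thesis using tail_pos[OF assms(1), of 0] by simp
qed

section \<open>Moments and tails under upper doubling\<close>

text \<open>By Tonelli, the integral of a nonnegative function is the integral over t > 0 of the
  measures of its superlevel sets; the hypothesis is integrated over t.\<close>

lemma nn_integral_le_of_distribution:
  fixes f h :: "'a \<Rightarrow> real"
  assumes "sigma_finite_measure M"
    and [measurable]: "f \<in> borel_measurable M" "h \<in> borel_measurable M"
    and le: "\<And>t. 0 < t \<Longrightarrow> emeasure M {x \<in> space M. t \<le> f x} \<le> ennreal C * emeasure M {x \<in> space M. t \<le> h x}"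
  shows "(\<integral>\<^sup>+x. ennreal (f x) \<partial>M) \<le> ennreal C * (\<integral>\<^sup>+x. ennreal (h x) \<partial>M)"
proof -
  interpret sigma_finite_measure M by fact
  interpret pair_sigma_finite M lborel by standard
  have cake: "(\<integral>\<^sup>+x. ennreal (g x) \<partial>M) = (\<integral>\<^sup>+t. emeasure M {x \<in> space M. t \<le> g x} * indicator {0<..} t \<partial>lborel)"
    if [measurable]: "g \<in> borel_measurable M" for g :: "'a \<Rightarrow> real"
  proof -
    have "(\<integral>\<^sup>+x. ennreal (g x) \<partial>M) = (\<integral>\<^sup>+x. (\<integral>\<^sup>+t. indicator {(x, t). 0 < t \<and> t \<le> g x} (x, t) \<partial>lborel) \<partial>M)"
    proof (intro nn_integral_cong)
      fix x
      have "(\<integral>\<^sup>+t. indicator {(x, t). 0 < t \<and> t \<le> g x} (x, t) \<partial>lborel) = (\<integral>\<^sup>+t. indicator {0<..g x} t \<partial>lborel)"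
        by (intro nn_integral_cong) (auto split: split_indicator)
      also have "\<dots> = ennreal (g x)"
        by (cases "0 \<le> g x") (auto simp: ennreal_neg)
      finally show "ennreal (g x) = (\<integral>\<^sup>+t. indicator {(x, t). 0 < t \<and> t \<le> g x} (x, t) \<partial>lborel)" ..
    qed
    also have "\<dots> = (\<integral>\<^sup>+t. (\<integral>\<^sup>+x. indicator {(x, t). 0 < t \<and> t \<le> g x} (x, t) \<partial>M) \<partial>lborel)"
      by (rule Fubini'[symmetric]) measurable
    also have "\<dots> = (\<integral>\<^sup>+t. emeasure M {x \<in> space M. t \<le> g x} * indicator {0<..} t \<partial>lborel)"
    proof (intro nn_integral_cong)
      fix t :: real
      have "(\<integral>\<^sup>+x. indicator {(x, t). 0 < t \<and> t \<le> g x} (x, t) \<partial>M)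
          = (\<integral>\<^sup>+x. indicator {0<..} t * indicator {x \<in> space M. t \<le> g x} x \<partial>M)"
        by (intro nn_integral_cong) (auto split: split_indicator)
      then show "(\<integral>\<^sup>+x. indicator {(x, t). 0 < t \<and> t \<le> g x} (x, t) \<partial>M)
          = emeasure M {x \<in> space M. t \<le> g x} * indicator {0<..} t"
        by (simp add: nn_integral_cmult_indicator mult.commute)
    qed
    finally show ?thesis .
  qed
  have "(\<integral>\<^sup>+x. ennreal (f x) \<partial>M) \<le> (\<integral>\<^sup>+t. ennreal C * (emeasure M {x \<in> space M. t \<le> h x} * indicator {0<..} t) \<partial>lborel)"
    unfolding cake[OF assms(2)] using le
    by (intro nn_integral_mono) (auto split: split_indicator)
  also have "\<dots> = ennreal C * (\<integral>\<^sup>+x. ennreal (h x) \<partial>M)"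
    unfolding cake[OF assms(3)] by (intro nn_integral_cmult) measurable
  finally show ?thesis .
qed

text \<open>Superlevel sets of s powr x are intervals {\<rho>..<1}, which upper doubling compares
  with {(1 + \<rho>) / 2..<1}. The square of (1 + \<rho>) / 2 is at least \<rho>, so the smaller
  interval lies in the superlevel set of s powr (2 * x) at the same level.\<close>

lemma upper_doubling_moment:
  assumes w: "radial_weight \<omega>" and C: "upper_doubling_with C \<omega>" and x: "0 < x"
  shows "moment \<omega> x \<le> C * moment \<omega> (2 * x)"
proof -
  have C1: "1 \<le> C" and D: "\<And>r. 0 \<le> r \<Longrightarrow> r < 1 \<Longrightarrow> tail \<omega> r \<le> C * tail \<omega> ((1 + r) / 2)"
    using C by (auto simp: upper_doubling_with_def)
  interpret finite_measure "weight_measure \<omega>" by (rule finite_weight_measure[OF w])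
  let ?M = "weight_measure \<omega>"
  have meas: "(\<lambda>s. s powr a) \<in> borel_measurable ?M" for a
    by (intro borel_measurable_weight_measureI) auto
  have "(\<integral>\<^sup>+s. ennreal (s powr x) \<partial>?M) \<le> ennreal C * (\<integral>\<^sup>+s. ennreal (s powr (2 * x)) \<partial>?M)"
  proof (rule nn_integral_le_of_distribution[OF sigma_finite_measure_axioms meas meas])
    fix t :: real assume t: "0 < t"
    define \<rho> where "\<rho> = t powr (1 / x)"
    have \<rho>: "0 < \<rho>" and \<rho>x: "\<rho> powr x = t" using t x by (auto simp: \<rho>_def powr_powr)
    have ge: "\<rho> \<le> s" if "0 \<le> s" "t \<le> s powr x" for s
    proof (rule ccontr)
      assume "\<not> \<rho> \<le> s"
      then have "s powr x < \<rho> powr x" using that x by (intro powr_less_mono2) auto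
      then show False using that \<rho>x by simp
    qed
    show "emeasure ?M {s \<in> space ?M. t \<le> s powr x} \<le> ennreal C * emeasure ?M {s \<in> space ?M. t \<le> s powr (2 * x)}"
    proof (cases "\<rho> < 1")
      case False
      have e: "{s \<in> space ?M. t \<le> s powr x} = {}" using ge False by force
      show ?thesis unfolding e by simp
    next
      case True
      have "emeasure ?M {s \<in> space ?M. t \<le> s powr x} \<le> emeasure ?M {\<rho>..<1}"
        using ge \<rho> by (intro emeasure_mono Ico_sets_weight_measure) auto
      also have "\<dots> = ennreal (tail \<omega> \<rho>)" using True \<rho> by (simp add: emeasure_weight_measure[OF w])
      also have "\<dots> \<le> ennreal (C * tail \<omega> ((1 + \<rho>) / 2))" using True \<rho> by (intro ennreal_leI D) auto
      also have "\<dots> = ennreal C * emeasure ?M {(1 + \<rho>) / 2..<1}"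
        using True \<rho> C1 tail_pos[OF w, of "(1 + \<rho>) / 2"] by (simp add: emeasure_weight_measure[OF w] ennreal_mult)
      also have "\<dots> \<le> ennreal C * emeasure ?M {s \<in> space ?M. t \<le> s powr (2 * x)}"
      proof (intro mult_left_mono emeasure_mono)
        show "{(1 + \<rho>) / 2..<1} \<subseteq> {s \<in> space ?M. t \<le> s powr (2 * x)}"
        proof
          fix s assume s: "s \<in> {(1 + \<rho>) / 2..<1}"
          have "\<rho> \<le> ((1 + \<rho>) / 2)\<^sup>2"
            using zero_le_power2[of "1 - \<rho>"] by (simp add: power2_eq_square field_simps)
          also have "\<dots> \<le> s\<^sup>2" using s \<rho> by (intro power_mono) auto
          finally have "t \<le> (s\<^sup>2) powr x" using \<rho>x \<rho> x powr_mono2[of x \<rho> "s\<^sup>2"] by simp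
          also have "(s\<^sup>2) powr x = s powr (2 * x)" using s \<rho> by (simp add: powr_powr flip: powr_numeral)
          finally show "s \<in> {s \<in> space ?M. t \<le> s powr (2 * x)}" using s \<rho> by auto
        qed
        show "{s \<in> space ?M. t \<le> s powr (2 * x)} \<in> sets ?M"
          using meas[of "2 * x"] by measurable
      qed simp
      finally show ?thesis .
    qed
  qed
  then have "ennreal (moment \<omega> x) \<le> ennreal (C * moment \<omega> (2 * x))"
    using x C1 moment_nonneg[OF w] by (simp add: moment_eq[OF w] ennreal_mult)
  then show ?thesis using C1 moment_nonneg[OF w] by (simp add: ennreal_le_iff)
qed

text \<open>Each doubling step halves the distance to 1, so j steps from r reach t or go beyond
  it.\<close>

lemma upper_doubling_iterate:
  assumes w: "radial_weight \<omega>" and C: "upper_doubling_with C \<omega>"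
    and r: "0 \<le> r" "r < 1" and t: "0 \<le> t" "t < 1" "1 - r \<le> 2 ^ j * (1 - t)"
  shows "tail \<omega> r \<le> C ^ j * tail \<omega> t"
  using r t(3)
proof (induction j arbitrary: r)
  case 0
  then show ?case using t by (auto intro!: tail_antimono[OF w])
next
  case (Suc j)
  have C1: "1 \<le> C" and D: "tail \<omega> r \<le> C * tail \<omega> ((1 + r) / 2)"
    using C Suc.prems by (auto simp: upper_doubling_with_def)
  have "tail \<omega> ((1 + r) / 2) \<le> C ^ j * tail \<omega> t"
    using Suc.prems by (intro Suc.IH) (auto simp: field_simps)
  then have "C * tail \<omega> ((1 + r) / 2) \<le> C * (C ^ j * tail \<omega> t)"
    using C1 by (intro mult_left_mono) auto
  then show ?case using D by (simp add: mult.assoc)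
qed

text \<open>A is a power of C chosen from C and K alone, before any weight is given; for C < 1 no
  weight satisfies the hypothesis.\<close>

lemma upper_doubling_ratio:
  "\<exists>A\<ge>1. \<forall>\<omega> r t. radial_weight \<omega> \<longrightarrow> upper_doubling_with C \<omega> \<longrightarrow> 0 \<le> r \<longrightarrow> r < 1 \<longrightarrow> 0 \<le> t \<longrightarrow> t < 1 \<longrightarrow>
     1 - r \<le> K * (1 - t) \<longrightarrow> tail \<omega> r \<le> A * tail \<omega> t"
proof (cases "1 \<le> C")
  case True
  obtain j :: nat where j: "K \<le> 2 ^ j"
    using real_arch_pow[of 2 K] by (auto intro: less_imp_le)
  show ?thesis
  proof (intro exI[of _ "C ^ j"] conjI allI impI)
    show "1 \<le> C ^ j" using True by simp
    fix \<omega> and r t :: real assume *: "radial_weight \<omega>" "upper_doubling_with C \<omega>" "0 \<le> r" "r < 1" "0 \<le> t" "t < 1"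
      "1 - r \<le> K * (1 - t)"
    then have "1 - r \<le> 2 ^ j * (1 - t)" using j by (auto intro: order_trans mult_right_mono)
    with * show "tail \<omega> r \<le> C ^ j * tail \<omega> t" by (intro upper_doubling_iterate)
  qed
qed (auto simp: upper_doubling_with_def)

text \<open>Multiplying the exponent y by 2^j costs a factor C^j. For s < r the additional exponent
  gains a factor exp (1 - 2^j), because s powr y is at most exp (- 1) there. For large j the gain
  wins, and the contribution of s < r is absorbed into half of the moment.\<close>

lemma upper_doubling_moment_le_tail:
  "\<exists>A\<ge>1. \<forall>\<omega> r y. radial_weight \<omega> \<longrightarrow> upper_doubling_with C \<omega> \<longrightarrow> 0 \<le> r \<longrightarrow> r < 1 \<longrightarrow> 1 \<le> y * (1 - r) \<longrightarrow>
     moment \<omega> y \<le> A * tail \<omega> r"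
proof (cases "1 \<le> C")
  case True
  have "((\<lambda>j::nat. C ^ j * exp (1 - 2 ^ j)) \<longlongrightarrow> 0) sequentially"
  proof -
    have "filterlim (\<lambda>j::nat. real j * ln C + (1 - 2 ^ j)) at_bot sequentially"
      by real_asymp
    then have "((\<lambda>j::nat. exp (real j * ln C + (1 - 2 ^ j))) \<longlongrightarrow> 0) sequentially"
      by (rule filterlim_compose[OF exp_at_bot])
    then show ?thesis using True by (simp add: exp_add exp_of_nat_mult)
  qed
  then have "eventually (\<lambda>j::nat. C ^ j * exp (1 - 2 ^ j) < 1/2) sequentially"
    by (rule order_tendstoD) simp
  then obtain j :: nat where j: "C ^ j * exp (1 - 2 ^ j) < 1/2"
    by (auto simp: eventually_sequentially)
  show ?thesis
  proof (intro exI[of _ "2 * C ^ j"] conjI allI impI)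
    show "1 \<le> 2 * C ^ j" using one_le_power[OF True, of j] by linarith
    fix \<omega> and r y :: real assume w: "radial_weight \<omega>" and C: "upper_doubling_with C \<omega>" and r: "0 \<le> r" "r < 1" and y: "1 \<le> y * (1 - r)"
    have y0: "0 < y"
    proof (rule ccontr)
      assume "\<not> 0 < y" then have "y * (1 - r) \<le> 0" using r by (simp add: mult_le_0_iff)
      then show False using y by simp
    qed
    have 1: "moment \<omega> y \<le> C ^ i * moment \<omega> (2 ^ i * y)" for i
    proof (induction i)
      case (Suc i)
      have "moment \<omega> (2 ^ i * y) \<le> C * moment \<omega> (2 * (2 ^ i * y))"
        using y0 by (intro upper_doubling_moment[OF w C]) auto
      then have "C ^ i * moment \<omega> (2 ^ i * y) \<le> C ^ i * (C * moment \<omega> (2 * (2 ^ i * y)))"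
        using True by (intro mult_left_mono) auto
      then show ?case using Suc by (simp add: ac_simps)
    qed simp
    define E where "E = exp (1 - 2 ^ j :: real)"
    have "ennreal (moment \<omega> (2 ^ j * y)) = (\<integral>\<^sup>+s. ennreal (s powr (2 ^ j * y)) \<partial>weight_measure \<omega>)"
      using y0 by (simp add: moment_eq[OF w])
    also have "\<dots> \<le> (\<integral>\<^sup>+s. indicator {r..<1} s + ennreal E * ennreal (s powr y) \<partial>weight_measure \<omega>)"
    proof (rule nn_integral_mono)
      fix s assume "s \<in> space (weight_measure \<omega>)"
      then have s: "0 \<le> s" "s < 1" by auto
      show "ennreal (s powr (2 ^ j * y)) \<le> indicator {r..<1} s + ennreal E * ennreal (s powr y)"
      proof (cases "r \<le> s \<or> s = 0")
        case True
        have "s powr (2 ^ j * y) \<le> 1" using s y0 by (intro powr_le1) auto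
        then have "ennreal (s powr (2 ^ j * y)) \<le> indicator {r..<1} s" using True s
          by (cases "s = 0") (auto split: split_indicator)
        then show ?thesis by (rule order_trans) simp
      next
        case False
        then have sr: "s < r" "0 < s" using s by auto
        have "s powr (2 ^ j * y) = s powr ((2 ^ j - 1) * y) * s powr y"
          using sr by (simp add: powr_add[symmetric] algebra_simps)
        also have "s powr ((2 ^ j - 1) * y) \<le> exp (- (1 - r)) powr ((2 ^ j - 1) * y)"
        proof (rule powr_mono2)
          have "r \<le> exp (r - 1)" using exp_ge_add_one_self[of "r - 1"] by simp
          then show "s \<le> exp (- (1 - r))" using sr by simp
        qed (use sr y0 in auto)
        also have "\<dots> = exp (- ((2 ^ j - 1) * (y * (1 - r))))" by (simp add: exp_powr_real algebra_simps)
        also have "\<dots> \<le> E"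
        proof -
          have "(2 ^ j - 1) * 1 \<le> (2 ^ j - 1 :: real) * (y * (1 - r))"
            using y by (intro mult_left_mono) auto
          then show ?thesis unfolding E_def by simp
        qed
        finally have "s powr (2 ^ j * y) \<le> E * s powr y" by (simp add: mult_right_mono)
        then have "ennreal (s powr (2 ^ j * y)) \<le> ennreal E * ennreal (s powr y)"
          by (simp add: ennreal_mult'[symmetric] E_def)
        then show ?thesis by (rule order_trans) simp
      qed
    qed
    also have "\<dots> = ennreal (tail \<omega> r) + ennreal E * ennreal (moment \<omega> y)"
    proof -
      have m: "(\<lambda>s. ennreal (s powr y)) \<in> borel_measurable (weight_measure \<omega>)"
        by (intro borel_measurable_weight_measureI) auto
      then show ?thesis
        using r y0 by (subst nn_integral_add)
          (auto simp: Ico_sets_weight_measure emeasure_weight_measure[OF w] moment_eq[OF w] nn_integral_cmult[OF m]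
              intro!: borel_measurable_indicator)
    qed
    also have "\<dots> = ennreal (tail \<omega> r + E * moment \<omega> y)"
      using tail_pos[OF w r] moment_nonneg[OF w] by (simp add: E_def ennreal_mult)
    finally have 2: "moment \<omega> (2 ^ j * y) \<le> tail \<omega> r + E * moment \<omega> y"
      using tail_pos[OF w r] moment_nonneg[OF w] by (subst (asm) ennreal_le_iff) (auto simp: E_def intro: add_nonneg_nonneg)
    have "moment \<omega> y \<le> C ^ j * (tail \<omega> r + E * moment \<omega> y)"
      using 1[of j] 2 True by (meson mult_left_mono order_trans zero_le_power zero_le_one)
    also have "\<dots> = C ^ j * tail \<omega> r + (C ^ j * E) * moment \<omega> y" by (simp add: algebra_simps)
    also have "(C ^ j * E) * moment \<omega> y \<le> (1/2) * moment \<omega> y"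
      using j moment_nonneg[OF w] unfolding E_def by (intro mult_right_mono) auto
    finally show "moment \<omega> y \<le> 2 * C ^ j * tail \<omega> r" by simp
  qed
qed (auto simp: upper_doubling_with_def)

text \<open>On [1/2, 1) one has ln x \<ge> - 2 (1 - x). Hence a power of x whose exponent is of
  order 1 / (1 - x) stays bounded below.\<close>

lemma power_ge_exp:
  fixes x a B :: real
  assumes "1/2 \<le> x" "x < 1" "a * (1 - x) \<le> B" "0 \<le> a"
  shows "exp (- 2 * B) \<le> x powr a"
proof -
  have "ln (1 / x) \<le> 1 / x - 1" using assms by (intro ln_le_minus_one) auto
  also have "\<dots> \<le> 2 * (1 - x)" using assms mult_nonneg_nonneg[of "1 - x" "2 * x - 1"]
    by (auto simp: field_simps)
  finally have "- 2 * (1 - x) \<le> ln x" using assms by (simp add: ln_div)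
  then have "a * (- 2 * (1 - x)) \<le> a * ln x" using assms by (intro mult_left_mono) auto
  moreover have "a * (- 2 * (1 - x)) = - 2 * (a * (1 - x))" by (simp add: algebra_simps)
  ultimately have "- 2 * B \<le> a * ln x" using assms(3) by linarith
  then have "exp (- 2 * B) \<le> exp (a * ln x)" by simp
  then show ?thesis using assms by (simp add: powr_def)
qed

subsection \<open>Means over circles\<close>

text \<open>Normalised arc length, parametrised by a half-open interval so that each point of the
  circle is counted once.\<close>

definition circle_measure :: "real measure" where
  "circle_measure = density lborel (\<lambda>\<theta>. ennreal (indicator {0..<2*pi} \<theta> / (2*pi)))"

lemma space_circle [simp]: "space circle_measure = UNIV"
  by (simp add: circle_measure_def)

lemma sets_circle [simp, measurable_cong]: "sets circle_measure = sets borel"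
  by (simp add: circle_measure_def)

lemma nn_integral_circle:
  assumes [measurable]: "f \<in> borel_measurable borel"
  shows "(\<integral>\<^sup>+\<theta>. f \<theta> \<partial>circle_measure) = ennreal (1 / (2*pi)) * (\<integral>\<^sup>+\<theta>. f \<theta> * indicator {0..<2*pi} \<theta> \<partial>lborel)"
proof -
  have "(\<integral>\<^sup>+\<theta>. f \<theta> \<partial>circle_measure) = (\<integral>\<^sup>+\<theta>. ennreal (indicator {0..<2*pi} \<theta> / (2*pi)) * f \<theta> \<partial>lborel)"
    unfolding circle_measure_def by (subst nn_integral_density) auto
  also have "\<dots> = (\<integral>\<^sup>+\<theta>. ennreal (1 / (2*pi)) * (f \<theta> * indicator {0..<2*pi} \<theta>) \<partial>lborel)"
    by (intro nn_integral_cong) (auto split: split_indicator)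
  finally show ?thesis by (simp add: nn_integral_cmult)
qed

lemma emeasure_circle: "emeasure circle_measure UNIV = 1"
  using nn_integral_circle[of "\<lambda>_. 1"] by (simp add: ennreal_mult'[symmetric])

lemma finite_measure_circle: "finite_measure circle_measure"
  by (rule finite_measureI) (simp add: emeasure_circle)

lemma integral_circle:
  fixes f :: "real \<Rightarrow> 'a::{banach, second_countable_topology}"
  assumes [measurable]: "f \<in> borel_measurable borel"
  shows "integral\<^sup>L circle_measure f = (1 / (2*pi)) *\<^sub>R (LINT \<theta>:{0..2*pi}|lborel. f \<theta>)"
proof -
  have "integral\<^sup>L circle_measure f = (\<integral>\<theta>. (indicator {0..<2*pi} \<theta> / (2*pi)) *\<^sub>R f \<theta> \<partial>lborel)"
    unfolding circle_measure_def by (subst integral_density) auto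
  also have "\<dots> = (\<integral>\<theta>. (1 / (2*pi)) *\<^sub>R (indicator {0..2*pi} \<theta> *\<^sub>R f \<theta>) \<partial>lborel)"
  proof (rule integral_cong_AE)
    have "AE \<theta> in lborel. \<theta> \<noteq> 2*pi" by (rule AE_lborel_singleton)
    then show "AE \<theta> in lborel. (indicator {0..<2*pi} \<theta> / (2*pi)) *\<^sub>R f \<theta> = (1 / (2*pi)) *\<^sub>R (indicator {0..2*pi} \<theta> *\<^sub>R f \<theta>)"
      by eventually_elim (auto split: split_indicator)
  qed auto
  finally show ?thesis unfolding set_lebesgue_integral_def by (simp only: integral_scaleR_right)
qed

lemma integrable_circle:
  fixes f :: "real \<Rightarrow> 'a::{banach, second_countable_topology}"
  assumes f: "f \<in> borel_measurable borel" and B: "\<And>\<theta>. 0 \<le> \<theta> \<Longrightarrow> \<theta> \<le> 2*pi \<Longrightarrow> norm (f \<theta>) \<le> B"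
  shows "integrable circle_measure f"
proof -
  interpret finite_measure circle_measure by (rule finite_measure_circle)
  have "AE \<theta> in circle_measure. norm (f \<theta>) \<le> B"
    unfolding circle_measure_def using B by (subst AE_density) (auto split: split_indicator)
  then show ?thesis
    using f by (intro integrable_const_bound[where B = B]) (auto simp: measurable_cong_sets[OF sets_circle refl])
qed

lemma cis_measurable [measurable]: "(\<lambda>\<theta>. cis (f \<theta>)) \<in> borel_measurable M" if "f \<in> borel_measurable M"
proof -
  have "cis \<in> borel_measurable borel"
    by (intro borel_measurable_continuous_onI continuous_intros)
  from measurable_compose[OF that this] show ?thesis .
qed

section \<open>Fourier coefficients, Parseval's identity and Hardy's inequality\<close>

lemma integral_circle_cis:
  "(\<integral>\<theta>. cis (of_int n * \<theta>) \<partial>circle_measure) = (if n = 0 then 1 else 0)"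
proof (cases "n = 0")
  case True
  then show ?thesis by (simp add: measure_def emeasure_circle)
next
  case False
  let ?F = "\<lambda>\<theta>. cis (of_int n * \<theta>) / (\<i> * of_int n)"
  have "(LINT \<theta>:{0..2*pi}|lborel. cis (of_int n * \<theta>)) = ?F (2*pi) - ?F 0"
    unfolding set_lebesgue_integral_def
  proof (rule integral_FTC_Icc)
    fix \<theta> :: real assume "0 \<le> \<theta>" "\<theta> \<le> 2*pi"
    show "(?F has_vector_derivative cis (of_int n * \<theta>)) (at \<theta> within {0..2*pi})"
      unfolding cis_conv_exp using False
      by (auto intro!: derivative_eq_intros has_vector_derivative_real_field simp: field_simps)
  qed (auto intro!: continuous_intros)
  also have "?F (2*pi) = ?F 0"
    using cis_multiple_2pi[of "of_int n"] by (simp add: mult.commute mult.left_commute)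
  finally show ?thesis using False by (subst integral_circle) auto
qed

lemma integral_circle_saw:
  "(\<integral>\<theta>. cis (real (Suc n) * \<theta>) * of_real (pi - \<theta>) \<partial>circle_measure) = \<i> / of_nat (Suc n)"
proof -
  let ?N = "of_nat (Suc n) :: complex"
  \<comment> \<open>An antiderivative found by integration by parts; its last term takes equal
    values at both end points and drops out.\<close>
  let ?F = "\<lambda>\<theta>. cis (real (Suc n) * \<theta>) * (of_real (pi - \<theta>) / (\<i> * ?N) - 1 / ?N\<^sup>2)"
  have N: "?N \<noteq> 0" using of_nat_neq_0 by blast
  have "(LINT \<theta>:{0..2*pi}|lborel. cis (real (Suc n) * \<theta>) * of_real (pi - \<theta>)) = ?F (2*pi) - ?F 0"
    unfolding set_lebesgue_integral_def
  proof (rule integral_FTC_Icc)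
    fix \<theta> :: real assume "0 \<le> \<theta>" "\<theta> \<le> 2*pi"
    have "((\<lambda>z. exp (\<i> * (?N * z)) * ((of_real pi - z) / (\<i> * ?N) - 1 / ?N\<^sup>2)) has_field_derivative
        exp (\<i> * (?N * of_real \<theta>)) * (of_real pi - of_real \<theta>)) (at (of_real \<theta>))"
      using N by (auto intro!: derivative_eq_intros simp: field_simps power2_eq_square simp del: of_nat_Suc)
    then show "(?F has_vector_derivative cis (real (Suc n) * \<theta>) * of_real (pi - \<theta>)) (at \<theta> within {0..2*pi})"
      unfolding cis_conv_exp
      using has_vector_derivative_real_field[of _ _ \<theta>] by (force simp: has_vector_derivative_at_within)
  qed (auto intro!: continuous_intros)
  also have "cis (real (Suc n) * (2*pi)) = 1"
    using cis_multiple_2pi[of "real (Suc n)"] by (simp add: mult.commute mult.left_commute del: of_nat_Suc)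
  finally have *: "(LINT \<theta>:{0..2*pi}|lborel. cis (real (Suc n) * \<theta>) * of_real (pi - \<theta>)) = - 2 * pi / (\<i> * ?N)"
    using N by (simp add: field_simps)
  show ?thesis
    by (subst integral_circle, measurable, subst *)
      (use N in \<open>simp add: scaleR_conv_of_real field_simps del: of_nat_Suc\<close>)
qed

context
  fixes a :: "nat \<Rightarrow> complex" and \<phi> :: "real \<Rightarrow> complex" and B :: real
  assumes a: "summable (\<lambda>n. cmod (a n))"
    and \<phi> [measurable]: "\<phi> \<in> borel_measurable borel"
    and B: "\<And>\<theta>. 0 \<le> \<theta> \<Longrightarrow> \<theta> \<le> 2*pi \<Longrightarrow> cmod (\<phi> \<theta>) \<le> B"
begin

text \<open>Absolute convergence of the coefficients and boundedness of \<open>\<phi>\<close> permit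
  termwise integration. The coefficient formula, Parseval's identity and Hardy's inequality are the
  cases where \<open>\<phi>\<close> is a character, the conjugate of the sum itself, and a
  sawtooth.\<close>

lemma sums_integral_circle:
  "(\<lambda>n. a n * (\<integral>\<theta>. cis (real n * \<theta>) * \<phi> \<theta> \<partial>circle_measure)) sums
     (\<integral>\<theta>. (\<Sum>n. a n * cis (real n * \<theta>)) * \<phi> \<theta> \<partial>circle_measure)"
proof -
  interpret finite_measure circle_measure by (rule finite_measure_circle)
  let ?f = "\<lambda>n \<theta>. a n * (cis (real n * \<theta>) * \<phi> \<theta>)"
  have i: "integrable circle_measure (?f n)" for n
    using B by (intro integrable_circle[where B = "cmod (a n) * B"])
      (auto simp: norm_mult intro!: mult_left_mono)
  have B0: "0 \<le> B" using B[of 0] order_trans[OF norm_ge_zero[of "\<phi> 0"], of B] by simp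
  have ae: "AE \<theta> in circle_measure. norm (?f n \<theta>) \<le> cmod (a n) * B" for n
    unfolding circle_measure_def using B
    by (subst AE_density) (auto simp: norm_mult intro!: mult_left_mono split: split_indicator)
  have "(\<lambda>n. integral\<^sup>L circle_measure (?f n)) sums (\<integral>\<theta>. (\<Sum>n. ?f n \<theta>) \<partial>circle_measure)"
  proof (rule sums_integral[OF i])
    have "summable (\<lambda>n. norm (?f n \<theta>))" for \<theta>
    proof -
      have "summable (\<lambda>n. cmod (a n) * cmod (\<phi> \<theta>))" using a by (rule summable_mult2)
      then show ?thesis by (simp add: norm_mult)
    qed
    then show "AE \<theta> in circle_measure. summable (\<lambda>n. norm (?f n \<theta>))" by simp
    show "summable (\<lambda>n. \<integral>\<theta>. norm (?f n \<theta>) \<partial>circle_measure)"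
    proof (rule summable_comparison_test'[where N = 0])
      show "summable (\<lambda>n. cmod (a n) * B)" using a by (rule summable_mult2)
      fix n
      have "(\<integral>\<theta>. norm (?f n \<theta>) \<partial>circle_measure) \<le> (\<integral>\<theta>. cmod (a n) * B \<partial>circle_measure)"
        using i ae by (intro integral_mono_AE) auto
      also have "\<dots> = cmod (a n) * B" using emeasure_circle by (simp add: measure_def)
      finally show "norm (\<integral>\<theta>. norm (?f n \<theta>) \<partial>circle_measure) \<le> cmod (a n) * B" by simp
    qed
  qed
  moreover have "(\<Sum>n. ?f n \<theta>) = (\<Sum>n. a n * cis (real n * \<theta>)) * \<phi> \<theta>" for \<theta>
  proof -
    have "summable (\<lambda>n. a n * cis (real n * \<theta>))"
      by (rule summable_norm_cancel) (simp add: norm_mult a)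
    then show ?thesis by (simp add: suminf_mult2 mult.assoc)
  qed
  ultimately show ?thesis by simp
qed

end

lemma series_circle_bounded:
  assumes a: "summable (\<lambda>n. cmod (a n))"
  shows "cmod (\<Sum>n. a n * cis (real n * \<theta>)) \<le> (\<Sum>n. cmod (a n))"
  using summable_norm[of "\<lambda>n. a n * cis (real n * \<theta>)"] a by (simp add: norm_mult)

lemma integral_circle_coeff:
  assumes a: "summable (\<lambda>n. cmod (a n))"
  shows "(\<integral>\<theta>. (\<Sum>n. a n * cis (real n * \<theta>)) * cis (- (real m * \<theta>)) \<partial>circle_measure) = a m"
proof -
  have "(\<lambda>n. a n * (\<integral>\<theta>. cis (real n * \<theta>) * cis (- (real m * \<theta>)) \<partial>circle_measure)) sums
      (\<integral>\<theta>. (\<Sum>n. a n * cis (real n * \<theta>)) * cis (- (real m * \<theta>)) \<partial>circle_measure)"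
    by (rule sums_integral_circle[OF a, where B = 1]) auto
  moreover have "(\<integral>\<theta>. cis (real n * \<theta>) * cis (- (real m * \<theta>)) \<partial>circle_measure) = (if n = m then 1 else 0)" for n
    using integral_circle_cis[of "int n - int m"] by (simp add: cis_mult algebra_simps)
  ultimately have "(\<lambda>n. if n = m then a n else 0) sums
      (\<integral>\<theta>. (\<Sum>n. a n * cis (real n * \<theta>)) * cis (- (real m * \<theta>)) \<partial>circle_measure)"
    by (simp add: if_distrib cong: if_cong)
  then show ?thesis using sums_single[of m a] sums_unique2 by blast
qed

text \<open>The sum is integrated termwise against its own conjugate; the n-th integral is the
  conjugate of the n-th coefficient.\<close>

lemma Parseval_circle:
  assumes a: "summable (\<lambda>n. cmod (a n))"
  shows "(\<lambda>n. (cmod (a n))\<^sup>2) sums (\<integral>\<theta>. (cmod (\<Sum>n. a n * cis (real n * \<theta>)))\<^sup>2 \<partial>circle_measure)"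
proof -
  let ?g = "\<lambda>\<theta>. \<Sum>n. a n * cis (real n * \<theta>)"
  have cnj: "cnj \<in> borel_measurable borel"
    by (intro borel_measurable_continuous_onI continuous_intros)
  have "(\<lambda>n. a n * (\<integral>\<theta>. cis (real n * \<theta>) * cnj (?g \<theta>) \<partial>circle_measure)) sums
      (\<integral>\<theta>. ?g \<theta> * cnj (?g \<theta>) \<partial>circle_measure)"
    using series_circle_bounded[OF a]
    by (intro sums_integral_circle[OF a, where B = "\<Sum>n. cmod (a n)"])
       (auto intro!: borel_measurable_suminf measurable_compose[OF _ cnj])
  moreover have "(\<integral>\<theta>. cis (real n * \<theta>) * cnj (?g \<theta>) \<partial>circle_measure) = cnj (a n)" for n
  proof -
    have "(\<integral>\<theta>. cis (real n * \<theta>) * cnj (?g \<theta>) \<partial>circle_measure)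
        = (\<integral>\<theta>. cnj (?g \<theta> * cis (- (real n * \<theta>))) \<partial>circle_measure)"
      by (simp add: cis_cnj mult.commute)
    then show ?thesis by (simp only: Bochner_Integration.integral_cnj integral_circle_coeff[OF a])
  qed
  ultimately have "(\<lambda>n. complex_of_real ((cmod (a n))\<^sup>2)) sums
      (\<integral>\<theta>. complex_of_real ((cmod (?g \<theta>))\<^sup>2) \<partial>circle_measure)"
    by (simp only: complex_norm_square)
  then show ?thesis by (simp only: integral_complex_of_real sums_of_real_iff)
qed

text \<open>Each coefficient is the integral of the sum against a function of modulus 1.\<close>

lemma coeff_le_circle_mean:
  assumes a: "summable (\<lambda>n. cmod (a n))"
  shows "cmod (a m) \<le> (\<integral>\<theta>. cmod (\<Sum>n. a n * cis (real n * \<theta>)) \<partial>circle_measure)"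
proof -
  have "cmod (a m) \<le> (\<integral>\<theta>. cmod ((\<Sum>n. a n * cis (real n * \<theta>)) * cis (- (real m * \<theta>))) \<partial>circle_measure)"
    unfolding integral_circle_coeff[OF a, of m, symmetric] by (rule integral_norm_bound)
  then show ?thesis by (simp add: norm_mult)
qed

text \<open>Hardy's inequality for nonnegative coefficients: the coefficients of the sawtooth
  \<open>\<pi> - \<theta>\<close> are \<open>\<plusminus>\<i> / n\<close>, and it is bounded by \<open>\<pi>\<close>.\<close>

lemma Hardy_circle_mean:
  assumes a: "summable a" and nonneg: "\<And>n. 0 \<le> a n" and F: "finite F"
  shows "(\<Sum>n\<in>F. a n / real (Suc n))
    \<le> pi * (\<integral>\<theta>. cmod (\<Sum>n. of_real (a n) * cis (real n * \<theta>)) \<partial>circle_measure)"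
proof -
  let ?g = "\<lambda>\<theta>. \<Sum>n. of_real (a n) * cis (real n * \<theta>)"
  \<comment> \<open>The factor cis \<theta> shifts frequencies by one: coefficient n meets the
    sawtooth at frequency n + 1, so frequency 0 never occurs and the divisor is Suc n.\<close>
  let ?\<phi> = "\<lambda>\<theta>. cis \<theta> * of_real (pi - \<theta>)"
  have a': "summable (\<lambda>n. cmod (of_real (a n)))" using a nonneg by simp
  have meas: "?g \<in> borel_measurable borel" by (intro borel_measurable_suminf) measurable
  have "(\<lambda>n. of_real (a n) * (\<integral>\<theta>. cis (real n * \<theta>) * ?\<phi> \<theta> \<partial>circle_measure)) sums
      (\<integral>\<theta>. ?g \<theta> * ?\<phi> \<theta> \<partial>circle_measure)"
    by (rule sums_integral_circle[OF a', where B = pi]) (auto simp: norm_mult simp del: of_real_diff)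
  moreover have "(\<integral>\<theta>. cis (real n * \<theta>) * ?\<phi> \<theta> \<partial>circle_measure) = \<i> / of_nat (Suc n)" for n
  proof -
    have "cis (real n * \<theta>) * ?\<phi> \<theta> = cis (real (Suc n) * \<theta>) * of_real (pi - \<theta>)" for \<theta>
    proof -
      have "real n * \<theta> + \<theta> = real (Suc n) * \<theta>" by (simp add: distrib_right)
      then show ?thesis by (simp only: mult.assoc[symmetric] cis_mult)
    qed
    then show ?thesis by (simp only: integral_circle_saw)
  qed
  ultimately have "(\<lambda>n. \<i> * of_real (a n / real (Suc n))) sums (\<integral>\<theta>. ?g \<theta> * ?\<phi> \<theta> \<partial>circle_measure)"
    by (simp add: mult.commute)
  then have S: "(\<lambda>n. of_real (a n / real (Suc n))) sums (- \<i> * (\<integral>\<theta>. ?g \<theta> * ?\<phi> \<theta> \<partial>circle_measure))"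
    using sums_mult[of "\<lambda>n. \<i> * of_real (a n / real (Suc n))" _ "- \<i>"] by (simp del: of_nat_Suc)
  have S2: "summable (\<lambda>n. a n / real (Suc n))"
  proof (rule summable_comparison_test'[OF a])
    fix n show "norm (a n / real (Suc n)) \<le> a n"
      using nonneg[of n] by (simp add: field_simps mult_left_mono)
  qed
  have "(\<Sum>n\<in>F. a n / real (Suc n)) \<le> (\<Sum>n. a n / real (Suc n))"
    using nonneg by (intro sum_le_suminf S2 F) auto
  \<comment> \<open>The terms are nonnegative, so the sum is its own modulus and is bounded by the
    norm of the integral.\<close>
  also have "\<dots> = cmod (of_real (\<Sum>n. a n / real (Suc n)))"
    using nonneg by (simp add: suminf_nonneg S2 del: of_nat_Suc)
  also have "complex_of_real (\<Sum>n. a n / real (Suc n)) = - \<i> * (\<integral>\<theta>. ?g \<theta> * ?\<phi> \<theta> \<partial>circle_measure)"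
    using sums_of_real[OF summable_sums[OF S2]] S by (rule sums_unique2)
  also have "cmod \<dots> \<le> (\<integral>\<theta>. cmod (?g \<theta> * ?\<phi> \<theta>) \<partial>circle_measure)"
    by (simp add: norm_mult) (use integral_norm_bound[of circle_measure "\<lambda>\<theta>. ?g \<theta> * ?\<phi> \<theta>"] in \<open>simp add: norm_mult\<close>)
  also have "\<dots> \<le> (\<integral>\<theta>. pi * cmod (?g \<theta>) \<partial>circle_measure)"
  proof (rule integral_mono_AE)
    have b: "cmod (?g \<theta>) \<le> (\<Sum>n. cmod (of_real (a n)))" for \<theta>
      by (rule series_circle_bounded[OF a'])
    show "integrable circle_measure (\<lambda>\<theta>. pi * cmod (?g \<theta>))"
      using meas b by (intro integrable_mult_right integrable_circle[where B = "\<Sum>n. cmod (of_real (a n))"]) auto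
    show "integrable circle_measure (\<lambda>\<theta>. cmod (?g \<theta> * ?\<phi> \<theta>))"
    proof (rule integrable_circle[where B = "(\<Sum>n. cmod (of_real (a n))) * pi"])
      show "(\<lambda>\<theta>. cmod (?g \<theta> * ?\<phi> \<theta>)) \<in> borel_measurable borel" using meas by measurable
      fix \<theta> :: real assume "0 \<le> \<theta>" "\<theta> \<le> 2*pi"
      then show "norm (cmod (?g \<theta> * ?\<phi> \<theta>)) \<le> (\<Sum>n. cmod (of_real (a n))) * pi"
        using b[of \<theta>] by (auto simp: norm_mult simp del: of_real_diff intro!: mult_mono)
          (use a' in \<open>auto intro!: suminf_nonneg\<close>)
    qed
    show "AE \<theta> in circle_measure. cmod (?g \<theta> * ?\<phi> \<theta>) \<le> pi * cmod (?g \<theta>)"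
      unfolding circle_measure_def
      by (subst AE_density) (auto simp: norm_mult mult.commute simp del: of_real_diff split: split_indicator intro!: mult_right_mono)
  qed
  finally show ?thesis by simp
qed

text \<open>Rotation by the angle \<phi> moves the range of integration to {\<phi>..<2*pi+\<phi>};
  the piece beyond 2*pi is moved back to {0..<\<phi>} by periodicity.\<close>

lemma nn_integral_circle_rotate:
  assumes [measurable]: "h \<in> borel_measurable borel" and c: "cmod c = 1"
  shows "(\<integral>\<^sup>+\<theta>. h (c * cis \<theta>) \<partial>circle_measure) = (\<integral>\<^sup>+\<theta>. h (cis \<theta>) \<partial>circle_measure)"
proof -
  obtain \<phi> where \<phi>: "0 \<le> \<phi>" "\<phi> < 2*pi" "c = cis \<phi>"
  proof
    show "c = cis (Arg2pi c)" using Arg2pi_eq[of c] unfolding cis_conv_exp c by simp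
  qed (auto simp: Arg2pi_ge_0 Arg2pi_lt_2pi)
  let ?g = "\<lambda>\<theta>. h (cis \<theta>)"
  have shift: "(\<integral>\<^sup>+\<theta>. f \<theta> \<partial>lborel) = (\<integral>\<^sup>+\<theta>. f (t + \<theta>) \<partial>lborel)" if "f \<in> borel_measurable borel" for f and t :: real
    using nn_integral_real_affine[of f 1 t] that by simp
  have "(\<integral>\<^sup>+\<theta>. ?g (\<phi> + \<theta>) * indicator {0..<2*pi} \<theta> \<partial>lborel)
      = (\<integral>\<^sup>+\<theta>. ?g (\<phi> + \<theta>) * indicator {\<phi>..<2*pi+\<phi>} (\<phi> + \<theta>) \<partial>lborel)"
    by (intro nn_integral_cong) (auto split: split_indicator)
  also have "\<dots> = (\<integral>\<^sup>+\<theta>. ?g \<theta> * indicator {\<phi>..<2*pi+\<phi>} \<theta> \<partial>lborel)"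
    by (subst shift[of "\<lambda>\<theta>. ?g \<theta> * indicator {\<phi>..<2*pi+\<phi>} \<theta>" \<phi>]) auto
  also have "\<dots> = (\<integral>\<^sup>+\<theta>. ?g \<theta> * indicator {\<phi>..<2*pi} \<theta> + ?g \<theta> * indicator {2*pi..<2*pi+\<phi>} \<theta> \<partial>lborel)"
    using \<phi> by (intro nn_integral_cong) (auto split: split_indicator)
  also have "\<dots> = (\<integral>\<^sup>+\<theta>. ?g \<theta> * indicator {\<phi>..<2*pi} \<theta> \<partial>lborel) + (\<integral>\<^sup>+\<theta>. ?g \<theta> * indicator {2*pi..<2*pi+\<phi>} \<theta> \<partial>lborel)"
    by (intro nn_integral_add) auto
  also have "(\<integral>\<^sup>+\<theta>. ?g \<theta> * indicator {2*pi..<2*pi+\<phi>} \<theta> \<partial>lborel)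
      = (\<integral>\<^sup>+\<theta>. ?g (2*pi+\<theta>) * indicator {2*pi..<2*pi+\<phi>} (2*pi+\<theta>) \<partial>lborel)"
    by (rule shift) auto
  also have "\<dots> = (\<integral>\<^sup>+\<theta>. ?g \<theta> * indicator {0..<\<phi>} \<theta> \<partial>lborel)"
    by (intro nn_integral_cong) (auto split: split_indicator simp flip: cis_mult)
  also have "(\<integral>\<^sup>+\<theta>. ?g \<theta> * indicator {\<phi>..<2*pi} \<theta> \<partial>lborel) + (\<integral>\<^sup>+\<theta>. ?g \<theta> * indicator {0..<\<phi>} \<theta> \<partial>lborel)
      = (\<integral>\<^sup>+\<theta>. ?g \<theta> * indicator {\<phi>..<2*pi} \<theta> + ?g \<theta> * indicator {0..<\<phi>} \<theta> \<partial>lborel)"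
    by (intro nn_integral_add[symmetric]) auto
  also have "\<dots> = (\<integral>\<^sup>+\<theta>. ?g \<theta> * indicator {0..<2*pi} \<theta> \<partial>lborel)"
    using \<phi> by (intro nn_integral_cong) (auto split: split_indicator)
  finally show ?thesis by (subst (1 2) nn_integral_circle) (auto simp: \<phi> cis_mult)
qed

subsection \<open>The circle means of the Bergman kernel\<close>

definition kernel_coeff :: "(real \<Rightarrow> real) \<Rightarrow> nat \<Rightarrow> real" where
  "kernel_coeff \<omega> n = 1 / (2 * moment \<omega> (2 * real n + 1))"

text \<open>The kernel depends only on \<open>cnj z * \<zeta>\<close>; with first argument 1 it is
  the function F of its second argument, taken here on the circle of radius x.\<close>

definition kernel_mean :: "(real \<Rightarrow> real) \<Rightarrow> real \<Rightarrow> real" where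
  "kernel_mean \<omega> x = (\<integral>\<theta>. cmod (bergman_kernel \<omega> 1 (of_real x * cis \<theta>)) \<partial>circle_measure)"

lemma kernel_coeff_pos: "radial_weight \<omega> \<Longrightarrow> 0 < kernel_coeff \<omega> n"
  by (simp add: kernel_coeff_def moment_pos)

lemma kernel_coeff_mono:
  assumes "radial_weight \<omega>" "m \<le> n"
  shows "kernel_coeff \<omega> m \<le> kernel_coeff \<omega> n"
  unfolding kernel_coeff_def using assms
  by (intro divide_left_mono mult_left_mono moment_antimono mult_pos_pos) (auto intro: moment_pos)

text \<open>Keeping only the mass beyond the radius sqrt q shows that the moment of order 2 n + 1 is
  at least a constant times q^n. With x < q < 1 a geometric series of ratio x / q dominates.\<close>

lemma summable_kernel_coeff:
  assumes w: "radial_weight \<omega>" and x: "0 \<le> x" "x < 1"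
  shows "summable (\<lambda>n. kernel_coeff \<omega> n * x ^ n)"
proof -
  define q where "q = (1 + x) / 2"
  have q: "0 < q" "q < 1" "x < q" using x by (auto simp: q_def)
  let ?r = "sqrt q"
  have r: "0 < ?r" "?r < 1" using q by (auto simp: real_sqrt_lt_1_iff)
  have T: "0 < tail \<omega> ?r" using tail_pos[OF w] r by auto
  have rp: "?r powr (2 * real n + 1) = ?r * q ^ n" for n
  proof -
    have "2 * real n + 1 = real (2 * n + 1)" by simp
    then have "?r powr (2 * real n + 1) = ?r ^ (2 * n + 1)" using r by (simp only: powr_realpow)
    also have "\<dots> = ?r * q ^ n" using q by (simp add: power_mult)
    finally show ?thesis .
  qed
  show ?thesis
  proof (rule summable_comparison_test'[where N = 0])
    show "summable (\<lambda>n. 1 / (2 * ?r * tail \<omega> ?r) * (x / q) ^ n)"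
      using q x by (intro summable_mult summable_geometric) auto
    fix n
    have "?r * q ^ n * tail \<omega> ?r \<le> moment \<omega> (2 * real n + 1)"
      using moment_ge[OF w, of "2 * real n + 1" ?r] r rp[of n] by simp
    then have "kernel_coeff \<omega> n \<le> 1 / (2 * (?r * q ^ n * tail \<omega> ?r))"
      unfolding kernel_coeff_def using r q T moment_pos[OF w, of "2 * real n + 1"]
      by (intro divide_left_mono mult_left_mono mult_pos_pos) auto
    then have "kernel_coeff \<omega> n * x ^ n \<le> 1 / (2 * (?r * q ^ n * tail \<omega> ?r)) * x ^ n"
      using x by (intro mult_right_mono) auto
    also have "\<dots> = 1 / (2 * ?r * tail \<omega> ?r) * (x / q) ^ n" by (simp add: power_divide)
    finally show "norm (kernel_coeff \<omega> n * x ^ n) \<le> 1 / (2 * ?r * tail \<omega> ?r) * (x / q) ^ n"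
      using x kernel_coeff_pos[OF w, of n] by (simp add: abs_mult)
  qed
qed

lemma bergman_kernel_eq:
  "bergman_kernel \<omega> z \<zeta> = (\<Sum>n. of_real (kernel_coeff \<omega> n) * (cnj z * \<zeta>) ^ n)"
  unfolding bergman_kernel_def kernel_coeff_def by (simp add: field_simps)

lemma bergman_kernel_circle:
  "bergman_kernel \<omega> 1 (of_real x * cis \<theta>)
     = (\<Sum>n. of_real (kernel_coeff \<omega> n * x ^ n) * cis (real n * \<theta>))"
  unfolding bergman_kernel_eq by (simp add: power_mult_distrib Complex.DeMoivre mult.assoc)

lemma kernel_mean_eq:
  "kernel_mean \<omega> x = (\<integral>\<theta>. cmod (\<Sum>n. of_real (kernel_coeff \<omega> n * x ^ n) * cis (real n * \<theta>)) \<partial>circle_measure)"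
  unfolding kernel_mean_def bergman_kernel_circle ..

lemma kernel_mean_nonneg: "0 \<le> kernel_mean \<omega> x"
  unfolding kernel_mean_def by (intro Bochner_Integration.integral_nonneg) simp

lemma kernel_mean_ge_coeff:
  assumes w: "radial_weight \<omega>" and x: "0 \<le> x" "x < 1"
  shows "kernel_coeff \<omega> n * x ^ n \<le> kernel_mean \<omega> x"
proof -
  have "summable (\<lambda>n. cmod (of_real (kernel_coeff \<omega> n * x ^ n)))"
    using summable_kernel_coeff[OF w x] x kernel_coeff_pos[OF w]
    by (simp add: norm_mult norm_power less_imp_le)
  from coeff_le_circle_mean[OF this, of n] show ?thesis
    unfolding kernel_mean_eq using x kernel_coeff_pos[OF w, of n] by (simp add: norm_mult norm_power)
qed

lemma kernel_mean_Hardy: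
  assumes w: "radial_weight \<omega>" and x: "0 \<le> x" "x < 1" and F: "finite F"
  shows "(\<Sum>n\<in>F. kernel_coeff \<omega> n * x ^ n / real (Suc n)) \<le> pi * kernel_mean \<omega> x"
  unfolding kernel_mean_eq
  by (rule Hardy_circle_mean[OF summable_kernel_coeff[OF w x] _ F])
    (use x kernel_coeff_pos[OF w] in \<open>auto simp: less_imp_le\<close>)

lemma bergman_kernel_measurable [measurable]:
  assumes "f \<in> borel_measurable M" "g \<in> borel_measurable M"
  shows "(\<lambda>x. bergman_kernel \<omega> (f x) (g x)) \<in> borel_measurable M"
proof -
  have "cnj \<in> borel_measurable borel"
    by (intro borel_measurable_continuous_onI continuous_intros)
  from measurable_compose[OF assms(1) this] assms(2) show ?thesis
    unfolding bergman_kernel_eq by (intro borel_measurable_suminf) simp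
qed

lemma bergman_kernel_bounded:
  assumes w: "radial_weight \<omega>" and u: "cmod z * cmod \<zeta> < 1"
  shows "cmod (bergman_kernel \<omega> z \<zeta>) \<le> (\<Sum>n. kernel_coeff \<omega> n * (cmod z * cmod \<zeta>) ^ n)"
proof -
  have "summable (\<lambda>n. cmod (of_real (kernel_coeff \<omega> n) * (cnj z * \<zeta>) ^ n))"
    using summable_kernel_coeff[OF w _ u] kernel_coeff_pos[OF w]
    by (simp add: norm_mult norm_power less_imp_le)
  from summable_norm[OF this] show ?thesis
    unfolding bergman_kernel_eq using kernel_coeff_pos[OF w] by (simp add: norm_mult norm_power less_imp_le)
qed

lemma kernel_mean_nn_integral:
  assumes w: "radial_weight \<omega>" and x: "0 \<le> x" "x < 1"
  shows "ennreal (kernel_mean \<omega> x) = (\<integral>\<^sup>+\<theta>. ennreal (cmod (bergman_kernel \<omega> 1 (of_real x * cis \<theta>))) \<partial>circle_measure)"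
proof -
  have "integrable circle_measure (\<lambda>\<theta>. cmod (bergman_kernel \<omega> 1 (of_real x * cis \<theta>)))"
    using bergman_kernel_bounded[OF w, of 1 "of_real x * cis \<theta>" for \<theta>] x
    by (intro integrable_circle[where B = "\<Sum>n. kernel_coeff \<omega> n * x ^ n"]) (auto simp: norm_mult)
  then show ?thesis unfolding kernel_mean_def by (intro nn_integral_eq_integral[symmetric]) auto
qed

text \<open>Write cnj z * \<zeta> as its modulus times a number c of modulus 1; the circle mean does
  not see c. If the product is 0, any such c will do.\<close>

lemma kernel_mean_complex:
  assumes w: "radial_weight \<omega>" and u: "cmod z * cmod \<zeta> < 1"
  shows "(\<integral>\<^sup>+\<theta>. ennreal (cmod (bergman_kernel \<omega> z (cis \<theta> * \<zeta>))) \<partial>circle_measure)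
     = ennreal (kernel_mean \<omega> (cmod z * cmod \<zeta>))"
proof -
  obtain c where c: "cmod c = 1" "cnj z * \<zeta> = of_real (cmod z * cmod \<zeta>) * c"
  proof (cases "cnj z * \<zeta> = 0")
    case True then show ?thesis by (intro that[of 1]) auto
  next
    case False
    then show ?thesis
      by (intro that[of "cnj z * \<zeta> / of_real (cmod z * cmod \<zeta>)"]) (auto simp: norm_mult norm_divide)
  qed
  let ?h = "\<lambda>v. ennreal (cmod (bergman_kernel \<omega> 1 (of_real (cmod z * cmod \<zeta>) * v)))"
  have h: "?h \<in> borel_measurable borel" by measurable
  have "cnj z * (cis \<theta> * \<zeta>) = of_real (cmod z * cmod \<zeta>) * (c * cis \<theta>)" for \<theta>
    using c(2) by (metis mult.assoc mult.commute)
  then have "(\<integral>\<^sup>+\<theta>. ennreal (cmod (bergman_kernel \<omega> z (cis \<theta> * \<zeta>))) \<partial>circle_measure)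
      = (\<integral>\<^sup>+\<theta>. ?h (c * cis \<theta>) \<partial>circle_measure)"
    by (simp only: bergman_kernel_eq complex_cnj_one mult_1_left)
  also have "\<dots> = (\<integral>\<^sup>+\<theta>. ?h (cis \<theta>) \<partial>circle_measure)" by (rule nn_integral_circle_rotate[OF h c(1)])
  also have "\<dots> = ennreal (kernel_mean \<omega> (cmod z * cmod \<zeta>))"
    by (rule kernel_mean_nn_integral[OF w _ u, symmetric]) simp
  finally show ?thesis .
qed

lemma kernel_mean_measurable [measurable]: "kernel_mean \<omega> \<in> borel_measurable borel"
proof -
  interpret finite_measure circle_measure by (rule finite_measure_circle)
  show ?thesis
    unfolding kernel_mean_def
    by (rule borel_measurable_lebesgue_integral) measurable
qed

lemma finite_measure_disc_area: "finite_measure disc_area"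
  by (rule finite_measureI) (use emeasure_disc_area_UNIV in simp)

lemma id_measurable_disc_area: "(\<lambda>z. z) \<in> disc_area \<rightarrow>\<^sub>M borel"
  by (rule borel_measurable_disc_areaI) simp

text \<open>Averaging over rotations replaces the modulus of the kernel by its circle mean.\<close>

lemma nn_integral_bergman_kernel_radial:
  assumes w: "radial_weight \<omega>" and z: "cmod z < 1" and G: "G \<in> borel_measurable radial_measure"
  shows "(\<integral>\<^sup>+\<zeta>. G (cmod \<zeta>) * ennreal (cmod (bergman_kernel \<omega> z \<zeta>)) \<partial>disc_area)
      = (\<integral>\<^sup>+s. G s * ennreal (kernel_mean \<omega> (cmod z * s)) \<partial>radial_measure)"
proof -
  obtain H where H [measurable]: "H \<in> borel_measurable borel" and GH: "AE r in radial_measure. G r = H r"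
    by (rule borel_representative_radial[OF G])
  interpret c: finite_measure circle_measure by (rule finite_measure_circle)
  interpret d: finite_measure disc_area by (rule finite_measure_disc_area)
  interpret pair_sigma_finite disc_area circle_measure ..
  note id_measurable_disc_area [measurable]
  define F where "F \<zeta> = H (cmod \<zeta>) * ennreal (cmod (bergman_kernel \<omega> z \<zeta>))" for \<zeta>
  have F [measurable]: "F \<in> borel_measurable borel" unfolding F_def by measurable
  have "(\<integral>\<^sup>+\<zeta>. G (cmod \<zeta>) * ennreal (cmod (bergman_kernel \<omega> z \<zeta>)) \<partial>disc_area) = (\<integral>\<^sup>+\<zeta>. F \<zeta> \<partial>disc_area)"
    using AE_disc_area_radial[OF GH] unfolding F_def by (intro nn_integral_cong_AE) auto
  \<comment> \<open>The circle has total mass 1 and the area integral is rotation invariant, so a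
    mean over \<theta> can be inserted; after Tonelli only the kernel depends on \<theta>.\<close>
  also have "\<dots> = (\<integral>\<^sup>+\<theta>. (\<integral>\<^sup>+\<zeta>. F \<zeta> \<partial>disc_area) \<partial>circle_measure)"
    by (simp add: emeasure_circle)
  also have "\<dots> = (\<integral>\<^sup>+\<theta>. (\<integral>\<^sup>+\<zeta>. F (cis \<theta> * \<zeta>) \<partial>disc_area) \<partial>circle_measure)"
    by (subst nn_integral_disc_area_rotate[OF F]) auto
  also have "\<dots> = (\<integral>\<^sup>+\<zeta>. (\<integral>\<^sup>+\<theta>. F (cis \<theta> * \<zeta>) \<partial>circle_measure) \<partial>disc_area)"
    by (rule Fubini') measurable
  also have "\<dots> = (\<integral>\<^sup>+\<zeta>. H (cmod \<zeta>) * ennreal (kernel_mean \<omega> (cmod z * cmod \<zeta>)) \<partial>disc_area)"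
  proof (rule nn_integral_cong)
    fix \<zeta> assume "\<zeta> \<in> space disc_area"
    then have u: "cmod z * cmod \<zeta> < 1" using z mult_left_le[of "cmod \<zeta>" "cmod z"] by simp
    have "(\<integral>\<^sup>+\<theta>. F (cis \<theta> * \<zeta>) \<partial>circle_measure)
        = (\<integral>\<^sup>+\<theta>. H (cmod \<zeta>) * ennreal (cmod (bergman_kernel \<omega> z (cis \<theta> * \<zeta>))) \<partial>circle_measure)"
      by (simp add: F_def norm_mult)
    also have "\<dots> = H (cmod \<zeta>) * (\<integral>\<^sup>+\<theta>. ennreal (cmod (bergman_kernel \<omega> z (cis \<theta> * \<zeta>))) \<partial>circle_measure)"
      by (rule nn_integral_cmult) measurable
    finally show "(\<integral>\<^sup>+\<theta>. F (cis \<theta> * \<zeta>) \<partial>circle_measure) = H (cmod \<zeta>) * ennreal (kernel_mean \<omega> (cmod z * cmod \<zeta>))"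
      by (simp add: kernel_mean_complex[OF w u])
  qed
  also have "\<dots> = (\<integral>\<^sup>+s. H s * ennreal (kernel_mean \<omega> (cmod z * s)) \<partial>radial_measure)"
    by (rule nn_integral_disc_area_radial[where F = "\<lambda>s. H s * ennreal (kernel_mean \<omega> (cmod z * s))"])
      (rule borel_measurable_radialI, measurable)
  also have "\<dots> = (\<integral>\<^sup>+s. G s * ennreal (kernel_mean \<omega> (cmod z * s)) \<partial>radial_measure)"
    using GH by (intro nn_integral_cong_AE) auto
  finally show ?thesis .
qed

section \<open>Upper bound for the kernel mean\<close>

text \<open>Geometric summation over scales. One step back from r multiplies the distance to 1 by K,
  the increment of N over it is at most B \<Phi>(r), and \<Phi> loses a factor q, so the increments
  form a geometric series. It serves for the integrated derivative of the kernel and again for an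
  integral against \<sigma>.\<close>

lemma geometric_growth:
  fixes N :: "real \<Rightarrow> ennreal" and \<Phi> :: "real \<Rightarrow> real"
  assumes K: "1 < K" and q: "0 \<le> q" "q < 1" and B: "0 \<le> B"
    and \<Phi>: "\<And>r. 0 \<le> r \<Longrightarrow> r < 1 \<Longrightarrow> 0 \<le> \<Phi> r"
    and base: "\<And>r. 0 \<le> r \<Longrightarrow> r < 1 \<Longrightarrow> 1 - K * (1 - r) < 0 \<Longrightarrow> N r \<le> ennreal (B * \<Phi> r)"
    and step: "\<And>r. r < 1 \<Longrightarrow> 0 \<le> 1 - K * (1 - r) \<Longrightarrow> N r \<le> N (1 - K * (1 - r)) + ennreal (B * \<Phi> r)"
    and decay: "\<And>r. r < 1 \<Longrightarrow> 0 \<le> 1 - K * (1 - r) \<Longrightarrow> \<Phi> (1 - K * (1 - r)) \<le> q * \<Phi> r"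
    and r: "0 \<le> r" "r < 1"
  shows "N r \<le> ennreal (B / (1 - q) * \<Phi> r)"
proof -
  \<comment> \<open>n bounds the number of steps back that stay in [0, 1), since each multiplies the
    distance to 1 by K; the induction is on n.\<close>
  obtain n where "1 / (1 - r) < K ^ n" using real_arch_pow[OF K] by blast
  then have "1 \<le> K ^ n * (1 - r)" using r by (simp add: field_simps)
  then show ?thesis using r
  proof (induction n arbitrary: r)
    case (0 r)
    then have "1 - K * (1 - r) < 0" using K by auto
    then have "N r \<le> ennreal (B * \<Phi> r)" using 0 by (intro base) auto
    also have "\<dots> \<le> ennreal (B / (1 - q) * \<Phi> r)"
      using q B \<Phi>[OF 0(2,3)] by (intro ennreal_leI mult_right_mono) (auto simp: field_simps mult_left_le)
    finally show ?case .
  next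
    case (Suc n r)
    show ?case
    proof (cases "1 - K * (1 - r) < 0")
      case True
      then have "N r \<le> ennreal (B * \<Phi> r)" using Suc by (intro base) auto
      also have "\<dots> \<le> ennreal (B / (1 - q) * \<Phi> r)"
        using q B \<Phi>[of r] Suc.prems by (intro ennreal_leI mult_right_mono) (auto simp: field_simps mult_left_le)
      finally show ?thesis .
    next
      case False
      let ?r = "1 - K * (1 - r)"
      have r': "0 \<le> ?r" "?r < 1" using False Suc.prems K by auto
      have d: "\<Phi> ?r \<le> q * \<Phi> r" using False Suc.prems by (intro decay) auto
      have "N r \<le> N ?r + ennreal (B * \<Phi> r)" using False Suc.prems by (intro step) auto
      also have "N ?r \<le> ennreal (B / (1 - q) * \<Phi> ?r)"
        using Suc.prems r' by (intro Suc.IH) (auto simp: algebra_simps)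
      also have "\<dots> \<le> ennreal (B / (1 - q) * (q * \<Phi> r))"
        using d q B by (intro ennreal_leI mult_left_mono) auto
      also have "\<dots> + ennreal (B * \<Phi> r) = ennreal (B / (1 - q) * \<Phi> r)"
        using q B \<Phi>[of r] Suc.prems by (subst ennreal_plus[symmetric]) (auto simp: field_simps)
      finally show ?thesis by (simp add: add_right_mono)
    qed
  qed
qed

text \<open>For s < 1 the quotient (1 - s^n) / (1 - s) is a sum of n powers of s, each at least
  s^n.\<close>

lemma power_times_gap: "0 \<le> s \<Longrightarrow> s \<le> 1 \<Longrightarrow> real n * s ^ n * (1 - s) \<le> 1 - s ^ n" for s :: real
proof (induction n)
  case (Suc n)
  have "real (Suc n) * s ^ Suc n * (1 - s) = s * (real n * s ^ n * (1 - s)) + s ^ Suc n * (1 - s)"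
    by (simp add: algebra_simps)
  also have "\<dots> \<le> s * (1 - s ^ n) + s ^ Suc n * (1 - s)"
    using Suc by (intro add_right_mono mult_left_mono) auto
  also have "\<dots> = 1 - s ^ Suc n - (1 - s) * (1 - s ^ Suc n)" by (simp add: algebra_simps)
  also have "\<dots> \<le> 1 - s ^ Suc n" using Suc.prems power_le_one[of s "Suc n"] by (simp add: mult_nonneg_nonneg)
  finally show ?case .
qed simp

text \<open>The integrand of the difference contains 1 - s^2, and n s^n (1 - s) is at most 1. About
  half of the exponent 2 n + 1 is spent on cancelling n; the exponent n + 1 that remains is restored
  later by doubling.\<close>

lemma moment_difference:
  assumes w: "radial_weight \<omega>"
  shows "real n * (moment \<omega> (2 * real n + 1) - moment \<omega> (2 * real n + 3)) \<le> 2 * moment \<omega> (real n + 1)"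
proof -
  have i: "set_integrable lebesgue {0..<1} (\<lambda>s. s powr x * \<omega> s)" if "0 \<le> x" for x
    using integrable_weight_measure[OF w, of "\<lambda>s. s powr x" 1] that
    by (simp add: set_integrable_def integrable_restrict_space powr_le1)
  have "real n * (moment \<omega> (2 * real n + 1) - moment \<omega> (2 * real n + 3))
      = (LINT s:{0..<1}|lebesgue. real n * (s powr (2 * real n + 1) * \<omega> s - s powr (2 * real n + 3) * \<omega> s))"
    unfolding moment_def by (simp add: i set_integral_diff)
  also have "\<dots> \<le> (LINT s:{0..<1}|lebesgue. 2 * (s powr (real n + 1) * \<omega> s))"
  proof (rule set_integral_mono)
    fix s :: real assume "s \<in> {0..<1}"
    then have s: "0 \<le> s" "s < 1" by auto
    have \<omega>: "0 \<le> \<omega> s" by (rule radial_weight_nonneg[OF w s])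
    have p: "s powr (real k) = s ^ k" if "0 < k" for k
      using s that by (cases "s = 0") (auto simp: powr_realpow)
    have "s powr (2 * real n + 1) = s ^ (2 * n + 1)" "s powr (2 * real n + 3) = s ^ (2 * n + 3)"
      "s powr (real n + 1) = s ^ (n + 1)"
      using p[of "2 * n + 1"] p[of "2 * n + 3"] p[of "n + 1"] by (simp_all add: add.commute)
    moreover have "real n * (s ^ (2 * n + 1) - s ^ (2 * n + 3)) \<le> 2 * s ^ (n + 1)"
    proof -
      have "real n * (s ^ (2 * n + 1) - s ^ (2 * n + 3)) = s ^ (n + 1) * ((1 + s) * (real n * s ^ n * (1 - s)))"
      proof -
        have p: "s ^ (2 * n + 1) = s ^ n * s ^ n * s" "s ^ (2 * n + 3) = s ^ n * s ^ n * (s * s * s)"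
          "s ^ (n + 1) = s ^ n * s"
          by (simp_all only: power_add mult_2 power_one_right power3_eq_cube)
        have "k * (q * q * s - q * q * (s * s * s)) = q * s * ((1 + s) * (k * q * (1 - s)))" for q k :: real
          by (simp add: algebra_simps)
        then show ?thesis unfolding p .
      qed
      also have "\<dots> \<le> s ^ (n + 1) * (2 * 1)"
      proof -
        have "real n * s ^ n * (1 - s) \<le> 1"
          using s power_times_gap[of s n] zero_le_power[of s n] by linarith
        then show ?thesis using s by (intro mult_left_mono mult_mono) auto
      qed
      finally show ?thesis by (simp only: mult_1_right mult.commute)
    qed
    moreover have "real n * (a * v - b * v) \<le> 2 * (c * v)" if "real n * (a - b) \<le> 2 * c" "0 \<le> v" for a b c v :: real
      using mult_right_mono[OF that] by (simp add: algebra_simps)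
    ultimately show "real n * (s powr (2 * real n + 1) * \<omega> s - s powr (2 * real n + 3) * \<omega> s) \<le> 2 * (s powr (real n + 1) * \<omega> s)"
      using \<omega> by (simp only:)
  qed (auto intro!: set_integrable_mult_right set_integral_diff i)
  also have "\<dots> = 2 * moment \<omega> (real n + 1)" by (simp add: moment_def)
  finally show ?thesis .
qed

definition kernel_deriv :: "(real \<Rightarrow> real) \<Rightarrow> complex \<Rightarrow> complex" where
  "kernel_deriv \<omega> u = (\<Sum>n. of_real (real (Suc n) * kernel_coeff \<omega> (Suc n)) * u ^ n)"

text \<open>The Taylor coefficients of (1 - u) F'(u). For upper doubling weights they lack the
  factor n that differentiation brings.\<close>

definition kernel_diff :: "(real \<Rightarrow> real) \<Rightarrow> nat \<Rightarrow> real" where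
  "kernel_diff \<omega> n = real (Suc n) * kernel_coeff \<omega> (Suc n) - real n * kernel_coeff \<omega> n"

text \<open>With a(n) the coefficients of F, the value is a(n+1) + n (a(n+1) - a(n)). The difference
  of reciprocals is a difference of moments over their product, so the bound for n times that
  difference, combined with doubling, leaves a multiple of a(n+1).\<close>

lemma kernel_diff_bounds:
  assumes w: "radial_weight \<omega>" and C: "upper_doubling_with C \<omega>"
  shows "0 \<le> kernel_diff \<omega> n" "kernel_diff \<omega> n \<le> (1 + 2 * C) * kernel_coeff \<omega> (Suc n)"
proof -
  have C1: "1 \<le> C" using C by (simp add: upper_doubling_with_def)
  have mono: "kernel_coeff \<omega> n \<le> kernel_coeff \<omega> (Suc n)" by (rule kernel_coeff_mono[OF w]) simp
  have p: "0 < kernel_coeff \<omega> n" "0 < kernel_coeff \<omega> (Suc n)" using kernel_coeff_pos[OF w] by auto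
  have eq: "kernel_diff \<omega> n = kernel_coeff \<omega> (Suc n) + real n * (kernel_coeff \<omega> (Suc n) - kernel_coeff \<omega> n)"
    by (simp add: kernel_diff_def algebra_simps)
  show "0 \<le> kernel_diff \<omega> n" unfolding eq using p mono by (intro add_nonneg_nonneg mult_nonneg_nonneg) auto
  let ?a = "moment \<omega> (2 * real n + 1)" and ?b = "moment \<omega> (2 * real n + 3)"
  have ab: "0 < ?a" "0 < ?b" using moment_pos[OF w] by auto
  have S: "kernel_coeff \<omega> (Suc n) = 1 / (2 * ?b)" by (simp add: kernel_coeff_def add.commute)
  have "moment \<omega> (real n + 1) \<le> C * moment \<omega> (2 * (real n + 1))"
    by (rule upper_doubling_moment[OF w C]) simp
  also have "\<dots> \<le> C * ?a" using C1 by (intro mult_left_mono moment_antimono[OF w]) auto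
  finally have "real n * (?a - ?b) \<le> 2 * C * ?a" using moment_difference[OF w, of n] by simp
  then have "real n * (?a - ?b) / (2 * ?a * ?b) \<le> 2 * C * ?a / (2 * ?a * ?b)"
    using ab by (intro divide_right_mono) auto
  moreover have "real n * (kernel_coeff \<omega> (Suc n) - kernel_coeff \<omega> n) = real n * (?a - ?b) / (2 * ?a * ?b)"
    unfolding S kernel_coeff_def[of \<omega> n] using ab by (simp add: field_simps)
  moreover have "2 * C * ?a / (2 * ?a * ?b) = 2 * C * kernel_coeff \<omega> (Suc n)"
    unfolding S using ab by (simp add: field_simps)
  ultimately have "real n * (kernel_coeff \<omega> (Suc n) - kernel_coeff \<omega> n) \<le> 2 * C * kernel_coeff \<omega> (Suc n)"
    by simp
  then show "kernel_diff \<omega> n \<le> (1 + 2 * C) * kernel_coeff \<omega> (Suc n)" unfolding eq by (simp add: algebra_simps)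
qed

context
  fixes \<omega> :: "real \<Rightarrow> real"
  assumes w: "radial_weight \<omega>"
begin

lemma summable_kernel_coeff_complex:
  "cmod u < 1 \<Longrightarrow> summable (\<lambda>n. complex_of_real (kernel_coeff \<omega> n) * u ^ n)"
  using summable_kernel_coeff[OF w, of "cmod u"] kernel_coeff_pos[OF w]
  by (intro summable_norm_cancel[of "\<lambda>n. complex_of_real (kernel_coeff \<omega> n) * u ^ n"])
     (simp add: norm_mult norm_power less_imp_le)

lemma summable_kernel_deriv:
  assumes "cmod u < 1"
  shows "summable (\<lambda>n. complex_of_real (real (Suc n) * kernel_coeff \<omega> (Suc n)) * u ^ n)"
  using termdiff_converges[of u 1 "\<lambda>n. complex_of_real (kernel_coeff \<omega> n)"] summable_kernel_coeff_complex assms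
  by (simp add: diffs_def)

lemma summable_kernel_deriv_real:
  assumes "0 \<le> x" "x < 1"
  shows "summable (\<lambda>n. real (Suc n) * kernel_coeff \<omega> (Suc n) * x ^ n)"
proof -
  have "summable (\<lambda>n. complex_of_real (real (Suc n) * kernel_coeff \<omega> (Suc n) * x ^ n))"
    using summable_kernel_deriv[of "of_real x"] assms by simp
  then show ?thesis by (rule summable_of_real_iff[THEN iffD1])
qed

lemma kernel_has_derivative:
  assumes "cmod u < 1"
  shows "(bergman_kernel \<omega> 1 has_field_derivative kernel_deriv \<omega> u) (at u)"
proof -
  obtain x where x: "cmod u < x" "x < 1" using dense[OF assms] by blast
  then have x0: "0 < x" using norm_ge_zero[of u] by linarith
  have "((\<lambda>u. \<Sum>n. complex_of_real (kernel_coeff \<omega> n) * u ^ n) has_field_derivative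
      (\<Sum>n. diffs (\<lambda>n. complex_of_real (kernel_coeff \<omega> n)) n * u ^ n)) (at u)"
    using x x0 summable_kernel_coeff_complex[of "of_real x"]
    by (intro termdiffs_strong[where K = "of_real x"]) auto
  moreover have "bergman_kernel \<omega> 1 = (\<lambda>u. \<Sum>n. complex_of_real (kernel_coeff \<omega> n) * u ^ n)"
    by (simp add: bergman_kernel_eq fun_eq_iff)
  ultimately show ?thesis by (simp add: kernel_deriv_def diffs_def)
qed

text \<open>This continuity is needed for the fundamental theorem of calculus along a
  radius.\<close>

lemma kernel_deriv_continuous:
  "continuous_on (ball 0 1) (kernel_deriv \<omega>)"
proof -
  have "isCont (kernel_deriv \<omega>) u" if "cmod u < 1" for u
  proof -
    obtain x where x: "cmod u < x" "x < 1" using dense[OF \<open>cmod u < 1\<close>] by blast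
    then have x0: "0 < x" using norm_ge_zero[of u] by linarith
    show ?thesis unfolding kernel_deriv_def
      using x x0 by (intro isCont_powser[OF summable_kernel_deriv[of "of_real x"]]) auto
  qed
  then show ?thesis by (auto intro: continuous_at_imp_continuous_on)
qed

text \<open>Multiplication by u shifts the coefficients of F' by one; the term n = 0 of the shifted
  series carries the factor 0.\<close>

lemma one_minus_times_kernel_deriv:
  assumes u: "cmod u < 1"
  shows "(1 - u) * kernel_deriv \<omega> u = (\<Sum>n. of_real (kernel_diff \<omega> n) * u ^ n)"
proof -
  let ?d = "\<lambda>n. complex_of_real (real (Suc n) * kernel_coeff \<omega> (Suc n))"
  let ?f = "\<lambda>n. complex_of_real (real n * kernel_coeff \<omega> n) * u ^ n"
  have D: "(\<lambda>n. ?d n * u ^ n) sums kernel_deriv \<omega> u"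
    unfolding kernel_deriv_def by (rule summable_sums[OF summable_kernel_deriv[OF u]])
  have "(\<lambda>n. ?f (Suc n)) sums (u * kernel_deriv \<omega> u)"
    using sums_mult[OF D, of u] by (simp add: mult_ac)
  then have "?f sums (u * kernel_deriv \<omega> u)" by (subst (asm) sums_Suc_iff) simp
  from sums_diff[OF D this] have "(\<lambda>n. of_real (kernel_diff \<omega> n) * u ^ n) sums ((1 - u) * kernel_deriv \<omega> u)"
    by (simp add: kernel_diff_def algebra_simps)
  then show ?thesis by (rule sums_unique)
qed

end

text \<open>A bound for the coefficients at the scale \<open>t\<close>: here \<open>1 - y = (1 - t) / 4\<close>, so that \<open>t \<le> y ^ 4\<close>.\<close>

lemma kernel_coeff_square_bound:
  assumes w: "radial_weight \<omega>" and C: "upper_doubling_with C \<omega>" and t: "0 \<le> t" "t < 1"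
  shows "(kernel_coeff \<omega> (Suc n) * t ^ n)\<^sup>2 \<le> 2 * C ^ 4 / (tail \<omega> t)\<^sup>2 * t ^ n"
proof -
  define y where "y = 1 - (1 - t) / 4"
  have y: "3/4 \<le> y" "0 \<le> y" "y < 1" using t by (auto simp: y_def)
  have C1: "1 \<le> C" using C by (simp add: upper_doubling_with_def)
  let ?m = "moment \<omega> (2 * real n + 3)"
  have m: "0 < ?m" using moment_pos[OF w] by simp
  have T: "0 < tail \<omega> t" "0 < tail \<omega> y" using tail_pos[OF w] t y by auto
  have "tail \<omega> t \<le> C ^ 2 * tail \<omega> y"
    using t y by (intro upper_doubling_iterate[OF w C]) (auto simp: y_def)
  moreover have "y ^ (2 * n + 3) * tail \<omega> y \<le> ?m"
  proof -
    have "y powr (2 * real n + 3) = y ^ (2 * n + 3)"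
      using y powr_realpow[of y "2 * n + 3"] by simp
    then show ?thesis using moment_ge[OF w, of "2 * real n + 3" y] y by simp
  qed
  ultimately have "y ^ (2 * n + 3) * tail \<omega> t \<le> C ^ 2 * ?m"
  proof -
    assume a: "tail \<omega> t \<le> C ^ 2 * tail \<omega> y" "y ^ (2 * n + 3) * tail \<omega> y \<le> ?m"
    have "y ^ (2 * n + 3) * tail \<omega> t \<le> y ^ (2 * n + 3) * (C ^ 2 * tail \<omega> y)"
      using a(1) y by (intro mult_left_mono) auto
    also have "\<dots> = C ^ 2 * (y ^ (2 * n + 3) * tail \<omega> y)" by simp
    also have "\<dots> \<le> C ^ 2 * ?m" using a(2) by (intro mult_left_mono) auto
    finally show ?thesis .
  qed
  then have "(y ^ (2 * n + 3) * tail \<omega> t)\<^sup>2 \<le> (C ^ 2 * ?m)\<^sup>2"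
    using y T by (intro power_mono) auto
  then have 1: "(y ^ 4) ^ n * y ^ 6 * (tail \<omega> t)\<^sup>2 \<le> C ^ 4 * ?m\<^sup>2"
    by (simp add: power_mult_distrib power_add flip: power_mult)
  have "1 + 4 * (y - 1) \<le> y ^ 4" using Bernoulli_inequality[of "y - 1" 4] y by simp
  moreover have "1 + 4 * (y - 1) = t" by (simp add: y_def field_simps)
  ultimately have "t \<le> y ^ 4" by (simp only:)
  then have "t ^ n \<le> (y ^ 4) ^ n" using t by (intro power_mono) auto
  \<comment> \<open>The surplus power y^6 costs only a constant because y \<ge> 3/4.\<close>
  moreover have "1 / 8 \<le> y ^ 6"
  proof -
    have "1 / 8 \<le> (3/4 :: real) ^ 6" by (simp add: power_divide)
    also have "\<dots> \<le> y ^ 6" using y by (intro power_mono) auto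
    finally show ?thesis .
  qed
  ultimately have "t ^ n * (1 / 8) * (tail \<omega> t)\<^sup>2 \<le> (y ^ 4) ^ n * y ^ 6 * (tail \<omega> t)\<^sup>2"
    using t y by (intro mult_right_mono mult_mono) auto
  with 1 have 2: "t ^ n * (tail \<omega> t)\<^sup>2 \<le> 8 * C ^ 4 * ?m\<^sup>2" by simp
  \<comment> \<open>Of the two factors t^n one compensates the growth of the coefficients; the other
    survives and makes the bound summable.\<close>
  have "(kernel_coeff \<omega> (Suc n) * t ^ n)\<^sup>2 = t ^ n * (t ^ n * (tail \<omega> t)\<^sup>2) / (4 * ?m\<^sup>2 * (tail \<omega> t)\<^sup>2)"
    using T m by (simp add: kernel_coeff_def field_simps power2_eq_square add.commute)
  also have "\<dots> \<le> t ^ n * (8 * C ^ 4 * ?m\<^sup>2) / (4 * ?m\<^sup>2 * (tail \<omega> t)\<^sup>2)"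
    using 2 t by (intro divide_right_mono mult_left_mono) auto
  also have "\<dots> = 2 * C ^ 4 / (tail \<omega> t)\<^sup>2 * t ^ n" using m T by (simp add: field_simps)
  finally show ?thesis .
qed

text \<open>F' is the product of P = (1 - u) F' and G = 1 / (1 - u). Their square means are at most
  Q / (T^2 (1 - t)) and 1 / (1 - t), where T is the tail at t; weighting the arithmetic-geometric
  mean by T makes both halves of order 1 / (T (1 - t)).\<close>

lemma kernel_deriv_mean:
  assumes w: "radial_weight \<omega>" and C: "upper_doubling_with C \<omega>" and t: "0 \<le> t" "t < 1"
  shows "(\<integral>\<^sup>+\<theta>. ennreal (cmod (kernel_deriv \<omega> (of_real t * cis \<theta>))) \<partial>circle_measure)
      \<le> ennreal (((1 + 2 * C)\<^sup>2 * C ^ 4 + 1) / ((1 - t) * tail \<omega> t))"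
proof -
  define T where "T = tail \<omega> t"
  define Q where "Q = (1 + 2 * C)\<^sup>2 * (2 * C ^ 4)"
  have T: "0 < T" unfolding T_def using tail_pos[OF w t] .
  have C1: "1 \<le> C" using C by (simp add: upper_doubling_with_def)
  let ?b = "\<lambda>n. kernel_diff \<omega> n * t ^ n"
  let ?P = "\<lambda>\<theta>. \<Sum>n. of_real (?b n) * cis (real n * \<theta>)"
  let ?G = "\<lambda>\<theta>. \<Sum>n. of_real (t ^ n) * cis (real n * \<theta>)"
  have G: "summable (\<lambda>n. cmod (of_real (t ^ n)))" using t by (simp add: norm_power summable_geometric)
  have b: "summable (\<lambda>n. cmod (of_real (?b n)))"
  proof (rule summable_comparison_test'[OF summable_kernel_deriv_real[OF w t], where N = 0])
    fix n
    have "0 \<le> kernel_diff \<omega> n" by (rule kernel_diff_bounds(1)[OF w C])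
    moreover have "kernel_diff \<omega> n \<le> real (Suc n) * kernel_coeff \<omega> (Suc n)"
      using kernel_coeff_pos[OF w, of n] unfolding kernel_diff_def by simp
    ultimately have "\<bar>kernel_diff \<omega> n\<bar> * t ^ n \<le> real (Suc n) * kernel_coeff \<omega> (Suc n) * t ^ n"
      using t by (intro mult_right_mono) auto
    then show "norm (cmod (of_real (?b n))) \<le> real (Suc n) * kernel_coeff \<omega> (Suc n) * t ^ n"
      using t by (simp only: norm_of_real real_norm_def abs_abs abs_mult power_abs abs_of_nonneg)
  qed
  have meas: "?P \<in> borel_measurable borel" "?G \<in> borel_measurable borel"
    by (intro borel_measurable_suminf; measurable)+
  have sq: "integrable circle_measure (\<lambda>\<theta>. (cmod (g \<theta>))\<^sup>2)"
    if g: "g \<in> borel_measurable borel" and B: "\<And>\<theta>. cmod (g \<theta>) \<le> B" for g :: "real \<Rightarrow> complex" and B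
  proof (rule integrable_circle)
    show "(\<lambda>\<theta>. (cmod (g \<theta>))\<^sup>2) \<in> borel_measurable borel" using g by measurable
    show "norm ((cmod (g \<theta>))\<^sup>2) \<le> B\<^sup>2" for \<theta>
      using power_mono[OF B[of \<theta>] norm_ge_zero, of 2] by simp
  qed
  note int = sq[OF meas(1) series_circle_bounded[OF b]] sq[OF meas(2) series_circle_bounded[OF G]]
  have point: "cmod (kernel_deriv \<omega> (of_real t * cis \<theta>)) \<le> T / 2 * (cmod (?P \<theta>))\<^sup>2 + 1 / (2 * T) * (cmod (?G \<theta>))\<^sup>2" for \<theta>
  proof -
    let ?u = "complex_of_real t * cis \<theta>"
    have u: "cmod ?u < 1" using t by (simp add: norm_mult)
    then have u1: "1 - ?u \<noteq> 0" by auto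
    have pw: "?u ^ n = of_real (t ^ n) * cis (real n * \<theta>)" for n
      by (simp add: power_mult_distrib Complex.DeMoivre)
    have "(1 - ?u) * kernel_deriv \<omega> ?u = ?P \<theta>"
      by (simp only: one_minus_times_kernel_deriv[OF w u] pw of_real_mult mult.assoc)
    moreover have "1 / (1 - ?u) = ?G \<theta>"
      using suminf_geometric[OF u] by (simp only: pw)
    moreover have "kernel_deriv \<omega> ?u = ((1 - ?u) * kernel_deriv \<omega> ?u) * (1 / (1 - ?u))" using u1 by simp
    ultimately have "kernel_deriv \<omega> ?u = ?P \<theta> * ?G \<theta>" by (simp only:)
    then have "cmod (kernel_deriv \<omega> ?u) = cmod (?P \<theta>) * cmod (?G \<theta>)" by (simp only: norm_mult)
    also have "\<dots> \<le> T / 2 * (cmod (?P \<theta>))\<^sup>2 + 1 / (2 * T) * (cmod (?G \<theta>))\<^sup>2"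
      using zero_le_power2[of "T * cmod (?P \<theta>) - cmod (?G \<theta>)"] T
      by (simp add: field_simps power2_eq_square)
    finally show ?thesis .
  qed
  have P2: "(\<integral>\<theta>. (cmod (?P \<theta>))\<^sup>2 \<partial>circle_measure) \<le> Q / (T\<^sup>2 * (1 - t))"
  proof -
    have geo: "(\<lambda>n. Q / T\<^sup>2 * t ^ n) sums (Q / T\<^sup>2 * (1 / (1 - t)))"
      using t by (intro sums_mult geometric_sums) auto
    have "(\<integral>\<theta>. (cmod (?P \<theta>))\<^sup>2 \<partial>circle_measure) \<le> Q / T\<^sup>2 * (1 / (1 - t))"
    proof (rule sums_le[OF _ Parseval_circle[OF b] geo])
      fix n
      have "(cmod (of_real (?b n)))\<^sup>2 = (kernel_diff \<omega> n * t ^ n)\<^sup>2" by (simp only: norm_of_real power2_abs)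
      also have "\<dots> \<le> ((1 + 2 * C) * kernel_coeff \<omega> (Suc n) * t ^ n)\<^sup>2"
        using kernel_diff_bounds[OF w C, of n] t by (intro power_mono mult_right_mono) auto
      also have "\<dots> = (1 + 2 * C)\<^sup>2 * (kernel_coeff \<omega> (Suc n) * t ^ n)\<^sup>2" by (simp add: power_mult_distrib)
      also have "\<dots> \<le> (1 + 2 * C)\<^sup>2 * (2 * C ^ 4 / T\<^sup>2 * t ^ n)"
        unfolding T_def by (intro mult_left_mono kernel_coeff_square_bound[OF w C t]) auto
      finally show "(cmod (of_real (?b n)))\<^sup>2 \<le> Q / T\<^sup>2 * t ^ n" by (simp add: Q_def)
    qed
    then show ?thesis by simp
  qed
  have G2: "(\<integral>\<theta>. (cmod (?G \<theta>))\<^sup>2 \<partial>circle_measure) \<le> 1 / (1 - t)"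
  proof (rule sums_le[OF _ Parseval_circle[OF G]])
    show "(\<lambda>n. t ^ n) sums (1 / (1 - t))" using t by (intro geometric_sums) auto
    fix n
    have "(t ^ n) * (t ^ n) \<le> t ^ n * 1" using t by (intro mult_left_mono power_le_one) auto
    then show "(cmod (of_real (t ^ n)))\<^sup>2 \<le> t ^ n" using t by (simp add: norm_power power2_eq_square)
  qed
  have "(\<integral>\<^sup>+\<theta>. ennreal (cmod (kernel_deriv \<omega> (of_real t * cis \<theta>))) \<partial>circle_measure)
      \<le> (\<integral>\<^sup>+\<theta>. ennreal (T / 2 * (cmod (?P \<theta>))\<^sup>2 + 1 / (2 * T) * (cmod (?G \<theta>))\<^sup>2) \<partial>circle_measure)"
    by (intro nn_integral_mono ennreal_leI point)
  also have "\<dots> = ennreal (\<integral>\<theta>. T / 2 * (cmod (?P \<theta>))\<^sup>2 + 1 / (2 * T) * (cmod (?G \<theta>))\<^sup>2 \<partial>circle_measure)"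
    using int T by (intro nn_integral_eq_integral) auto
  also have "(\<integral>\<theta>. T / 2 * (cmod (?P \<theta>))\<^sup>2 + 1 / (2 * T) * (cmod (?G \<theta>))\<^sup>2 \<partial>circle_measure)
      = T / 2 * (\<integral>\<theta>. (cmod (?P \<theta>))\<^sup>2 \<partial>circle_measure) + 1 / (2 * T) * (\<integral>\<theta>. (cmod (?G \<theta>))\<^sup>2 \<partial>circle_measure)"
    using int by (subst Bochner_Integration.integral_add) auto
  also have "\<dots> \<le> T / 2 * (Q / (T\<^sup>2 * (1 - t))) + 1 / (2 * T) * (1 / (1 - t))"
    using P2 G2 T by (intro add_mono mult_left_mono) auto
  also have "\<dots> = (Q / 2 + 1 / 2) / ((1 - t) * T)"
  proof -
    have "T / 2 * (Q / (T\<^sup>2 * d)) + 1 / (2 * T) * (1 / d) = (Q / 2 + 1 / 2) / (d * T)" if "0 < d" for d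
      using T that by (simp add: field_simps power2_eq_square)
    then show ?thesis using t by simp
  qed
  also have "\<dots> \<le> ((1 + 2 * C)\<^sup>2 * C ^ 4 + 1) / ((1 - t) * T)"
    using T t by (intro divide_right_mono) (auto simp: Q_def)
  finally show ?thesis unfolding T_def by (auto intro: ennreal_leI)
qed

text \<open>F' is integrated along the radius at angle \<theta>, starting from the value
  F(0).\<close>

lemma kernel_le_integral_deriv:
  assumes w: "radial_weight \<omega>" and x: "0 \<le> x" "x < 1"
  shows "ennreal (cmod (bergman_kernel \<omega> 1 (of_real x * cis \<theta>)))
     \<le> ennreal (kernel_coeff \<omega> 0) + (\<integral>\<^sup>+t. ennreal (cmod (kernel_deriv \<omega> (of_real t * cis \<theta>))) * indicator {0..x} t \<partial>lborel)"
proof -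
  let ?K = "bergman_kernel \<omega> 1"
  let ?f = "\<lambda>t. cis \<theta> * kernel_deriv \<omega> (of_real t * cis \<theta>)"
  have cont: "continuous_on {0..x} ?f"
    by (intro continuous_intros continuous_on_compose2[OF kernel_deriv_continuous[OF w]])
      (use x in \<open>auto simp: norm_mult\<close>)
  have "(LINT t:{0..x}|lborel. ?f t) = ?K (of_real x * cis \<theta>) - ?K (of_real 0 * cis \<theta>)"
    unfolding set_lebesgue_integral_def
  proof (rule integral_FTC_Icc[OF x(1) _ cont])
    fix t assume t: "0 \<le> t" "t \<le> x"
    have "((\<lambda>t. of_real t * cis \<theta>) has_vector_derivative cis \<theta>) (at t within {0..x})"
      by (auto intro!: derivative_eq_intros)
    moreover have "(?K has_field_derivative kernel_deriv \<omega> (of_real t * cis \<theta>)) (at (of_real t * cis \<theta>))"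
      using t x by (intro kernel_has_derivative[OF w]) (simp add: norm_mult)
    ultimately show "((\<lambda>t. ?K (of_real t * cis \<theta>)) has_vector_derivative ?f t) (at t within {0..x})"
      using field_vector_diff_chain_within[of "\<lambda>t. of_real t * cis \<theta>" "cis \<theta>" t "{0..x}" ?K]
      by (auto simp: o_def has_field_derivative_at_within)
  qed
  moreover have "?K (of_real 0 * cis \<theta>) = of_real (kernel_coeff \<omega> 0)"
    by (simp add: bergman_kernel_eq)
  ultimately have eq: "?K (of_real x * cis \<theta>) = of_real (kernel_coeff \<omega> 0) + (LINT t:{0..x}|lborel. ?f t)" by simp
  have si: "set_integrable lborel {0..x} ?f" by (rule borel_integrable_atLeastAtMost'[OF cont])
  have "ennreal (cmod (LINT t:{0..x}|lborel. ?f t)) \<le> (\<integral>\<^sup>+t. ennreal (norm (indicator {0..x} t *\<^sub>R ?f t)) \<partial>lborel)"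
    using si unfolding set_integrable_def set_lebesgue_integral_def
    by (intro integral_norm_bound_ennreal)
  also have "\<dots> = (\<integral>\<^sup>+t. ennreal (cmod (kernel_deriv \<omega> (of_real t * cis \<theta>))) * indicator {0..x} t \<partial>lborel)"
    by (intro nn_integral_cong) (auto simp: norm_mult split: split_indicator)
  finally have le: "ennreal (cmod (LINT t:{0..x}|lborel. ?f t)) \<le> \<dots>" .
  have "ennreal (cmod (?K (of_real x * cis \<theta>))) \<le> ennreal (kernel_coeff \<omega> 0 + cmod (LINT t:{0..x}|lborel. ?f t))"
    unfolding eq using norm_triangle_ineq[of "of_real (kernel_coeff \<omega> 0)" "LINT t:{0..x}|lborel. ?f t"] kernel_coeff_pos[OF w, of 0]
    by (intro ennreal_leI) simp
  also have "\<dots> = ennreal (kernel_coeff \<omega> 0) + ennreal (cmod (LINT t:{0..x}|lborel. ?f t))"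
    using kernel_coeff_pos[OF w, of 0] by (intro ennreal_plus) auto
  finally show ?thesis using le by (meson add_left_mono order_trans)
qed

text \<open>The derivative mean is at most a multiple of 1 / ((1 - t) tail t). Over a step from 1 -
  K (1 - r) to r this integrates to a multiple of 1 / tail r, and lower doubling makes these values
  grow geometrically towards 1. The weight \<open>\<omega>\<^sub>0\<close> certifies that C, K and L
  are admissible before the constant is fixed.\<close>

lemma kernel_mean_upper:
  assumes "upper_doubling_with C \<omega>\<^sub>0" and "lower_doubling_with K L \<omega>\<^sub>0"
  shows "\<exists>c>0. \<forall>\<omega> x. radial_weight \<omega> \<longrightarrow> upper_doubling_with C \<omega> \<longrightarrow> lower_doubling_with K L \<omega> \<longrightarrow>
     0 \<le> x \<longrightarrow> x < 1 \<longrightarrow> kernel_mean \<omega> x \<le> c / tail \<omega> x"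
proof -
  have C1: "1 \<le> C" and K: "1 < K" and L: "1 < L"
    using assms by (auto simp: upper_doubling_with_def lower_doubling_with_def)
  define A where "A = (1 + 2 * C)\<^sup>2 * C ^ 4 + 1"
  have A: "0 < A" unfolding A_def using C1 by (intro add_nonneg_pos) auto
  \<comment> \<open>A controls the derivative mean at the right end of a step, and K (1 - r) bounds
    the length of the step.\<close>
  define B where "B = A * K"
  define c where "c = C + B / (1 - 1 / L)"
  have B0: "0 \<le> B" using A K by (simp add: B_def)
  have c: "0 < c" using C1 B0 L by (auto simp: c_def intro!: add_pos_nonneg)
  show ?thesis
  proof (intro exI[of _ c] conjI c allI impI)
    fix \<omega> and x :: real
    assume w: "radial_weight \<omega>" and C: "upper_doubling_with C \<omega>" and KL: "lower_doubling_with K L \<omega>" and x: "0 \<le> x" "x < 1"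
    interpret c: finite_measure circle_measure by (rule finite_measure_circle)
    interpret pair_sigma_finite circle_measure lborel ..
    let ?D = "\<lambda>t \<theta>. ennreal (cmod (kernel_deriv \<omega> (complex_of_real t * cis \<theta>)))"
    define m where "m t = (\<integral>\<^sup>+\<theta>. ?D t \<theta> \<partial>circle_measure)" for t :: real
    have Dm [measurable]: "kernel_deriv \<omega> \<in> borel_measurable borel"
      unfolding kernel_deriv_def by (intro borel_measurable_suminf) measurable
    have mm [measurable]: "m \<in> borel_measurable borel"
      unfolding m_def by measurable
    define N where "N r = (\<integral>\<^sup>+t. m t * indicator {0..r} t \<partial>lborel)" for r
    have mb: "m t \<le> ennreal (A / ((1 - t) * tail \<omega> t))" if "0 \<le> t" "t < 1" for t
      unfolding m_def A_def by (rule kernel_deriv_mean[OF w C that])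
    have piece: "(\<integral>\<^sup>+t. m t * indicator {r'..r} t \<partial>lborel) \<le> ennreal (B * (1 / tail \<omega> r))"
      if r: "0 \<le> r'" "r' \<le> r" "r < 1" "1 - r' \<le> K * (1 - r)" for r r'
    proof -
      have T: "0 < tail \<omega> r" using tail_pos[OF w] r by auto
      have "(\<integral>\<^sup>+t. m t * indicator {r'..r} t \<partial>lborel)
          \<le> (\<integral>\<^sup>+t. ennreal (A / ((1 - r) * tail \<omega> r)) * indicator {r'..r} t \<partial>lborel)"
      proof (rule nn_integral_mono)
        fix t
        show "m t * indicator {r'..r} t \<le> ennreal (A / ((1 - r) * tail \<omega> r)) * indicator {r'..r} t"
        proof (cases "t \<in> {r'..r}")
          case True
          then have t: "0 \<le> t" "t < 1" "t \<le> r" using r by auto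
          have "A / ((1 - t) * tail \<omega> t) \<le> A / ((1 - r) * tail \<omega> r)"
            using t r A T tail_pos[OF w t(1,2)] tail_antimono[OF w t(1,3) r(3)] by (intro divide_left_mono mult_mono mult_pos_pos) auto
          then show ?thesis using True mb[OF t(1,2)] by (auto intro: order_trans ennreal_leI)
        qed simp
      qed
      also have "\<dots> = ennreal (A / ((1 - r) * tail \<omega> r)) * ennreal (r - r')"
        using r by (simp add: nn_integral_cmult_indicator)
      also have "\<dots> = ennreal (A / ((1 - r) * tail \<omega> r) * (r - r'))"
        using r by (intro ennreal_mult''[symmetric]) auto
      also have "\<dots> \<le> ennreal (B * (1 / tail \<omega> r))"
      proof (rule ennreal_leI)
        have "r - r' \<le> K * (1 - r)" using r by linarith
        then have "A / ((1 - r) * tail \<omega> r) * (r - r') \<le> A / ((1 - r) * tail \<omega> r) * (K * (1 - r))"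
          using A T r by (intro mult_left_mono) auto
        also have "\<dots> = B * (1 / tail \<omega> r)" using r T by (simp add: B_def)
        finally show "A / ((1 - r) * tail \<omega> r) * (r - r') \<le> B * (1 / tail \<omega> r)" .
      qed
      finally show ?thesis .
    qed
    have Nx: "N x \<le> ennreal (B / (1 - 1 / L) * (1 / tail \<omega> x))"
    proof (rule geometric_growth[where K = K and q = "1 / L" and B = B and N = N and \<Phi> = "\<lambda>r. 1 / tail \<omega> r"])
      show "0 \<le> 1 / tail \<omega> r" if "0 \<le> r" "r < 1" for r using tail_pos[OF w that] by simp
      show "N r \<le> ennreal (B * (1 / tail \<omega> r))" if "0 \<le> r" "r < 1" "1 - K * (1 - r) < 0" for r
        unfolding N_def using that by (intro piece) auto
      show "N r \<le> N (1 - K * (1 - r)) + ennreal (B * (1 / tail \<omega> r))" if r: "r < 1" "0 \<le> 1 - K * (1 - r)" for r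
      proof -
        let ?r = "1 - K * (1 - r)"
        have "1 * (1 - r) \<le> K * (1 - r)" using K r by (intro mult_right_mono) auto
        then have le: "?r \<le> r" by simp
        have "N r \<le> (\<integral>\<^sup>+t. m t * indicator {0..?r} t + m t * indicator {?r..r} t \<partial>lborel)"
          unfolding N_def by (intro nn_integral_mono) (auto split: split_indicator)
        also have "\<dots> = N ?r + (\<integral>\<^sup>+t. m t * indicator {?r..r} t \<partial>lborel)"
          unfolding N_def by (intro nn_integral_add) auto
        also have "\<dots> \<le> N ?r + ennreal (B * (1 / tail \<omega> r))"
          using r le by (intro add_left_mono piece) auto
        finally show ?thesis .
      qed
      show "1 / tail \<omega> (1 - K * (1 - r)) \<le> 1 / L * (1 / tail \<omega> r)" if r: "r < 1" "0 \<le> 1 - K * (1 - r)" for r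
      proof -
        let ?r = "1 - K * (1 - r)"
        have r': "?r < 1" using K r by simp
        \<comment> \<open>Lower doubling is applied at the earlier point \<open>?r\<close>, from
          which it leads exactly to r.\<close>
        have "1 - (1 - ?r) / K = r" using K by (simp add: field_simps)
        then have "L * tail \<omega> r \<le> tail \<omega> ?r"
          using KL r(2) r' unfolding lower_doubling_with_def by (metis atLeastLessThan_iff)
        moreover have "0 < tail \<omega> r"
        proof (rule tail_pos[OF w _ r(1)])
          have "1 * (1 - r) \<le> K * (1 - r)" using K r by (intro mult_right_mono) auto
          also have "\<dots> \<le> 1" using r(2) by simp
          finally show "0 \<le> r" by simp
        qed
        ultimately have "1 / tail \<omega> ?r \<le> 1 / (L * tail \<omega> r)" using L tail_pos[OF w r(2) r'] by (intro divide_left_mono) (auto intro!: mult_pos_pos)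
        then show ?thesis by simp
      qed
    qed (use K L B0 x in auto)
    have "ennreal (kernel_mean \<omega> x) = (\<integral>\<^sup>+\<theta>. ennreal (cmod (bergman_kernel \<omega> 1 (of_real x * cis \<theta>))) \<partial>circle_measure)"
      by (rule kernel_mean_nn_integral[OF w x])
    also have "\<dots> \<le> (\<integral>\<^sup>+\<theta>. ennreal (kernel_coeff \<omega> 0) + (\<integral>\<^sup>+t. ?D t \<theta> * indicator {0..x} t \<partial>lborel) \<partial>circle_measure)"
      by (intro nn_integral_mono kernel_le_integral_deriv[OF w x])
    also have "\<dots> = ennreal (kernel_coeff \<omega> 0) + (\<integral>\<^sup>+\<theta>. (\<integral>\<^sup>+t. ?D t \<theta> * indicator {0..x} t \<partial>lborel) \<partial>circle_measure)"
      by (subst nn_integral_add) (auto simp: emeasure_circle)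
    also have "(\<integral>\<^sup>+\<theta>. (\<integral>\<^sup>+t. ?D t \<theta> * indicator {0..x} t \<partial>lborel) \<partial>circle_measure)
        = (\<integral>\<^sup>+t. (\<integral>\<^sup>+\<theta>. ?D t \<theta> * indicator {0..x} t \<partial>circle_measure) \<partial>lborel)"
      by (rule Fubini'[symmetric]) measurable
    also have "\<dots> = N x"
      unfolding N_def m_def by (intro nn_integral_cong nn_integral_multc) measurable
    finally have "ennreal (kernel_mean \<omega> x) \<le> ennreal (kernel_coeff \<omega> 0) + ennreal (B / (1 - 1 / L) * (1 / tail \<omega> x))"
      using Nx by (meson add_left_mono order_trans)
    also have "\<dots> = ennreal (kernel_coeff \<omega> 0 + B / (1 - 1 / L) * (1 / tail \<omega> x))"
      using kernel_coeff_pos[OF w, of 0] B0 L tail_pos[OF w x] by (intro ennreal_plus[symmetric]) auto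
    finally have 1: "kernel_mean \<omega> x \<le> kernel_coeff \<omega> 0 + B / (1 - 1 / L) * (1 / tail \<omega> x)"
      using kernel_coeff_pos[OF w, of 0] B0 L tail_pos[OF w x] by (subst (asm) ennreal_le_iff) (auto intro!: add_nonneg_nonneg)
    \<comment> \<open>The initial value F(0): twice the first moment is at least tail (1/2), which
      doubling compares with tail 0.\<close>
    have "kernel_coeff \<omega> 0 \<le> C / tail \<omega> x"
    proof -
      have "tail \<omega> x \<le> tail \<omega> 0" using x by (intro tail_antimono[OF w]) auto
      also have "\<dots> \<le> C * tail \<omega> (1/2)"
        using C bspec[of "{0..<1}" "\<lambda>r. tail \<omega> r \<le> C * tail \<omega> ((1 + r) / 2)" 0]
        by (simp add: upper_doubling_with_def)
      also have "tail \<omega> (1/2) \<le> 2 * moment \<omega> 1" using moment_ge[OF w, of 1 "1/2"] by simp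
      finally have "tail \<omega> x \<le> C * (2 * moment \<omega> 1)" using C1 by (simp add: mult_left_mono)
      then show ?thesis using moment_pos[OF w, of 1] tail_pos[OF w x]
        by (simp add: kernel_coeff_def field_simps)
    qed
    with 1 show "kernel_mean \<omega> x \<le> c / tail \<omega> x"
      by (simp add: c_def add_divide_distrib)
  qed
qed

text \<open>The mean dominates every single term of the series. For n of order 1 / (1 - x) the power
  x^n is bounded below, while the moment of order 2 n + 1 is at most a multiple of tail x. Below 1/2
  the constant term suffices.\<close>

lemma kernel_mean_lower:
  "\<exists>c>0. \<forall>\<omega> x. radial_weight \<omega> \<longrightarrow> upper_doubling_with C \<omega> \<longrightarrow>
     0 \<le> x \<longrightarrow> x < 1 \<longrightarrow> c / tail \<omega> x \<le> kernel_mean \<omega> x"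
proof -
  obtain A where A: "1 \<le> A" and le: "\<And>\<omega> r y. radial_weight \<omega> \<Longrightarrow> upper_doubling_with C \<omega> \<Longrightarrow> 0 \<le> r \<Longrightarrow> r < 1 \<Longrightarrow>
      1 \<le> y * (1 - r) \<Longrightarrow> moment \<omega> y \<le> A * tail \<omega> r"
    using upper_doubling_moment_le_tail[of C] by blast
  \<comment> \<open>The lower bound for x^n when n (1 - x) \<le> 2.\<close>
  define e where "e = exp (- 4 :: real)"
  have e: "0 < e" "e \<le> 1" by (auto simp: e_def)
  show ?thesis
  \<comment> \<open>\<open>max C 1\<close> keeps the constant positive for every real C; for
    admissible C it is C itself.\<close>
  proof (intro exI[of _ "e / (2 * A * max C 1)"] conjI allI impI)
    show "0 < e / (2 * A * max C 1)" using A e by (intro divide_pos_pos mult_pos_pos) auto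
    fix \<omega> and x :: real assume w: "radial_weight \<omega>" and C: "upper_doubling_with C \<omega>" and x: "0 \<le> x" "x < 1"
    have C1: "1 \<le> C" using C by (simp add: upper_doubling_with_def)
    have T: "0 < tail \<omega> x" by (rule tail_pos[OF w x])
    have "e / (2 * A * C * tail \<omega> x) \<le> kernel_mean \<omega> x"
    proof (cases "x < 1/2")
      case True
      have "moment \<omega> 1 \<le> tail \<omega> 0" by (rule moment_le_tail_0[OF w]) simp
      also have "\<dots> \<le> C * tail \<omega> (1/2)"
        using C bspec[of "{0..<1}" "\<lambda>r. tail \<omega> r \<le> C * tail \<omega> ((1 + r) / 2)" 0]
        by (simp add: upper_doubling_with_def)
      also have "\<dots> \<le> C * tail \<omega> x" using C1 x True by (intro mult_left_mono tail_antimono[OF w]) auto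
      also have "\<dots> \<le> A * (C * tail \<omega> x)" using A C1 T by simp
      finally have "e * moment \<omega> 1 \<le> 1 * (A * (C * tail \<omega> x))"
        using e moment_pos[OF w, of 1] by (intro mult_mono) auto
      then have "e / (2 * A * C * tail \<omega> x) \<le> kernel_coeff \<omega> 0"
        using moment_pos[OF w, of 1] A C1 T by (simp add: kernel_coeff_def field_simps)
      then show ?thesis using kernel_mean_ge_coeff[OF w x, of 0] by simp
    next
      case False
      \<comment> \<open>Rounding up gives n (1 - x) \<ge> 1 and adds at most 1 - x to this
        product.\<close>
      define n where "n = nat \<lceil>1 / (1 - x)\<rceil>"
      have n: "1 / (1 - x) \<le> real n" "real n \<le> 1 / (1 - x) + 1"
        using x unfolding n_def by (auto simp: le_of_int_ceiling of_nat_nat ceiling_correct intro: less_imp_le)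
      have n1: "1 \<le> real n * (1 - x)" "real n * (1 - x) \<le> 2" using n x False by (auto simp: field_simps)
      have "1 \<le> (2 * real n + 1) * (1 - x)" using n1 x by (simp add: algebra_simps)
      then have m: "moment \<omega> (2 * real n + 1) \<le> A * tail \<omega> x" by (rule le[OF w C x])
      have "e \<le> x ^ n"
        using power_ge_exp[of x "real n" 2] False x n1 by (simp add: e_def powr_realpow)
      moreover have "1 / (2 * A * C * tail \<omega> x) \<le> kernel_coeff \<omega> n"
      proof -
        have "moment \<omega> (2 * real n + 1) \<le> (A * tail \<omega> x) * C" using m C1 A T by (smt (verit) mult_left_le mult_le_cancel_left1 mult_pos_pos)
        then show ?thesis unfolding kernel_coeff_def
          using moment_pos[OF w, of "2 * real n + 1"] A C1 T by (intro divide_left_mono) (auto simp: ac_simps)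
      qed
      ultimately have "1 / (2 * A * C * tail \<omega> x) * e \<le> kernel_coeff \<omega> n * x ^ n"
        using e kernel_coeff_pos[OF w, of n] by (intro mult_mono) auto
      then show ?thesis using kernel_mean_ge_coeff[OF w x, of n] by simp
    qed
    then show "e / (2 * A * max C 1) / tail \<omega> x \<le> kernel_mean \<omega> x" using C1 by (simp add: max_def)
  qed
qed

subsection \<open>Testing on radial functions\<close>

lemma conj_exp_pos: "1 < p \<Longrightarrow> 1 < conj_exp p"
  by (simp add: conj_exp_def field_simps)

lemma epowr_ennreal: "0 \<le> x \<Longrightarrow> epowr (ennreal x) a = ennreal (x powr a)"
  by (simp add: epowr_def)

lemma epowr_mono:
  assumes "x \<le> y" "0 \<le> a" shows "epowr x a \<le> epowr y a"
proof (cases "y = top")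
  case False
  then have "x \<noteq> top" using assms(1) by (auto simp: top_unique)
  then show ?thesis using False assms
    by (auto simp: epowr_def less_top intro!: ennreal_leI powr_mono2 enn2real_mono)
qed (simp add: epowr_def)

lemma epowr_epowr:
  assumes "0 < a" shows "epowr (epowr x a) b = epowr x (a * b)"
  by (auto simp: epowr_def powr_powr)

lemma epowr_1 [simp]: "epowr x 1 = x"
  by (auto simp: epowr_def less_top)

lemma epowr_mult:
  assumes "0 \<le> c" "0 < a" "x < top"
  shows "epowr (ennreal c * x) a = ennreal (c powr a) * epowr x a"
proof -
  obtain y where y: "x = ennreal y" "0 \<le> y" using assms(3) by (cases x) auto
  then show ?thesis using assms by (simp add: ennreal_mult[symmetric] epowr_ennreal powr_mult)
qed

lemma Lp_norm_le_imp:
  assumes p: "1 < p" and N: "0 \<le> N" and f: "Lp_norm p \<nu> f < top"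
    and le: "Lp_norm p \<nu> h \<le> ennreal N * Lp_norm p \<nu> f"
  shows "(\<integral>\<^sup>+z. ennreal (cmod (h z) powr p * \<nu> (cmod z)) \<partial>disc_area)
    \<le> ennreal (N powr p) * (\<integral>\<^sup>+z. ennreal (cmod (f z) powr p * \<nu> (cmod z)) \<partial>disc_area)"
proof -
  have "epowr (Lp_norm p \<nu> h) p \<le> epowr (ennreal N * Lp_norm p \<nu> f) p"
    using le p by (intro epowr_mono) auto
  also have "\<dots> = ennreal (N powr p) * epowr (Lp_norm p \<nu> f) p"
    using p N f by (intro epowr_mult) auto
  finally show ?thesis using p unfolding Lp_norm_def by (simp add: epowr_epowr)
qed

lemma measurable_radial_iff:
  "f \<in> borel_measurable radial_measure \<longleftrightarrow> f \<in> borel_measurable (lebesgue_on {0..<1})"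
  by (simp add: measurable_cong_sets[OF sets_radial refl])

lemma measurable_weight_measure_iff:
  "f \<in> borel_measurable (weight_measure \<omega>) \<longleftrightarrow> f \<in> borel_measurable (lebesgue_on {0..<1})"
  by (simp add: measurable_cong_sets[OF sets_weight_measure refl])

lemma nn_integral_weight_measure_density:
  assumes w: "radial_weight \<omega>" and F: "F \<in> borel_measurable (lebesgue_on {0..<1})"
  shows "(\<integral>\<^sup>+s. F s \<partial>weight_measure \<omega>) = (\<integral>\<^sup>+s. ennreal (\<omega> s) * F s \<partial>lebesgue_on {0..<1})"
  unfolding weight_measure_def
  using radial_weight_measurable[OF w] F by (intro nn_integral_density) auto

lemma nn_integral_radial_weight:
  assumes w: "radial_weight \<omega>" and F: "F \<in> borel_measurable (lebesgue_on {0..<1})"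
  shows "(\<integral>\<^sup>+s. ennreal (\<omega> s) * F s \<partial>radial_measure) = (\<integral>\<^sup>+s. ennreal (2 * s) * F s \<partial>weight_measure \<omega>)"
proof -
  note [measurable] = radial_weight_measurable[OF w] F
  have [measurable]: "(\<lambda>r. ennreal (2 * r)) \<in> borel_measurable (lebesgue_on {0..<1})"
    by (intro borel_measurable_lebesgue_onI) auto
  have "(\<integral>\<^sup>+s. ennreal (\<omega> s) * F s \<partial>radial_measure) = (\<integral>\<^sup>+s. ennreal (2 * s) * (ennreal (\<omega> s) * F s) \<partial>lebesgue_on {0..<1})"
    unfolding radial_measure_def by (intro nn_integral_density) auto
  also have "\<dots> = (\<integral>\<^sup>+s. ennreal (\<omega> s) * (ennreal (2 * s) * F s) \<partial>lebesgue_on {0..<1})"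
    by (simp add: ac_simps)
  also have "\<dots> = (\<integral>\<^sup>+s. ennreal (2 * s) * F s \<partial>weight_measure \<omega>)"
    by (intro nn_integral_weight_measure_density[OF w, symmetric]) auto
  finally show ?thesis .
qed

text \<open>For radial f the integral defining the operator at z, where it converges, is a
  one-dimensional integral with the kernel \<open>kernel_mean\<close>. A lower bound c for it on a
  set E of radii turns boundedness into an inequality between integrals against \<nu>.\<close>

lemma radial_test:
  assumes p: "1 < p" and w: "radial_weight \<omega>" and v: "radial_weight \<nu>"
    and N: "max_bergman_bounded_by p \<omega> \<nu> N"
    and g: "g \<in> borel_measurable (lebesgue_on {0..<1})" and g0: "\<And>s. 0 \<le> s \<Longrightarrow> s < 1 \<Longrightarrow> 0 \<le> g s"
    and fin: "(\<integral>\<^sup>+s. ennreal (2 * s) * ennreal (g s powr p) \<partial>weight_measure \<nu>) < top"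
    and c: "c \<in> borel_measurable (lebesgue_on {0..<1})" and c0: "\<And>r. r \<in> E \<Longrightarrow> 0 \<le> c r"
    and E: "E \<in> sets (lebesgue_on {0..<1})"
    and le: "\<And>r. r \<in> E \<Longrightarrow> ennreal (c r)
        \<le> (\<integral>\<^sup>+s. ennreal (2 * s) * (ennreal (g s) * ennreal (kernel_mean \<omega> (r * s))) \<partial>weight_measure \<omega>)"
  shows "(\<integral>\<^sup>+r. ennreal (2 * r) * (ennreal (c r powr p) * indicator E r) \<partial>weight_measure \<nu>)
     \<le> ennreal (N powr p) * (\<integral>\<^sup>+s. ennreal (2 * s) * ennreal (g s powr p) \<partial>weight_measure \<nu>)"
proof -
  define f where "f z = complex_of_real (g (cmod z))" for z
  have N0: "0 \<le> N" using N by (simp add: max_bergman_bounded_by_def)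
  note m = radial_weight_measurable[OF w] radial_weight_measurable[OF v]
  have gm: "(\<lambda>z. g (cmod z)) \<in> borel_measurable disc_area"
    by (rule measurable_compose[OF measurable_cmod]) (use g in \<open>simp add: measurable_radial_iff\<close>)
  then have fm: "f \<in> borel_measurable disc_area" unfolding f_def by measurable
  have "(\<integral>\<^sup>+z. ennreal (cmod (f z) powr p * \<nu> (cmod z)) \<partial>disc_area)
      = (\<integral>\<^sup>+z. ennreal (\<nu> (cmod z)) * ennreal (g (cmod z) powr p) \<partial>disc_area)"
    using g0 radial_weight_nonneg[OF v]
    by (intro nn_integral_cong) (auto simp: f_def ennreal_mult mult.commute)
  also have "\<dots> = (\<integral>\<^sup>+s. ennreal (\<nu> s) * ennreal (g s powr p) \<partial>radial_measure)"
    by (rule nn_integral_disc_area_radial[where F = "\<lambda>s. ennreal (\<nu> s) * ennreal (g s powr p)"])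
      (use m g in \<open>simp add: measurable_radial_iff\<close>)
  also have "\<dots> = (\<integral>\<^sup>+s. ennreal (2 * s) * ennreal (g s powr p) \<partial>weight_measure \<nu>)"
    using g by (intro nn_integral_radial_weight[OF v]) auto
  finally have If: "(\<integral>\<^sup>+z. ennreal (cmod (f z) powr p * \<nu> (cmod z)) \<partial>disc_area)
      = (\<integral>\<^sup>+s. ennreal (2 * s) * ennreal (g s powr p) \<partial>weight_measure \<nu>)" .
  have fL: "f \<in> Lp_space p \<nu>"
    using fm fin unfolding If[symmetric] by (auto simp: Lp_space_def Lp_norm_def epowr_def)
  then have nf: "Lp_norm p \<nu> f < top" by (simp add: Lp_space_def)
  have ae: "AE z in disc_area. 0 < \<nu> (cmod z) \<longrightarrow> integrable disc_area (max_bergman_integrand \<omega> f z)"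
    and le': "Lp_norm p \<nu> (max_bergman \<omega> f) \<le> ennreal N * Lp_norm p \<nu> f"
    using N fL by (auto simp: max_bergman_bounded_by_def)
  have point: "c (cmod z) \<le> cmod (max_bergman \<omega> f z)"
    if z: "cmod z < 1" "cmod z \<in> E" and i: "integrable disc_area (max_bergman_integrand \<omega> f z)" for z
  proof -
    let ?h = "\<lambda>\<zeta>. g (cmod \<zeta>) * (cmod (bergman_kernel \<omega> z \<zeta>) * \<omega> (cmod \<zeta>))"
    have eq: "max_bergman_integrand \<omega> f z = (\<lambda>\<zeta>. complex_of_real (?h \<zeta>))"
      by (simp add: max_bergman_integrand_def f_def fun_eq_iff)
    have ih: "integrable disc_area ?h" using i unfolding eq by (simp only: complex_of_real_integrable_eq)
    have h0: "0 \<le> ?h \<zeta>" if "\<zeta> \<in> space disc_area" for \<zeta>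
      using that g0 radial_weight_nonneg[OF w] by auto
    have "ennreal (c (cmod z))
        \<le> (\<integral>\<^sup>+s. ennreal (2 * s) * (ennreal (g s) * ennreal (kernel_mean \<omega> (cmod z * s))) \<partial>weight_measure \<omega>)"
      by (rule le[OF z(2)])
    also have "\<dots> = (\<integral>\<^sup>+s. ennreal (\<omega> s) * (ennreal (g s) * ennreal (kernel_mean \<omega> (cmod z * s))) \<partial>radial_measure)"
    proof (intro nn_integral_radial_weight[OF w, symmetric] borel_measurable_times_ennreal)
      show "(\<lambda>s. ennreal (g s)) \<in> borel_measurable (lebesgue_on {0..<1})" using g by measurable
      show "(\<lambda>s. ennreal (kernel_mean \<omega> (cmod z * s))) \<in> borel_measurable (lebesgue_on {0..<1})"
        by (intro borel_measurable_lebesgue_onI) measurable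
    qed
    also have "\<dots> = (\<integral>\<^sup>+s. (ennreal (\<omega> s) * ennreal (g s)) * ennreal (kernel_mean \<omega> (cmod z * s)) \<partial>radial_measure)"
      by (simp add: mult.assoc)
    also have "\<dots> = (\<integral>\<^sup>+\<zeta>. (ennreal (\<omega> (cmod \<zeta>)) * ennreal (g (cmod \<zeta>))) * ennreal (cmod (bergman_kernel \<omega> z \<zeta>)) \<partial>disc_area)"
      by (rule nn_integral_bergman_kernel_radial[OF w z(1), symmetric]) (use m g in \<open>simp add: measurable_radial_iff\<close>)
    also have "\<dots> = (\<integral>\<^sup>+\<zeta>. ennreal (?h \<zeta>) \<partial>disc_area)"
      using g0 radial_weight_nonneg[OF w] by (intro nn_integral_cong) (auto simp: ennreal_mult' ac_simps)
    also have "\<dots> = ennreal (\<integral>\<zeta>. ?h \<zeta> \<partial>disc_area)"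
      by (intro nn_integral_eq_integral ih AE_I2 h0)
    finally have "c (cmod z) \<le> (\<integral>\<zeta>. ?h \<zeta> \<partial>disc_area)"
      using Bochner_Integration.integral_nonneg[of disc_area ?h] h0 by (subst (asm) ennreal_le_iff) auto
    also have "\<dots> \<le> cmod (max_bergman \<omega> f z)"
      unfolding max_bergman_def eq integral_complex_of_real by simp
    finally show ?thesis .
  qed
  have "(\<integral>\<^sup>+r. ennreal (2 * r) * (ennreal (c r powr p) * indicator E r) \<partial>weight_measure \<nu>)
      = (\<integral>\<^sup>+r. ennreal (\<nu> r) * (ennreal (c r powr p) * indicator E r) \<partial>radial_measure)"
    using c E by (intro nn_integral_radial_weight[OF v, symmetric]) auto
  also have "\<dots> = (\<integral>\<^sup>+z. ennreal (\<nu> (cmod z)) * (ennreal (c (cmod z) powr p) * indicator E (cmod z)) \<partial>disc_area)"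
    by (rule nn_integral_disc_area_radial[where F = "\<lambda>r. ennreal (\<nu> r) * (ennreal (c r powr p) * indicator E r)", symmetric])
      (use m c E in \<open>auto simp: measurable_radial_iff\<close>)
  also have "\<dots> \<le> (\<integral>\<^sup>+z. ennreal (cmod (max_bergman \<omega> f z) powr p * \<nu> (cmod z)) \<partial>disc_area)"
  proof (rule nn_integral_mono_AE)
    show "AE z in disc_area. ennreal (\<nu> (cmod z)) * (ennreal (c (cmod z) powr p) * indicator E (cmod z))
        \<le> ennreal (cmod (max_bergman \<omega> f z) powr p * \<nu> (cmod z))"
      using ae
    proof (rule AE_mp[OF _ AE_I2], intro impI)
      fix z assume z: "z \<in> space disc_area"
        and i: "0 < \<nu> (cmod z) \<longrightarrow> integrable disc_area (max_bergman_integrand \<omega> f z)"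
      have v0: "0 \<le> \<nu> (cmod z)" using z radial_weight_nonneg[OF v] by auto
      show "ennreal (\<nu> (cmod z)) * (ennreal (c (cmod z) powr p) * indicator E (cmod z))
        \<le> ennreal (cmod (max_bergman \<omega> f z) powr p * \<nu> (cmod z))"
      \<comment> \<open>Convergence is guaranteed only where \<nu> is positive; elsewhere the
        left-hand side vanishes.\<close>
      proof (cases "\<nu> (cmod z) = 0 \<or> cmod z \<notin> E")
        case False
        then have "c (cmod z) powr p \<le> cmod (max_bergman \<omega> f z) powr p"
          using z i v0 p c0 by (intro powr_mono2 point) auto
        then have "\<nu> (cmod z) * c (cmod z) powr p \<le> cmod (max_bergman \<omega> f z) powr p * \<nu> (cmod z)"
          using v0 by (simp add: mult.commute mult_left_mono)
        then show ?thesis using False v0 by (simp add: ennreal_mult[symmetric] ennreal_leI)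
      qed auto
    qed
  qed
  also have "\<dots> \<le> ennreal (N powr p) * (\<integral>\<^sup>+s. ennreal (2 * s) * ennreal (g s powr p) \<partial>weight_measure \<nu>)"
    using Lp_norm_le_imp[OF p N0 nf le'] unfolding If .
  finally show ?thesis .
qed

text \<open>The test function is the indicator of {a..<b}, and the output is examined on {d..<e}.
  There 2 r \<ge> 1 removes the polar density on the left; on the right 2 s \<le> 2 causes the
  factor 2.\<close>

lemma radial_test_Ico:
  assumes p: "1 < p" and w: "radial_weight \<omega>" and v: "radial_weight \<nu>"
    and N: "max_bergman_bounded_by p \<omega> \<nu> N"
    and ab: "0 \<le> a" "b \<le> 1" and de: "1/2 \<le> d" "e \<le> 1" and c: "0 \<le> c"
    and le: "\<And>r. d \<le> r \<Longrightarrow> r < e \<Longrightarrow> ennreal c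
        \<le> (\<integral>\<^sup>+s. ennreal (2 * s * kernel_mean \<omega> (r * s)) * indicator {a..<b} s \<partial>weight_measure \<omega>)"
  shows "c powr p * measure (weight_measure \<nu>) {d..<e} \<le> 2 * N powr p * measure (weight_measure \<nu>) {a..<b}"
proof -
  interpret v: finite_measure "weight_measure \<nu>" by (rule finite_weight_measure[OF v])
  note S = Ico_sets_weight_measure
  have up: "(\<integral>\<^sup>+s. ennreal (2 * s) * ennreal ((indicator {a..<b} s) powr p) \<partial>weight_measure \<nu>)
      \<le> ennreal (2 * measure (weight_measure \<nu>) {a..<b})"
  proof -
    have "(\<integral>\<^sup>+s. ennreal (2 * s) * ennreal ((indicator {a..<b} s) powr p) \<partial>weight_measure \<nu>)
        \<le> (\<integral>\<^sup>+s. 2 * indicator {a..<b} s \<partial>weight_measure \<nu>)"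
      by (intro nn_integral_mono) (auto split: split_indicator simp flip: ennreal_numeral intro!: ennreal_leI)
    also have "\<dots> = ennreal (2 * measure (weight_measure \<nu>) {a..<b})"
      using ab by (simp add: nn_integral_cmult_indicator S v.emeasure_eq_measure ennreal_mult)
    finally show ?thesis .
  qed
  have "ennreal (c powr p * measure (weight_measure \<nu>) {d..<e})
      = (\<integral>\<^sup>+r. ennreal (c powr p) * indicator {d..<e} r \<partial>weight_measure \<nu>)"
    using de by (simp add: nn_integral_cmult_indicator S v.emeasure_eq_measure ennreal_mult)
  also have "\<dots> \<le> (\<integral>\<^sup>+r. ennreal (2 * r) * (ennreal (c powr p) * indicator {d..<e} r) \<partial>weight_measure \<nu>)"
  proof (intro nn_integral_mono)
    fix r
    have "ennreal (c powr p) \<le> ennreal (2 * r) * ennreal (c powr p)" if "d \<le> r"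
    proof -
      have "1 * c powr p \<le> 2 * r * c powr p" using that de by (intro mult_right_mono) auto
      then show ?thesis using that de by (simp add: ennreal_mult[symmetric] ennreal_leI)
    qed
    then show "ennreal (c powr p) * indicator {d..<e} r \<le> ennreal (2 * r) * (ennreal (c powr p) * indicator {d..<e} r)"
      by (auto split: split_indicator)
  qed
  also have "\<dots> \<le> ennreal (N powr p) * (\<integral>\<^sup>+s. ennreal (2 * s) * ennreal ((indicator {a..<b} s) powr p) \<partial>weight_measure \<nu>)"
  proof (rule radial_test[OF p w v N])
    show "(indicator {a..<b} :: real \<Rightarrow> real) \<in> borel_measurable (lebesgue_on {0..<1})"
      by (intro borel_measurable_lebesgue_onI) auto
    show "(\<integral>\<^sup>+s. ennreal (2 * s) * ennreal ((indicator {a..<b} s) powr p) \<partial>weight_measure \<nu>) < top"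
      using up by (rule le_less_trans) simp
    show "{d..<e} \<in> sets (lebesgue_on {0..<1})" using de S[of d e \<omega>] by (simp add: sets_weight_measure)
    fix r assume "r \<in> {d..<e}"
    then have "ennreal c \<le> (\<integral>\<^sup>+s. ennreal (2 * s * kernel_mean \<omega> (r * s)) * indicator {a..<b} s \<partial>weight_measure \<omega>)"
      by (intro le) auto
    also have "\<dots> \<le> (\<integral>\<^sup>+s. ennreal (2 * s) * (ennreal (indicator {a..<b} s) * ennreal (kernel_mean \<omega> (r * s))) \<partial>weight_measure \<omega>)"
      using kernel_mean_nonneg by (intro nn_integral_mono) (auto simp: ennreal_mult split: split_indicator)
    finally show "ennreal c \<le> \<dots>" .
  qed (use c in auto)
  also have "\<dots> \<le> ennreal (N powr p) * ennreal (2 * measure (weight_measure \<nu>) {a..<b})"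
    using up by (intro mult_left_mono) auto
  also have "\<dots> = ennreal (2 * N powr p * measure (weight_measure \<nu>) {a..<b})"
    by (simp add: ennreal_mult[symmetric] ac_simps)
  finally show ?thesis by (subst (asm) ennreal_le_iff) auto
qed

subsection \<open>Boundedness forces the doubling conditions\<close>

text \<open>For r < 1/2 the point (1 + r) / 2 lies below 3/4, so one fixed quotient of tails serves
  all these r. The tests on annuli treat r \<ge> 1/2, where the polar density is bounded
  below.\<close>

lemma tail_from_half:
  assumes v: "radial_weight \<nu>" and B: "\<And>r. 1/2 \<le> r \<Longrightarrow> r < 1 \<Longrightarrow> tail \<nu> r \<le> B * tail \<nu> ((1 + r) / 2)"
  shows "\<exists>C. upper_doubling_with C \<nu>"
proof
  let ?D = "tail \<nu> 0 / tail \<nu> (3/4)"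
  have T: "0 < tail \<nu> 0" "0 < tail \<nu> (3/4)" using tail_pos[OF v] by auto
  show "upper_doubling_with (max 1 (max B ?D)) \<nu>"
    unfolding upper_doubling_with_def
  proof (intro conjI ballI)
    fix r :: real assume "r \<in> {0..<1}"
    then have r: "0 \<le> r" "r < 1" by auto
    have P: "0 < tail \<nu> ((1 + r) / 2)" using r by (intro tail_pos[OF v]) auto
    show "tail \<nu> r \<le> max 1 (max B ?D) * tail \<nu> ((1 + r) / 2)"
    proof (cases "r < 1/2")
      case False
      then have "tail \<nu> r \<le> B * tail \<nu> ((1 + r) / 2)" using r by (intro B) auto
      also have "\<dots> \<le> max 1 (max B ?D) * tail \<nu> ((1 + r) / 2)" using P by (intro mult_right_mono) auto
      finally show ?thesis .
    next
      case True
      have "tail \<nu> r \<le> tail \<nu> 0" using r by (intro tail_antimono[OF v]) auto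
      also have "\<dots> = ?D * tail \<nu> (3/4)" using T by simp
      also have "\<dots> \<le> ?D * tail \<nu> ((1 + r) / 2)"
        using r True T by (intro mult_left_mono tail_antimono[OF v]) auto
      also have "\<dots> \<le> max 1 (max B ?D) * tail \<nu> ((1 + r) / 2)" using P by (intro mult_right_mono) auto
      finally show ?thesis .
    qed
  qed simp
qed

lemma mult_unit_interval:
  fixes a b :: real
  assumes "0 \<le> a" "a < 1" "0 \<le> b" "b < 1"
  shows "0 \<le> a * b" "a * b < 1"
  using assms mult_left_le[of b a] by auto

lemma nn_integral_Ico_ge:
  assumes w: "radial_weight \<omega>" and ab: "1/2 \<le> a" "b \<le> 1" and \<kappa>: "0 \<le> \<kappa>"
    and le: "\<And>s. a \<le> s \<Longrightarrow> s < b \<Longrightarrow> \<kappa> \<le> f s"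
  shows "ennreal (\<kappa> * measure (weight_measure \<omega>) {a..<b})
     \<le> (\<integral>\<^sup>+s. ennreal (2 * s * f s) * indicator {a..<b} s \<partial>weight_measure \<omega>)"
proof -
  interpret finite_measure "weight_measure \<omega>" by (rule finite_weight_measure[OF w])
  have "ennreal (\<kappa> * measure (weight_measure \<omega>) {a..<b}) = (\<integral>\<^sup>+s. ennreal \<kappa> * indicator {a..<b} s \<partial>weight_measure \<omega>)"
    using ab \<kappa> by (simp add: nn_integral_cmult_indicator Ico_sets_weight_measure emeasure_eq_measure ennreal_mult)
  also have "\<dots> \<le> (\<integral>\<^sup>+s. ennreal (2 * s * f s) * indicator {a..<b} s \<partial>weight_measure \<omega>)"
  proof (intro nn_integral_mono)
    fix s
    have "\<kappa> \<le> 2 * s * f s" if "a \<le> s" "s < b"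
    proof -
      have "1 * \<kappa> \<le> 2 * s * f s" using that ab \<kappa> le[OF that] by (intro mult_mono) auto
      then show ?thesis by simp
    qed
    then show "ennreal \<kappa> * indicator {a..<b} s \<le> ennreal (2 * s * f s) * indicator {a..<b} s"
      by (auto split: split_indicator intro: ennreal_leI)
  qed
  finally show ?thesis .
qed

lemma powr_le_imp_le:
  assumes "1 < p" "0 \<le> a" "0 \<le> b" "a powr p \<le> b powr p" shows "a \<le> (b::real)"
  using assms powr_less_mono2[of p b a] by (metis not_le less_le_trans zero_less_one less_trans)

context
  fixes p :: real and \<omega> \<nu> :: "real \<Rightarrow> real" and N :: real
  assumes p: "1 < p" and w: "radial_weight \<omega>" and v: "radial_weight \<nu>"
    and N: "max_bergman_bounded_by p \<omega> \<nu> N"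
begin

lemma N_nonneg: "0 \<le> N"
  using N by (simp add: max_bergman_bounded_by_def)

text \<open>Testing and evaluating on the same interval {r..<1} makes the \<nu>-masses cancel, and a
  condition on \<omega> alone remains.\<close>

lemma kernel_mean_tail_le:
  assumes r: "1/2 \<le> r" "r < 1" and \<kappa>: "0 \<le> \<kappa>"
    and le: "\<And>s t. r \<le> s \<Longrightarrow> s < 1 \<Longrightarrow> r \<le> t \<Longrightarrow> t < 1 \<Longrightarrow> \<kappa> \<le> kernel_mean \<omega> (t * s)"
  shows "\<kappa> * tail \<omega> r \<le> 2 * N"
proof -
  have T: "0 < tail \<nu> r" "0 < tail \<omega> r" using tail_pos v w r by auto
  have "(\<kappa> * tail \<omega> r) powr p * measure (weight_measure \<nu>) {r..<1} \<le> 2 * N powr p * measure (weight_measure \<nu>) {r..<1}"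
  proof (rule radial_test_Ico[OF p w v N])
    fix t assume t: "r \<le> t" "t < 1"
    show "ennreal (\<kappa> * tail \<omega> r) \<le> (\<integral>\<^sup>+s. ennreal (2 * s * kernel_mean \<omega> (t * s)) * indicator {r..<1} s \<partial>weight_measure \<omega>)"
      using nn_integral_Ico_ge[OF w r(1) _ \<kappa>, of 1 "\<lambda>s. kernel_mean \<omega> (t * s)"] le t r tail_eq_measure[OF w, of r]
      by simp
  qed (use r \<kappa> T in auto)
  then have "(\<kappa> * tail \<omega> r) powr p \<le> 2 * N powr p"
    using T tail_eq_measure[OF v, of r] r by simp
  \<comment> \<open>As p > 1, the factor 2 may be enlarged to 2 powr p and drawn into the
    power.\<close>
  also have "\<dots> \<le> 2 powr p * N powr p"
    using p powr_mono[of 1 p 2] by (intro mult_right_mono) auto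
  also have "\<dots> = (2 * N) powr p" using N_nonneg by (simp add: powr_mult)
  finally have "(\<kappa> * tail \<omega> r) powr p \<le> (2 * N) powr p" .
  from powr_le_imp_le[OF p _ _ this] show ?thesis using \<kappa> T N_nonneg by auto
qed

text \<open>Test with the indicator of {\<rho>..<1} and evaluate on {r..<\<rho>}, where \<rho> = (1
  + r) / 2. All products t s stay within 3 (1 - \<rho>) of 1, so the kernel mean is at least a
  multiple of 1 / tail \<omega> \<rho> and the output exceeds a constant. This bounds the \<nu>-mass
  of the annulus by the \<nu>-tail beyond it.\<close>

lemma upper_doubling_nu:
  assumes C: "upper_doubling_with C \<omega>"
  shows "\<exists>C'. upper_doubling_with C' \<nu>"
proof -
  obtain c0 where c0: "0 < c0" "\<And>x. 0 \<le> x \<Longrightarrow> x < 1 \<Longrightarrow> c0 / tail \<omega> x \<le> kernel_mean \<omega> x"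
    using kernel_mean_lower[of C] w C by blast
  obtain A where A: "1 \<le> A" "\<And>r t. 0 \<le> r \<Longrightarrow> r < 1 \<Longrightarrow> 0 \<le> t \<Longrightarrow> t < 1 \<Longrightarrow> 1 - r \<le> 3 * (1 - t) \<Longrightarrow> tail \<omega> r \<le> A * tail \<omega> t"
    using upper_doubling_ratio[of C 3] w C by blast
  define B where "B = 1 + 2 * N powr p / (c0 / A) powr p"
  show ?thesis
  proof (rule tail_from_half[OF v, of B])
    fix r :: real assume r: "1/2 \<le> r" "r < 1"
    define \<rho> where "\<rho> = (1 + r) / 2"
    have \<rho>: "1/2 \<le> \<rho>" "r < \<rho>" "\<rho> < 1" using r by (auto simp: \<rho>_def)
    have T: "0 < tail \<omega> \<rho>" using tail_pos[OF w] \<rho> by auto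
    have "(c0 / A) powr p * measure (weight_measure \<nu>) {r..<\<rho>} \<le> 2 * N powr p * measure (weight_measure \<nu>) {\<rho>..<1}"
    proof (rule radial_test_Ico[OF p w v N])
      fix t assume t: "r \<le> t" "t < \<rho>"
      have k: "c0 / A / tail \<omega> \<rho> \<le> kernel_mean \<omega> (t * s)" if s: "\<rho> \<le> s" "s < 1" for s
      proof -
        have ts: "0 \<le> t * s" "t * s < 1" using s t r \<rho> mult_unit_interval[of t s] by auto
        have "r * \<rho> \<le> t * s" using s t r \<rho> by (intro mult_mono) auto
        moreover have "1 - r * \<rho> \<le> 3 * (1 - \<rho>)"
        proof -
          have "r = 2 * \<rho> - 1" by (simp add: \<rho>_def field_simps)
          then have "1 - r * \<rho> = 1 - (2 * \<rho> - 1) * \<rho>" by (simp only:)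
          also have "\<dots> = (1 - \<rho>) * (1 + 2 * \<rho>)" by (simp add: algebra_simps)
          also have "\<dots> \<le> (1 - \<rho>) * 3" using \<rho> by (intro mult_left_mono) auto
          finally show ?thesis by simp
        qed
        ultimately have "1 - t * s \<le> 3 * (1 - \<rho>)" by linarith
        then have "tail \<omega> (t * s) \<le> A * tail \<omega> \<rho>" using ts \<rho> by (intro A(2)) auto
        then have "c0 / (A * tail \<omega> \<rho>) \<le> c0 / tail \<omega> (t * s)"
          using c0(1) A(1) T tail_pos[OF w ts] by (intro divide_left_mono mult_pos_pos) auto
        also have "\<dots> \<le> kernel_mean \<omega> (t * s)" using ts by (intro c0(2))
        finally show ?thesis by simp
      qed
      have "c0 / A = c0 / A / tail \<omega> \<rho> * measure (weight_measure \<omega>) {\<rho>..<1}"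
        using T \<rho> tail_eq_measure[OF w, of \<rho>] by simp
      then show "ennreal (c0 / A) \<le> (\<integral>\<^sup>+s. ennreal (2 * s * kernel_mean \<omega> (t * s)) * indicator {\<rho>..<1} s \<partial>weight_measure \<omega>)"
        (is "_ \<le> ?I")
      proof -
        have "ennreal (c0 / A / tail \<omega> \<rho> * measure (weight_measure \<omega>) {\<rho>..<1}) \<le> ?I"
          using \<rho> T c0(1) A(1) by (intro nn_integral_Ico_ge[OF w _ _ _ k]) auto
        then show ?thesis using \<open>c0 / A = _\<close> by (simp only:)
      qed
    qed (use r \<rho> A c0 in auto)
    moreover have "0 < (c0 / A) powr p" using c0 A by simp
    ultimately have "measure (weight_measure \<nu>) {r..<\<rho>} \<le> 2 * N powr p / (c0 / A) powr p * measure (weight_measure \<nu>) {\<rho>..<1}"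
      by (simp add: field_simps)
    then show "tail \<nu> r \<le> B * tail \<nu> ((1 + r) / 2)"
      using tail_diff[OF v, of r \<rho>] tail_eq_measure[OF v, of \<rho>] r \<rho>
      by (simp add: B_def algebra_simps flip: \<rho>_def)
  qed
qed

text \<open>For n \<ge> 1 / (1 - r) the n-th coefficient is at least a multiple of 1 / tail r. With
  \<rho> = 1 - (1 - r) / 2^m, the powers of t s, for t and s beyond \<rho>, stay bounded below for
  all n up to the order of 2^m / (1 - r). Hardy's inequality sums 1 / (n + 1) over these m dyadic
  blocks, so the mean is at least a multiple of m / tail r. Since that lower bound times tail \<rho>
  is at most 2 N, a large m forces tail \<rho> to be at most half of tail r.\<close>

lemma lower_doubling_omega:
  assumes C: "upper_doubling_with C \<omega>"
  shows "\<exists>K L. lower_doubling_with K L \<omega>"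
proof -
  obtain A where A: "1 \<le> A" "\<And>r y. 0 \<le> r \<Longrightarrow> r < 1 \<Longrightarrow> 1 \<le> y * (1 - r) \<Longrightarrow> moment \<omega> y \<le> A * tail \<omega> r"
    using upper_doubling_moment_le_tail[of C] w C by blast
  \<comment> \<open>This bounds \<rho>^(2 n) from below, as 2 n (1 - \<rho>) \<le> 4 for the indices
    in use.\<close>
  define e where "e = exp (- 8 :: real)"
  have e: "0 < e" by (simp add: e_def)
  \<comment> \<open>N + 1 in place of N makes the threshold positive, so that m \<ge> 1 and the
    factor N + 1 can be cancelled at the end.\<close>
  obtain m :: nat where m: "16 * pi * A * (N + 1) / e < real m" using reals_Archimedean2 by blast
  have m1: "1 \<le> m"
  proof -
    have "0 < 16 * pi * A * (N + 1) / e" using A N_nonneg e by auto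
    then show ?thesis using m by linarith
  qed
  have "lower_doubling_with (2 ^ m) 2 \<omega>"
    unfolding lower_doubling_with_def
  proof (intro conjI ballI)
    show "1 < (2::real) ^ m" using m1 by (simp add: one_less_power)
    fix r :: real assume "r \<in> {0..<1}"
    then have r: "0 \<le> r" "r < 1" by auto
    define \<rho> where "\<rho> = 1 - (1 - r) / 2 ^ m"
    have "(1 - r) / 2 ^ m \<le> (1 - r) / 2 ^ 1" using r m1 by (intro divide_left_mono power_increasing) auto
    moreover have "(1 - r) / 2 ^ 1 \<le> 1/2" "0 < (1 - r) / 2 ^ m" using r by auto
    ultimately have \<rho>: "1/2 \<le> \<rho>" "\<rho> < 1" unfolding \<rho>_def by linarith+
    have T: "0 < tail \<omega> r" "0 < tail \<omega> \<rho>" using tail_pos[OF w] r \<rho> by auto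
    \<comment> \<open>The first index, 1 / (1 - r) rounded up; rounding costs at most a factor 2
      because 1 / (1 - r) \<ge> 1.\<close>
    define a where "a = nat \<lceil>1 / (1 - r)\<rceil>"
    have a: "1 / (1 - r) \<le> real a" "real a \<le> 1 / (1 - r) + 1"
      using r unfolding a_def by (auto simp: le_of_int_ceiling of_nat_nat ceiling_correct intro: less_imp_le)
    have "1 \<le> 1 / (1 - r)" using r by (simp add: field_simps)
    then have a1: "1 \<le> a" "real a \<le> 2 / (1 - r)" using a by (auto simp: field_simps)
    \<comment> \<open>m / 2 is the lower bound for the harmonic sum and 1 / pi the constant of
      Hardy's inequality.\<close>
    define \<kappa> where "\<kappa> = e / (2 * A * tail \<omega> r) * (real m / 2) / pi"
    have \<kappa>0: "0 \<le> \<kappa>" using e A T by (simp add: \<kappa>_def)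
    have "\<kappa> * tail \<omega> \<rho> \<le> 2 * N"
    proof (rule kernel_mean_tail_le[OF \<rho> \<kappa>0])
      fix s t assume st: "\<rho> \<le> s" "s < 1" "\<rho> \<le> t" "t < 1"
      have x: "0 \<le> t * s" "t * s < 1" using st \<rho> mult_unit_interval[of t s] by auto
      let ?F = "{a..<2 ^ m * a}"
      have summand: "e / (2 * A * tail \<omega> r) / real (Suc n) \<le> kernel_coeff \<omega> n * (t * s) ^ n / real (Suc n)" if n: "n \<in> ?F" for n
      proof (rule divide_right_mono)
        have "1 \<le> real a * (1 - r)" using a r by (simp add: field_simps)
        also have "\<dots> \<le> (2 * real n + 1) * (1 - r)" using n r by (intro mult_right_mono) auto
        finally have "moment \<omega> (2 * real n + 1) \<le> A * tail \<omega> r" by (intro A(2) r)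
        then have k: "1 / (2 * (A * tail \<omega> r)) \<le> kernel_coeff \<omega> n"
          unfolding kernel_coeff_def using moment_pos[OF w, of "2 * real n + 1"] A T by (intro divide_left_mono) auto
        have "real n \<le> real (2 ^ m * a)" using n by (intro of_nat_mono) auto
        also have "\<dots> = 2 ^ m * real a" by simp
        also have "\<dots> \<le> 2 ^ m * (2 / (1 - r))" using a1 by (intro mult_left_mono) auto
        finally have "real n * ((1 - r) / 2 ^ m) \<le> 2 ^ m * (2 / (1 - r)) * ((1 - r) / 2 ^ m)"
          using r by (intro mult_right_mono) auto
        then have "2 * real n * (1 - \<rho>) \<le> 4" using r by (simp add: \<rho>_def)
        then have "e \<le> \<rho> powr (2 * real n)"
          using power_ge_exp[OF \<rho>, of "2 * real n" 4] by (simp add: e_def)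
        also have "\<dots> = (\<rho> * \<rho>) ^ n"
          using \<rho> powr_realpow[of \<rho> "2 * n"] by (simp add: power_mult power2_eq_square)
        also have "\<dots> \<le> (t * s) ^ n" using st \<rho> by (intro power_mono mult_mono) auto
        finally have "1 / (2 * (A * tail \<omega> r)) * e \<le> kernel_coeff \<omega> n * (t * s) ^ n"
          using k e kernel_coeff_pos[OF w, of n] by (intro mult_mono) auto
        then show "e / (2 * A * tail \<omega> r) \<le> kernel_coeff \<omega> n * (t * s) ^ n" by (simp add: mult.assoc)
      qed simp
      \<comment> \<open>The harmonic sum grows by at least 1/2 over each block {b..<2 * b}.\<close>
      have harm: "real m / 2 \<le> (\<Sum>n\<in>{a..<2 ^ m * a}. 1 / real (Suc n))" for m
      proof (induction m)
        case (Suc m)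
        let ?b = "2 ^ m * a"
        have "1 / 2 = (\<Sum>n\<in>{?b..<2 * ?b}. 1 / real (2 * ?b))" using a1 by simp
        also have "\<dots> \<le> (\<Sum>n\<in>{?b..<2 * ?b}. 1 / real (Suc n))"
        proof (intro sum_mono)
          fix n assume "n \<in> {?b..<2 * ?b}"
          then have "real (Suc n) \<le> real (2 * ?b)" by (intro of_nat_mono) auto
          then show "1 / real (2 * ?b) \<le> 1 / real (Suc n)"
            using a1(1) by (intro divide_left_mono mult_pos_pos) (simp_all del: of_nat_Suc of_nat_mult)
        qed
        finally have "real m / 2 + 1 / 2 \<le> (\<Sum>n\<in>{a..<?b}. 1 / real (Suc n)) + (\<Sum>n\<in>{?b..<2 * ?b}. 1 / real (Suc n))"
          using Suc.IH by (rule add_mono[rotated])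
        also have "\<dots> = (\<Sum>n\<in>{a..<2 * ?b}. 1 / real (Suc n))"
          using sum.atLeastLessThan_concat[of a ?b "2 * ?b" "\<lambda>n. 1 / real (Suc n)"] by simp
        finally show ?case by (simp add: add_divide_distrib mult.assoc)
      qed simp
      have "e / (2 * A * tail \<omega> r) * (real m / 2) \<le> e / (2 * A * tail \<omega> r) * (\<Sum>n\<in>?F. 1 / real (Suc n))"
        using e A T by (intro mult_left_mono harm) auto
      also have "\<dots> = (\<Sum>n\<in>?F. e / (2 * A * tail \<omega> r) / real (Suc n))" by (simp add: sum_distrib_left)
      also have "\<dots> \<le> (\<Sum>n\<in>?F. kernel_coeff \<omega> n * (t * s) ^ n / real (Suc n))" by (intro sum_mono summand)
      also have "\<dots> \<le> pi * kernel_mean \<omega> (t * s)" by (rule kernel_mean_Hardy[OF w x]) simp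
      finally show "\<kappa> \<le> kernel_mean \<omega> (t * s)"
        unfolding \<kappa>_def by (subst pos_divide_le_eq) (simp_all only: mult.commute pi_gt_zero)
    qed
    then have 1: "e * real m * tail \<omega> \<rho> \<le> 8 * pi * A * N * tail \<omega> r"
      using T A by (simp add: \<kappa>_def field_simps)
    have "16 * pi * A * (N + 1) * tail \<omega> \<rho> \<le> real m * e * tail \<omega> \<rho>"
      using m e T by (intro mult_right_mono) (auto simp: field_simps)
    also have "\<dots> \<le> 8 * pi * A * N * tail \<omega> r" using 1 by (simp add: mult_ac)
    also have "\<dots> \<le> 8 * pi * A * (N + 1) * tail \<omega> r" using A T by (intro mult_right_mono mult_left_mono) auto
    finally have "(8 * pi * A * (N + 1)) * (2 * tail \<omega> \<rho>) \<le> (8 * pi * A * (N + 1)) * tail \<omega> r" by simp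
    moreover have "0 < 8 * pi * A * (N + 1)" using A N_nonneg by auto
    ultimately show "2 * tail \<omega> (1 - (1 - r) / 2 ^ m) \<le> tail \<omega> r"
      unfolding \<rho>_def[symmetric] by (simp only: mult_le_cancel_left_pos)
  qed simp
  then show ?thesis by blast
qed

text \<open>By lower doubling, each annulus between R j and R (j + 1) carries a fixed part of the
  tail of \<omega> at R j, hence adds at least \<delta> to the output at every radius beyond R m.
  Testing with {r..<R m} produces at least m \<delta> on {R m..<1}; if m is large compared with the
  norm, at most half of the \<nu>-tail at r can lie beyond R m.\<close>

lemma lower_doubling_nu:
  assumes C: "upper_doubling_with C \<omega>" and KL: "lower_doubling_with K L \<omega>"
  shows "\<exists>K' L'. lower_doubling_with K' L' \<nu>"
proof -
  have K: "1 < K" and L: "1 < L" and lo: "\<And>r. 0 \<le> r \<Longrightarrow> r < 1 \<Longrightarrow> L * tail \<omega> (1 - (1 - r) / K) \<le> tail \<omega> r"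
    using KL by (auto simp: lower_doubling_with_def)
  obtain c0 where c0: "0 < c0" "\<And>x. 0 \<le> x \<Longrightarrow> x < 1 \<Longrightarrow> c0 / tail \<omega> x \<le> kernel_mean \<omega> x"
    using kernel_mean_lower[of C] w C by blast
  obtain A where A: "1 \<le> A" "\<And>r t. 0 \<le> r \<Longrightarrow> r < 1 \<Longrightarrow> 0 \<le> t \<Longrightarrow> t < 1 \<Longrightarrow> 1 - r \<le> 2 * (1 - t) \<Longrightarrow> tail \<omega> r \<le> A * tail \<omega> t"
    using upper_doubling_ratio[of C 2] w C by blast
  \<comment> \<open>c0 / A is the constant of the kernel mean, and 1 - 1 / L is the part of the tail
    of \<omega> inside one annulus.\<close>
  define \<delta> where "\<delta> = c0 / A * (1 - 1 / L)"
  have \<delta>: "0 < \<delta>" using c0 A L by (simp add: \<delta>_def)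
  obtain m0 :: nat where m0: "4 * (N + 1) / \<delta> < real m0" using reals_Archimedean2 by blast
  define m where "m = Suc m0"
  have m: "4 * (N + 1) \<le> real m * \<delta>" using m0 \<delta> by (simp add: m_def field_simps)
  have half: "2 * tail \<nu> (1 - (1 - r) / K ^ m) \<le> tail \<nu> r" if r: "1/2 \<le> r" "r < 1" for r
  proof -
    define R where "R j = 1 - (1 - r) / K ^ j" for j :: nat
    have R_lt: "R j < 1" for j using r K by (simp add: R_def)
    have R_mono: "R i \<le> R j" if "i \<le> j" for i j
      unfolding R_def using that r K by (intro diff_left_mono divide_left_mono power_increasing) auto
    have R0: "R 0 = r" by (simp add: R_def)
    have R_ge: "1/2 \<le> R j" for j using R_mono[of 0 j] r R0 by simp
    have R_Suc: "R (Suc j) = 1 - (1 - R j) / K" for j by (simp add: R_def)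
    have T: "0 < tail \<omega> (R j)" for j using tail_pos[OF w _ R_lt] R_ge[of j] by auto
    have Tv: "0 < tail \<nu> (R j)" for j using tail_pos[OF v _ R_lt] R_ge[of j] by auto
    have "(real m * \<delta>) powr p * measure (weight_measure \<nu>) {R m..<1}
        \<le> 2 * N powr p * measure (weight_measure \<nu>) {r..<R m}"
    proof (rule radial_test_Ico[OF p w v N])
      fix t assume t: "R m \<le> t" "t < 1"
      let ?I = "\<lambda>a b. \<integral>\<^sup>+s. ennreal (2 * s * kernel_mean \<omega> (t * s)) * indicator {a..<b} s \<partial>weight_measure \<omega>"
      \<comment> \<open>The annuli are added one by one; t lies beyond all of them, so t s is at
        least the square of R j on the j-th annulus.\<close>
      have "ennreal (real j * \<delta>) \<le> ?I r (R j)" if "j \<le> m" for j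
        using that
      proof (induction j)
        case (Suc j)
        have piece: "ennreal \<delta> \<le> ?I (R j) (R (Suc j))"
        proof -
          have k: "c0 / (A * tail \<omega> (R j)) \<le> kernel_mean \<omega> (t * s)" if s: "R j \<le> s" "s < R (Suc j)" for s
          proof -
            have s1: "s < 1" "1/2 \<le> s" using s R_lt[of "Suc j"] R_ge[of j] by auto
            have st: "s \<le> t" using s t R_mono[of "Suc j" m] Suc.prems by auto
            have ts: "0 \<le> t * s" "t * s < 1" using s1 st t mult_unit_interval[of t s] by auto
            have "R j * R j \<le> t * s" using s st R_ge[of j] by (intro mult_mono) auto
            moreover have "1 - R j * R j \<le> 2 * (1 - R j)"
              using zero_le_power2[of "1 - R j"] by (simp add: power2_eq_square algebra_simps)
            ultimately have "1 - t * s \<le> 2 * (1 - R j)" by linarith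
            then have "tail \<omega> (t * s) \<le> A * tail \<omega> (R j)" using ts R_lt[of j] R_ge[of j] by (intro A(2)) auto
            then have "c0 / (A * tail \<omega> (R j)) \<le> c0 / tail \<omega> (t * s)"
              using c0(1) A(1) T[of j] tail_pos[OF w ts] by (intro divide_left_mono mult_pos_pos) auto
            also have "\<dots> \<le> kernel_mean \<omega> (t * s)" using ts by (intro c0(2))
            finally show ?thesis .
          qed
          have "L * tail \<omega> (R (Suc j)) \<le> tail \<omega> (R j)"
            unfolding R_Suc using R_ge[of j] R_lt[of j] by (intro lo) auto
          moreover have "tail \<omega> (R j) = measure (weight_measure \<omega>) {R j..<R (Suc j)} + tail \<omega> (R (Suc j))"
            using R_ge[of j] R_lt[of "Suc j"] R_mono[of j "Suc j"] by (intro tail_diff[OF w]) auto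
          ultimately have "(1 - 1 / L) * tail \<omega> (R j) \<le> measure (weight_measure \<omega>) {R j..<R (Suc j)}"
            using L by (simp add: field_simps)
          then have "c0 / (A * tail \<omega> (R j)) * ((1 - 1 / L) * tail \<omega> (R j))
              \<le> c0 / (A * tail \<omega> (R j)) * measure (weight_measure \<omega>) {R j..<R (Suc j)}"
            using c0 A T[of j] by (intro mult_left_mono) auto
          moreover have "c0 / (A * tail \<omega> (R j)) * ((1 - 1 / L) * tail \<omega> (R j)) = \<delta>"
            using T[of j] by (simp add: \<delta>_def)
          ultimately have "ennreal \<delta> \<le> ennreal (c0 / (A * tail \<omega> (R j)) * measure (weight_measure \<omega>) {R j..<R (Suc j)})"
            by (intro ennreal_leI) simp
          also have "\<dots> \<le> ?I (R j) (R (Suc j))"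
            using R_ge[of j] R_lt[of "Suc j"] c0 A T[of j] by (intro nn_integral_Ico_ge[OF w _ _ _ k]) auto
          finally show ?thesis .
        qed
        have meas: "(\<lambda>s. ennreal (2 * s * kernel_mean \<omega> (t * s)) * indicator {a..<b} s) \<in> borel_measurable (weight_measure \<omega>)" for a b
          by (intro borel_measurable_weight_measureI) measurable
        have "ennreal (real (Suc j) * \<delta>) = ennreal (real j * \<delta>) + ennreal \<delta>"
          using \<delta> by (subst ennreal_plus[symmetric]) (auto simp: algebra_simps)
        also have "\<dots> \<le> ?I r (R j) + ?I (R j) (R (Suc j))"
          using Suc by (intro add_mono piece) auto
        also have "\<dots> = (\<integral>\<^sup>+s. ennreal (2 * s * kernel_mean \<omega> (t * s)) * indicator {r..<R j} s
              + ennreal (2 * s * kernel_mean \<omega> (t * s)) * indicator {R j..<R (Suc j)} s \<partial>weight_measure \<omega>)"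
          by (intro nn_integral_add[symmetric] meas)
        also have "\<dots> = ?I r (R (Suc j))"
          using R_mono[of 0 j] R_mono[of j "Suc j"] R0
          by (intro nn_integral_cong) (auto split: split_indicator)
        finally show ?case .
      qed simp
      then show "ennreal (real m * \<delta>) \<le> ?I r (R m)" by simp
    qed (use r R_ge[of m] R_lt[of m] \<delta> in auto)
    also have "\<dots> \<le> 2 * N powr p * tail \<nu> r"
      using tail_diff[OF v, of r "R m"] r R_mono[of 0 m] R0 R_lt[of m] Tv[of m] by (intro mult_left_mono) auto
    finally have 1: "(real m * \<delta>) powr p * tail \<nu> (R m) \<le> 2 * N powr p * tail \<nu> r"
      using tail_eq_measure[OF v, of "R m"] R_ge[of m] R_lt[of m] by simp
    \<comment> \<open>The factor 4 leaves a gain of 2 once the factor 2 of the test inequality is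
      paid.\<close>
    have "4 * (N + 1) powr p \<le> 4 powr p * (N + 1) powr p"
      using powr_mono[of 1 p "4::real"] p by (intro mult_right_mono) auto
    also have "\<dots> = (4 * (N + 1)) powr p" using N_nonneg by (subst powr_mult) auto
    also have "\<dots> \<le> (real m * \<delta>) powr p" using m p N_nonneg by (intro powr_mono2) auto
    finally have "4 * (N + 1) powr p * tail \<nu> (R m) \<le> (real m * \<delta>) powr p * tail \<nu> (R m)"
      using Tv[of m] by (intro mult_right_mono) auto
    also note 1
    also have "2 * N powr p * tail \<nu> r \<le> 2 * (N + 1) powr p * tail \<nu> r"
      using p N_nonneg Tv[of 0] R0 by (intro mult_right_mono mult_left_mono powr_mono2) auto
    finally have "(2 * (N + 1) powr p) * (2 * tail \<nu> (R m)) \<le> (2 * (N + 1) powr p) * tail \<nu> r" by simp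
    moreover have "0 < 2 * (N + 1) powr p" using N_nonneg by simp
    ultimately have "2 * tail \<nu> (R m) \<le> tail \<nu> r" by (simp only: mult_le_cancel_left_pos)
    then show ?thesis by (simp only: R_def)
  qed
  have Km: "1 \<le> K ^ m" using K by (intro one_le_power) auto
  \<comment> \<open>Radii below 1/2 are replaced by 1/2; the factor 2 in \<open>2 * K ^ m\<close>
    pays for it.\<close>
  have "lower_doubling_with (2 * K ^ m) 2 \<nu>"
    unfolding lower_doubling_with_def
  proof (intro conjI ballI)
    show "1 < 2 * K ^ m" using Km by simp
    fix r :: real assume "r \<in> {0..<1}"
    then have r: "0 \<le> r" "r < 1" by auto
    define q where "q = max r (1/2)"
    have q: "1/2 \<le> q" "q < 1" "r \<le> q" "1 - r \<le> 2 * (1 - q)" using r by (auto simp: q_def max_def)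
    have "(1 - r) / (2 * K ^ m) \<le> 2 * (1 - q) / (2 * K ^ m)" using q Km by (intro divide_right_mono) auto
    also have "\<dots> = (1 - q) / K ^ m" by (rule mult_divide_mult_cancel_left) simp
    finally have le: "1 - (1 - q) / K ^ m \<le> 1 - (1 - r) / (2 * K ^ m)" by (rule diff_left_mono)
    have "(1 - q) / K ^ m \<le> (1 - q) / 1" using q Km by (intro divide_left_mono) auto
    then have "2 * tail \<nu> (1 - (1 - r) / (2 * K ^ m)) \<le> 2 * tail \<nu> (1 - (1 - q) / K ^ m)"
      using le q r Km by (intro mult_left_mono tail_antimono[OF v]) auto
    also have "\<dots> \<le> tail \<nu> q" by (rule half[OF q(1,2)])
    also have "\<dots> \<le> tail \<nu> r" using q r by (intro tail_antimono[OF v])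
    finally show "2 * tail \<nu> (1 - (1 - r) / (2 * K ^ m)) \<le> tail \<nu> r" .
  qed simp
  then show ?thesis by blast
qed

section \<open>From upper doubling of \<nu> to upper doubling of \<omega>\<close>

text \<open>Test with s powr (n / 2) and keep only the n-th term of the kernel: the output at r is
  at least q r^n, where q is the quotient of the two moments of \<omega>. The p-th powers of input
  and output integrate to moments of \<nu> whose orders differ by a factor less than 2 when n is
  positive, so doubling of \<nu> bounds q by C N.\<close>

lemma moment_ratio:
  assumes C: "upper_doubling_with C \<nu>"
  shows "moment \<omega> (3 * real n / 2 + 1) \<le> C * N * moment \<omega> (2 * real n + 1)"
proof -
  have C1: "1 \<le> C" using C by (simp add: upper_doubling_with_def)
  define q where "q = moment \<omega> (3 * real n / 2 + 1) / moment \<omega> (2 * real n + 1)"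
  have mp: "0 < moment \<omega> (2 * real n + 1)" "0 < moment \<omega> (3 * real n / 2 + 1)" using moment_pos[OF w] by auto
  then have q: "0 < q" by (simp add: q_def)
  let ?\<mu> = "real n / 2"
  have mom: "(\<integral>\<^sup>+s. ennreal (2 * s) * ennreal (s powr a) \<partial>weight_measure \<nu>) = ennreal (2 * moment \<nu> (a + 1))" if "0 \<le> a" for a
  proof -
    have "(\<integral>\<^sup>+s. ennreal (2 * s) * ennreal (s powr a) \<partial>weight_measure \<nu>) = (\<integral>\<^sup>+s. 2 * ennreal (s powr (a + 1)) \<partial>weight_measure \<nu>)"
    proof (intro nn_integral_cong)
      fix s assume "s \<in> space (weight_measure \<nu>)"
      then have s: "0 \<le> s" by auto
      then have "2 * s * s powr a = 2 * s powr (a + 1)" by (cases "s = 0") (auto simp: powr_add)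
      then show "ennreal (2 * s) * ennreal (s powr a) = 2 * ennreal (s powr (a + 1))"
        using s by (simp add: ennreal_mult[symmetric] flip: ennreal_numeral)
    qed
    also have "\<dots> = 2 * (\<integral>\<^sup>+s. ennreal (s powr (a + 1)) \<partial>weight_measure \<nu>)"
      by (intro nn_integral_cmult borel_measurable_weight_measureI) measurable
    also have "\<dots> = ennreal (2 * moment \<nu> (a + 1))"
      using that moment_nonneg[OF v] by (simp add: moment_eq[OF v] ennreal_mult)
    finally show ?thesis .
  qed
  have pw: "(s powr ?\<mu>) powr p = s powr (p * ?\<mu>)" for s by (simp add: powr_powr mult.commute)
  have G: "(\<integral>\<^sup>+s. ennreal (2 * s) * ennreal ((s powr ?\<mu>) powr p) \<partial>weight_measure \<nu>) = ennreal (2 * moment \<nu> (p * ?\<mu> + 1))"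
    unfolding pw using p by (intro mom) auto
  have E: "{0..<1} \<in> sets (lebesgue_on {0..<1::real})" by (simp add: sets_restrict_space_iff)
  have "(\<integral>\<^sup>+r. ennreal (2 * r) * (ennreal ((q * r powr real n) powr p) * indicator {0..<1} r) \<partial>weight_measure \<nu>)
      \<le> ennreal (N powr p) * (\<integral>\<^sup>+s. ennreal (2 * s) * ennreal ((s powr ?\<mu>) powr p) \<partial>weight_measure \<nu>)"
  proof (rule radial_test[OF p w v N])
    show "(\<lambda>s. s powr ?\<mu>) \<in> borel_measurable (lebesgue_on {0..<1})"
      "(\<lambda>r. q * r powr real n) \<in> borel_measurable (lebesgue_on {0..<1})"
      by (intro borel_measurable_lebesgue_onI; measurable)+
    show "(\<integral>\<^sup>+s. ennreal (2 * s) * ennreal ((s powr ?\<mu>) powr p) \<partial>weight_measure \<nu>) < top" unfolding G by simp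
    show "{0..<1} \<in> sets (lebesgue_on {0..<1::real})" by (rule E)
    fix r :: real assume "r \<in> {0..<1}"
    then have r: "0 \<le> r" "r < 1" by auto
    show "0 \<le> q * r powr real n" using q by simp
    define b where "b = 2 * kernel_coeff \<omega> n * r powr real n"
    have b: "0 \<le> b" using kernel_coeff_pos[OF w, of n] by (simp add: b_def)
    have "q * r powr real n = b * moment \<omega> (3 * real n / 2 + 1)"
      using mp by (simp add: q_def b_def kernel_coeff_def)
    then have "ennreal (q * r powr real n) = ennreal b * (\<integral>\<^sup>+s. ennreal (s powr (3 * real n / 2 + 1)) \<partial>weight_measure \<omega>)"
      using b moment_nonneg[OF w] by (simp add: ennreal_mult moment_eq[OF w])
    also have "\<dots> = (\<integral>\<^sup>+s. ennreal b * ennreal (s powr (3 * real n / 2 + 1)) \<partial>weight_measure \<omega>)"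
      by (intro nn_integral_cmult[symmetric] borel_measurable_weight_measureI) measurable
    also have "\<dots> \<le> (\<integral>\<^sup>+s. ennreal (2 * s) * (ennreal (s powr ?\<mu>) * ennreal (kernel_mean \<omega> (r * s))) \<partial>weight_measure \<omega>)"
    proof (rule nn_integral_mono)
      fix s assume "s \<in> space (weight_measure \<omega>)"
      then have s: "0 \<le> s" "s < 1" by auto
      have rs: "0 \<le> r * s" "r * s < 1" using r s mult_unit_interval[of r s] by auto
      show "ennreal b * ennreal (s powr (3 * real n / 2 + 1))
          \<le> ennreal (2 * s) * (ennreal (s powr ?\<mu>) * ennreal (kernel_mean \<omega> (r * s)))"
      proof (cases "s = 0")
        case False
        then have s0: "0 < s" using s by simp
        have "s powr (3 * real n / 2 + 1) = s * s powr ?\<mu> * s powr real n"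
        proof -
          have "3 * real n / 2 + 1 = 1 + ?\<mu> + real n" by simp
          then show ?thesis using s0 by (simp only: powr_add powr_one)
        qed
        \<comment> \<open>Only an inequality, because 0 powr 0 is 0 while 0 ^ 0 is 1.\<close>
        moreover have "r powr real n * s powr real n \<le> (r * s) ^ n"
        proof (cases "r = 0")
          case True then show ?thesis by simp
        next
          case False
          then show ?thesis using r s0 by (simp add: powr_realpow power_mult_distrib)
        qed
        ultimately have "b * s powr (3 * real n / 2 + 1) \<le> 2 * s * s powr ?\<mu> * (kernel_coeff \<omega> n * (r * s) ^ n)"
          using kernel_coeff_pos[OF w, of n] s0
            mult_left_mono[of "r powr real n * s powr real n" "(r * s) ^ n" "2 * kernel_coeff \<omega> n * s * s powr ?\<mu>"]
          by (simp add: b_def mult_ac)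
        also have "\<dots> \<le> 2 * s * s powr ?\<mu> * kernel_mean \<omega> (r * s)"
          using s by (intro mult_left_mono kernel_mean_ge_coeff[OF w rs]) auto
        finally show ?thesis using b s kernel_mean_nonneg[of \<omega> "r * s"]
          by (simp add: ennreal_mult[symmetric] ennreal_leI mult.assoc)
      qed simp
    qed
    finally show "ennreal (q * r powr real n)
        \<le> (\<integral>\<^sup>+s. ennreal (2 * s) * (ennreal (s powr ?\<mu>) * ennreal (kernel_mean \<omega> (r * s))) \<partial>weight_measure \<omega>)" .
  qed simp
  also have "\<dots> = ennreal (N powr p * (2 * moment \<nu> (p * ?\<mu> + 1)))"
    unfolding G using moment_nonneg[OF v] by (simp add: ennreal_mult)
  also have "(\<integral>\<^sup>+r. ennreal (2 * r) * (ennreal ((q * r powr real n) powr p) * indicator {0..<1} r) \<partial>weight_measure \<nu>)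
      = (\<integral>\<^sup>+r. ennreal (q powr p) * (ennreal (2 * r) * ennreal (r powr (real n * p))) \<partial>weight_measure \<nu>)"
    using q by (intro nn_integral_cong)
      (auto simp: powr_mult powr_powr ennreal_mult mult_ac)
  also have "\<dots> = ennreal (q powr p) * (\<integral>\<^sup>+r. ennreal (2 * r) * ennreal (r powr (real n * p)) \<partial>weight_measure \<nu>)"
    by (intro nn_integral_cmult borel_measurable_weight_measureI) measurable
  also have "\<dots> = ennreal (q powr p * (2 * moment \<nu> (real n * p + 1)))"
    using p mom[of "real n * p"] moment_nonneg[OF v] by (simp add: ennreal_mult)
  finally have 1: "q powr p * moment \<nu> (real n * p + 1) \<le> N powr p * moment \<nu> (p * ?\<mu> + 1)"
    using moment_nonneg[OF v] by (subst (asm) ennreal_le_iff) auto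
  have "moment \<nu> (p * ?\<mu> + 1) \<le> C * moment \<nu> (2 * (p * ?\<mu> + 1))"
    using p by (intro upper_doubling_moment[OF v C]) (auto intro: add_nonneg_pos)
  also have "\<dots> \<le> C * moment \<nu> (real n * p + 1)"
    using C1 p by (intro mult_left_mono moment_antimono[OF v]) (auto simp: mult.commute)
  finally have "q powr p * moment \<nu> (real n * p + 1) \<le> (N powr p * C) * moment \<nu> (real n * p + 1)"
    using 1 mult_left_mono[of "moment \<nu> (p * ?\<mu> + 1)" "C * moment \<nu> (real n * p + 1)" "N powr p"] by simp
  then have "q powr p \<le> N powr p * C"
    using moment_pos[OF v, of "real n * p + 1"] p by simp
  also have "\<dots> \<le> N powr p * C powr p"
    using C1 p powr_mono[of 1 p C] by (intro mult_left_mono) auto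
  also have "\<dots> = (C * N) powr p" using C1 N_nonneg by (simp add: powr_mult)
  finally have "q powr p \<le> (C * N) powr p" .
  from powr_le_imp_le[OF p _ _ this] have "q \<le> C * N" using q C1 N_nonneg by auto
  then show ?thesis using mp by (simp add: q_def field_simps)
qed

text \<open>The moments of orders 3 n / 2 + 1 and 2 n + 1 are comparable, so the first cannot
  concentrate where the additional factor s powr (n / 2) is small. For n of order 1 / (1 - \<rho>)
  this factor is at most 1 / (2 Q) on s < \<rho>; that part is absorbed, and the moment is at most 2
  Q tail \<rho>, whereas it is at least a multiple of tail r.\<close>

lemma upper_doubling_omega:
  assumes C: "upper_doubling_with C \<nu>"
  shows "\<exists>C'. upper_doubling_with C' \<omega>"
proof -
  define Q where "Q = max 1 (C * N)"
  have Q: "1 \<le> Q" by (simp add: Q_def)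
  have mr: "moment \<omega> (3 * real n / 2 + 1) \<le> Q * moment \<omega> (2 * real n + 1)" for n
  proof -
    have "C * N * moment \<omega> (2 * real n + 1) \<le> Q * moment \<omega> (2 * real n + 1)"
      using moment_nonneg[OF w] by (intro mult_right_mono) (auto simp: Q_def)
    then show ?thesis using moment_ratio[OF C, of n] by linarith
  qed
  \<comment> \<open>With n (1 - \<rho>) \<ge> b this choice makes \<rho> powr (n / 2) at most 1 / (2
    Q).\<close>
  define b where "b = 2 * ln (2 * Q)"
  have b: "0 \<le> b" using Q by (simp add: b_def)
  show ?thesis
  \<comment> \<open>6 b + 8 is twice the bound 3 b + 4 for (3 n / 2 + 1) (1 - r), as required for
    the lower bound of the power of r.\<close>
  proof (rule tail_from_half[OF w, of "exp (6 * b + 8) * (2 * Q)"])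
    fix r :: real assume r: "1/2 \<le> r" "r < 1"
    define \<rho> where "\<rho> = (1 + r) / 2"
    have \<rho>: "1/2 \<le> \<rho>" "\<rho> < 1" "1 - r = 2 * (1 - \<rho>)" using r by (auto simp: \<rho>_def field_simps)
    have T: "0 < tail \<omega> \<rho>" using tail_pos[OF w] \<rho> by auto
    define n where "n = nat \<lceil>b / (1 - \<rho>)\<rceil>"
    have n: "b / (1 - \<rho>) \<le> real n" "real n \<le> b / (1 - \<rho>) + 1"
      using b \<rho> unfolding n_def by (auto simp: le_of_int_ceiling of_nat_nat ceiling_correct intro: less_imp_le)
    have nb: "b \<le> real n * (1 - \<rho>)" "real n * (1 - \<rho>) \<le> b + 1"
      using n \<rho> by (auto simp: field_simps)
    let ?x = "3 * real n / 2 + 1"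
    have E: "\<rho> powr (real n / 2) \<le> 1 / (2 * Q)"
    proof -
      have "\<rho> \<le> exp (- (1 - \<rho>))" using exp_ge_add_one_self[of "\<rho> - 1"] by simp
      then have "\<rho> powr (real n / 2) \<le> exp (- (1 - \<rho>)) powr (real n / 2)" using \<rho> by (intro powr_mono2) auto
      also have "\<dots> = exp (- (real n * (1 - \<rho>)) / 2)" by (simp add: exp_powr_real algebra_simps)
      also have "\<dots> \<le> exp (- ln (2 * Q))" using nb by (simp add: b_def)
      also have "\<dots> = 1 / (2 * Q)" using Q by (simp add: exp_minus inverse_eq_divide)
      finally show ?thesis .
    qed
    have "ennreal (moment \<omega> (2 * real n + 1)) = (\<integral>\<^sup>+s. ennreal (s powr (2 * real n + 1)) \<partial>weight_measure \<omega>)"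
      by (simp add: moment_eq[OF w])
    also have "\<dots> \<le> (\<integral>\<^sup>+s. indicator {\<rho>..<1} s + ennreal (1 / (2 * Q)) * ennreal (s powr ?x) \<partial>weight_measure \<omega>)"
    proof (rule nn_integral_mono)
      fix s assume "s \<in> space (weight_measure \<omega>)"
      then have s: "0 \<le> s" "s < 1" by auto
      show "ennreal (s powr (2 * real n + 1)) \<le> indicator {\<rho>..<1} s + ennreal (1 / (2 * Q)) * ennreal (s powr ?x)"
      proof (cases "\<rho> \<le> s")
        case True
        have "s powr (2 * real n + 1) \<le> 1" using s by (intro powr_le1) auto
        then have "ennreal (s powr (2 * real n + 1)) \<le> indicator {\<rho>..<1} s" using True s
          by (auto split: split_indicator)
        then show ?thesis by (rule order_trans) simp
      next
        case False
        have "s powr (2 * real n + 1) = s powr (real n / 2) * s powr ?x"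
          by (simp add: powr_add[symmetric])
        also have "\<dots> \<le> 1 / (2 * Q) * s powr ?x"
          using False s powr_mono2[of "real n / 2" s \<rho>] E by (intro mult_right_mono) auto
        finally have "ennreal (s powr (2 * real n + 1)) \<le> ennreal (1 / (2 * Q)) * ennreal (s powr ?x)"
          using Q by (simp add: ennreal_mult'[symmetric] ennreal_leI)
        then show ?thesis by (rule order_trans) simp
      qed
    qed
    also have "\<dots> = ennreal (tail \<omega> \<rho>) + ennreal (1 / (2 * Q)) * ennreal (moment \<omega> ?x)"
    proof -
      have m: "(\<lambda>s. ennreal (s powr ?x)) \<in> borel_measurable (weight_measure \<omega>)"
        by (intro borel_measurable_weight_measureI) auto
      have "(\<integral>\<^sup>+s. indicator {\<rho>..<1} s + ennreal (1 / (2 * Q)) * ennreal (s powr ?x) \<partial>weight_measure \<omega>)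
          = (\<integral>\<^sup>+s. indicator {\<rho>..<1} s \<partial>weight_measure \<omega>) + (\<integral>\<^sup>+s. ennreal (1 / (2 * Q)) * ennreal (s powr ?x) \<partial>weight_measure \<omega>)"
        using \<rho> m by (intro nn_integral_add borel_measurable_indicator Ico_sets_weight_measure borel_measurable_times_ennreal) auto
      then show ?thesis using \<rho>
        by (simp add: Ico_sets_weight_measure emeasure_weight_measure[OF w] moment_eq[OF w] nn_integral_cmult[OF m])
    qed
    also have "\<dots> = ennreal (tail \<omega> \<rho> + 1 / (2 * Q) * moment \<omega> ?x)"
      using T Q moment_nonneg[OF w] by (simp add: ennreal_mult'[symmetric])
    finally have "moment \<omega> (2 * real n + 1) \<le> tail \<omega> \<rho> + 1 / (2 * Q) * moment \<omega> ?x"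
      using T Q moment_nonneg[OF w] by (subst (asm) ennreal_le_iff) (auto intro!: add_nonneg_nonneg)
    then have "Q * moment \<omega> (2 * real n + 1) \<le> Q * (tail \<omega> \<rho> + 1 / (2 * Q) * moment \<omega> ?x)"
      using Q by (intro mult_left_mono) auto
    with mr[of n] have "moment \<omega> ?x \<le> Q * (tail \<omega> \<rho> + 1 / (2 * Q) * moment \<omega> ?x)" by linarith
    also have "\<dots> = Q * tail \<omega> \<rho> + moment \<omega> ?x / 2" using Q by (simp add: distrib_left)
    finally have m2: "moment \<omega> ?x \<le> 2 * Q * tail \<omega> \<rho>" by simp
    have "?x * (1 - r) = 3 * (real n * (1 - \<rho>)) + (1 - r)" unfolding \<rho>(3) by (simp add: field_simps)
    then have "?x * (1 - r) \<le> 3 * b + 4" using nb r by simp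
    then have "exp (- 2 * (3 * b + 4)) \<le> r powr ?x" using r by (intro power_ge_exp) auto
    then have "exp (- 2 * (3 * b + 4)) * tail \<omega> r \<le> r powr ?x * tail \<omega> r"
      using tail_pos[OF w, of r] r by (intro mult_right_mono) auto
    also have "\<dots> \<le> moment \<omega> ?x" using r by (intro moment_ge[OF w]) auto
    also note m2
    finally have "exp (6 * b + 8) * (exp (- 2 * (3 * b + 4)) * tail \<omega> r) \<le> exp (6 * b + 8) * (2 * Q * tail \<omega> \<rho>)"
      by (intro mult_left_mono) auto
    moreover have "exp (6 * b + 8) * (exp (- 2 * (3 * b + 4)) * tail \<omega> r) = tail \<omega> r"
    proof -
      have "exp (6 * b + 8) * exp (- 2 * (3 * b + 4)) = 1" by (subst exp_add[symmetric]) simp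
      then show ?thesis by (simp only: mult.assoc[symmetric] mult_1_left)
    qed
    ultimately show "tail \<omega> r \<le> exp (6 * b + 8) * (2 * Q) * tail \<omega> ((1 + r) / 2)"
      unfolding \<rho>_def[symmetric] by (simp only: mult.assoc)
  qed
qed

end

subsection \<open>The Muckenhoupt constant is controlled by the norm\<close>

text \<open>The density \<sigma>(s) / s with real division. Where \<nu> vanishes this is 0, unlike
  the value in \<open>ennreal\<close>; the two are consistent as soon as \<omega> vanishes there
  too.\<close>

definition sigma_real :: "real \<Rightarrow> (real \<Rightarrow> real) \<Rightarrow> (real \<Rightarrow> real) \<Rightarrow> real \<Rightarrow> real" where
  "sigma_real p \<omega> \<nu> s = (\<omega> s / \<nu> s powr (1 / p)) powr conj_exp p"

lemma sigma_real_nonneg: "0 \<le> sigma_real p \<omega> \<nu> s"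
  by (simp add: sigma_real_def)

lemma sigma_wt_eq:
  assumes "0 \<le> s" "0 \<le> \<omega> s" "0 \<le> \<nu> s" "\<nu> s = 0 \<longrightarrow> \<omega> s = 0"
  shows "sigma_wt p \<omega> \<nu> s = ennreal (s * sigma_real p \<omega> \<nu> s)"
proof (cases "\<nu> s = 0")
  case True
  then show ?thesis using assms by (simp add: sigma_wt_def sigma_real_def epowr_def)
next
  case False
  then have "ennreal (\<omega> s) / ennreal (\<nu> s powr (1 / p)) = ennreal (\<omega> s / \<nu> s powr (1 / p))"
    using assms by (intro divide_ennreal) auto
  then show ?thesis
    using assms by (simp add: sigma_wt_def sigma_real_def epowr_ennreal ennreal_mult)
qed

lemma sigma_real_measurable:
  assumes "radial_weight \<omega>" "radial_weight \<nu>"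
  shows "sigma_real p \<omega> \<nu> \<in> borel_measurable (lebesgue_on {0..<1})"
  unfolding sigma_real_def using assms[THEN radial_weight_measurable] by measurable

lemma tail_measurable:
  assumes w: "radial_weight \<omega>"
  shows "tail \<omega> \<in> borel_measurable (lebesgue_on {0..<1})"
proof -
  interpret finite_measure "weight_measure \<omega>" by (rule finite_weight_measure[OF w])
  have id: "(\<lambda>s. s) \<in> borel_measurable (weight_measure \<omega>)" by (intro borel_measurable_weight_measureI) simp
  note id [measurable]
  have "(\<lambda>r. \<integral>s. indicator {(r, s). r \<le> s \<and> s < 1} (r, s) \<partial>weight_measure \<omega> :: real) \<in> borel_measurable (borel :: real measure)"
    by (rule borel_measurable_lebesgue_integral) measurable
  then have m: "(\<lambda>r. \<integral>s. indicator {(r, s). r \<le> s \<and> s < 1} (r, s) \<partial>weight_measure \<omega> :: real) \<in> borel_measurable (lebesgue_on {0..<1})"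
    by (rule borel_measurable_lebesgue_onI)
  have eq: "tail \<omega> r = (\<integral>s. indicator {(r, s). r \<le> s \<and> s < 1} (r, s) \<partial>weight_measure \<omega>)" if "r \<in> {0..<1}" for r
  proof -
    have "(\<integral>s. indicator {(r, s). r \<le> s \<and> s < 1} (r, s) \<partial>weight_measure \<omega>) = (\<integral>s. indicator {r..<1} s \<partial>weight_measure \<omega> :: real)"
      by (intro Bochner_Integration.integral_cong) (auto split: split_indicator)
    then show ?thesis using that by (simp add: Ico_sets_weight_measure tail_eq_measure[OF w])
  qed
  show ?thesis by (subst measurable_cong[OF eq]) (auto simp: space_restrict_space m)
qed

lemma nn_integral_lebesgue_on:
  "(\<integral>\<^sup>+s. F s \<partial>lebesgue_on {0..<1::real}) = (\<integral>\<^sup>+s\<in>{0..<1}. F s \<partial>lebesgue)"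
  by (simp add: nn_integral_restrict_space)

lemma sets_lebesgue_on_Ico: "0 \<le> a \<Longrightarrow> b \<le> 1 \<Longrightarrow> {a..<b::real} \<in> sets (lebesgue_on {0..<1})"
  by (auto simp: sets_restrict_space_iff)

lemma sigma_tail_eq:
  assumes w: "radial_weight \<omega>" and v: "radial_weight \<nu>"
    and ae: "AE s in lebesgue_on {0..<1}. \<nu> s = 0 \<longrightarrow> \<omega> s = 0" and r: "0 \<le> r"
  shows "sigma_tail p \<omega> \<nu> r = (\<integral>\<^sup>+s. ennreal (s * sigma_real p \<omega> \<nu> s) * indicator {r..<1} s \<partial>lebesgue_on {0..<1})"
proof -
  have "sigma_tail p \<omega> \<nu> r = (\<integral>\<^sup>+s\<in>{0..<1}. (sigma_wt p \<omega> \<nu> s * indicator {r..<1} s) \<partial>lebesgue)"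
    unfolding sigma_tail_def using r by (intro nn_integral_cong) (auto split: split_indicator)
  also have "\<dots> = (\<integral>\<^sup>+s. sigma_wt p \<omega> \<nu> s * indicator {r..<1} s \<partial>lebesgue_on {0..<1})"
    by (rule nn_integral_lebesgue_on[symmetric])
  also have "\<dots> = (\<integral>\<^sup>+s. ennreal (s * sigma_real p \<omega> \<nu> s) * indicator {r..<1} s \<partial>lebesgue_on {0..<1})"
  proof (rule nn_integral_cong_AE)
    show "AE s in lebesgue_on {0..<1}. sigma_wt p \<omega> \<nu> s * indicator {r..<1} s
        = ennreal (s * sigma_real p \<omega> \<nu> s) * indicator {r..<1} s"
      using ae
    proof (rule AE_mp[OF _ AE_I2], intro impI)
      fix s assume "s \<in> space (lebesgue_on {0..<1::real})" "\<nu> s = 0 \<longrightarrow> \<omega> s = 0"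
      then show "sigma_wt p \<omega> \<nu> s * indicator {r..<1} s = ennreal (s * sigma_real p \<omega> \<nu> s) * indicator {r..<1} s"
        using radial_weight_nonneg[OF w] radial_weight_nonneg[OF v]
        by (subst sigma_wt_eq) (auto simp: space_restrict_space)
    qed
  qed
  finally show ?thesis .
qed

context
  fixes p :: real and \<omega> \<nu> :: "real \<Rightarrow> real" and N :: real
  assumes p: "1 < p" and w: "radial_weight \<omega>" and v: "radial_weight \<nu>"
    and N: "max_bergman_bounded_by p \<omega> \<nu> N"
begin

lemma twice_mass_ge: "ennreal (tail \<nu> (1/2)) \<le> (\<integral>\<^sup>+r. ennreal (2 * r) \<partial>weight_measure \<nu>)"
proof -
  have "ennreal (1 * measure (weight_measure \<nu>) {1/2..<1}) \<le> (\<integral>\<^sup>+r. ennreal (2 * r * 1) * indicator {1/2..<1} r \<partial>weight_measure \<nu>)"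
    by (rule nn_integral_Ico_ge[OF v]) auto
  also have "\<dots> \<le> (\<integral>\<^sup>+r. ennreal (2 * r) \<partial>weight_measure \<nu>)"
    by (intro nn_integral_mono) (auto split: split_indicator)
  finally show ?thesis by (simp add: tail_eq_measure[OF v])
qed

text \<open>The constant term of the kernel alone makes the output at least
  \<open>kernel_coeff \<omega> 0 * S\<close> at every radius. This serves twice: to show that
  \<omega> vanishes where \<nu> does, and to account for the summand 1 in
  \<open>M_const\<close>.\<close>

lemma radial_test_constant:
  assumes g: "g \<in> borel_measurable (lebesgue_on {0..<1})" and g0: "\<And>s. 0 \<le> s \<Longrightarrow> s < 1 \<Longrightarrow> 0 \<le> g s"
    and fin: "(\<integral>\<^sup>+s. ennreal (2 * s) * ennreal (g s powr p) \<partial>weight_measure \<nu>) < top"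
    and S: "ennreal S \<le> (\<integral>\<^sup>+s. ennreal (2 * s) * ennreal (g s) \<partial>weight_measure \<omega>)" "0 \<le> S"
  shows "ennreal ((kernel_coeff \<omega> 0 * S) powr p) * ennreal (tail \<nu> (1/2))
     \<le> ennreal (N powr p) * (\<integral>\<^sup>+s. ennreal (2 * s) * ennreal (g s powr p) \<partial>weight_measure \<nu>)"
proof -
  have k: "0 < kernel_coeff \<omega> 0" by (rule kernel_coeff_pos[OF w])
  let ?c = "kernel_coeff \<omega> 0 * S"
  have "ennreal (?c powr p) * ennreal (tail \<nu> (1/2)) \<le> ennreal (?c powr p) * (\<integral>\<^sup>+r. ennreal (2 * r) \<partial>weight_measure \<nu>)"
    by (intro mult_left_mono twice_mass_ge) auto
  also have "\<dots> = (\<integral>\<^sup>+r. ennreal (?c powr p) * ennreal (2 * r) \<partial>weight_measure \<nu>)"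
    by (intro nn_integral_cmult[symmetric] borel_measurable_weight_measureI) measurable
  also have "\<dots> = (\<integral>\<^sup>+r. ennreal (2 * r) * (ennreal (?c powr p) * indicator {0..<1} r) \<partial>weight_measure \<nu>)"
    by (intro nn_integral_cong) (auto simp: mult.commute)
  also have "\<dots> \<le> ennreal (N powr p) * (\<integral>\<^sup>+s. ennreal (2 * s) * ennreal (g s powr p) \<partial>weight_measure \<nu>)"
  proof (rule radial_test[OF p w v N g g0 fin])
    show "{0..<1} \<in> sets (lebesgue_on {0..<1::real})" by (rule sets_lebesgue_on_Ico) auto
    fix r :: real assume "r \<in> {0..<1}"
    then have r: "0 \<le> r" "r < 1" by auto
    have gm: "(\<lambda>s. ennreal (2 * s) * ennreal (g s)) \<in> borel_measurable (weight_measure \<omega>)"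
    proof (rule borel_measurable_times_ennreal)
      show "(\<lambda>s. ennreal (2 * s)) \<in> borel_measurable (weight_measure \<omega>)"
        by (intro borel_measurable_weight_measureI) measurable
      show "(\<lambda>s. ennreal (g s)) \<in> borel_measurable (weight_measure \<omega>)"
        using g unfolding measurable_weight_measure_iff by measurable
    qed
    have "ennreal ?c = ennreal (kernel_coeff \<omega> 0) * ennreal S" using k S by (simp add: ennreal_mult)
    also have "\<dots> \<le> ennreal (kernel_coeff \<omega> 0) * (\<integral>\<^sup>+s. ennreal (2 * s) * ennreal (g s) \<partial>weight_measure \<omega>)"
      using S by (intro mult_left_mono) auto
    also have "\<dots> = (\<integral>\<^sup>+s. ennreal (kernel_coeff \<omega> 0) * (ennreal (2 * s) * ennreal (g s)) \<partial>weight_measure \<omega>)"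
      by (rule nn_integral_cmult[symmetric, OF gm])
    also have "\<dots> = (\<integral>\<^sup>+s. ennreal (2 * s) * (ennreal (g s) * ennreal (kernel_coeff \<omega> 0)) \<partial>weight_measure \<omega>)"
      by (simp add: mult_ac)
    also have "\<dots> \<le> (\<integral>\<^sup>+s. ennreal (2 * s) * (ennreal (g s) * ennreal (kernel_mean \<omega> (r * s))) \<partial>weight_measure \<omega>)"
    proof (intro nn_integral_mono mult_left_mono ennreal_leI)
      fix s assume "s \<in> space (weight_measure \<omega>)"
      then show "kernel_coeff \<omega> 0 \<le> kernel_mean \<omega> (r * s)"
        using kernel_mean_ge_coeff[OF w mult_unit_interval[OF r, of s], of 0] by simp
    qed auto
    finally show "ennreal ?c \<le> (\<integral>\<^sup>+s. ennreal (2 * s) * (ennreal (g s) * ennreal (kernel_mean \<omega> (r * s))) \<partial>weight_measure \<omega>)" .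
  qed (use k S in auto)
  finally show ?thesis .
qed

text \<open>The indicator of the set where \<nu> = 0 has norm 0, yet its image is bounded below by a
  multiple of its integral against \<omega>; hence that integral is 0.\<close>

lemma AE_omega_zero: "AE s in lebesgue_on {0..<1}. \<nu> s = 0 \<longrightarrow> \<omega> s = 0"
proof -
  note m [measurable] = radial_weight_measurable[OF w] radial_weight_measurable[OF v]
  interpret finite_measure "weight_measure \<omega>" by (rule finite_weight_measure[OF w])
  define E where "E = {s \<in> space (lebesgue_on {0..<1}). \<nu> s = 0}"
  have E [measurable]: "E \<in> sets (lebesgue_on {0..<1})" unfolding E_def by measurable
  have g [measurable]: "(indicator E :: real \<Rightarrow> real) \<in> borel_measurable (lebesgue_on {0..<1})" by measurable
  have two: "(\<lambda>s. ennreal (2 * s)) \<in> borel_measurable (lebesgue_on {0..<1})"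
    by (intro borel_measurable_lebesgue_onI) measurable
  note two [measurable]
  have zero: "(\<integral>\<^sup>+s. ennreal (2 * s) * ennreal (indicator E s powr p) \<partial>weight_measure \<nu>) = 0"
  proof -
    have "(\<integral>\<^sup>+s. ennreal (2 * s) * ennreal (indicator E s powr p) \<partial>weight_measure \<nu>)
        = (\<integral>\<^sup>+s. ennreal (\<nu> s) * (ennreal (2 * s) * ennreal (indicator E s powr p)) \<partial>lebesgue_on {0..<1})"
      by (rule nn_integral_weight_measure_density[OF v]) measurable
    also have "\<dots> = (\<integral>\<^sup>+s. 0 \<partial>lebesgue_on {0..<1::real})"
      by (intro nn_integral_cong) (auto simp: E_def indicator_def)
    finally show ?thesis by simp
  qed
  let ?I = "\<integral>\<^sup>+s. ennreal (2 * s) * ennreal (indicator E s) \<partial>weight_measure \<omega>"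
  have "?I \<le> (\<integral>\<^sup>+s. 2 \<partial>weight_measure \<omega>)"
    by (intro nn_integral_mono) (auto split: split_indicator simp flip: ennreal_numeral intro!: ennreal_leI)
  also have "\<dots> < top" by (simp add: emeasure_eq_measure ennreal_mult_less_top)
  finally have "?I < top" .
  then obtain S where S: "?I = ennreal S" "0 \<le> S" by (cases ?I) auto
  have "ennreal ((kernel_coeff \<omega> 0 * S) powr p) * ennreal (tail \<nu> (1/2)) \<le> 0"
    using radial_test_constant[OF g, of S] zero S by auto
  then have "S = 0"
    using kernel_coeff_pos[OF w, of 0] tail_pos[OF v, of "1/2"] S
    by (auto simp: ennreal_eq_0_iff not_le)
  then have "(\<integral>\<^sup>+s. ennreal (\<omega> s) * (ennreal (2 * s) * ennreal (indicator E s)) \<partial>lebesgue_on {0..<1}) = 0"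
    using S by (subst nn_integral_weight_measure_density[OF w, symmetric]) auto
  then have ae: "AE s in lebesgue_on {0..<1}. ennreal (\<omega> s) * (ennreal (2 * s) * ennreal (indicator E s)) = 0"
    by (subst (asm) nn_integral_0_iff_AE) auto
  \<comment> \<open>The polar factor 2 s hides the point s = 0, which is a null set.\<close>
  have "AE s in lborel. s \<noteq> (0::real)" by (rule AE_lborel_singleton)
  then have "AE s in lebesgue_on {0..<1}. s \<noteq> (0::real)"
    by (subst AE_restrict_space_iff) (auto intro: AE_completion elim: AE_mp)
  with ae show ?thesis
  proof (rule AE_mp[OF AE_conjI, OF _ _ AE_I2], intro impI)
    fix s assume s: "s \<in> space (lebesgue_on {0..<1})" and "\<nu> s = 0"
      and *: "ennreal (\<omega> s) * (ennreal (2 * s) * ennreal (indicator E s)) = 0 \<and> s \<noteq> 0"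
    then have "s \<in> E" "0 < s" "s < 1" by (auto simp: E_def space_restrict_space)
    then show "\<omega> s = 0" using * radial_weight_nonneg[OF w, of s] by (auto simp: ennreal_eq_0_iff)
  qed
qed

text \<open>For g = (\<omega> / \<nu>) powr (1 / (p - 1)) both g \<omega> and g^p \<nu> equal the
  density \<open>sigma_real\<close>: this is the case of equality in Hoelder's inequality.\<close>

lemma sigma_identities:
  assumes "0 \<le> a" "0 < b"
  shows "(a / b) powr (1 / (p - 1)) * a = (a / b powr (1 / p)) powr conj_exp p"
    and "((a / b) powr (1 / (p - 1))) powr p * b = (a / b powr (1 / p)) powr conj_exp p"
proof -
  have e: "1 / (p - 1) + 1 = conj_exp p" "1 / (p - 1) * p = conj_exp p" "1 / p * conj_exp p = 1 / (p - 1)"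
    using p by (auto simp: conj_exp_def field_simps)
  have "(a / b powr (1 / p)) powr conj_exp p = a powr conj_exp p / b powr (1 / (p - 1))"
    using assms by (simp only: powr_divide powr_ge_zero powr_powr e)
  also have "a powr conj_exp p = a powr (1 / (p - 1)) * a"
    unfolding e(1)[symmetric] powr_add using assms by simp
  finally have 1: "(a / b powr (1 / p)) powr conj_exp p = a powr (1 / (p - 1)) * a / b powr (1 / (p - 1))" .
  then show "(a / b) powr (1 / (p - 1)) * a = (a / b powr (1 / p)) powr conj_exp p"
    using assms by (simp add: powr_divide)
  have "((a / b) powr (1 / (p - 1))) powr p * b = a powr conj_exp p / b powr conj_exp p * b"
    using assms by (simp only: powr_powr e powr_divide)
  also have "b powr conj_exp p = b powr (1 / (p - 1)) * b"
    unfolding e(1)[symmetric] powr_add using assms by simp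
  finally show "((a / b) powr (1 / (p - 1))) powr p * b = (a / b powr (1 / p)) powr conj_exp p"
    unfolding 1 using assms \<open>a powr conj_exp p = _\<close> by simp
qed

text \<open>The extremal function \<open>(\<omega> / \<nu>) powr (1 / (p - 1))\<close>, truncated to make it bounded.\<close>

lemma sigma_truncated_bound:
  fixes r :: real and n :: nat
  defines "E \<equiv> {s \<in> space (lebesgue_on {0..<1}). r \<le> s \<and> 1 / real (Suc n) < \<nu> s \<and> \<omega> s < real n}"
  assumes r: "0 \<le> r" "r < 1"
    and \<kappa>: "0 \<le> \<kappa>" "\<And>t s. 0 \<le> t \<Longrightarrow> t \<le> r \<Longrightarrow> r \<le> s \<Longrightarrow> s < 1 \<Longrightarrow> \<kappa> / tail \<omega> t \<le> kernel_mean \<omega> (t * s)"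
  obtains S where "0 \<le> S"
    and "(\<integral>\<^sup>+s. ennreal (2 * s * sigma_real p \<omega> \<nu> s) * indicator E s \<partial>lebesgue_on {0..<1}) = ennreal S"
    and "ennreal ((kernel_coeff \<omega> 0 * S) powr p) * ennreal (tail \<nu> (1/2)) \<le> ennreal (N powr p * S)"
    and "ennreal ((\<kappa> * S) powr p) * (\<integral>\<^sup>+t\<in>{0..r}. ennreal (\<nu> t / tail \<omega> t powr p * t) \<partial>lebesgue) \<le> ennreal (N powr p * S)"
proof -
  note m [measurable] = radial_weight_measurable[OF w] radial_weight_measurable[OF v] tail_measurable[OF w]
    sigma_real_measurable[OF w v]
  interpret finite_measure "weight_measure \<omega>" by (rule finite_weight_measure[OF w])
  have two [measurable]: "(\<lambda>s. ennreal (2 * s)) \<in> borel_measurable (lebesgue_on {0..<1})"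
    by (intro borel_measurable_lebesgue_onI) measurable
  have idm [measurable]: "(\<lambda>s. s) \<in> borel_measurable (lebesgue_on {0..<1::real})"
    by (intro borel_measurable_lebesgue_onI) measurable
  have E [measurable]: "E \<in> sets (lebesgue_on {0..<1})" unfolding E_def by measurable
  define g where "g s = (\<omega> s / \<nu> s) powr (1 / (p - 1)) * indicator E s" for s
  have g [measurable]: "g \<in> borel_measurable (lebesgue_on {0..<1})" unfolding g_def by measurable
  have g0: "0 \<le> g s" for s by (simp add: g_def)
  have EI: "0 \<le> s" "s < 1" "r \<le> s" "0 < \<nu> s" "0 \<le> \<omega> s" "\<omega> s \<le> real n" "1 / real (Suc n) < \<nu> s" if "s \<in> E" for s
  proof -
    have "0 < 1 / real (Suc n)" by simp
    with that have "0 < \<nu> s" unfolding E_def by (blast intro: less_trans)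
    then show "0 \<le> s" "s < 1" "r \<le> s" "0 < \<nu> s" "0 \<le> \<omega> s" "\<omega> s \<le> real n" "1 / real (Suc n) < \<nu> s"
      using that radial_weight_nonneg[OF w, of s] by (auto simp: E_def space_restrict_space simp del: of_nat_Suc)
  qed
  let ?J = "\<integral>\<^sup>+s. ennreal (2 * s * sigma_real p \<omega> \<nu> s) * indicator E s \<partial>lebesgue_on {0..<1}"
  have gw: "(\<integral>\<^sup>+s. ennreal (2 * s) * ennreal (g s) \<partial>weight_measure \<omega>) = ?J"
  proof -
    have "(\<integral>\<^sup>+s. ennreal (2 * s) * ennreal (g s) \<partial>weight_measure \<omega>)
        = (\<integral>\<^sup>+s. ennreal (\<omega> s) * (ennreal (2 * s) * ennreal (g s)) \<partial>lebesgue_on {0..<1})"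
      by (rule nn_integral_weight_measure_density[OF w]) measurable
    also have "\<dots> = ?J"
    proof (intro nn_integral_cong)
      fix s
      show "ennreal (\<omega> s) * (ennreal (2 * s) * ennreal (g s)) = ennreal (2 * s * sigma_real p \<omega> \<nu> s) * indicator E s"
      proof (cases "s \<in> E")
        case True
        note s = EI[OF this]
        have "\<omega> s * (2 * s * g s) = 2 * s * sigma_real p \<omega> \<nu> s"
          using sigma_identities(1)[OF s(5,4)] True by (simp add: g_def sigma_real_def mult_ac)
        moreover have "ennreal (\<omega> s) * (ennreal (2 * s) * ennreal (g s)) = ennreal (\<omega> s * (2 * s * g s))"
          using s g0[of s] by (simp add: ennreal_mult)
        ultimately have "ennreal (\<omega> s) * (ennreal (2 * s) * ennreal (g s)) = ennreal (2 * s * sigma_real p \<omega> \<nu> s)"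
          by (simp only:)
        then show ?thesis using True by simp
      qed (simp add: g_def)
    qed
    finally show ?thesis .
  qed
  have gv: "(\<integral>\<^sup>+s. ennreal (2 * s) * ennreal (g s powr p) \<partial>weight_measure \<nu>) = ?J"
  proof -
    have "(\<integral>\<^sup>+s. ennreal (2 * s) * ennreal (g s powr p) \<partial>weight_measure \<nu>)
        = (\<integral>\<^sup>+s. ennreal (\<nu> s) * (ennreal (2 * s) * ennreal (g s powr p)) \<partial>lebesgue_on {0..<1})"
      by (rule nn_integral_weight_measure_density[OF v]) measurable
    also have "\<dots> = ?J"
    proof (intro nn_integral_cong)
      fix s
      show "ennreal (\<nu> s) * (ennreal (2 * s) * ennreal (g s powr p)) = ennreal (2 * s * sigma_real p \<omega> \<nu> s) * indicator E s"
      proof (cases "s \<in> E")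
        case True
        note s = EI[OF this]
        have "\<nu> s * (2 * s * g s powr p) = 2 * s * sigma_real p \<omega> \<nu> s"
          using sigma_identities(2)[OF s(5,4)] True by (simp add: g_def sigma_real_def mult_ac)
        moreover have "ennreal (\<nu> s) * (ennreal (2 * s) * ennreal (g s powr p)) = ennreal (\<nu> s * (2 * s * g s powr p))"
          using s by (simp add: ennreal_mult)
        ultimately have "ennreal (\<nu> s) * (ennreal (2 * s) * ennreal (g s powr p)) = ennreal (2 * s * sigma_real p \<omega> \<nu> s)"
          by (simp only:)
        then show ?thesis using True by simp
      qed (simp add: g_def)
    qed
    finally show ?thesis .
  qed
  \<comment> \<open>On E the quotient \<omega> / \<nu> is at most n (n + 1), so g is bounded.
    Finiteness of S is the purpose of the truncation: later S is cancelled from an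
    inequality.\<close>
  have "?J < top"
  proof -
    define B where "B = (real n * real (Suc n)) powr (1 / (p - 1))"
    have gB: "g s \<le> B" for s
    proof (cases "s \<in> E")
      case True
      note s = EI[OF this]
      have "\<omega> s / \<nu> s \<le> real n / (1 / real (Suc n))" using s by (intro frac_le) (auto simp del: of_nat_Suc)
      then show ?thesis using True s p by (auto simp: g_def B_def intro!: powr_mono2)
    qed (simp add: g_def B_def)
    have "?J \<le> (\<integral>\<^sup>+s. ennreal (2 * B) \<partial>weight_measure \<omega>)"
      unfolding gw[symmetric]
    proof (intro nn_integral_mono)
      fix s assume "s \<in> space (weight_measure \<omega>)"
      then have s: "0 \<le> s" "s < 1" by auto
      have "2 * s * g s \<le> 2 * B" using s g0[of s] gB[of s] mult_mono[of s 1 "g s" B] by simp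
      then show "ennreal (2 * s) * ennreal (g s) \<le> ennreal (2 * B)"
        using s g0[of s] by (simp add: ennreal_mult[symmetric] ennreal_leI)
    qed
    also have "\<dots> < top" by (simp add: emeasure_eq_measure ennreal_mult_less_top)
    finally show ?thesis .
  qed
  then obtain S where S: "?J = ennreal S" "0 \<le> S" by (cases ?J) auto
  have fin: "(\<integral>\<^sup>+s. ennreal (2 * s) * ennreal (g s powr p) \<partial>weight_measure \<nu>) < top"
    unfolding gv S by simp
  have 1: "ennreal ((kernel_coeff \<omega> 0 * S) powr p) * ennreal (tail \<nu> (1/2)) \<le> ennreal (N powr p * S)"
    using radial_test_constant[OF g g0 fin _ S(2)] S by (simp add: gw gv ennreal_mult)
  \<comment> \<open>The test function lives beyond r and the output is examined on {0..r}, where it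
    is at least \<kappa> S / tail t. Its p-th power, integrated against \<nu>, produces the integral
    in the first factor of \<open>M_const\<close>.\<close>
  have 2: "ennreal ((\<kappa> * S) powr p) * (\<integral>\<^sup>+t\<in>{0..r}. ennreal (\<nu> t / tail \<omega> t powr p * t) \<partial>lebesgue) \<le> ennreal (N powr p * S)"
  proof -
    have E0: "{0..r} \<in> sets (lebesgue_on {0..<1})" using r by (auto simp: sets_restrict_space_iff)
    have tp: "0 < tail \<omega> t" if "t \<in> {0..r}" for t using that r by (intro tail_pos[OF w]) auto
    let ?c = "\<lambda>t. \<kappa> / tail \<omega> t * S"
    have cm [measurable]: "?c \<in> borel_measurable (lebesgue_on {0..<1})" by measurable
    have Vm: "(\<lambda>t. ennreal (\<nu> t / tail \<omega> t powr p * t) * indicator {0..r} t) \<in> borel_measurable (lebesgue_on {0..<1})"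
      using E0 by measurable
    have "(\<integral>\<^sup>+t\<in>{0..r}. ennreal (\<nu> t / tail \<omega> t powr p * t) \<partial>lebesgue)
        = (\<integral>\<^sup>+t. ennreal (\<nu> t / tail \<omega> t powr p * t) * indicator {0..r} t \<partial>lebesgue_on {0..<1})"
      unfolding nn_integral_lebesgue_on using r by (intro nn_integral_cong) (auto split: split_indicator)
    then have "ennreal ((\<kappa> * S) powr p) * (\<integral>\<^sup>+t\<in>{0..r}. ennreal (\<nu> t / tail \<omega> t powr p * t) \<partial>lebesgue)
        = (\<integral>\<^sup>+t. ennreal ((\<kappa> * S) powr p) * (ennreal (\<nu> t / tail \<omega> t powr p * t) * indicator {0..r} t) \<partial>lebesgue_on {0..<1})"
      using Vm by (simp add: nn_integral_cmult)
    also have "\<dots> \<le> (\<integral>\<^sup>+t. ennreal (\<nu> t) * (ennreal (2 * t) * (ennreal (?c t powr p) * indicator {0..r} t)) \<partial>lebesgue_on {0..<1})"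
    proof (intro nn_integral_mono)
      fix t assume "t \<in> space (lebesgue_on {0..<1::real})"
      show "ennreal ((\<kappa> * S) powr p) * (ennreal (\<nu> t / tail \<omega> t powr p * t) * indicator {0..r} t)
          \<le> ennreal (\<nu> t) * (ennreal (2 * t) * (ennreal (?c t powr p) * indicator {0..r} t))"
      proof (cases "t \<in> {0..r}")
        case True
        then have t: "0 \<le> t" "t < 1" using r by auto
        have v0: "0 \<le> \<nu> t" by (rule radial_weight_nonneg[OF v t])
        have "?c t powr p = (\<kappa> * S) powr p / tail \<omega> t powr p"
          using \<kappa>(1) S(2) tp[OF True] by (simp add: powr_divide[symmetric])
        then have "\<nu> t * (2 * t * ?c t powr p) = 2 * ((\<kappa> * S) powr p * (\<nu> t / tail \<omega> t powr p * t))"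
          by simp
        moreover have "0 \<le> (\<kappa> * S) powr p * (\<nu> t / tail \<omega> t powr p * t)" using v0 t by simp
        ultimately have "(\<kappa> * S) powr p * (\<nu> t / tail \<omega> t powr p * t) \<le> \<nu> t * (2 * t * ?c t powr p)"
          by linarith
        moreover have "ennreal ((\<kappa> * S) powr p) * ennreal (\<nu> t / tail \<omega> t powr p * t)
            = ennreal ((\<kappa> * S) powr p * (\<nu> t / tail \<omega> t powr p * t))"
          using v0 t by (intro ennreal_mult[symmetric]) auto
        moreover have "ennreal (\<nu> t) * (ennreal (2 * t) * ennreal (?c t powr p)) = ennreal (\<nu> t * (2 * t * ?c t powr p))"
          using v0 t by (subst ennreal_mult[symmetric], simp, simp)+ simp
        ultimately show ?thesis using True by (simp add: ennreal_leI)
      qed simp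
    qed
    also have "\<dots> = (\<integral>\<^sup>+t. ennreal (2 * t) * (ennreal (?c t powr p) * indicator {0..r} t) \<partial>weight_measure \<nu>)"
      by (intro nn_integral_weight_measure_density[OF v, symmetric])
        (use E0 in measurable)
    also have "\<dots> \<le> ennreal (N powr p) * (\<integral>\<^sup>+s. ennreal (2 * s) * ennreal (g s powr p) \<partial>weight_measure \<nu>)"
    proof (rule radial_test[OF p w v N g g0 fin cm _ E0])
      fix t assume t: "t \<in> {0..r}"
      show "0 \<le> ?c t" using \<kappa>(1) S(2) tp[OF t] by simp
      have "ennreal (?c t) = ennreal (\<kappa> / tail \<omega> t) * (\<integral>\<^sup>+s. ennreal (2 * s) * ennreal (g s) \<partial>weight_measure \<omega>)"
        unfolding gw S using \<kappa>(1) S(2) tp[OF t] by (intro ennreal_mult) auto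
      also have "\<dots> = (\<integral>\<^sup>+s. ennreal (\<kappa> / tail \<omega> t) * (ennreal (2 * s) * ennreal (g s)) \<partial>weight_measure \<omega>)"
        by (intro nn_integral_cmult[symmetric], unfold measurable_weight_measure_iff) measurable
      also have "\<dots> \<le> (\<integral>\<^sup>+s. ennreal (2 * s) * (ennreal (g s) * ennreal (kernel_mean \<omega> (t * s))) \<partial>weight_measure \<omega>)"
      proof (intro nn_integral_mono)
        fix s
        show "ennreal (\<kappa> / tail \<omega> t) * (ennreal (2 * s) * ennreal (g s))
            \<le> ennreal (2 * s) * (ennreal (g s) * ennreal (kernel_mean \<omega> (t * s)))"
        proof (cases "s \<in> E")
          case True
          note s = EI[OF this]
          have "ennreal (\<kappa> / tail \<omega> t) \<le> ennreal (kernel_mean \<omega> (t * s))"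
            using t s by (intro ennreal_leI \<kappa>(2)) auto
          then have "ennreal (2 * s) * ennreal (g s) * ennreal (\<kappa> / tail \<omega> t) \<le> ennreal (2 * s) * ennreal (g s) * ennreal (kernel_mean \<omega> (t * s))"
            by (intro mult_left_mono) auto
          then show ?thesis by (simp only: mult_ac)
        qed (simp add: g_def)
      qed
      finally show "ennreal (?c t) \<le> (\<integral>\<^sup>+s. ennreal (2 * s) * (ennreal (g s) * ennreal (kernel_mean \<omega> (t * s))) \<partial>weight_measure \<omega>)" .
    qed
    also have "\<dots> = ennreal (N powr p * S)" unfolding gv S using S(2) by (simp add: ennreal_mult)
    finally show ?thesis .
  qed
  show thesis by (rule that[OF S(2,1) 1 2])
qed

end

text \<open>Let S be a truncated \<sigma>-integral beyond r and V the integral over {0..r}. Testing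
  bounds both S^p V and S^p by multiples of N^p S, the second because of the summand 1. Adding and
  dividing by S bounds S independently of the truncation, which monotone convergence then
  removes.\<close>

lemma M_const_le_norm:
  assumes p: "1 < p"
  shows "\<exists>c>0. \<forall>\<omega> \<nu> N. radial_weight \<omega> \<longrightarrow> radial_weight \<nu> \<longrightarrow> upper_doubling_with C \<omega> \<longrightarrow> upper_doubling_with C' \<nu> \<longrightarrow>
     tail \<omega> 0 = m \<longrightarrow> tail \<nu> 0 = m' \<longrightarrow> max_bergman_bounded_by p \<omega> \<nu> N \<longrightarrow> M_const p \<omega> \<nu> \<le> ennreal (c * N)"
proof -
  obtain c0 where c0: "0 < c0" "\<And>\<omega> x. radial_weight \<omega> \<Longrightarrow> upper_doubling_with C \<omega> \<Longrightarrow> 0 \<le> x \<Longrightarrow> x < 1 \<Longrightarrow> c0 / tail \<omega> x \<le> kernel_mean \<omega> x"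
    using kernel_mean_lower[of C] by blast
  obtain A where A: "1 \<le> A" "\<And>\<omega> r t. radial_weight \<omega> \<Longrightarrow> upper_doubling_with C \<omega> \<Longrightarrow> 0 \<le> r \<Longrightarrow> r < 1 \<Longrightarrow> 0 \<le> t \<Longrightarrow> t < 1 \<Longrightarrow>
      1 - r \<le> 2 * (1 - t) \<Longrightarrow> tail \<omega> r \<le> A * tail \<omega> t"
    using upper_doubling_ratio[of C 2] by blast
  define \<kappa> where "\<kappa> = c0 / A"
  have \<kappa>: "0 < \<kappa>" using c0 A by (simp add: \<kappa>_def)
  \<comment> \<open>k and d are lower bounds for the constant coefficient of the kernel and for the
    \<nu>-tail at 1/2. Through them the masses m and m' enter the constant.\<close>
  define k where "k = 1 / (2 * m)"
  define d where "d = m' / C'"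
  define c1 where "c1 = 1 / \<kappa> powr p + 1 / (k powr p * d)"
  show ?thesis
  \<comment> \<open>The summand 1 makes the constant positive whatever the data are.\<close>
  proof (intro exI[of _ "1 + c1 powr (1 / p)"] conjI allI impI)
    show "0 < 1 + c1 powr (1 / p)" by (intro add_pos_nonneg) auto
    fix \<omega> \<nu> N
    assume w: "radial_weight \<omega>" and v: "radial_weight \<nu>" and C: "upper_doubling_with C \<omega>" and C': "upper_doubling_with C' \<nu>"
      and m: "tail \<omega> 0 = m" and m': "tail \<nu> 0 = m'" and N: "max_bergman_bounded_by p \<omega> \<nu> N"
    have N0: "0 \<le> N" using N by (simp add: max_bergman_bounded_by_def)
    have m0: "0 < m" "0 < m'" using tail_pos[OF w, of 0] tail_pos[OF v, of 0] m m' by auto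
    have C1: "1 \<le> C'" using C' by (simp add: upper_doubling_with_def)
    have kd: "0 < k" "0 < d" using m0 C1 by (auto simp: k_def d_def)
    have kk: "k \<le> kernel_coeff \<omega> 0"
      unfolding k_def kernel_coeff_def using m0 moment_le_tail_0[OF w, of 1] moment_pos[OF w, of 1] m
      by (intro divide_left_mono) auto
    have dd: "d \<le> tail \<nu> (1/2)"
    proof -
      have "m' \<le> C' * tail \<nu> (1/2)"
        using C' bspec[of "{0..<1}" "\<lambda>r. tail \<nu> r \<le> C' * tail \<nu> ((1 + r) / 2)" 0] m'
        by (simp add: upper_doubling_with_def)
      then show ?thesis using C1 by (simp add: d_def field_simps)
    qed
    have c1: "0 < c1" using \<kappa> kd by (auto simp: c1_def intro: add_pos_pos)
    \<comment> \<open>For t \<le> s the product t s lies within 2 (1 - t) of 1, so doubling replaces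
      tail (t s) by tail t.\<close>
    have kmean: "\<kappa> / tail \<omega> t \<le> kernel_mean \<omega> (t * s)" if "0 \<le> t" "t \<le> s" "s < 1" for t s
    proof -
      have ts: "0 \<le> t * s" "t * s < 1" using that mult_unit_interval[of t s] by auto
      have "t * t \<le> t * s" using that by (intro mult_left_mono) auto
      moreover have "1 - t * t \<le> 2 * (1 - t)"
        using zero_le_power2[of "1 - t"] by (simp add: power2_eq_square algebra_simps)
      ultimately have "tail \<omega> (t * s) \<le> A * tail \<omega> t" using ts that by (intro A(2) w C) auto
      then have "c0 / (A * tail \<omega> t) \<le> c0 / tail \<omega> (t * s)"
        using c0(1) A(1) tail_pos[OF w ts] tail_pos[OF w, of t] that by (intro divide_left_mono mult_pos_pos) auto
      also have "\<dots> \<le> kernel_mean \<omega> (t * s)" using ts by (intro c0(2) w C)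
      finally show ?thesis by (simp add: \<kappa>_def)
    qed
    have "epowr ((\<integral>\<^sup>+s\<in>{0..r}. ennreal (\<nu> s / tail \<omega> s powr p * s) \<partial>lebesgue) + 1) (1 / p)
        * epowr (sigma_tail p \<omega> \<nu> r) (1 / conj_exp p) \<le> ennreal ((1 + c1 powr (1 / p)) * N)"
      if "r \<in> {0<..<1}" for r
    proof -
      have r: "0 \<le> r" "r < 1" using that by auto
      let ?V = "\<integral>\<^sup>+s\<in>{0..r}. ennreal (\<nu> s / tail \<omega> s powr p * s) \<partial>lebesgue"
      let ?L = "lebesgue_on {0..<1::real}"
      note meas [measurable] = radial_weight_measurable[OF w] radial_weight_measurable[OF v]
        sigma_real_measurable[OF w v]
      have idm [measurable]: "(\<lambda>s. s) \<in> borel_measurable ?L"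
        by (intro borel_measurable_lebesgue_onI) measurable
      have Tr: "0 < tail \<omega> r" by (rule tail_pos[OF w r])
      have "?V \<le> (\<integral>\<^sup>+s. ennreal (\<nu> s) * ennreal (1 / tail \<omega> r powr p) \<partial>?L)"
        unfolding nn_integral_lebesgue_on
      proof (intro nn_integral_mono)
        fix s
        show "ennreal (\<nu> s / tail \<omega> s powr p * s) * indicator {0..r} s
            \<le> ennreal (\<nu> s) * ennreal (1 / tail \<omega> r powr p) * indicator {0..<1} s"
        proof (cases "s \<in> {0..r}")
          case True
          then have s: "0 \<le> s" "s < 1" "s \<le> r" using r by auto
          have v0: "0 \<le> \<nu> s" by (rule radial_weight_nonneg[OF v s(1,2)])
          have "tail \<omega> r powr p \<le> tail \<omega> s powr p"
            using p Tr tail_antimono[OF w s(1,3) r(2)] by (intro powr_mono2) auto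
          then have "\<nu> s / tail \<omega> s powr p * s \<le> \<nu> s / tail \<omega> r powr p * 1"
            using v0 s Tr tail_pos[OF w s(1,2)] by (intro mult_mono divide_left_mono mult_pos_pos) auto
          then show ?thesis using True s v0 by (simp add: ennreal_mult[symmetric] ennreal_leI)
        qed simp
      qed
      also have "\<dots> = ennreal (1 / tail \<omega> r powr p) * (\<integral>\<^sup>+s. 1 \<partial>weight_measure \<nu>)"
      proof -
        have "(\<lambda>s. ennreal (\<nu> s)) \<in> borel_measurable ?L" by measurable
        then show ?thesis
          by (subst nn_integral_weight_measure_density[OF v]) (simp_all add: nn_integral_multc mult.commute)
      qed
      also have "\<dots> < top"
        using emeasure_weight_measure[OF v, of 0] by (simp add: ennreal_mult_less_top)
      finally have "?V < top" .
      then obtain V where V: "?V = ennreal V" "0 \<le> V" by (cases ?V) auto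
      \<comment> \<open>Y solves S^(p - 1) (V + 1) = c1 N^p for S.\<close>
      define Y where "Y = (c1 * N powr p / (V + 1)) powr (1 / (p - 1))"
      have Y0: "0 \<le> Y" by (simp add: Y_def)
      let ?E = "\<lambda>n. {s \<in> space ?L. r \<le> s \<and> 1 / real (Suc n) < \<nu> s \<and> \<omega> s < real n}"
      let ?f = "\<lambda>n s. ennreal (2 * s * sigma_real p \<omega> \<nu> s) * indicator (?E n) s"
      have fY: "(\<integral>\<^sup>+s. ?f n s \<partial>?L) \<le> ennreal Y" for n
      proof -
        obtain S where S: "0 \<le> S" "(\<integral>\<^sup>+s. ?f n s \<partial>?L) = ennreal S"
          and S1: "ennreal ((kernel_coeff \<omega> 0 * S) powr p) * ennreal (tail \<nu> (1/2)) \<le> ennreal (N powr p * S)"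
          and S2: "ennreal ((\<kappa> * S) powr p) * ?V \<le> ennreal (N powr p * S)"
          using sigma_truncated_bound[OF p w v N r less_imp_le[OF \<kappa>] kmean, of n] by auto
        have tv: "0 < tail \<nu> (1/2)" using tail_pos[OF v] by simp
        have "(kernel_coeff \<omega> 0 * S) powr p * tail \<nu> (1/2) \<le> N powr p * S"
          using S1 S(1) tv by (simp add: ennreal_mult[symmetric] ennreal_le_iff)
        moreover have "(k * S) powr p * d \<le> (kernel_coeff \<omega> 0 * S) powr p * tail \<nu> (1/2)"
          using kk kd dd S(1) p by (intro mult_mono powr_mono2 mult_right_mono) auto
        ultimately have a: "k powr p * d * S powr p \<le> N powr p * S"
          using kd S(1) by (simp add: powr_mult mult_ac)
        have b: "\<kappa> powr p * V * S powr p \<le> N powr p * S"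
          using S2 S(1) V \<kappa> by (simp add: ennreal_mult[symmetric] ennreal_le_iff powr_mult mult_ac)
        have "S powr p * (V + 1) \<le> c1 * (N powr p * S)"
        proof -
          have "S powr p \<le> 1 / (k powr p * d) * (N powr p * S)" using a kd by (simp add: field_simps)
          moreover have "V * S powr p \<le> 1 / \<kappa> powr p * (N powr p * S)" using b \<kappa> by (simp add: field_simps)
          ultimately show ?thesis by (simp add: c1_def algebra_simps)
        qed
        have "S \<le> Y"
        proof (cases "S = 0")
          case False
          then have Sp: "0 < S" using S by simp
          have "S powr p = S powr (p - 1) * S" using Sp powr_add[of S "p - 1" 1] by simp
          with \<open>S powr p * (V + 1) \<le> _\<close> have "S powr (p - 1) * (V + 1) * S \<le> (c1 * N powr p) * S"
            by (simp add: mult_ac)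
          then have "S powr (p - 1) * (V + 1) \<le> c1 * N powr p" using Sp by simp
          then have "S powr (p - 1) \<le> c1 * N powr p / (V + 1)" using V by (simp add: field_simps)
          then have "(S powr (p - 1)) powr (1 / (p - 1)) \<le> Y" unfolding Y_def using p by (intro powr_mono2) auto
          then show ?thesis using p Sp by (simp add: powr_powr)
        qed (simp add: Y0)
        then show ?thesis using S by (simp add: ennreal_leI)
      qed
      have Em: "?E n \<in> sets ?L" for n by measurable
      have fm: "?f n \<in> borel_measurable ?L" for n using Em[of n] by measurable
      have inc: "incseq ?f"
      proof (rule incseq_SucI, rule le_funI)
        fix n s
        have "1 / real (Suc (Suc n)) \<le> 1 / real (Suc n)" by (intro divide_left_mono) auto
        then have "s \<in> ?E n \<Longrightarrow> s \<in> ?E (Suc n)" by auto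
        then show "?f n s \<le> ?f (Suc n) s" by (auto split: split_indicator)
      qed
      have "sigma_tail p \<omega> \<nu> r = (\<integral>\<^sup>+s. ennreal (s * sigma_real p \<omega> \<nu> s) * indicator {r..<1} s \<partial>?L)"
        by (rule sigma_tail_eq[OF w v AE_omega_zero[OF p w v N] r(1)])
      \<comment> \<open>Each s \<ge> r with \<nu> s > 0 belongs to some truncation set; where \<nu>
        s = 0, the density is 0 as well.\<close>
      also have "\<dots> \<le> (\<integral>\<^sup>+s. (SUP n. ?f n s) \<partial>?L)"
      proof (rule nn_integral_mono_AE)
        show "AE s in ?L. ennreal (s * sigma_real p \<omega> \<nu> s) * indicator {r..<1} s \<le> (SUP n. ?f n s)"
          using AE_omega_zero[OF p w v N]
        proof (rule AE_mp[OF _ AE_I2], intro impI)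
          fix s assume s: "s \<in> space ?L" and z: "\<nu> s = 0 \<longrightarrow> \<omega> s = 0"
          then have s01: "0 \<le> s" "s < 1" by (auto simp: space_restrict_space)
          show "ennreal (s * sigma_real p \<omega> \<nu> s) * indicator {r..<1} s \<le> (SUP n. ?f n s)"
          proof (cases "\<nu> s = 0 \<or> s < r")
            case True
            then show ?thesis using z by (auto simp: sigma_real_def)
          next
            case False
            then have vp: "0 < \<nu> s" using radial_weight_nonneg[OF v s01] by auto
            obtain i where i: "1 / real (Suc i) < \<nu> s" using nat_approx_posE[OF vp] by blast
            obtain j where j: "\<omega> s < real j" using reals_Archimedean2 by blast
            have "1 / real (Suc (max i j)) \<le> 1 / real (Suc i)" by (intro divide_left_mono) auto
            then have "s \<in> ?E (max i j)" using i j s False by auto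
            then have "ennreal (s * sigma_real p \<omega> \<nu> s) * indicator {r..<1} s \<le> ?f (max i j) s"
              using s01 sigma_real_nonneg[of p \<omega> \<nu> s] by (auto intro!: ennreal_leI mult_right_mono split: split_indicator)
            also have "\<dots> \<le> (SUP n. ?f n s)" by (rule SUP_upper) simp
            finally show ?thesis .
          qed
        qed
      qed
      also have "\<dots> = (SUP n. \<integral>\<^sup>+s. ?f n s \<partial>?L)"
        by (rule nn_integral_monotone_convergence_SUP[OF inc fm])
      also have "\<dots> \<le> ennreal Y" by (intro SUP_least fY)
      finally have sY: "sigma_tail p \<omega> \<nu> r \<le> ennreal Y" .
      have e: "1 / (p - 1) * (1 / conj_exp p) = 1 / p" using p by (simp add: conj_exp_def field_simps)
      have "epowr (sigma_tail p \<omega> \<nu> r) (1 / conj_exp p) \<le> epowr (ennreal Y) (1 / conj_exp p)"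
        using sY conj_exp_pos[OF p] by (intro epowr_mono) auto
      also have "\<dots> = ennreal ((c1 * N powr p / (V + 1)) powr (1 / p))"
        unfolding epowr_ennreal[OF Y0] unfolding Y_def powr_powr e ..
      finally have s: "epowr (sigma_tail p \<omega> \<nu> r) (1 / conj_exp p) \<le> ennreal ((c1 * N powr p / (V + 1)) powr (1 / p))" .
      have "?V + 1 = ennreal (V + 1)" using V by simp
      then have "epowr (?V + 1) (1 / p) = ennreal ((V + 1) powr (1 / p))" using V by (simp only: epowr_ennreal)
      then have "epowr (?V + 1) (1 / p) * epowr (sigma_tail p \<omega> \<nu> r) (1 / conj_exp p)
          \<le> ennreal ((V + 1) powr (1 / p)) * ennreal ((c1 * N powr p / (V + 1)) powr (1 / p))"
        using s by (simp add: mult_left_mono)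
      also have "\<dots> = ennreal (((V + 1) * (c1 * N powr p / (V + 1))) powr (1 / p))"
        using V c1 by (simp add: ennreal_mult[symmetric] powr_mult[symmetric])
      also have "((V + 1) * (c1 * N powr p / (V + 1))) powr (1 / p) = c1 powr (1 / p) * N"
        using V c1 p N0 by (simp add: powr_mult powr_powr)
      also have "ennreal (c1 powr (1 / p) * N) \<le> ennreal ((1 + c1 powr (1 / p)) * N)"
        using N0 by (intro ennreal_leI mult_right_mono) auto
      finally show ?thesis .
    qed
    then show "M_const p \<omega> \<nu> \<le> ennreal ((1 + c1 powr (1 / p)) * N)"
      unfolding M_const_def by (rule SUP_least)
  qed
qed

subsection \<open>Tools for the Schur test\<close>

lemma epowr_0 [simp]: "epowr 0 a = 0"
  by (simp add: epowr_def)

text \<open>Young's inequality for a / X^(1/p) and b / Y^(1/p'), where X is the integral of a^p and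
  Y any positive bound for that of b^p'. An infinite X leaves nothing to show, and X = 0 makes a b
  vanish almost everywhere.\<close>

lemma Hoelder_epowr:
  fixes a b :: "'a \<Rightarrow> real"
  assumes p: "1 < p" and [measurable]: "a \<in> borel_measurable M" "b \<in> borel_measurable M"
    and a0: "\<And>x. x \<in> space M \<Longrightarrow> 0 \<le> a x" and b0: "\<And>x. x \<in> space M \<Longrightarrow> 0 \<le> b x"
    and Y: "0 < Y" "(\<integral>\<^sup>+x. ennreal (b x powr conj_exp p) \<partial>M) \<le> ennreal Y"
  shows "epowr (\<integral>\<^sup>+x. ennreal (a x * b x) \<partial>M) p \<le> ennreal (Y powr (p - 1)) * (\<integral>\<^sup>+x. ennreal (a x powr p) \<partial>M)"
proof -
  let ?q = "conj_exp p"
  let ?I = "\<integral>\<^sup>+x. ennreal (a x powr p) \<partial>M"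
  have q: "1 < ?q" "1 / p + 1 / ?q = 1" "p * (1 / ?q) = p - 1" using p by (auto simp: conj_exp_def field_simps)
  consider "?I = top" | "?I = 0" | X where "?I = ennreal X" "0 < X"
    by (cases ?I) (auto simp: less_le)
  then show ?thesis
  proof cases
    case 1
    then show ?thesis using Y by (simp add: ennreal_mult_top)
  next
    case 2
    then have "AE x in M. ennreal (a x powr p) = 0" by (subst (asm) nn_integral_0_iff_AE) auto
    then have "AE x in M. ennreal (a x * b x) = 0" by eventually_elim (auto simp: ennreal_eq_0_iff)
    then have "(\<integral>\<^sup>+x. ennreal (a x * b x) \<partial>M) = 0" by (subst nn_integral_0_iff_AE) auto
    then show ?thesis by simp
  next
    case (3 X)
    define \<alpha> \<beta> where "\<alpha> = X powr (1 / p)" and "\<beta> = Y powr (1 / ?q)"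
    have \<alpha>\<beta>: "0 < \<alpha>" "0 < \<beta>" "\<alpha> powr p = X" "\<beta> powr ?q = Y"
      using 3 Y p q by (auto simp: \<alpha>_def \<beta>_def powr_powr)
    have point: "a x * b x \<le> \<alpha> * \<beta> * (a x powr p / (p * X) + b x powr ?q / (?q * Y))" if "x \<in> space M" for x
    proof -
      have "(a x / \<alpha>) * (b x / \<beta>) \<le> (a x / \<alpha>) powr p / p + (b x / \<beta>) powr ?q / ?q"
        using p q a0[OF that] b0[OF that] \<alpha>\<beta> by (intro Youngs_inequality) auto
      also have "\<dots> = a x powr p / (p * X) + b x powr ?q / (?q * Y)"
        using a0[OF that] b0[OF that] \<alpha>\<beta> by (simp add: powr_divide mult.commute)
      finally have "a x * b x / (\<alpha> * \<beta>) \<le> a x powr p / (p * X) + b x powr ?q / (?q * Y)" by simp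
      then show ?thesis using \<alpha>\<beta> by (subst (asm) pos_divide_le_eq) (auto simp: mult_ac)
    qed
    have "(\<integral>\<^sup>+x. ennreal (a x * b x) \<partial>M)
        \<le> (\<integral>\<^sup>+x. ennreal (\<alpha> * \<beta> / (p * X)) * ennreal (a x powr p) + ennreal (\<alpha> * \<beta> / (?q * Y)) * ennreal (b x powr ?q) \<partial>M)"
    proof (rule nn_integral_mono)
      fix x assume "x \<in> space M"
      from point[OF this] have "ennreal (a x * b x) \<le> ennreal (\<alpha> * \<beta> / (p * X) * a x powr p + \<alpha> * \<beta> / (?q * Y) * b x powr ?q)"
        by (intro ennreal_leI) (simp add: distrib_left)
      also have "\<dots> = ennreal (\<alpha> * \<beta> / (p * X)) * ennreal (a x powr p) + ennreal (\<alpha> * \<beta> / (?q * Y)) * ennreal (b x powr ?q)"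
      proof -
        have *: "ennreal (c * u + d * v) = ennreal c * ennreal u + ennreal d * ennreal v"
          if "0 \<le> c" "0 \<le> d" "0 \<le> u" "0 \<le> v" for c d u v :: real
          using that by (simp add: ennreal_mult)
        show ?thesis by (rule *) (use \<alpha>\<beta>(1,2) 3 Y p q in auto)
      qed
      finally show "ennreal (a x * b x) \<le> \<dots>" .
    qed
    also have "\<dots> = ennreal (\<alpha> * \<beta> / (p * X)) * ?I + ennreal (\<alpha> * \<beta> / (?q * Y)) * (\<integral>\<^sup>+x. ennreal (b x powr ?q) \<partial>M)"
      by (subst nn_integral_add) (auto simp: nn_integral_cmult)
    also have "\<dots> \<le> ennreal (\<alpha> * \<beta> / (p * X)) * ennreal X + ennreal (\<alpha> * \<beta> / (?q * Y)) * ennreal Y"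
      using 3 Y by (intro add_mono mult_left_mono) auto
    also have "\<dots> = ennreal (\<alpha> * \<beta> / (p * X) * X + \<alpha> * \<beta> / (?q * Y) * Y)"
      using \<alpha>\<beta> 3 Y p q by (subst ennreal_plus) (auto simp: ennreal_mult[symmetric])
    also have "\<alpha> * \<beta> / (p * X) * X + \<alpha> * \<beta> / (?q * Y) * Y = \<alpha> * \<beta> * (1 / p + 1 / ?q)"
      using 3 Y by (simp add: distrib_left)
    also have "\<dots> = \<alpha> * \<beta>" using q by simp
    finally have "epowr (\<integral>\<^sup>+x. ennreal (a x * b x) \<partial>M) p \<le> epowr (ennreal (\<alpha> * \<beta>)) p"
      using p by (intro epowr_mono) auto
    also have "\<dots> = ennreal ((\<alpha> * \<beta>) powr p)" using \<alpha>\<beta> by (simp add: epowr_ennreal)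
    also have "(\<alpha> * \<beta>) powr p = X * Y powr (p - 1)"
    proof -
      have "\<beta> powr p = Y powr (p - 1)"
        unfolding \<beta>_def powr_powr using q(3) by (simp add: mult.commute)
      then show ?thesis using \<alpha>\<beta> by (simp add: powr_mult)
    qed
    also have "ennreal (X * Y powr (p - 1)) = ennreal (Y powr (p - 1)) * ?I"
      using 3 by (simp add: ennreal_mult mult.commute)
    finally show ?thesis .
  qed
qed

section \<open>Integrals of powers of tails\<close>

text \<open>\<open>2 powr a\<close> times the sum of the geometric series of ratio
  \<open>2 powr (a - 1)\<close>, one term for each dyadic layer.\<close>

definition layer_const :: "real \<Rightarrow> real" where
  "layer_const a = 2 powr a / (1 - 2 powr (a - 1))"

lemma layer_const_pos: "0 < a \<Longrightarrow> a < 1 \<Longrightarrow> 0 < layer_const a"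
  using powr_less_mono[of "a - 1" 0 2] by (auto simp: layer_const_def)

text \<open>This replaces the substitution v = F(x). On the layer F0 / 2^(j+1) < F \<le> F0 / 2^j
  the integrand is at most its value at the lower end, and the layer has measure at most the upper
  end; the resulting series is geometric because a < 1.\<close>

lemma nn_integral_layer_power:
  fixes F :: "'a \<Rightarrow> real"
  assumes a: "0 < a" "a < 1" and F0: "0 < F0" and X: "X \<subseteq> space M"
    and F: "\<And>x. x \<in> X \<Longrightarrow> 0 \<le> F x \<and> F x \<le> F0"
    and lev: "\<And>v. 0 < v \<Longrightarrow> {x \<in> X. F x \<le> v} \<in> sets M \<and> emeasure M {x \<in> X. F x \<le> v} \<le> ennreal v"
  shows "(\<integral>\<^sup>+x. ennreal (F x powr (- a)) * indicator X x \<partial>M) \<le> ennreal (layer_const a * F0 powr (1 - a))"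
proof -
  define t where "t j = F0 / 2 ^ j" for j :: nat
  have t: "0 < t j" for j using F0 by (simp add: t_def)
  let ?U = "\<lambda>j. {x \<in> X. F x \<le> t j}"
  have U: "?U j \<in> sets M" "emeasure M (?U j) \<le> ennreal (t j)" for j using lev[OF t] by auto
  have single: "g j \<le> (\<Sum>j. g j)" for g :: "nat \<Rightarrow> ennreal" and j
    using sum_le_suminf[of g "{j}"] by simp
  have "(\<integral>\<^sup>+x. ennreal (F x powr (- a)) * indicator X x \<partial>M)
      \<le> (\<integral>\<^sup>+x. (\<Sum>j. ennreal (t (Suc j) powr (- a)) * indicator (?U j) x) \<partial>M)"
  proof (rule nn_integral_mono)
    fix x
    show "ennreal (F x powr (- a)) * indicator X x \<le> (\<Sum>j. ennreal (t (Suc j) powr (- a)) * indicator (?U j) x)"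
    proof (cases "x \<in> X \<and> 0 < F x")
      \<comment> \<open>Outside X the indicator vanishes; where F x = 0 the integrand vanishes too,
        because 0 powr (- a) = 0.\<close>
      case False
      then have "ennreal (F x powr (- a)) * indicator X x = 0" using F[of x] by (auto split: split_indicator)
      then show ?thesis by (simp only: zero_le)
    next
      case True
      then have x: "x \<in> X" "0 < F x" "F x \<le> F0" using F by auto
      have "\<exists>j. t (Suc j) < F x"
      proof -
        obtain n where "F0 / F x < 2 ^ n" using real_arch_pow[of 2 "F0 / F x"] by auto
        also have "(2::real) ^ n \<le> 2 ^ Suc n" by simp
        finally show ?thesis using x by (intro exI[of _ n]) (simp add: t_def field_simps)
      qed
      then obtain j where j: "t (Suc j) < F x" and min: "\<And>i. i < j \<Longrightarrow> \<not> t (Suc i) < F x"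
        using exists_least_iff[of "\<lambda>j. t (Suc j) < F x"] by blast
      have "F x \<le> t j"
      proof (cases j)
        case 0 then show ?thesis using x by (simp add: t_def)
      next
        case (Suc i) then show ?thesis using min[of i] by simp
      qed
      then have "x \<in> ?U j" using x by simp
      moreover have "F x powr (- a) \<le> t (Suc j) powr (- a)"
        using a j t[of "Suc j"] by (intro powr_mono2') auto
      ultimately have "ennreal (F x powr (- a)) * indicator X x \<le> ennreal (t (Suc j) powr (- a)) * indicator (?U j) x"
        using x by (simp add: ennreal_leI)
      also have "\<dots> \<le> (\<Sum>j. ennreal (t (Suc j) powr (- a)) * indicator (?U j) x)"
        by (rule single)
      finally show ?thesis .
    qed
  qed
  also have "\<dots> = (\<Sum>j. ennreal (t (Suc j) powr (- a)) * emeasure M (?U j))"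
    using U by (subst nn_integral_suminf) (auto simp: nn_integral_cmult_indicator)
  also have "\<dots> \<le> (\<Sum>j. ennreal (2 powr a * F0 powr (1 - a) * (2 powr (a - 1)) ^ j))"
  proof (intro suminf_le summableI)
    fix j
    have "ennreal (t (Suc j) powr (- a)) * emeasure M (?U j) \<le> ennreal (t (Suc j) powr (- a)) * ennreal (t j)"
      using U by (intro mult_left_mono) auto
    also have "\<dots> = ennreal (t (Suc j) powr (- a) * t j)" using t[of j] by (intro ennreal_mult[symmetric]) auto
    also have "t (Suc j) powr (- a) * t j = 2 powr a * F0 powr (1 - a) * (2 powr (a - 1)) ^ j"
    proof -
      have 2: "(2::real) ^ j = 2 powr real j" by (simp add: powr_realpow)
      have "t (Suc j) powr (- a) = F0 powr (- a) * 2 powr (a * (real j + 1))"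
      proof -
        have "(2::real) powr (- real (Suc j)) = inverse (2 ^ Suc j)"
          by (simp only: powr_minus powr_realpow zero_less_numeral)
        then have "(2::real) powr (- (real j + 1)) = inverse (2 ^ Suc j)"
          by (simp only: of_nat_Suc add.commute)
        then have "t (Suc j) = F0 * 2 powr (- (real j + 1))" by (simp only: t_def divide_inverse)
        then show ?thesis using F0 by (simp add: powr_mult powr_powr algebra_simps)
      qed
      moreover have "t j = F0 * 2 powr (- real j)" by (simp add: t_def 2 powr_minus field_simps)
      moreover have "(2 powr (a - 1)) ^ j = (2::real) powr ((a - 1) * real j)"
        by (simp add: powr_realpow[symmetric] powr_powr)
      moreover have "F0 powr (1 - a) = F0 * F0 powr (- a)" using F0 powr_add[of F0 1 "- a"] by simp
      moreover have "(2::real) powr (a * (real j + 1)) * 2 powr (- real j) = 2 powr a * 2 powr ((a - 1) * real j)"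
        by (simp add: powr_add[symmetric] algebra_simps)
      ultimately show ?thesis by (simp add: mult_ac)
    qed
    finally show "ennreal (t (Suc j) powr (- a)) * emeasure M (?U j) \<le> ennreal (2 powr a * F0 powr (1 - a) * (2 powr (a - 1)) ^ j)" .
  qed
  also have "\<dots> = ennreal (2 powr a * F0 powr (1 - a) * (1 / (1 - 2 powr (a - 1))))"
  proof (rule suminf_ennreal_eq)
    have "(2::real) powr (a - 1) < 1" using a powr_less_mono[of "a - 1" 0 "2::real"] by simp
    then show "(\<lambda>j. 2 powr a * F0 powr (1 - a) * (2 powr (a - 1)) ^ j) sums (2 powr a * F0 powr (1 - a) * (1 / (1 - 2 powr (a - 1))))"
      by (intro sums_mult geometric_sums) auto
  qed (use F0 in auto)
  finally show ?thesis by (simp add: layer_const_def mult_ac)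
qed

text \<open>If nonempty, such a set is {t..<1} or {t<..<1} with t its infimum. The open interval is
  an increasing union of intervals {s n..<1} to which the bound applies. Level sets of monotone
  functions thus become measurable with controlled measure, without any continuity.\<close>

lemma emeasure_up_closed:
  fixes U :: "real set"
  assumes U: "U \<subseteq> {0..<1}" "\<And>u s. u \<in> U \<Longrightarrow> u \<le> s \<Longrightarrow> s < 1 \<Longrightarrow> s \<in> U"
    and M: "sets M = sets (lebesgue_on {0..<1})"
    and le: "\<And>u. u \<in> U \<Longrightarrow> emeasure M {u..<1} \<le> c"
  shows "U \<in> sets M \<and> emeasure M U \<le> c"
proof (cases "U = {}")
  case False
  have S: "{u..<1} \<in> sets M" if "0 \<le> u" for u :: real using that M sets_lebesgue_on_Ico[of u 1] by auto
  define t where "t = Inf U"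
  have bdd: "bdd_below U" by (rule bdd_belowI[where m = 0]) (use U(1) in auto)
  have tU: "t \<le> u" if "u \<in> U" for u unfolding t_def using that bdd by (rule cInf_lower)
  have up: "s \<in> U" if ts: "t < s" "s < 1" for s
  proof -
    obtain u where "u \<in> U" "u < s" using cInf_lessD[OF False, of s] ts(1) unfolding t_def by blast
    then show ?thesis using U(2)[of u s] ts by auto
  qed
  have t0: "0 \<le> t" unfolding t_def using False U(1) by (intro cInf_greatest) auto
  show ?thesis
  proof (cases "t \<in> U")
    case True
    have "U = {t..<1}"
    proof (intro equalityI subsetI)
      fix x assume "x \<in> {t..<1}"
      then show "x \<in> U" using True up[of x] by (cases "x = t") auto
    qed (use tU U(1) in auto)
    then show ?thesis using le[OF True] S[OF t0] by simp
  next
    case nt: False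
    obtain u0 where u0: "u0 \<in> U" using False by auto
    then have t1: "t < 1" using tU U(1) by fastforce
    define s where "s n = t + (1 - t) / real (n + 2)" for n
    have s: "t < s n" "s n < 1" for n
    proof -
      have "(1 - t) / real (n + 2) < (1 - t) / 1" using t1 by (intro divide_strict_left_mono) auto
      then have "(1 - t) / real (n + 2) < 1 - t" by (simp only: div_by_1)
      then show "s n < 1" unfolding s_def by (simp only: less_diff_eq add.commute)
      show "t < s n" using t1 by (simp add: s_def)
    qed
    have dec: "s (Suc n) \<le> s n" for n unfolding s_def using t1 by (intro add_left_mono divide_left_mono) auto
    have eq: "U = (\<Union>n. {s n..<1})"
    proof (intro equalityI subsetI)
      fix x assume x: "x \<in> U"
      then have "t < x" "x < 1" using tU[OF x] nt U(1) by (auto simp: less_le)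
      obtain n where n: "(1 - t) / (x - t) < real n" using reals_Archimedean2 by blast
      then have "(1 - t) / real (n + 2) \<le> x - t"
        using \<open>t < x\<close> by (simp add: field_simps)
      then show "x \<in> (\<Union>n. {s n..<1})" using \<open>x < 1\<close> by (auto simp: s_def intro!: exI[of _ n])
    next
      fix x assume "x \<in> (\<Union>n. {s n..<1})"
      then obtain n where "s n \<le> x" "x < 1" by auto
      then show "x \<in> U" using up[of x] s(1)[of n] by auto
    qed
    have "0 \<le> s n" for n using t0 s(1)[of n] by linarith
    then have Sn: "range (\<lambda>n. {s n..<1}) \<subseteq> sets M" using S by auto
    have inc: "incseq (\<lambda>n. {s n..<1})" using dec by (intro incseq_SucI) auto
    have "emeasure M U = (SUP n. emeasure M {s n..<1})"
      unfolding eq by (rule SUP_emeasure_incseq[symmetric, OF Sn inc])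
    also have "\<dots> \<le> c" using up s by (intro SUP_least le) auto
    finally show ?thesis using Sn unfolding eq by (auto intro!: sets.countable_UN)
  qed
qed simp

text \<open>If nonempty, the set is {0..t} with t its supremum, or, when t is not attained, the
  increasing union of the intervals {0..s n}.\<close>

lemma emeasure_down_closed:
  fixes U :: "real set"
  assumes U: "U \<subseteq> {0..<1}" "\<And>u s. u \<in> U \<Longrightarrow> 0 \<le> s \<Longrightarrow> s \<le> u \<Longrightarrow> s \<in> U"
    and M: "sets M = sets (lebesgue_on {0..<1})"
    and le: "\<And>u. u \<in> U \<Longrightarrow> emeasure M {0..u} \<le> c"
  shows "U \<in> sets M \<and> emeasure M U \<le> c"
proof (cases "U = {}")
  case False
  have S: "{0..u} \<in> sets M" if "u < 1" for u :: real using that M by (auto simp: sets_restrict_space_iff)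
  define t where "t = Sup U"
  have bdd: "bdd_above U" by (rule bdd_aboveI[where M = 1]) (use U(1) in \<open>auto simp: less_imp_le\<close>)
  have tU: "u \<le> t" if "u \<in> U" for u unfolding t_def using that bdd by (rule cSup_upper)
  have down: "s \<in> U" if ts: "s < t" "0 \<le> s" for s
  proof -
    obtain u where "u \<in> U" "s < u" using less_cSupD[OF False, of s] ts(1) unfolding t_def by blast
    then show ?thesis using U(2)[of u s] ts by auto
  qed
  show ?thesis
  proof (cases "t \<in> U")
    case True
    have "U = {0..t}"
    proof (intro equalityI subsetI)
      fix x assume "x \<in> {0..t}"
      then show "x \<in> U" using True down[of x] by (cases "x = t") auto
    qed (use tU U(1) in auto)
    moreover have "t < 1" using True U(1) by auto
    ultimately show ?thesis using le[OF True] S by simp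
  next
    case nt: False
    obtain u0 where u0: "u0 \<in> U" using False by auto
    then have t0: "0 < t" using tU[OF u0] nt U(1) by (cases "t = u0") auto
    have t1: "t \<le> 1" unfolding t_def using False U(1) by (intro cSup_least) auto
    define s where "s n = t - t / real (n + 2)" for n
    have s: "s n < t" "0 \<le> s n" for n using t0 by (auto simp: s_def field_simps)
    have inc': "s n \<le> s (Suc n)" for n unfolding s_def using t0 by (intro diff_left_mono divide_left_mono) auto
    have eq: "U = (\<Union>n. {0..s n})"
    proof (intro equalityI subsetI)
      fix x assume x: "x \<in> U"
      then have "x < t" "0 \<le> x" using tU[OF x] nt U(1) by (auto simp: less_le)
      obtain n where n: "t / (t - x) < real n" using reals_Archimedean2 by blast
      then have "t / real (n + 2) \<le> t - x"
        using \<open>x < t\<close> by (simp add: field_simps)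
      then show "x \<in> (\<Union>n. {0..s n})" using \<open>0 \<le> x\<close> by (auto simp: s_def intro!: exI[of _ n])
    next
      fix x assume "x \<in> (\<Union>n. {0..s n})"
      then obtain n where "x \<le> s n" "0 \<le> x" by auto
      then show "x \<in> U" using down[of x] s(1)[of n] by auto
    qed
    have "s n < 1" for n using t1 s(1)[of n] by linarith
    then have Sn: "range (\<lambda>n. {0..s n}) \<subseteq> sets M" using S by auto
    have inc: "incseq (\<lambda>n. {0..s n})" using inc' by (intro incseq_SucI) (auto intro: order_trans)
    have "emeasure M U = (SUP n. emeasure M {0..s n})"
      unfolding eq by (rule SUP_emeasure_incseq[symmetric, OF Sn inc])
    also have "\<dots> \<le> c" using down s by (intro SUP_least le) auto
    finally show ?thesis using Sn unfolding eq by (auto intro!: sets.countable_UN)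
  qed
qed simp

text \<open>The set where T \<le> v is closed upwards, and each {u..<1} with u in it has mass T u
  \<le> v. So the tail function can play the role of the variable of integration.\<close>

lemma tail_power_integral:
  fixes M :: "real measure" and T :: "real \<Rightarrow> real"
  assumes a: "0 < a" "a < 1" and M: "sets M = sets (lebesgue_on {0..<1})"
    and T: "\<And>s. 0 \<le> s \<Longrightarrow> s < 1 \<Longrightarrow> emeasure M {s..<1} = ennreal (T s) \<and> 0 < T s" and r: "0 \<le> r" "r < 1"
  shows "(\<integral>\<^sup>+s. ennreal (T s powr (- a)) * indicator {r..<1} s \<partial>M) \<le> ennreal (layer_const a * T r powr (1 - a))"
proof (rule nn_integral_layer_power[OF a])
  have S: "{u..<1} \<in> sets M" if "0 \<le> u" for u :: real using that M sets_lebesgue_on_Ico[of u 1] by auto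
  have anti: "T t \<le> T s" if "0 \<le> s" "s \<le> t" "t < 1" for s t :: real
  proof -
    have "emeasure M {t..<1} \<le> emeasure M {s..<1}" using that S by (intro emeasure_mono) auto
    then show ?thesis using T[of s] T[of t] that by (simp add: ennreal_le_iff less_imp_le)
  qed
  show "0 < T r" using T r by blast
  show "{r..<1} \<subseteq> space M" using sets.sets_into_space[OF S[OF r(1)]] .
  show "0 \<le> T s \<and> T s \<le> T r" if "s \<in> {r..<1}" for s using that T[of s] anti[of r s] r by auto
  fix v :: real assume v: "0 < v"
  show "{s \<in> {r..<1}. T s \<le> v} \<in> sets M \<and> emeasure M {s \<in> {r..<1}. T s \<le> v} \<le> ennreal v"
  proof (rule emeasure_up_closed[OF _ _ M])
    show "{s \<in> {r..<1}. T s \<le> v} \<subseteq> {0..<1}" using r by auto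
    show "s \<in> {s \<in> {r..<1}. T s \<le> v}" if "u \<in> {s \<in> {r..<1}. T s \<le> v}" "u \<le> s" "s < 1" for u s
      using that anti[of u s] r by auto
    show "emeasure M {u..<1} \<le> ennreal v" if "u \<in> {s \<in> {r..<1}. T s \<le> v}" for u
      using that T[of u] r by (auto intro: ennreal_leI)
  qed
qed

text \<open>Where 1 + V \<le> v, the initial segments have mass at most v - 1, in particular at most
  v. The summand 1 keeps the base of the negative power away from 0.\<close>

lemma head_power_integral:
  fixes M :: "real measure" and V :: "real \<Rightarrow> real"
  assumes a: "0 < a" "a < 1" and M: "sets M = sets (lebesgue_on {0..<1})"
    and V: "\<And>s. 0 \<le> s \<Longrightarrow> s < 1 \<Longrightarrow> emeasure M {0..s} = ennreal (V s) \<and> 0 \<le> V s" and r: "0 \<le> r" "r < 1"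
  shows "(\<integral>\<^sup>+s. ennreal ((1 + V s) powr (- a)) * indicator {0..r} s \<partial>M) \<le> ennreal (layer_const a * (1 + V r) powr (1 - a))"
proof (rule nn_integral_layer_power[OF a])
  have S: "{0..u} \<in> sets M" if "u < 1" for u :: real using that M by (auto simp: sets_restrict_space_iff)
  have mono: "V s \<le> V t" if "0 \<le> s" "s \<le> t" "t < 1" for s t :: real
  proof -
    have "emeasure M {0..s} \<le> emeasure M {0..t}" using that S by (intro emeasure_mono) auto
    then show ?thesis using V[of s] V[of t] that by (simp add: ennreal_le_iff)
  qed
  show "0 < 1 + V r" using V[of r] r by linarith
  show "{0..r} \<subseteq> space M" using sets.sets_into_space[OF S[OF r(2)]] .
  show "0 \<le> 1 + V s \<and> 1 + V s \<le> 1 + V r" if "s \<in> {0..r}" for s using that V[of s] mono[of s r] r by auto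
  fix v :: real assume v: "0 < v"
  show "{s \<in> {0..r}. 1 + V s \<le> v} \<in> sets M \<and> emeasure M {s \<in> {0..r}. 1 + V s \<le> v} \<le> ennreal v"
  proof (rule emeasure_down_closed[OF _ _ M])
    show "{s \<in> {0..r}. 1 + V s \<le> v} \<subseteq> {0..<1}" using r by auto
    show "s \<in> {s \<in> {0..r}. 1 + V s \<le> v}" if "u \<in> {s \<in> {0..r}. 1 + V s \<le> v}" "0 \<le> s" "s \<le> u" for u s
      using that mono[of s u] r by auto
    show "emeasure M {0..u} \<le> ennreal v" if "u \<in> {s \<in> {0..r}. 1 + V s \<le> v}" for u
      using that V[of u] r by (auto intro: ennreal_leI)
  qed
qed

section \<open>The Schur test for radial weights\<close>

text \<open>The coefficients are real, so conjugating the series exchanges the arguments. The second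
  Schur condition integrates over the first variable and needs this.\<close>

lemma bergman_kernel_sym:
  assumes w: "radial_weight \<omega>" and z: "cmod z < 1" "cmod \<zeta> < 1"
  shows "cmod (bergman_kernel \<omega> z \<zeta>) = cmod (bergman_kernel \<omega> \<zeta> z)"
proof -
  have u: "cmod (cnj z * \<zeta>) < 1" using z mult_unit_interval[of "cmod z" "cmod \<zeta>"] by (simp add: norm_mult)
  have "(\<lambda>n. of_real (kernel_coeff \<omega> n) * (cnj z * \<zeta>) ^ n) sums bergman_kernel \<omega> z \<zeta>"
    unfolding bergman_kernel_eq by (rule summable_sums[OF summable_kernel_coeff_complex[OF w u]])
  then have "(\<lambda>n. cnj (of_real (kernel_coeff \<omega> n) * (cnj z * \<zeta>) ^ n)) sums cnj (bergman_kernel \<omega> z \<zeta>)"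
    by (simp only: sums_cnj)
  then have "cnj (bergman_kernel \<omega> z \<zeta>) = bergman_kernel \<omega> \<zeta> z"
    unfolding bergman_kernel_eq[of \<omega> \<zeta> z] by (intro sums_unique) (simp add: mult.commute)
  then show ?thesis by (metis complex_mod_cnj)
qed

text \<open>Hoelder's inequality for the measure |B_z| dA restricted to R, with f \<omega> = (f
  \<nu>^(1/p) h) (\<omega> \<nu>^(-1/p) / h). The second factor is governed by condition
  \<open>1\<close>; after Tonelli the first is governed by condition \<open>2\<close>. As h and A
  are radial, only circle means of the kernel enter.\<close>

lemma Schur_test_radial:
  fixes h A :: "real \<Rightarrow> real" and R :: "(real \<times> real) set"
  assumes p: "1 < p" and w: "radial_weight \<omega>" and v: "radial_weight \<nu>"
    and ae: "AE s in lebesgue_on {0..<1}. \<nu> s = 0 \<longrightarrow> \<omega> s = 0"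
    and R: "R \<in> sets (borel \<Otimes>\<^sub>M borel)"
    and h: "h \<in> borel_measurable (lebesgue_on {0..<1})" "\<And>s. 0 \<le> s \<Longrightarrow> s < 1 \<Longrightarrow> 0 < h s"
    and A: "A \<in> borel_measurable (lebesgue_on {0..<1})" "\<And>r. 0 \<le> r \<Longrightarrow> r < 1 \<Longrightarrow> 0 < A r"
    and 1: "\<And>r. 0 \<le> r \<Longrightarrow> r < 1 \<Longrightarrow>
      (\<integral>\<^sup>+s. ennreal (sigma_real p \<omega> \<nu> s * h s powr (- conj_exp p)) * indicator R (r, s) * ennreal (kernel_mean \<omega> (r * s)) \<partial>radial_measure) \<le> ennreal (A r)"
    and 2: "\<And>s. 0 \<le> s \<Longrightarrow> s < 1 \<Longrightarrow>
      (\<integral>\<^sup>+r. ennreal (\<nu> r * A r powr (p - 1)) * indicator R (r, s) * ennreal (kernel_mean \<omega> (s * r)) \<partial>radial_measure) * ennreal (h s powr p) \<le> ennreal B"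
    and f: "f \<in> borel_measurable disc_area"
  shows "(\<integral>\<^sup>+z. ennreal (\<nu> (cmod z)) * epowr (\<integral>\<^sup>+\<zeta>. ennreal (cmod (f \<zeta>) * \<omega> (cmod \<zeta>))
        * (ennreal (cmod (bergman_kernel \<omega> z \<zeta>)) * indicator R (cmod z, cmod \<zeta>)) \<partial>disc_area) p \<partial>disc_area)
    \<le> ennreal B * (\<integral>\<^sup>+z. ennreal (cmod (f z) powr p * \<nu> (cmod z)) \<partial>disc_area)"
proof -
  let ?q = "conj_exp p"
  interpret d: finite_measure disc_area by (rule finite_measure_disc_area)
  interpret pair_sigma_finite disc_area disc_area ..
  note idm [measurable] = id_measurable_disc_area
  have comp: "(\<lambda>z. g (cmod z)) \<in> borel_measurable disc_area" if "g \<in> borel_measurable (lebesgue_on {0..<1})" for g :: "real \<Rightarrow> real"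
    by (rule measurable_compose[OF measurable_cmod]) (use that in \<open>simp add: measurable_radial_iff\<close>)
  note [measurable] = comp[OF radial_weight_measurable[OF w]] comp[OF radial_weight_measurable[OF v]] comp[OF h(1)] comp[OF A(1)]
    f R sigma_real_measurable[OF w v, of p] radial_weight_measurable[OF w] radial_weight_measurable[OF v] h(1) A(1)
  have RL: "(\<lambda>s. indicator R (r, s) :: ennreal) \<in> borel_measurable (lebesgue_on {0..<1})"
    "(\<lambda>s. indicator R (s, r) :: ennreal) \<in> borel_measurable (lebesgue_on {0..<1})" for r
    by (intro borel_measurable_lebesgue_onI; measurable)+
  note RL [measurable]
  define \<kappa> where "\<kappa> z \<zeta> = ennreal (cmod (bergman_kernel \<omega> z \<zeta>)) * indicator R (cmod z, cmod \<zeta>)" for z \<zeta>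
  have \<kappa>2 [measurable]: "(\<lambda>(z, \<zeta>). \<kappa> z \<zeta>) \<in> borel_measurable (disc_area \<Otimes>\<^sub>M disc_area)"
    unfolding \<kappa>_def by measurable
  have \<kappa>1 [measurable]: "\<kappa> z \<in> borel_measurable disc_area" for z
    unfolding \<kappa>_def by measurable
  define a where "a \<zeta> = cmod (f \<zeta>) * \<nu> (cmod \<zeta>) powr (1 / p) * h (cmod \<zeta>)" for \<zeta>
  define b where "b \<zeta> = \<omega> (cmod \<zeta>) / \<nu> (cmod \<zeta>) powr (1 / p) / h (cmod \<zeta>)" for \<zeta>
  have ab [measurable]: "a \<in> borel_measurable disc_area" "b \<in> borel_measurable disc_area"
    unfolding a_def b_def by measurable
  have nn: "0 \<le> \<omega> (cmod \<zeta>)" "0 \<le> \<nu> (cmod \<zeta>)" "0 < h (cmod \<zeta>)" "0 < A (cmod \<zeta>)" if "\<zeta> \<in> space disc_area" for \<zeta>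
    using that radial_weight_nonneg[OF w] radial_weight_nonneg[OF v] h(2) A(2) by auto
  have ap: "a \<zeta> powr p = cmod (f \<zeta>) powr p * \<nu> (cmod \<zeta>) * h (cmod \<zeta>) powr p" if "\<zeta> \<in> space disc_area" for \<zeta>
    using nn[OF that] p by (simp add: a_def powr_mult powr_powr)
  have bq: "b \<zeta> powr ?q = sigma_real p \<omega> \<nu> (cmod \<zeta>) * h (cmod \<zeta>) powr (- ?q)" if "\<zeta> \<in> space disc_area" for \<zeta>
    using nn[OF that] by (simp add: b_def sigma_real_def powr_divide powr_mult powr_minus field_simps)
  have T: "epowr (\<integral>\<^sup>+\<zeta>. ennreal (cmod (f \<zeta>) * \<omega> (cmod \<zeta>)) * \<kappa> z \<zeta> \<partial>disc_area) p
      \<le> ennreal (A (cmod z) powr (p - 1)) * (\<integral>\<^sup>+\<zeta>. ennreal (a \<zeta> powr p) * \<kappa> z \<zeta> \<partial>disc_area)"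
    if z: "z \<in> space disc_area" for z
  proof -
    \<comment> \<open>The factor b divides by a power of \<nu>; that the product a b recovers |f|
      \<omega> almost everywhere rests on \<omega> vanishing where \<nu> does.\<close>
    have "AE \<zeta> in disc_area. \<nu> (cmod \<zeta>) = 0 \<longrightarrow> \<omega> (cmod \<zeta>) = 0"
    proof (rule AE_disc_area_radial)
      show "AE s in radial_measure. \<nu> s = 0 \<longrightarrow> \<omega> s = 0"
        unfolding radial_measure_def using ae
        by (subst AE_density) (auto intro: borel_measurable_lebesgue_onI)
    qed
    then have "(\<integral>\<^sup>+\<zeta>. ennreal (cmod (f \<zeta>) * \<omega> (cmod \<zeta>)) * \<kappa> z \<zeta> \<partial>disc_area)
        = (\<integral>\<^sup>+\<zeta>. \<kappa> z \<zeta> * ennreal (a \<zeta> * b \<zeta>) \<partial>disc_area)"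
    proof (intro nn_integral_cong_AE, elim AE_mp, intro AE_I2 impI)
      fix \<zeta> assume \<zeta>: "\<zeta> \<in> space disc_area" "\<nu> (cmod \<zeta>) = 0 \<longrightarrow> \<omega> (cmod \<zeta>) = 0"
      then have "cmod (f \<zeta>) * \<omega> (cmod \<zeta>) = a \<zeta> * b \<zeta>"
        using nn[OF \<zeta>(1)] by (cases "\<nu> (cmod \<zeta>) = 0") (auto simp: a_def b_def)
      then show "ennreal (cmod (f \<zeta>) * \<omega> (cmod \<zeta>)) * \<kappa> z \<zeta> = \<kappa> z \<zeta> * ennreal (a \<zeta> * b \<zeta>)"
        by (simp add: mult.commute)
    qed
    also have "\<dots> = (\<integral>\<^sup>+\<zeta>. ennreal (a \<zeta> * b \<zeta>) \<partial>density disc_area (\<kappa> z))"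
      by (intro nn_integral_density[symmetric]) measurable
    finally have eq: "(\<integral>\<^sup>+\<zeta>. ennreal (cmod (f \<zeta>) * \<omega> (cmod \<zeta>)) * \<kappa> z \<zeta> \<partial>disc_area)
        = (\<integral>\<^sup>+\<zeta>. ennreal (a \<zeta> * b \<zeta>) \<partial>density disc_area (\<kappa> z))" .
    have "(\<integral>\<^sup>+\<zeta>. ennreal (b \<zeta> powr ?q) \<partial>density disc_area (\<kappa> z)) = (\<integral>\<^sup>+\<zeta>. \<kappa> z \<zeta> * ennreal (b \<zeta> powr ?q) \<partial>disc_area)"
      by (intro nn_integral_density) measurable
    also have "\<dots> = (\<integral>\<^sup>+\<zeta>. ennreal (sigma_real p \<omega> \<nu> (cmod \<zeta>) * h (cmod \<zeta>) powr (- ?q)) * indicator R (cmod z, cmod \<zeta>)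
        * ennreal (cmod (bergman_kernel \<omega> z \<zeta>)) \<partial>disc_area)"
      by (intro nn_integral_cong) (simp add: bq \<kappa>_def mult_ac)
    also have "\<dots> = (\<integral>\<^sup>+s. ennreal (sigma_real p \<omega> \<nu> s * h s powr (- ?q)) * indicator R (cmod z, s)
        * ennreal (kernel_mean \<omega> (cmod z * s)) \<partial>radial_measure)"
      by (rule nn_integral_bergman_kernel_radial[OF w, where G = "\<lambda>s. ennreal (sigma_real p \<omega> \<nu> s * h s powr (- ?q)) * indicator R (cmod z, s)"])
        (use z in \<open>auto simp: measurable_radial_iff\<close>)
    also have "\<dots> \<le> ennreal (A (cmod z))" using z by (intro 1) auto
    finally have "(\<integral>\<^sup>+\<zeta>. ennreal (b \<zeta> powr ?q) \<partial>density disc_area (\<kappa> z)) \<le> ennreal (A (cmod z))" .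
    then have "epowr (\<integral>\<^sup>+\<zeta>. ennreal (a \<zeta> * b \<zeta>) \<partial>density disc_area (\<kappa> z)) p
        \<le> ennreal (A (cmod z) powr (p - 1)) * (\<integral>\<^sup>+\<zeta>. ennreal (a \<zeta> powr p) \<partial>density disc_area (\<kappa> z))"
      using nn z by (intro Hoelder_epowr p) (auto simp: a_def b_def less_imp_le)
    also have "(\<integral>\<^sup>+\<zeta>. ennreal (a \<zeta> powr p) \<partial>density disc_area (\<kappa> z)) = (\<integral>\<^sup>+\<zeta>. \<kappa> z \<zeta> * ennreal (a \<zeta> powr p) \<partial>disc_area)"
      by (intro nn_integral_density) measurable
    finally show ?thesis unfolding eq by (simp add: mult.commute)
  qed
  have "(\<integral>\<^sup>+z. ennreal (\<nu> (cmod z)) * epowr (\<integral>\<^sup>+\<zeta>. ennreal (cmod (f \<zeta>) * \<omega> (cmod \<zeta>)) * \<kappa> z \<zeta> \<partial>disc_area) p \<partial>disc_area)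
      \<le> (\<integral>\<^sup>+z. (\<integral>\<^sup>+\<zeta>. ennreal (\<nu> (cmod z) * A (cmod z) powr (p - 1)) * (ennreal (a \<zeta> powr p) * \<kappa> z \<zeta>) \<partial>disc_area) \<partial>disc_area)"
  proof (rule nn_integral_mono)
    fix z assume z: "z \<in> space disc_area"
    have "ennreal (\<nu> (cmod z)) * epowr (\<integral>\<^sup>+\<zeta>. ennreal (cmod (f \<zeta>) * \<omega> (cmod \<zeta>)) * \<kappa> z \<zeta> \<partial>disc_area) p
        \<le> ennreal (\<nu> (cmod z)) * (ennreal (A (cmod z) powr (p - 1)) * (\<integral>\<^sup>+\<zeta>. ennreal (a \<zeta> powr p) * \<kappa> z \<zeta> \<partial>disc_area))"
      by (intro mult_left_mono T z) auto
    also have "\<dots> = ennreal (\<nu> (cmod z) * A (cmod z) powr (p - 1)) * (\<integral>\<^sup>+\<zeta>. ennreal (a \<zeta> powr p) * \<kappa> z \<zeta> \<partial>disc_area)"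
      using nn[OF z] by (simp add: ennreal_mult mult.assoc)
    also have "\<dots> = (\<integral>\<^sup>+\<zeta>. ennreal (\<nu> (cmod z) * A (cmod z) powr (p - 1)) * (ennreal (a \<zeta> powr p) * \<kappa> z \<zeta>) \<partial>disc_area)"
      by (intro nn_integral_cmult[symmetric]) measurable
    finally show "ennreal (\<nu> (cmod z)) * epowr (\<integral>\<^sup>+\<zeta>. ennreal (cmod (f \<zeta>) * \<omega> (cmod \<zeta>)) * \<kappa> z \<zeta> \<partial>disc_area) p \<le> \<dots>" .
  qed
  also have "\<dots> = (\<integral>\<^sup>+\<zeta>. (\<integral>\<^sup>+z. ennreal (\<nu> (cmod z) * A (cmod z) powr (p - 1)) * (ennreal (a \<zeta> powr p) * \<kappa> z \<zeta>) \<partial>disc_area) \<partial>disc_area)"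
    by (rule Fubini'[symmetric]) measurable
  also have "\<dots> \<le> (\<integral>\<^sup>+\<zeta>. ennreal B * ennreal (cmod (f \<zeta>) powr p * \<nu> (cmod \<zeta>)) \<partial>disc_area)"
  proof (rule nn_integral_mono)
    fix \<zeta> assume \<zeta>: "\<zeta> \<in> space disc_area"
    let ?I = "\<integral>\<^sup>+z. ennreal (\<nu> (cmod z) * A (cmod z) powr (p - 1)) * indicator R (cmod z, cmod \<zeta>) * ennreal (cmod (bergman_kernel \<omega> \<zeta> z)) \<partial>disc_area"
    have "(\<integral>\<^sup>+z. ennreal (\<nu> (cmod z) * A (cmod z) powr (p - 1)) * (ennreal (a \<zeta> powr p) * \<kappa> z \<zeta>) \<partial>disc_area)
        = (\<integral>\<^sup>+z. ennreal (a \<zeta> powr p) * (ennreal (\<nu> (cmod z) * A (cmod z) powr (p - 1)) * indicator R (cmod z, cmod \<zeta>) * ennreal (cmod (bergman_kernel \<omega> \<zeta> z))) \<partial>disc_area)"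
      using \<zeta> by (intro nn_integral_cong) (simp add: \<kappa>_def bergman_kernel_sym[OF w] mult_ac)
    also have "\<dots> = ennreal (a \<zeta> powr p) * ?I"
      by (intro nn_integral_cmult) measurable
    also have "?I = (\<integral>\<^sup>+r. ennreal (\<nu> r * A r powr (p - 1)) * indicator R (r, cmod \<zeta>) * ennreal (kernel_mean \<omega> (cmod \<zeta> * r)) \<partial>radial_measure)"
      by (rule nn_integral_bergman_kernel_radial[OF w, where G = "\<lambda>r. ennreal (\<nu> r * A r powr (p - 1)) * indicator R (r, cmod \<zeta>)"])
        (use \<zeta> in \<open>auto simp: measurable_radial_iff\<close>)
    also have "ennreal (a \<zeta> powr p) * \<dots> = ennreal (cmod (f \<zeta>) powr p * \<nu> (cmod \<zeta>)) * (\<dots> * ennreal (h (cmod \<zeta>) powr p))"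
      using nn[OF \<zeta>] by (simp add: ap[OF \<zeta>] ennreal_mult mult_ac)
    also have "\<dots> \<le> ennreal (cmod (f \<zeta>) powr p * \<nu> (cmod \<zeta>)) * ennreal B"
      using \<zeta> by (intro mult_left_mono 2) auto
    finally show "(\<integral>\<^sup>+z. ennreal (\<nu> (cmod z) * A (cmod z) powr (p - 1)) * (ennreal (a \<zeta> powr p) * \<kappa> z \<zeta>) \<partial>disc_area)
        \<le> ennreal B * ennreal (cmod (f \<zeta>) powr p * \<nu> (cmod \<zeta>))" by (simp add: mult.commute)
  qed
  also have "\<dots> = ennreal B * (\<integral>\<^sup>+\<zeta>. ennreal (cmod (f \<zeta>) powr p * \<nu> (cmod \<zeta>)) \<partial>disc_area)"
    by (intro nn_integral_cmult) measurable
  finally show ?thesis unfolding \<kappa>_def .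
qed

subsection \<open>Sufficiency of the Muckenhoupt condition\<close>

text \<open>The factor 2 is that of the polar density; when \<omega> vanishes where \<nu> does, the
  mass of {r..<1} is twice \<open>sigma_tail\<close>.\<close>

definition sigma_measure :: "real \<Rightarrow> (real \<Rightarrow> real) \<Rightarrow> (real \<Rightarrow> real) \<Rightarrow> real measure" where
  "sigma_measure p \<omega> \<nu> = density (lebesgue_on {0..<1}) (\<lambda>s. ennreal (2 * s * sigma_real p \<omega> \<nu> s))"

text \<open>Here the factor 2 is left out, so that the mass of {0..r} is exactly the integral in
  \<open>M_const\<close>.\<close>

definition nu_measure :: "real \<Rightarrow> (real \<Rightarrow> real) \<Rightarrow> (real \<Rightarrow> real) \<Rightarrow> real measure" where
  "nu_measure p \<omega> \<nu> = density (lebesgue_on {0..<1}) (\<lambda>s. ennreal (\<nu> s / tail \<omega> s powr p * s))"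

definition sigma_mass :: "real \<Rightarrow> (real \<Rightarrow> real) \<Rightarrow> (real \<Rightarrow> real) \<Rightarrow> real \<Rightarrow> real" where
  "sigma_mass p \<omega> \<nu> r = measure (sigma_measure p \<omega> \<nu>) {r..<1}"

definition nu_mass :: "real \<Rightarrow> (real \<Rightarrow> real) \<Rightarrow> (real \<Rightarrow> real) \<Rightarrow> real \<Rightarrow> real" where
  "nu_mass p \<omega> \<nu> r = measure (nu_measure p \<omega> \<nu>) {0..r}"

lemma sets_sigma_measure [simp]: "sets (sigma_measure p \<omega> \<nu>) = sets (lebesgue_on {0..<1})"
  by (simp add: sigma_measure_def)

lemma sets_nu_measure [simp]: "sets (nu_measure p \<omega> \<nu>) = sets (lebesgue_on {0..<1})"
  by (simp add: nu_measure_def)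

lemma sets_lebesgue_on_Icc: "0 \<le> a \<Longrightarrow> b < 1 \<Longrightarrow> {a..b::real} \<in> sets (lebesgue_on {0..<1})"
  by (auto simp: sets_restrict_space_iff)

lemma nu_density_measurable:
  assumes "radial_weight \<omega>" "radial_weight \<nu>"
  shows "(\<lambda>s. \<nu> s / tail \<omega> s powr p * s) \<in> borel_measurable (lebesgue_on {0..<1})"
proof -
  note [measurable] = radial_weight_measurable[OF assms(2)] tail_measurable[OF assms(1)]
  have [measurable]: "(\<lambda>s. s) \<in> borel_measurable (lebesgue_on {0..<1::real})"
    by (intro borel_measurable_lebesgue_onI) measurable
  show ?thesis by measurable
qed

lemma sigma_density_measurable:
  assumes "radial_weight \<omega>" "radial_weight \<nu>"
  shows "(\<lambda>s. 2 * s * sigma_real p \<omega> \<nu> s) \<in> borel_measurable (lebesgue_on {0..<1})"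
proof -
  note [measurable] = sigma_real_measurable[OF assms]
  have [measurable]: "(\<lambda>s. s) \<in> borel_measurable (lebesgue_on {0..<1::real})"
    by (intro borel_measurable_lebesgue_onI) measurable
  show ?thesis by measurable
qed

lemma mono_on_measurable_lebesgue_on:
  fixes f :: "real \<Rightarrow> real"
  assumes "mono_on {0..<1} f"
  shows "f \<in> borel_measurable (lebesgue_on {0..<1})"
proof -
  have "f \<in> borel_measurable (restrict_space borel {0..<1})"
    by (rule borel_measurable_mono_on_fnc[OF assms])
  moreover have "(\<lambda>x. x) \<in> lebesgue_on {0..<1} \<rightarrow>\<^sub>M restrict_space borel {0..<1::real}"
    by (intro measurable_restrict_space3 measurable_completion) auto
  ultimately show ?thesis using measurable_compose by blast
qed

lemma nn_integral_radial_on: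
  assumes "F \<in> borel_measurable (lebesgue_on {0..<1})"
  shows "(\<integral>\<^sup>+s. F s \<partial>radial_measure) = (\<integral>\<^sup>+s. ennreal (2 * s) * F s \<partial>lebesgue_on {0..<1})"
  unfolding radial_measure_def using assms
  by (intro nn_integral_density) (auto intro: borel_measurable_lebesgue_onI)

text \<open>For s > 0 with \<nu> s = 0 < \<omega> s the value \<open>sigma_wt\<close> is infinite,
  so a non-null set of such s would make some tail infinite. The sets E n stay away from 0 because
  finiteness is known only for tails at positive radii.\<close>

lemma AE_omega_zero_of_sigma_tail:
  assumes w: "radial_weight \<omega>" and v: "radial_weight \<nu>"
    and fin: "\<And>r. 0 < r \<Longrightarrow> r < 1 \<Longrightarrow> sigma_tail p \<omega> \<nu> r < top"
  shows "AE s in lebesgue_on {0..<1}. \<nu> s = 0 \<longrightarrow> \<omega> s = 0"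
proof -
  note [measurable] = radial_weight_measurable[OF w] radial_weight_measurable[OF v]
  have [measurable]: "(\<lambda>s. s) \<in> borel_measurable (lebesgue_on {0..<1::real})"
    by (intro borel_measurable_lebesgue_onI) measurable
  define E where "E n = {s \<in> space (lebesgue_on {0..<1}). 1 / real (n + 2) \<le> s \<and> \<nu> s = 0 \<and> \<omega> s \<noteq> 0}" for n :: nat
  have E: "E n \<in> sets (lebesgue_on {0..<1})" for n unfolding E_def by measurable
  have "emeasure (lebesgue_on {0..<1}) (E n) = 0" for n
  proof (rule ccontr)
    assume "emeasure (lebesgue_on {0..<1}) (E n) \<noteq> 0"
    then have "top = top * emeasure (lebesgue_on {0..<1}) (E n)" by (simp add: ennreal_top_mult)
    also have "\<dots> = (\<integral>\<^sup>+s. top * indicator (E n) s \<partial>lebesgue_on {0..<1})"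
      by (rule nn_integral_cmult_indicator[OF E, symmetric])
    also have "\<dots> = (\<integral>\<^sup>+s\<in>{0..<1}. (top * indicator (E n) s) \<partial>lebesgue)" by (rule nn_integral_lebesgue_on)
    also have "\<dots> \<le> sigma_tail p \<omega> \<nu> (1 / real (n + 2))"
      unfolding sigma_tail_def
    proof (intro nn_integral_mono)
      fix s
      show "top * indicator (E n) s * indicator {0..<1} s
          \<le> sigma_wt p \<omega> \<nu> s * indicator {1 / real (n + 2)..<1} s"
      proof (cases "s \<in> E n")
        case True
        then have s: "0 \<le> s" "s < 1" "1 / real (n + 2) \<le> s" "\<nu> s = 0" "\<omega> s \<noteq> 0"
          by (auto simp: E_def space_restrict_space)
        have "0 < 1 / real (n + 2)" by simp
        then have "0 < s" using s(3) by linarith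
        moreover have "0 < \<omega> s" using radial_weight_nonneg[OF w s(1,2)] s(5) by simp
        ultimately have s0: "0 < s" "0 < \<omega> s" by auto
        have "ennreal (\<omega> s) / 0 = top" using s0 by (simp add: ennreal_divide_zero)
        then have "sigma_wt p \<omega> \<nu> s = top"
          using s s0 by (simp add: sigma_wt_def epowr_def ennreal_mult_top)
        then show ?thesis using s True by simp
      qed simp
    qed
    also have "\<dots> < top" by (rule fin) auto
    finally show False by simp
  qed
  then have "AE s in lebesgue_on {0..<1}. \<forall>n. s \<notin> E n"
    unfolding AE_all_countable using E by (intro allI AE_not_in) (auto simp: null_sets_def)
  moreover have "AE s in lebesgue_on {0..<1}. s \<noteq> (0::real)"
    by (subst AE_restrict_space_iff) (auto intro!: AE_completion[OF AE_mp[OF AE_lborel_singleton]])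
  ultimately show ?thesis
  proof (rule AE_mp[OF AE_conjI, OF _ _ AE_I2], intro impI)
    fix s assume s: "s \<in> space (lebesgue_on {0..<1::real})" "(\<forall>n. s \<notin> E n) \<and> s \<noteq> 0" "\<nu> s = 0"
    then have "0 < s" by (auto simp: space_restrict_space less_le)
    then obtain n where "1 / real (Suc n) < s" using nat_approx_posE by blast
    moreover have "1 / real (n + 2) \<le> 1 / real (Suc n)" by (intro divide_left_mono) auto
    ultimately have "1 / real (n + 2) \<le> s" by linarith
    then show "\<omega> s = 0" using s unfolding E_def by blast
  qed
qed

lemma powr_mono_neg: "0 < x \<Longrightarrow> x \<le> y \<Longrightarrow> 0 \<le> a \<Longrightarrow> y powr (- a) \<le> x powr (- a)" for x y a :: real
  by (intro powr_mono2') auto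

section \<open>Consequences of a finite Muckenhoupt constant\<close>

context
  fixes p :: real and \<omega> \<nu> :: "real \<Rightarrow> real" and c M :: real
  assumes p: "1 < p" and w: "radial_weight \<omega>" and v: "radial_weight \<nu>"
    and M: "M_const p \<omega> \<nu> \<le> ennreal M" "0 \<le> M"
begin

lemma M_bound:
  assumes "0 < r" "r < 1"
  shows "epowr ((\<integral>\<^sup>+s\<in>{0..r}. ennreal (\<nu> s / tail \<omega> s powr p * s) \<partial>lebesgue) + 1) (1 / p)
      * epowr (sigma_tail p \<omega> \<nu> r) (1 / conj_exp p) \<le> ennreal M"
  using assms M(1) unfolding M_const_def by (auto simp: SUP_le_iff)

text \<open>The summand 1 makes the first factor in \<open>M_const\<close> at least 1, which leaves
  a bound for the second factor alone.\<close>

lemma sigma_tail_le: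
  assumes "0 < r" "r < 1"
  shows "sigma_tail p \<omega> \<nu> r \<le> ennreal (M powr conj_exp p)"
proof -
  have q: "1 < conj_exp p" by (rule conj_exp_pos[OF p])
  let ?V = "\<integral>\<^sup>+s\<in>{0..r}. ennreal (\<nu> s / tail \<omega> s powr p * s) \<partial>lebesgue"
  have "1 = epowr 1 (1 / p)" by (simp add: epowr_def)
  also have "\<dots> \<le> epowr (?V + 1) (1 / p)" using p by (intro epowr_mono) auto
  finally have "1 * epowr (sigma_tail p \<omega> \<nu> r) (1 / conj_exp p) \<le> ennreal M"
    using M_bound[OF assms] by (meson mult_right_mono order_trans zero_le)
  then have "epowr (epowr (sigma_tail p \<omega> \<nu> r) (1 / conj_exp p)) (conj_exp p) \<le> epowr (ennreal M) (conj_exp p)"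
    using q by (intro epowr_mono) auto
  then show ?thesis using q M by (simp add: epowr_epowr epowr_ennreal)
qed

lemma ae_zero: "AE s in lebesgue_on {0..<1}. \<nu> s = 0 \<longrightarrow> \<omega> s = 0"
  by (rule AE_omega_zero_of_sigma_tail[OF w v]) (auto intro: le_less_trans[OF sigma_tail_le])

lemma emeasure_sigma:
  assumes r: "0 \<le> r" "r < 1"
  shows "emeasure (sigma_measure p \<omega> \<nu>) {r..<1} = 2 * sigma_tail p \<omega> \<nu> r"
proof -
  note [measurable] = sigma_real_measurable[OF w v] sigma_density_measurable[OF w v]
  have I [measurable]: "{r..<1} \<in> sets (lebesgue_on {0..<1})" using r by (intro sets_lebesgue_on_Ico) auto
  have [measurable]: "(\<lambda>s. s) \<in> borel_measurable (lebesgue_on {0..<1::real})"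
    by (intro borel_measurable_lebesgue_onI) measurable
  have "emeasure (sigma_measure p \<omega> \<nu>) {r..<1}
      = (\<integral>\<^sup>+s. ennreal (2 * s * sigma_real p \<omega> \<nu> s) * indicator {r..<1} s \<partial>lebesgue_on {0..<1})"
    unfolding sigma_measure_def using I by (intro emeasure_density) auto
  also have "\<dots> = (\<integral>\<^sup>+s. 2 * (ennreal (s * sigma_real p \<omega> \<nu> s) * indicator {r..<1} s) \<partial>lebesgue_on {0..<1})"
    using sigma_real_nonneg[of p \<omega> \<nu>]
    by (intro nn_integral_cong) (auto simp: space_restrict_space ennreal_mult mult.assoc split: split_indicator)
  also have "\<dots> = 2 * sigma_tail p \<omega> \<nu> r"
    unfolding sigma_tail_eq[OF w v ae_zero r(1)] by (intro nn_integral_cmult) measurable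
  finally show ?thesis .
qed

text \<open>The supremum in \<open>M_const\<close> omits r = 0. The interval {0<..<1} inherits the
  bound as an up-closed set, and the point 0 has no mass because the density has the factor
  s.\<close>

lemma emeasure_sigma_le:
  assumes r: "0 \<le> r" "r < 1"
  shows "emeasure (sigma_measure p \<omega> \<nu>) {r..<1} \<le> ennreal (2 * M powr conj_exp p)"
proof -
  have pos: "emeasure (sigma_measure p \<omega> \<nu>) {u..<1} \<le> ennreal (2 * M powr conj_exp p)" if "0 < u" "u < 1" for u
    using that sigma_tail_le[of u] by (simp add: emeasure_sigma ennreal_mult mult_left_mono)
  show ?thesis
  proof (cases "r = 0")
    case False then show ?thesis using pos r by simp
  next
    case True
    let ?Z = "{0<..<1::real}"
    have Z: "?Z \<in> sets (sigma_measure p \<omega> \<nu>) \<and> emeasure (sigma_measure p \<omega> \<nu>) ?Z \<le> ennreal (2 * M powr conj_exp p)"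
      by (rule emeasure_up_closed) (auto intro: pos)
    have S0: "{0} \<in> sets (lebesgue_on {0..<1::real})" by (auto simp: sets_restrict_space_iff)
    have "emeasure (sigma_measure p \<omega> \<nu>) {0}
        = (\<integral>\<^sup>+s. ennreal (2 * s * sigma_real p \<omega> \<nu> s) * indicator {0} s \<partial>lebesgue_on {0..<1})"
      unfolding sigma_measure_def using S0 sigma_density_measurable[OF w v] by (intro emeasure_density) auto
    also have "\<dots> = (\<integral>\<^sup>+s. 0 \<partial>lebesgue_on {0..<1::real})"
      by (intro nn_integral_cong) (auto split: split_indicator)
    finally have "emeasure (sigma_measure p \<omega> \<nu>) {0} = 0" by simp
    moreover have "{0..<1} = {0} \<union> ?Z" by auto
    ultimately have "emeasure (sigma_measure p \<omega> \<nu>) {0..<1} \<le> emeasure (sigma_measure p \<omega> \<nu>) ?Z"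
      using emeasure_subadditive[of "{0}" "sigma_measure p \<omega> \<nu>" ?Z] S0 Z by simp
    then show ?thesis using Z True by (auto intro: order_trans)
  qed
qed

lemma finite_sigma_measure: "finite_measure (sigma_measure p \<omega> \<nu>)"
proof (rule finite_measureI)
  have "space (sigma_measure p \<omega> \<nu>) = {0..<1}" by (simp add: sigma_measure_def space_restrict_space)
  then show "emeasure (sigma_measure p \<omega> \<nu>) (space (sigma_measure p \<omega> \<nu>)) \<noteq> \<infinity>"
    using emeasure_sigma_le[of 0] by (auto simp: top_unique)
qed

lemma emeasure_sigma_mass: "emeasure (sigma_measure p \<omega> \<nu>) {r..<1} = ennreal (sigma_mass p \<omega> \<nu> r)"
  unfolding sigma_mass_def by (rule finite_measure.emeasure_eq_measure[OF finite_sigma_measure])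

text \<open>On {0..r} the tail of \<omega> is at least its value at r, which makes the mass
  finite.\<close>

lemma emeasure_nu:
  assumes r: "0 \<le> r" "r < 1"
  shows "emeasure (nu_measure p \<omega> \<nu>) {0..r} = (\<integral>\<^sup>+s\<in>{0..r}. ennreal (\<nu> s / tail \<omega> s powr p * s) \<partial>lebesgue)"
    and "emeasure (nu_measure p \<omega> \<nu>) {0..r} = ennreal (nu_mass p \<omega> \<nu> r)"
proof -
  have "emeasure (nu_measure p \<omega> \<nu>) {0..r}
      = (\<integral>\<^sup>+s. ennreal (\<nu> s / tail \<omega> s powr p * s) * indicator {0..r} s \<partial>lebesgue_on {0..<1})"
    unfolding nu_measure_def using r sets_lebesgue_on_Icc[of 0 r] nu_density_measurable[OF w v]
    by (intro emeasure_density) auto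
  also have "\<dots> = (\<integral>\<^sup>+s\<in>{0..r}. ennreal (\<nu> s / tail \<omega> s powr p * s) \<partial>lebesgue)"
    unfolding nn_integral_lebesgue_on using r by (intro nn_integral_cong) (auto split: split_indicator)
  finally show 1: "emeasure (nu_measure p \<omega> \<nu>) {0..r} = (\<integral>\<^sup>+s\<in>{0..r}. ennreal (\<nu> s / tail \<omega> s powr p * s) \<partial>lebesgue)" .
  have Tr: "0 < tail \<omega> r" by (rule tail_pos[OF w r])
  have "(\<integral>\<^sup>+s\<in>{0..r}. ennreal (\<nu> s / tail \<omega> s powr p * s) \<partial>lebesgue)
      \<le> (\<integral>\<^sup>+s. ennreal (\<nu> s) * ennreal (1 / tail \<omega> r powr p) \<partial>lebesgue_on {0..<1})"
    unfolding nn_integral_lebesgue_on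
  proof (intro nn_integral_mono)
    fix s
    show "ennreal (\<nu> s / tail \<omega> s powr p * s) * indicator {0..r} s
        \<le> ennreal (\<nu> s) * ennreal (1 / tail \<omega> r powr p) * indicator {0..<1} s"
    proof (cases "s \<in> {0..r}")
      case True
      then have s: "0 \<le> s" "s < 1" "s \<le> r" using r by auto
      have v0: "0 \<le> \<nu> s" by (rule radial_weight_nonneg[OF v s(1,2)])
      have "tail \<omega> r powr p \<le> tail \<omega> s powr p"
        using p Tr tail_antimono[OF w s(1,3) r(2)] by (intro powr_mono2) auto
      then have "\<nu> s / tail \<omega> s powr p * s \<le> \<nu> s / tail \<omega> r powr p * 1"
        using v0 s Tr tail_pos[OF w s(1,2)] by (intro mult_mono divide_left_mono mult_pos_pos) auto
      then show ?thesis using True s v0 by (simp add: ennreal_mult[symmetric] ennreal_leI)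
    qed simp
  qed
  also have "\<dots> = ennreal (1 / tail \<omega> r powr p) * (\<integral>\<^sup>+s. 1 \<partial>weight_measure \<nu>)"
  proof -
    have "(\<lambda>s. ennreal (\<nu> s)) \<in> borel_measurable (lebesgue_on {0..<1})"
      using radial_weight_measurable[OF v] by measurable
    then show ?thesis
      by (subst nn_integral_weight_measure_density[OF v]) (simp_all add: nn_integral_multc mult.commute)
  qed
  also have "\<dots> < top"
    using emeasure_weight_measure[OF v, of 0] by (simp add: ennreal_mult_less_top)
  finally have "emeasure (nu_measure p \<omega> \<nu>) {0..r} < top" unfolding 1 .
  then show "emeasure (nu_measure p \<omega> \<nu>) {0..r} = ennreal (nu_mass p \<omega> \<nu> r)"
    unfolding nu_mass_def by (intro emeasure_eq_ennreal_measure) simp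
qed

lemma nu_mass_nonneg: "0 \<le> nu_mass p \<omega> \<nu> r"
  by (simp add: nu_mass_def)

text \<open>Hoelder's inequality for \<omega> = \<nu>^(1/p) (\<omega> \<nu>^(-1/p)) on {r..<1}; for
  r \<ge> 1/2 the factor 2 s in \<open>sigma_measure\<close> is at least 1.\<close>

lemma tail_power_le:
  assumes r: "1/2 \<le> r" "r < 1" and Y: "0 < Y" "sigma_mass p \<omega> \<nu> r \<le> Y"
  shows "tail \<omega> r powr p \<le> Y powr (p - 1) * tail \<nu> r"
proof -
  note [measurable] = radial_weight_measurable[OF w] radial_weight_measurable[OF v] sigma_real_measurable[OF w v]
  have I [measurable]: "{r..<1} \<in> sets (lebesgue_on {0..<1})" using r by (intro sets_lebesgue_on_Ico) auto
  have T: "0 < tail \<omega> r" "0 < tail \<nu> r" using tail_pos w v r by auto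
  define a where "a s = \<nu> s powr (1 / p) * indicator {r..<1} s" for s
  define b where "b s = \<omega> s / \<nu> s powr (1 / p) * indicator {r..<1} s" for s
  have ab [measurable]: "a \<in> borel_measurable (lebesgue_on {0..<1})" "b \<in> borel_measurable (lebesgue_on {0..<1})"
    unfolding a_def b_def by measurable
  have tail_I: "ennreal (tail \<mu> r) = (\<integral>\<^sup>+s. ennreal (\<mu> s) * indicator {r..<1} s \<partial>lebesgue_on {0..<1})"
    if \<mu>: "radial_weight \<mu>" for \<mu>
    using r emeasure_weight_measure[OF \<mu>, of r] I radial_weight_measurable[OF \<mu>]
    unfolding weight_measure_def by (subst (asm) emeasure_density) auto
  have "epowr (\<integral>\<^sup>+s. ennreal (a s * b s) \<partial>lebesgue_on {0..<1}) p
      \<le> ennreal (Y powr (p - 1)) * (\<integral>\<^sup>+s. ennreal (a s powr p) \<partial>lebesgue_on {0..<1})"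
  proof (rule Hoelder_epowr[OF p ab _ _ Y(1)])
    show "0 \<le> a s" for s by (simp add: a_def)
    show "0 \<le> b s" if "s \<in> space (lebesgue_on {0..<1})" for s
      using that radial_weight_nonneg[OF w] by (auto simp: b_def space_restrict_space)
    have "(\<integral>\<^sup>+s. ennreal (b s powr conj_exp p) \<partial>lebesgue_on {0..<1})
        \<le> (\<integral>\<^sup>+s. ennreal (2 * s * sigma_real p \<omega> \<nu> s) * indicator {r..<1} s \<partial>lebesgue_on {0..<1})"
    proof (intro nn_integral_mono)
      fix s
      show "ennreal (b s powr conj_exp p) \<le> ennreal (2 * s * sigma_real p \<omega> \<nu> s) * indicator {r..<1} s"
      proof (cases "s \<in> {r..<1}")
        case True
        then have "1 * sigma_real p \<omega> \<nu> s \<le> 2 * s * sigma_real p \<omega> \<nu> s"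
          using r sigma_real_nonneg by (intro mult_right_mono) auto
        then show ?thesis using True by (simp add: b_def sigma_real_def ennreal_leI)
      qed (simp add: b_def)
    qed
    also have "\<dots> = emeasure (sigma_measure p \<omega> \<nu>) {r..<1}"
      unfolding sigma_measure_def using I sigma_density_measurable[OF w v] by (intro emeasure_density[symmetric]) auto
    also have "\<dots> \<le> ennreal Y" unfolding emeasure_sigma_mass using Y(2) by (rule ennreal_leI)
    finally show "(\<integral>\<^sup>+s. ennreal (b s powr conj_exp p) \<partial>lebesgue_on {0..<1}) \<le> ennreal Y" .
  qed
  also have "(\<integral>\<^sup>+s. ennreal (a s * b s) \<partial>lebesgue_on {0..<1}) = ennreal (tail \<omega> r)"
    unfolding tail_I[OF w]
  proof (rule nn_integral_cong_AE, rule AE_mp[OF ae_zero AE_I2], intro impI)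
    fix s assume "\<nu> s = 0 \<longrightarrow> \<omega> s = 0"
    then show "ennreal (a s * b s) = ennreal (\<omega> s) * indicator {r..<1} s"
      by (cases "\<nu> s = 0") (auto simp: a_def b_def split: split_indicator)
  qed
  also have "(\<integral>\<^sup>+s. ennreal (a s powr p) \<partial>lebesgue_on {0..<1}) = ennreal (tail \<nu> r)"
    unfolding tail_I[OF v] using p radial_weight_nonneg[OF v]
    by (intro nn_integral_cong) (auto simp: a_def powr_powr space_restrict_space split: split_indicator)
  finally show ?thesis using T by (simp add: epowr_ennreal ennreal_mult[symmetric])
qed

lemma sigma_mass_antimono:
  assumes "0 \<le> r" "r \<le> t" shows "sigma_mass p \<omega> \<nu> t \<le> sigma_mass p \<omega> \<nu> r"
  unfolding sigma_mass_def
  using assms sets_lebesgue_on_Ico[of r 1]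
  by (intro finite_measure.finite_measure_mono[OF finite_sigma_measure]) auto

lemma sigma_mass_pos:
  assumes "0 \<le> r" "r < 1" shows "0 < sigma_mass p \<omega> \<nu> r"
proof (rule ccontr)
  assume "\<not> 0 < sigma_mass p \<omega> \<nu> r"
  define t where "t = max r (1/2)"
  have t: "1/2 \<le> t" "t < 1" "r \<le> t" using assms by (auto simp: t_def)
  have T: "0 < tail \<omega> t" "0 < tail \<nu> t" using tail_pos w v t by auto
  \<comment> \<open>This makes Y^(p - 1) tail \<nu> t equal to half of (tail \<omega> t)^p. With a
    vanishing \<sigma>-mass, Hoelder's inequality would then contradict the positivity of tail
    \<omega> t.\<close>
  define Y where "Y = (tail \<omega> t powr p / (2 * tail \<nu> t)) powr (1 / (p - 1))"
  have Y: "0 < Y" using T by (simp add: Y_def)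
  have "sigma_mass p \<omega> \<nu> t \<le> Y"
    using sigma_mass_antimono[OF assms(1) t(3)] \<open>\<not> 0 < sigma_mass p \<omega> \<nu> r\<close> Y by linarith
  then have "tail \<omega> t powr p \<le> Y powr (p - 1) * tail \<nu> t" using t Y by (intro tail_power_le)
  also have "Y powr (p - 1) = tail \<omega> t powr p / (2 * tail \<nu> t)" using p T by (simp add: Y_def powr_powr)
  also have "\<dots> * tail \<nu> t = tail \<omega> t powr p / 2" using T by simp
  finally show False using T by simp
qed

text \<open>The Muckenhoupt condition solved for the factor with \<sigma>; 2^(1/p') stems from the
  doubled density. At r = 0, which the supremum omits, the \<nu>-mass is 0 and the bound for the
  whole \<sigma>-mass is used.\<close>

lemma sigma_mass_bound:
  assumes r: "0 \<le> r" "r < 1"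
  shows "sigma_mass p \<omega> \<nu> r powr (1 / conj_exp p) \<le> 2 powr (1 / conj_exp p) * M * (1 + nu_mass p \<omega> \<nu> r) powr (- (1 / p))"
proof -
  have q: "1 < conj_exp p" by (rule conj_exp_pos[OF p])
  have S0: "0 \<le> sigma_mass p \<omega> \<nu> r" using sigma_mass_pos[OF r] by simp
  have V0: "0 \<le> nu_mass p \<omega> \<nu> r" by (rule nu_mass_nonneg)
  have "(1 + nu_mass p \<omega> \<nu> r) powr (1 / p) * (sigma_mass p \<omega> \<nu> r / 2) powr (1 / conj_exp p) \<le> M"
  proof (cases "r = 0")
    case True
    have n0: "nu_mass p \<omega> \<nu> 0 = 0"
    proof -
      have "ennreal (nu_mass p \<omega> \<nu> 0) = (\<integral>\<^sup>+s\<in>{0..0}. ennreal (\<nu> s / tail \<omega> s powr p * s) \<partial>lebesgue)"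
        using emeasure_nu[of 0] by simp
      also have "\<dots> = (\<integral>\<^sup>+s. 0 \<partial>(lebesgue::real measure))" by (intro nn_integral_cong) (auto split: split_indicator)
      finally show ?thesis using nu_mass_nonneg by (simp add: ennreal_eq_0_iff antisym)
    qed
    have "ennreal (sigma_mass p \<omega> \<nu> 0) \<le> ennreal (2 * M powr conj_exp p)"
      using emeasure_sigma_le[of 0] by (simp add: emeasure_sigma_mass)
    then have "sigma_mass p \<omega> \<nu> 0 / 2 \<le> M powr conj_exp p" using S0 True by (simp add: ennreal_le_iff)
    then have "(sigma_mass p \<omega> \<nu> 0 / 2) powr (1 / conj_exp p) \<le> (M powr conj_exp p) powr (1 / conj_exp p)"
      using S0 True q by (intro powr_mono2) auto
    then show ?thesis using True q M by (simp add: n0 powr_powr)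
  next
    case False
    have "ennreal (sigma_mass p \<omega> \<nu> r) = 2 * sigma_tail p \<omega> \<nu> r"
      using emeasure_sigma[OF r] by (simp add: emeasure_sigma_mass)
    moreover obtain x where x: "sigma_tail p \<omega> \<nu> r = ennreal x" "0 \<le> x"
      using sigma_tail_le[of r] False r by (cases "sigma_tail p \<omega> \<nu> r") (auto simp: top_unique)
    ultimately have "ennreal (sigma_mass p \<omega> \<nu> r) = ennreal (2 * x)" by (simp add: ennreal_mult)
    then have xs: "x = sigma_mass p \<omega> \<nu> r / 2" using S0 x by (simp add: ennreal_inj)
    have e: "(\<integral>\<^sup>+s\<in>{0..r}. ennreal (\<nu> s / tail \<omega> s powr p * s) \<partial>lebesgue) + 1 = ennreal (1 + nu_mass p \<omega> \<nu> r)"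
      unfolding emeasure_nu(1)[OF r, symmetric] emeasure_nu(2)[OF r] using V0 by (simp add: add.commute)
    have "0 < r" using False r by simp
    then have "ennreal ((1 + nu_mass p \<omega> \<nu> r) powr (1 / p)) * ennreal (x powr (1 / conj_exp p)) \<le> ennreal M"
      using M_bound[OF _ r(2), unfolded e x(1)] x V0 by (simp add: epowr_ennreal del: ennreal_plus)
    then show ?thesis using M(2) unfolding xs by (simp add: ennreal_mult[symmetric] ennreal_le_iff)
  qed
  then have "sigma_mass p \<omega> \<nu> r powr (1 / conj_exp p) * (1 + nu_mass p \<omega> \<nu> r) powr (1 / p) \<le> 2 powr (1 / conj_exp p) * M"
    using S0 by (simp add: powr_divide field_simps)
  then show ?thesis using V0 by (simp add: powr_minus field_simps)
qed

lemma nu_mass_mono: "0 \<le> r \<Longrightarrow> r \<le> t \<Longrightarrow> t < 1 \<Longrightarrow> nu_mass p \<omega> \<nu> r \<le> nu_mass p \<omega> \<nu> t"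
proof -
  assume r: "0 \<le> r" "r \<le> t" "t < 1"
  have "emeasure (nu_measure p \<omega> \<nu>) {0..r} \<le> emeasure (nu_measure p \<omega> \<nu>) {0..t}"
    using r sets_lebesgue_on_Icc[of 0 t] by (intro emeasure_mono) auto
  then show ?thesis using r emeasure_nu(2)[of r] emeasure_nu(2)[of t] nu_mass_nonneg by (simp add: ennreal_le_iff)
qed

lemma nu_mass_measurable: "nu_mass p \<omega> \<nu> \<in> borel_measurable (lebesgue_on {0..<1})"
  by (intro mono_on_measurable_lebesgue_on mono_onI) (auto intro: nu_mass_mono)

lemma sigma_mass_measurable: "sigma_mass p \<omega> \<nu> \<in> borel_measurable (lebesgue_on {0..<1})"
proof -
  have "(\<lambda>r. - sigma_mass p \<omega> \<nu> r) \<in> borel_measurable (lebesgue_on {0..<1})"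
    by (intro mono_on_measurable_lebesgue_on mono_onI) (auto intro: sigma_mass_antimono)
  then have "(\<lambda>r. - (- sigma_mass p \<omega> \<nu> r)) \<in> borel_measurable (lebesgue_on {0..<1})" by measurable
  then show ?thesis by simp
qed

end

lemma conj_exp_identities:
  assumes "1 < p"
  shows "1 / p + 1 / conj_exp p = 1" "(p - 1) / p = 1 / conj_exp p" "conj_exp p * (p - 1) = p"
    "p / conj_exp p = p - 1" "(conj_exp p - 1) * (p - 1) = 1" "1 - 1 / conj_exp p = 1 / p"
    "1 - 1 / p = 1 / conj_exp p"
  using assms by (auto simp: conj_exp_def field_simps)

section \<open>The two halves of the operator\<close>

context
  fixes p :: real and \<omega> \<nu> :: "real \<Rightarrow> real" and c M :: real
  assumes p: "1 < p" and w: "radial_weight \<omega>" and v: "radial_weight \<nu>"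
    and M: "M_const p \<omega> \<nu> \<le> ennreal M" and M0: "0 < M"
    and c: "0 < c" and k: "\<And>x. 0 \<le> x \<Longrightarrow> x < 1 \<Longrightarrow> kernel_mean \<omega> x \<le> c / tail \<omega> x"
begin

text \<open>Tails decrease and r s \<le> r. Both halves of the operator use the bound at the smaller
  of the two radii.\<close>

lemma kernel_mean_le_left:
  assumes "0 \<le> r" "r < 1" "0 \<le> s" "s < 1"
  shows "kernel_mean \<omega> (r * s) \<le> c / tail \<omega> r"
proof -
  note rs = mult_unit_interval[OF assms]
  have "r * s \<le> r" using assms by (simp add: mult_left_le)
  then have "tail \<omega> r \<le> tail \<omega> (r * s)" using rs assms by (intro tail_antimono[OF w]) auto
  then have "c / tail \<omega> (r * s) \<le> c / tail \<omega> r"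
    using c tail_pos[OF w rs] tail_pos[OF w assms(1,2)] by (intro divide_left_mono mult_pos_pos) auto
  then show ?thesis using k[OF rs] by linarith
qed

text \<open>The weight is h = S^(1/(p p')) with S the \<sigma>-mass. Then h^(-p') = S^(-1/p)
  integrates against \<sigma> to a multiple of S^(1/p'), which the Muckenhoupt condition bounds by a
  multiple of M (1 + V)^(-1/p). The power p - 1 of this integrates against the \<nu>-measure to a
  multiple of (1 + V)^(1/p), which the same condition cancels against h^p = S^(1/p'). The powers of
  M add up to (p - 1) + 1 = p.\<close>

lemma Schur_outer:
  assumes f: "f \<in> borel_measurable disc_area"
  shows "(\<integral>\<^sup>+z. ennreal (\<nu> (cmod z)) * epowr (\<integral>\<^sup>+\<zeta>. ennreal (cmod (f \<zeta>) * \<omega> (cmod \<zeta>))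
        * (ennreal (cmod (bergman_kernel \<omega> z \<zeta>)) * indicator {(r, s). r \<le> s} (cmod z, cmod \<zeta>)) \<partial>disc_area) p \<partial>disc_area)
    \<le> ennreal ((c * layer_const (1 / p) * 2 powr (1 / conj_exp p)) powr (p - 1)
          * (2 * c * layer_const (1 / conj_exp p) * 2 powr (1 / conj_exp p)) * M powr p)
      * (\<integral>\<^sup>+z. ennreal (cmod (f z) powr p * \<nu> (cmod z)) \<partial>disc_area)"
proof -
  let ?q = "conj_exp p"
  let ?R = "{(r, s). r \<le> s} :: (real \<times> real) set"
  note q = conj_exp_pos[OF p] and id = conj_exp_identities[OF p]
  define S where "S = sigma_mass p \<omega> \<nu>"
  define V where "V = nu_mass p \<omega> \<nu>"
  define k1 where "k1 = c * layer_const (1 / p) * 2 powr (1 / ?q)"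
  define h where "h s = S s powr (1 / (p * ?q))" for s
  \<comment> \<open>The factor 1 / tail comes from the kernel. Raised to the power p - 1 and joined
    by the kernel bound of the second integral, it yields the density of
    \<open>nu_measure\<close>.\<close>
  define A where "A r = k1 * M * (1 + V r) powr (- (1 / p)) / tail \<omega> r" for r
  have lp: "0 < layer_const (1 / p)" "0 < layer_const (1 / ?q)" using p q by (auto intro!: layer_const_pos)
  have k1: "0 < k1" using c lp by (simp add: k1_def)
  have S0: "0 < S s" if "0 \<le> s" "s < 1" for s
    unfolding S_def using sigma_mass_pos[OF p w v M _ that] M0 by simp
  have V0: "0 \<le> V s" for s unfolding V_def using nu_mass_nonneg[OF p w v M] M0 by simp
  have SV: "S s powr (1 / ?q) \<le> 2 powr (1 / ?q) * M * (1 + V s) powr (- (1 / p))" if "0 \<le> s" "s < 1" for s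
    unfolding S_def V_def using sigma_mass_bound[OF p w v M _ that] M0 by simp
  have [measurable]: "S \<in> borel_measurable (lebesgue_on {0..<1})" "V \<in> borel_measurable (lebesgue_on {0..<1})"
    unfolding S_def V_def using sigma_mass_measurable[OF p w v M] nu_mass_measurable[OF p w v M] M0 by auto
  note [measurable] = radial_weight_measurable[OF w] radial_weight_measurable[OF v] tail_measurable[OF w]
    sigma_real_measurable[OF w v] sigma_density_measurable[OF w v] nu_density_measurable[OF w v]
  have km [measurable]: "(\<lambda>s. kernel_mean \<omega> (r * s)) \<in> borel_measurable (lebesgue_on {0..<1})" for r
    by (intro borel_measurable_lebesgue_onI) measurable
  have R: "?R \<in> sets (borel \<Otimes>\<^sub>M borel)"
  proof -
    have "{x \<in> space (borel \<Otimes>\<^sub>M borel). fst x \<le> (snd x :: real)} \<in> sets (borel \<Otimes>\<^sub>M borel)" by measurable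
    moreover have "{x \<in> space (borel \<Otimes>\<^sub>M borel). fst x \<le> (snd x :: real)} = ?R" by (auto simp: space_pair_measure)
    ultimately show ?thesis by simp
  qed
  have RL [measurable]: "(\<lambda>s. indicator ?R (r, s) :: ennreal) \<in> borel_measurable (lebesgue_on {0..<1})"
    "(\<lambda>s. indicator ?R (s, r) :: ennreal) \<in> borel_measurable (lebesgue_on {0..<1})" for r
    using R by (intro borel_measurable_lebesgue_onI; measurable)+
  have IL [measurable]: "(\<lambda>s. indicator {a..<b} s :: ennreal) \<in> borel_measurable (lebesgue_on {0..<1})"
    "(\<lambda>s. indicator {a..b} s :: ennreal) \<in> borel_measurable (lebesgue_on {0..<1})" for a b :: real
    by (intro borel_measurable_lebesgue_onI; measurable)+
  have hm [measurable]: "h \<in> borel_measurable (lebesgue_on {0..<1})" unfolding h_def by measurable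
  have Am [measurable]: "A \<in> borel_measurable (lebesgue_on {0..<1})" unfolding A_def by measurable
  have "k1 powr (p - 1) * (2 * c * layer_const (1 / ?q) * 2 powr (1 / ?q)) * M powr p
      = (k1 * M) powr (p - 1) * (2 * c * layer_const (1 / ?q)) * (2 powr (1 / ?q) * M)"
  proof -
    have "M powr p = M powr (p - 1) * M" using M0 powr_add[of M "p - 1" 1] by simp
    then show ?thesis using k1 M0 by (simp add: powr_mult mult_ac)
  qed
  note B = this
  show ?thesis
    unfolding k1_def[symmetric] B
  proof (rule Schur_test_radial[OF p w v _ R hm _ Am _ _ _ f])
    show "AE s in lebesgue_on {0..<1}. \<nu> s = 0 \<longrightarrow> \<omega> s = 0" using ae_zero[OF p w v M] M0 by simp
    show "0 < h s" if "0 \<le> s" "s < 1" for s unfolding h_def using S0[OF that] by simp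
    show "0 < A r" if "0 \<le> r" "r < 1" for r
      unfolding A_def using k1 M0 V0[of r] tail_pos[OF w that] by (intro divide_pos_pos mult_pos_pos) auto
    fix r :: real assume r: "0 \<le> r" "r < 1"
    have Tr: "0 < tail \<omega> r" by (rule tail_pos[OF w r])
    have "(\<integral>\<^sup>+s. ennreal (sigma_real p \<omega> \<nu> s * h s powr (- ?q)) * indicator ?R (r, s) * ennreal (kernel_mean \<omega> (r * s)) \<partial>radial_measure)
        = (\<integral>\<^sup>+s. ennreal (2 * s) * (ennreal (sigma_real p \<omega> \<nu> s * h s powr (- ?q)) * indicator ?R (r, s) * ennreal (kernel_mean \<omega> (r * s))) \<partial>lebesgue_on {0..<1})"
      by (rule nn_integral_radial_on) measurable
    also have "\<dots> \<le> (\<integral>\<^sup>+s. ennreal (c / tail \<omega> r) * (ennreal (2 * s * sigma_real p \<omega> \<nu> s) * (ennreal (S s powr (- (1 / p))) * indicator {r..<1} s)) \<partial>lebesgue_on {0..<1})"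
    proof (intro nn_integral_mono)
      fix s assume "s \<in> space (lebesgue_on {0..<1::real})"
      then have s: "0 \<le> s" "s < 1" by (auto simp: space_restrict_space)
      show "ennreal (2 * s) * (ennreal (sigma_real p \<omega> \<nu> s * h s powr (- ?q)) * indicator ?R (r, s) * ennreal (kernel_mean \<omega> (r * s)))
          \<le> ennreal (c / tail \<omega> r) * (ennreal (2 * s * sigma_real p \<omega> \<nu> s) * (ennreal (S s powr (- (1 / p))) * indicator {r..<1} s))"
      proof (cases "r \<le> s")
        case True
        have "1 / (p * ?q) * - ?q = - (1 / p)" using q by simp
        then have hs: "h s powr (- ?q) = S s powr (- (1 / p))" unfolding h_def powr_powr by simp
        have "ennreal (kernel_mean \<omega> (r * s)) \<le> ennreal (c / tail \<omega> r)"
          by (intro ennreal_leI kernel_mean_le_left r s)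
        then have "ennreal (2 * s) * (ennreal (sigma_real p \<omega> \<nu> s) * ennreal (S s powr (- (1 / p)))) * ennreal (kernel_mean \<omega> (r * s))
            \<le> ennreal (2 * s) * (ennreal (sigma_real p \<omega> \<nu> s) * ennreal (S s powr (- (1 / p)))) * ennreal (c / tail \<omega> r)"
          by (intro mult_left_mono) auto
        then show ?thesis using True s sigma_real_nonneg[of p \<omega> \<nu> s] by (simp add: hs ennreal_mult mult_ac)
      qed simp
    qed
    also have "\<dots> = ennreal (c / tail \<omega> r) * (\<integral>\<^sup>+s. ennreal (2 * s * sigma_real p \<omega> \<nu> s) * (ennreal (S s powr (- (1 / p))) * indicator {r..<1} s) \<partial>lebesgue_on {0..<1})"
      by (intro nn_integral_cmult) measurable
    also have "(\<integral>\<^sup>+s. ennreal (2 * s * sigma_real p \<omega> \<nu> s) * (ennreal (S s powr (- (1 / p))) * indicator {r..<1} s) \<partial>lebesgue_on {0..<1})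
        = (\<integral>\<^sup>+s. ennreal (S s powr (- (1 / p))) * indicator {r..<1} s \<partial>sigma_measure p \<omega> \<nu>)"
      unfolding sigma_measure_def by (intro nn_integral_density[symmetric]) measurable
    also have "\<dots> \<le> ennreal (layer_const (1 / p) * S r powr (1 - 1 / p))"
      by (rule tail_power_integral) (use p r S0 emeasure_sigma_mass[OF p w v M] M0 in \<open>auto simp: S_def\<close>)
    finally have "(\<integral>\<^sup>+s. ennreal (sigma_real p \<omega> \<nu> s * h s powr (- ?q)) * indicator ?R (r, s) * ennreal (kernel_mean \<omega> (r * s)) \<partial>radial_measure)
        \<le> ennreal (c / tail \<omega> r) * ennreal (layer_const (1 / p) * S r powr (1 - 1 / p))"
      by (rule meta_mp) (rule mult_left_mono, simp_all)
    also have "\<dots> = ennreal (c / tail \<omega> r * (layer_const (1 / p) * S r powr (1 / ?q)))"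
      using c Tr lp unfolding id(7) by (intro ennreal_mult[symmetric]) auto
    also have "\<dots> \<le> ennreal (c / tail \<omega> r * (layer_const (1 / p) * (2 powr (1 / ?q) * M * (1 + V r) powr (- (1 / p)))))"
      using c Tr lp by (intro ennreal_leI mult_left_mono SV r) auto
    also have "\<dots> = ennreal (A r)" by (simp add: A_def k1_def mult_ac)
    finally show "(\<integral>\<^sup>+s. ennreal (sigma_real p \<omega> \<nu> s * h s powr (- ?q)) * indicator ?R (r, s) * ennreal (kernel_mean \<omega> (r * s)) \<partial>radial_measure) \<le> ennreal (A r)" .
  next
    fix s :: real assume s: "0 \<le> s" "s < 1"
    define b where "b = (k1 * M) powr (p - 1) * (2 * c)"
    have b: "0 < b" using k1 M0 c by (simp add: b_def)
    have "(\<integral>\<^sup>+r. ennreal (\<nu> r * A r powr (p - 1)) * indicator ?R (r, s) * ennreal (kernel_mean \<omega> (s * r)) \<partial>radial_measure)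
        = (\<integral>\<^sup>+r. ennreal (2 * r) * (ennreal (\<nu> r * A r powr (p - 1)) * indicator ?R (r, s) * ennreal (kernel_mean \<omega> (s * r))) \<partial>lebesgue_on {0..<1})"
      by (rule nn_integral_radial_on) measurable
    also have "\<dots> \<le> (\<integral>\<^sup>+r. ennreal b * (ennreal (\<nu> r / tail \<omega> r powr p * r) * (ennreal ((1 + V r) powr (- (1 / ?q))) * indicator {0..s} r)) \<partial>lebesgue_on {0..<1})"
    proof (intro nn_integral_mono)
      fix r assume "r \<in> space (lebesgue_on {0..<1::real})"
      then have r: "0 \<le> r" "r < 1" by (auto simp: space_restrict_space)
      have Tr: "0 < tail \<omega> r" by (rule tail_pos[OF w r])
      have v0: "0 \<le> \<nu> r" by (rule radial_weight_nonneg[OF v r])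
      show "ennreal (2 * r) * (ennreal (\<nu> r * A r powr (p - 1)) * indicator ?R (r, s) * ennreal (kernel_mean \<omega> (s * r)))
          \<le> ennreal b * (ennreal (\<nu> r / tail \<omega> r powr p * r) * (ennreal ((1 + V r) powr (- (1 / ?q))) * indicator {0..s} r))"
      proof (cases "r \<le> s")
        case True
        have "(1 + V r) powr (- (1 / p) * (p - 1)) = (1 + V r) powr (- (1 / ?q))"
          using id(2) by simp
        then have Ap: "A r powr (p - 1) = (k1 * M) powr (p - 1) * (1 + V r) powr (- (1 / ?q)) / tail \<omega> r powr (p - 1)"
          unfolding A_def using k1 M0 V0[of r] Tr by (simp add: powr_divide powr_mult powr_powr)
        have "2 * r * (\<nu> r * A r powr (p - 1) * kernel_mean \<omega> (s * r)) \<le> 2 * r * (\<nu> r * A r powr (p - 1) * (c / tail \<omega> r))"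
          using r v0 kernel_mean_le_left[OF r s] by (intro mult_left_mono) (auto simp: mult.commute)
        also have "\<dots> = b * (\<nu> r / tail \<omega> r powr p * r * (1 + V r) powr (- (1 / ?q)))"
        proof -
          have "tail \<omega> r powr p = tail \<omega> r powr (p - 1) * tail \<omega> r" using Tr powr_add[of "tail \<omega> r" "p - 1" 1] by simp
          then show ?thesis unfolding Ap b_def by simp
        qed
        finally have "ennreal (2 * r * (\<nu> r * A r powr (p - 1) * kernel_mean \<omega> (s * r)))
            \<le> ennreal (b * (\<nu> r / tail \<omega> r powr p * r * (1 + V r) powr (- (1 / ?q))))" by (rule ennreal_leI)
        moreover have "ennreal (2 * r * (\<nu> r * A r powr (p - 1) * kernel_mean \<omega> (s * r)))
            = ennreal (2 * r) * (ennreal (\<nu> r * A r powr (p - 1)) * ennreal (kernel_mean \<omega> (s * r)))"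
          using r v0 kernel_mean_nonneg[of \<omega> "s * r"] by (simp add: ennreal_mult del: times_divide_eq_left times_divide_eq_right)
        moreover have "ennreal (b * (\<nu> r / tail \<omega> r powr p * r * (1 + V r) powr (- (1 / ?q))))
            = ennreal b * (ennreal (\<nu> r / tail \<omega> r powr p * r) * ennreal ((1 + V r) powr (- (1 / ?q))))"
          using b r v0 by (simp only: ennreal_mult less_imp_le mult_nonneg_nonneg divide_nonneg_nonneg powr_ge_zero)
        ultimately show ?thesis using True r by simp
      qed simp
    qed
    also have "\<dots> = ennreal b * (\<integral>\<^sup>+r. ennreal (\<nu> r / tail \<omega> r powr p * r) * (ennreal ((1 + V r) powr (- (1 / ?q))) * indicator {0..s} r) \<partial>lebesgue_on {0..<1})"
      by (intro nn_integral_cmult) measurable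
    also have "(\<integral>\<^sup>+r. ennreal (\<nu> r / tail \<omega> r powr p * r) * (ennreal ((1 + V r) powr (- (1 / ?q))) * indicator {0..s} r) \<partial>lebesgue_on {0..<1})
        = (\<integral>\<^sup>+r. ennreal ((1 + V r) powr (- (1 / ?q))) * indicator {0..s} r \<partial>nu_measure p \<omega> \<nu>)"
      unfolding nu_measure_def by (intro nn_integral_density[symmetric]) measurable
    also have "\<dots> \<le> ennreal (layer_const (1 / ?q) * (1 + V s) powr (1 - 1 / ?q))"
      by (rule head_power_integral) (use p q s V0 emeasure_nu(2)[OF p w v M] M0 in \<open>auto simp: V_def\<close>)
    finally have "(\<integral>\<^sup>+r. ennreal (\<nu> r * A r powr (p - 1)) * indicator ?R (r, s) * ennreal (kernel_mean \<omega> (s * r)) \<partial>radial_measure)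
        \<le> ennreal b * ennreal (layer_const (1 / ?q) * (1 + V s) powr (1 - 1 / ?q))"
      by (rule meta_mp) (rule mult_left_mono, simp_all)
    also have "\<dots> = ennreal (b * (layer_const (1 / ?q) * (1 + V s) powr (1 / p)))"
      using b lp unfolding id(6) by (intro ennreal_mult[symmetric]) auto
    finally have "(\<integral>\<^sup>+r. ennreal (\<nu> r * A r powr (p - 1)) * indicator ?R (r, s) * ennreal (kernel_mean \<omega> (s * r)) \<partial>radial_measure) * ennreal (h s powr p)
        \<le> ennreal (b * (layer_const (1 / ?q) * (1 + V s) powr (1 / p))) * ennreal (h s powr p)"
      by (intro mult_right_mono) auto
    also have "\<dots> = ennreal (b * (layer_const (1 / ?q) * (1 + V s) powr (1 / p)) * S s powr (1 / ?q))"
    proof -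
      have "1 / (p * ?q) * p = 1 / ?q" using p by simp
      then have "h s powr p = S s powr (1 / ?q)" unfolding h_def powr_powr by simp
      then show ?thesis using b lp by (simp add: ennreal_mult)
    qed
    also have "\<dots> \<le> ennreal (b * (layer_const (1 / ?q) * (1 + V s) powr (1 / p)) * (2 powr (1 / ?q) * M * (1 + V s) powr (- (1 / p))))"
      using b lp by (intro ennreal_leI mult_left_mono SV s) auto
    also have "\<dots> = ennreal ((k1 * M) powr (p - 1) * (2 * c * layer_const (1 / ?q)) * (2 powr (1 / ?q) * M))"
    proof -
      have one: "(1 + V s) powr (1 / p) * (1 + V s) powr (- (1 / p)) = 1"
        using V0[of s] by (simp add: powr_add[symmetric])
      have gen: "b * (l * x) * (t * y) = (k1 * M) powr (p - 1) * (2 * c * l) * t * (x * y)" for l x t y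
        by (simp add: b_def mult_ac)
      show ?thesis by (simp only: gen one mult_1_right)
    qed
    finally show "(\<integral>\<^sup>+r. ennreal (\<nu> r * A r powr (p - 1)) * indicator ?R (r, s) * ennreal (kernel_mean \<omega> (s * r)) \<partial>radial_measure) * ennreal (h s powr p)
        \<le> ennreal ((k1 * M) powr (p - 1) * (2 * c * layer_const (1 / ?q)) * (2 powr (1 / ?q) * M))" .
  qed
qed

lemma kernel_mean_le_right:
  assumes "0 \<le> r" "r < 1" "0 \<le> s" "s < 1"
  shows "kernel_mean \<omega> (r * s) \<le> c / tail \<omega> s"
  using kernel_mean_le_left[OF assms(3,4,1,2)] by (simp add: mult.commute)

text \<open>Inserting 1 + V \<ge> e tail \<nu> / (tail \<omega>)^p into the Muckenhoupt condition
  bounds the \<sigma>-mass by a multiple of (tail \<omega>)^p' (tail \<nu>)^(-2 \<gamma>), where 2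
  \<gamma> = p' / p. Over one step the powers of tail \<omega> cancel by doubling, and (tail
  \<nu>)^(-\<gamma>) is left. Halving the exponent p' / p is what leaves this negative power, which
  lower doubling of \<nu> sums geometrically.\<close>

lemma sigma_tail_integral_growth:
  fixes A K L e \<gamma> :: real
  defines "\<gamma> \<equiv> conj_exp p / (2 * p)"
  assumes A: "1 \<le> A" "\<And>r t. 0 \<le> r \<Longrightarrow> r < 1 \<Longrightarrow> 0 \<le> t \<Longrightarrow> t < 1 \<Longrightarrow> 1 - r \<le> K * (1 - t) \<Longrightarrow> tail \<omega> r \<le> A * tail \<omega> t"
    and KL: "lower_doubling_with K L \<nu>"
    and e: "0 < e" "\<And>r. 0 \<le> r \<Longrightarrow> r < 1 \<Longrightarrow> e * tail \<nu> r / tail \<omega> r powr p \<le> 1 + nu_mass p \<omega> \<nu> r"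
    and r: "0 \<le> r" "r < 1"
  shows "(\<integral>\<^sup>+s. ennreal (tail \<omega> s powr (- conj_exp p) * tail \<nu> s powr \<gamma>) * indicator {0..<r} s \<partial>sigma_measure p \<omega> \<nu>)
    \<le> ennreal (2 * M powr conj_exp p * e powr (- (2 * \<gamma>)) * A powr conj_exp p / (1 - L powr (- \<gamma>)) * tail \<nu> r powr (- \<gamma>))"
proof -
  let ?q = "conj_exp p"
  note q = conj_exp_pos[OF p] and id = conj_exp_identities[OF p]
  have K: "1 < K" and L: "1 < L" and lo: "\<And>r. 0 \<le> r \<Longrightarrow> r < 1 \<Longrightarrow> L * tail \<nu> (1 - (1 - r) / K) \<le> tail \<nu> r"
    using KL by (auto simp: lower_doubling_with_def)
  have \<gamma>: "0 < \<gamma>" using p q by (simp add: \<gamma>_def)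
  define S where "S = sigma_mass p \<omega> \<nu>"
  define V where "V = nu_mass p \<omega> \<nu>"
  define B where "B = 2 * M powr ?q * e powr (- (2 * \<gamma>)) * A powr ?q"
  have B0: "0 \<le> B" using M0 e by (simp add: B_def)
  have S0: "0 < S s" if "0 \<le> s" "s < 1" for s
    unfolding S_def using sigma_mass_pos[OF p w v M _ that] M0 by simp
  have V0: "0 \<le> V s" for s unfolding V_def using nu_mass_nonneg[OF p w v M] M0 by simp
  have SV: "S s powr (1 / ?q) \<le> 2 powr (1 / ?q) * M * (1 + V s) powr (- (1 / p))" if "0 \<le> s" "s < 1" for s
    unfolding S_def V_def using sigma_mass_bound[OF p w v M _ that] M0 by simp
  have S_le: "S s \<le> 2 * M powr ?q * e powr (- (2 * \<gamma>)) * (tail \<omega> s powr ?q * tail \<nu> s powr (- (2 * \<gamma>)))" if s: "0 \<le> s" "s < 1" for s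
  proof -
    have T: "0 < tail \<omega> s" "0 < tail \<nu> s" using tail_pos w v s by auto
    have "S s = (S s powr (1 / ?q)) powr ?q" using S0[OF s] q by (simp add: powr_powr)
    also have "\<dots> \<le> (2 powr (1 / ?q) * M * (1 + V s) powr (- (1 / p))) powr ?q"
      using q by (intro powr_mono2 SV s) auto
    also have "\<dots> = 2 * M powr ?q * (1 + V s) powr (- (2 * \<gamma>))"
      using q M0 V0[of s] by (simp add: powr_mult powr_powr \<gamma>_def)
    also have "\<dots> \<le> 2 * M powr ?q * (e * tail \<nu> s / tail \<omega> s powr p) powr (- (2 * \<gamma>))"
      using e(2)[OF s] e(1) T \<gamma> by (intro mult_left_mono powr_mono_neg) (auto simp: V_def)
    also have "(e * tail \<nu> s / tail \<omega> s powr p) powr (- (2 * \<gamma>)) = e powr (- (2 * \<gamma>)) * (tail \<omega> s powr ?q * tail \<nu> s powr (- (2 * \<gamma>)))"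
    proof -
      have "p * - (2 * \<gamma>) = - ?q" using p by (simp add: \<gamma>_def)
      then have "(tail \<omega> s powr p) powr (- (2 * \<gamma>)) = tail \<omega> s powr (- ?q)" by (simp only: powr_powr)
      then show ?thesis using e(1) T by (simp add: powr_divide powr_mult powr_minus field_simps)
    qed
    finally show ?thesis by (simp only: mult.assoc)
  qed
  let ?F = "\<lambda>s. ennreal (tail \<omega> s powr (- ?q) * tail \<nu> s powr \<gamma>)"
  define N where "N r = (\<integral>\<^sup>+s. ?F s * indicator {0..<r} s \<partial>sigma_measure p \<omega> \<nu>)" for r
  note [measurable] = tail_measurable[OF w] tail_measurable[OF v]
  have Fm [measurable]: "?F \<in> borel_measurable (lebesgue_on {0..<1})" by measurable
  have IL [measurable]: "(\<lambda>s. indicator {a..<b} s :: ennreal) \<in> borel_measurable (lebesgue_on {0..<1})" for a b :: real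
    by (intro borel_measurable_lebesgue_onI; measurable)
  have Fm': "(\<lambda>s. ?F s * indicator {a..<b} s) \<in> borel_measurable (sigma_measure p \<omega> \<nu>)" for a b :: real
    unfolding measurable_cong_sets[OF sets_sigma_measure refl] by measurable
  have piece: "(\<integral>\<^sup>+s. ?F s * indicator {r'..<r} s \<partial>sigma_measure p \<omega> \<nu>) \<le> ennreal (B * tail \<nu> r powr (- \<gamma>))"
    if r: "0 \<le> r'" "r' \<le> r" "r < 1" "1 - r' \<le> K * (1 - r)" for r r'
  proof -
    have r1: "0 \<le> r" "r' < 1" using r by auto
    have T: "0 < tail \<omega> r" "0 < tail \<nu> r" "0 < tail \<omega> r'" "0 < tail \<nu> r'" using tail_pos w v r r1 by auto
    have TA: "tail \<omega> r' \<le> A * tail \<omega> r" using r r1 by (intro A(2)) auto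
    have Tv: "tail \<nu> r \<le> tail \<nu> r'" using r by (intro tail_antimono[OF v])
    have "(\<integral>\<^sup>+s. ?F s * indicator {r'..<r} s \<partial>sigma_measure p \<omega> \<nu>)
        \<le> (\<integral>\<^sup>+s. ennreal (tail \<omega> r powr (- ?q) * tail \<nu> r' powr \<gamma>) * indicator {r'..<1} s \<partial>sigma_measure p \<omega> \<nu>)"
    proof (intro nn_integral_mono)
      fix s
      show "?F s * indicator {r'..<r} s \<le> ennreal (tail \<omega> r powr (- ?q) * tail \<nu> r' powr \<gamma>) * indicator {r'..<1} s"
      proof (cases "s \<in> {r'..<r}")
        case True
        then have s: "0 \<le> s" "s < 1" "r' \<le> s" "s \<le> r" using r by auto
        have "tail \<omega> s powr (- ?q) * tail \<nu> s powr \<gamma> \<le> tail \<omega> r powr (- ?q) * tail \<nu> r' powr \<gamma>"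
          using T q \<gamma> tail_antimono[OF w s(1,4) r(3)] tail_antimono[OF v r(1) s(3,2)] tail_pos[OF v s(1,2)]
          by (intro mult_mono powr_mono_neg powr_mono2) auto
        then show ?thesis using True s by (simp add: ennreal_leI)
      qed simp
    qed
    also have "\<dots> = ennreal (tail \<omega> r powr (- ?q) * tail \<nu> r' powr \<gamma>) * ennreal (S r')"
      using r1 r sets_lebesgue_on_Ico[of r' 1]
      by (simp add: nn_integral_cmult_indicator emeasure_sigma_mass[OF p w v M less_imp_le[OF M0]] S_def)
    also have "\<dots> = ennreal (tail \<omega> r powr (- ?q) * tail \<nu> r' powr \<gamma> * S r')"
      using S0[OF r(1) r1(2)] by (intro ennreal_mult[symmetric]) auto
    also have "\<dots> \<le> ennreal (B * tail \<nu> r powr (- \<gamma>))"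
    proof (rule ennreal_leI)
      have "tail \<omega> r powr (- ?q) * tail \<nu> r' powr \<gamma> * S r'
          \<le> tail \<omega> r powr (- ?q) * tail \<nu> r' powr \<gamma> * (2 * M powr ?q * e powr (- (2 * \<gamma>)) * (tail \<omega> r' powr ?q * tail \<nu> r' powr (- (2 * \<gamma>))))"
        using r(1) r1(2) by (intro mult_left_mono S_le) auto
      also have "\<dots> \<le> tail \<omega> r powr (- ?q) * tail \<nu> r' powr \<gamma> * (2 * M powr ?q * e powr (- (2 * \<gamma>)) * ((A * tail \<omega> r) powr ?q * tail \<nu> r' powr (- (2 * \<gamma>))))"
        using T TA q by (intro mult_left_mono mult_right_mono powr_mono2) auto
      also have "\<dots> = B * (tail \<nu> r' powr \<gamma> * tail \<nu> r' powr (- (2 * \<gamma>))) * (tail \<omega> r powr (- ?q) * tail \<omega> r powr ?q)"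
        using A(1) T by (simp add: B_def powr_mult mult_ac)
      also have "tail \<omega> r powr (- ?q) * tail \<omega> r powr ?q = 1" using T by (simp add: powr_add[symmetric])
      also have "tail \<nu> r' powr \<gamma> * tail \<nu> r' powr (- (2 * \<gamma>)) = tail \<nu> r' powr (- \<gamma>)" by (simp add: powr_add[symmetric])
      also have "B * tail \<nu> r' powr (- \<gamma>) * 1 \<le> B * tail \<nu> r powr (- \<gamma>)"
        using B0 T Tv \<gamma> by (simp add: mult_left_mono powr_mono_neg)
      finally show "tail \<omega> r powr (- ?q) * tail \<nu> r' powr \<gamma> * S r' \<le> B * tail \<nu> r powr (- \<gamma>)" .
    qed
    finally show ?thesis .
  qed
  have "N r \<le> ennreal (B / (1 - L powr (- \<gamma>)) * tail \<nu> r powr (- \<gamma>))"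
  proof (rule geometric_growth[OF K, where N = N and \<Phi> = "\<lambda>r. tail \<nu> r powr (- \<gamma>)"])
    show "L powr (- \<gamma>) < 1" using L \<gamma> powr_less_mono[of "- \<gamma>" 0 L] by simp
    show "N r \<le> ennreal (B * tail \<nu> r powr (- \<gamma>))" if "0 \<le> r" "r < 1" "1 - K * (1 - r) < 0" for r
      unfolding N_def using that by (intro piece) auto
    show "N r \<le> N (1 - K * (1 - r)) + ennreal (B * tail \<nu> r powr (- \<gamma>))" if r: "r < 1" "0 \<le> 1 - K * (1 - r)" for r
    proof -
      let ?r = "1 - K * (1 - r)"
      have "1 * (1 - r) \<le> K * (1 - r)" using K r by (intro mult_right_mono) auto
      then have le: "?r \<le> r" by simp
      have "N r \<le> (\<integral>\<^sup>+s. ?F s * indicator {0..<?r} s + ?F s * indicator {?r..<r} s \<partial>sigma_measure p \<omega> \<nu>)"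
        unfolding N_def by (intro nn_integral_mono) (auto split: split_indicator)
      also have "\<dots> = N ?r + (\<integral>\<^sup>+s. ?F s * indicator {?r..<r} s \<partial>sigma_measure p \<omega> \<nu>)"
        unfolding N_def by (intro nn_integral_add Fm')
      also have "\<dots> \<le> N ?r + ennreal (B * tail \<nu> r powr (- \<gamma>))"
        using r le by (intro add_left_mono piece) auto
      finally show ?thesis .
    qed
    show "tail \<nu> (1 - K * (1 - r)) powr (- \<gamma>) \<le> L powr (- \<gamma>) * tail \<nu> r powr (- \<gamma>)" if r: "r < 1" "0 \<le> 1 - K * (1 - r)" for r
    proof -
      let ?r = "1 - K * (1 - r)"
      have r': "?r < 1" using K r by simp
      have "1 * (1 - r) \<le> K * (1 - r)" using K r by (intro mult_right_mono) auto
      also have "\<dots> \<le> 1" using r(2) by simp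
      finally have r0: "0 \<le> r" by simp
      have "1 - (1 - ?r) / K = r" using K by (simp add: field_simps)
      then have le: "L * tail \<nu> r \<le> tail \<nu> ?r" using lo[OF r(2) r'] by simp
      have T: "0 < tail \<nu> r" by (rule tail_pos[OF v r0 r(1)])
      have "tail \<nu> ?r powr (- \<gamma>) \<le> (L * tail \<nu> r) powr (- \<gamma>)"
        using le L T \<gamma> by (intro powr_mono_neg) auto
      also have "\<dots> = L powr (- \<gamma>) * tail \<nu> r powr (- \<gamma>)" using L T by (simp add: powr_mult)
      finally show ?thesis .
    qed
  qed (use B0 r in auto)
  then show ?thesis unfolding N_def B_def .
qed

text \<open>The weight is given by h^p' = (tail \<omega>)^(p' - 1) (tail \<nu>)^(-\<gamma>). With
  the kernel bound c / tail \<omega> s the first condition becomes the preceding growth estimate. In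
  the second, \<gamma> (p - 1) = 1/2 leads to \<nu> (tail \<nu>)^(-1/2), whose integral beyond s is
  at most a multiple of (tail \<nu> s)^(1/2); h^p = tail \<omega> (tail \<nu>)^(-1/2) cancels it
  together with the kernel factor.\<close>

lemma Schur_inner:
  fixes A K L e \<gamma> k2 :: real
  defines "\<gamma> \<equiv> conj_exp p / (2 * p)"
  defines "k2 \<equiv> c * (2 * e powr (- (2 * \<gamma>)) * A powr conj_exp p / (1 - L powr (- \<gamma>)))"
  assumes A: "1 \<le> A" "\<And>r t. 0 \<le> r \<Longrightarrow> r < 1 \<Longrightarrow> 0 \<le> t \<Longrightarrow> t < 1 \<Longrightarrow> 1 - r \<le> K * (1 - t) \<Longrightarrow> tail \<omega> r \<le> A * tail \<omega> t"
    and KL: "lower_doubling_with K L \<nu>"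
    and e: "0 < e" "\<And>r. 0 \<le> r \<Longrightarrow> r < 1 \<Longrightarrow> e * tail \<nu> r / tail \<omega> r powr p \<le> 1 + nu_mass p \<omega> \<nu> r"
    and f: "f \<in> borel_measurable disc_area"
  shows "(\<integral>\<^sup>+z. ennreal (\<nu> (cmod z)) * epowr (\<integral>\<^sup>+\<zeta>. ennreal (cmod (f \<zeta>) * \<omega> (cmod \<zeta>))
        * (ennreal (cmod (bergman_kernel \<omega> z \<zeta>)) * indicator {(r, s). s < r} (cmod z, cmod \<zeta>)) \<partial>disc_area) p \<partial>disc_area)
    \<le> ennreal (k2 powr (p - 1) * (2 * c * layer_const (1 / 2)) * M powr p)
      * (\<integral>\<^sup>+z. ennreal (cmod (f z) powr p * \<nu> (cmod z)) \<partial>disc_area)"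
proof -
  let ?q = "conj_exp p"
  let ?R = "{(r, s). s < r} :: (real \<times> real) set"
  note q = conj_exp_pos[OF p] and id = conj_exp_identities[OF p]
  have L: "1 < L" using KL by (simp add: lower_doubling_with_def)
  have \<gamma>: "0 < \<gamma>" using p q by (simp add: \<gamma>_def)
  have \<gamma>p: "\<gamma> * (p - 1) = 1 / 2" using p by (simp add: \<gamma>_def conj_exp_def field_simps)
  have "L powr (- \<gamma>) < 1" using L \<gamma> powr_less_mono[of "- \<gamma>" 0 L] by simp
  then have k2: "0 < k2" using c e A by (auto simp: k2_def intro!: mult_pos_pos divide_pos_pos)
  define h where "h s = (tail \<omega> s powr (?q - 1) * tail \<nu> s powr (- \<gamma>)) powr (1 / ?q)" for s
  define D where "D r = k2 * M powr ?q * tail \<nu> r powr (- \<gamma>)" for r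
  note [measurable] = radial_weight_measurable[OF w] radial_weight_measurable[OF v] tail_measurable[OF w] tail_measurable[OF v]
    sigma_real_measurable[OF w v] sigma_density_measurable[OF w v]
  have km [measurable]: "(\<lambda>s. kernel_mean \<omega> (r * s)) \<in> borel_measurable (lebesgue_on {0..<1})" for r
    by (intro borel_measurable_lebesgue_onI) measurable
  have R: "?R \<in> sets (borel \<Otimes>\<^sub>M borel)"
  proof -
    have "{x \<in> space (borel \<Otimes>\<^sub>M borel). snd x < (fst x :: real)} \<in> sets (borel \<Otimes>\<^sub>M borel)" by measurable
    moreover have "{x \<in> space (borel \<Otimes>\<^sub>M borel). snd x < (fst x :: real)} = ?R" by (auto simp: space_pair_measure)
    ultimately show ?thesis by simp
  qed
  have RL [measurable]: "(\<lambda>s. indicator ?R (r, s) :: ennreal) \<in> borel_measurable (lebesgue_on {0..<1})"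
    "(\<lambda>s. indicator ?R (s, r) :: ennreal) \<in> borel_measurable (lebesgue_on {0..<1})" for r
    using R by (intro borel_measurable_lebesgue_onI; measurable)+
  have IL [measurable]: "(\<lambda>s. indicator {a..<b} s :: ennreal) \<in> borel_measurable (lebesgue_on {0..<1})" for a b :: real
    by (intro borel_measurable_lebesgue_onI; measurable)
  have two [measurable]: "(\<lambda>s. ennreal (2 * s)) \<in> borel_measurable (lebesgue_on {0..<1})"
    by (intro borel_measurable_lebesgue_onI) measurable
  have hm [measurable]: "h \<in> borel_measurable (lebesgue_on {0..<1})" unfolding h_def by measurable
  have Dm [measurable]: "D \<in> borel_measurable (lebesgue_on {0..<1})" unfolding D_def by measurable
  have T: "0 < tail \<omega> s" "0 < tail \<nu> s" if "0 \<le> s" "s < 1" for s using that tail_pos w v by auto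
  \<comment> \<open>As p' (p - 1) = p, the constant M enters with the power p here as well.\<close>
  have B: "k2 powr (p - 1) * (2 * c * layer_const (1 / 2)) * M powr p
      = (k2 * M powr ?q) powr (p - 1) * (2 * c * layer_const (1 / 2))"
    using k2 M0 by (simp add: powr_mult powr_powr id(3) mult_ac)
  show ?thesis
    unfolding B
  proof (rule Schur_test_radial[OF p w v _ R hm _ Dm _ _ _ f])
    show "AE s in lebesgue_on {0..<1}. \<nu> s = 0 \<longrightarrow> \<omega> s = 0" using ae_zero[OF p w v M] M0 by simp
    show "0 < h s" if "0 \<le> s" "s < 1" for s unfolding h_def using T[OF that] by simp
    show "0 < D r" if "0 \<le> r" "r < 1" for r
      unfolding D_def using k2 M0 T[OF that] by simp
    fix r :: real assume r: "0 \<le> r" "r < 1"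
    have "(\<integral>\<^sup>+s. ennreal (sigma_real p \<omega> \<nu> s * h s powr (- ?q)) * indicator ?R (r, s) * ennreal (kernel_mean \<omega> (r * s)) \<partial>radial_measure)
        = (\<integral>\<^sup>+s. ennreal (2 * s) * (ennreal (sigma_real p \<omega> \<nu> s * h s powr (- ?q)) * indicator ?R (r, s) * ennreal (kernel_mean \<omega> (r * s))) \<partial>lebesgue_on {0..<1})"
      by (rule nn_integral_radial_on) measurable
    also have "\<dots> \<le> (\<integral>\<^sup>+s. ennreal c * (ennreal (2 * s * sigma_real p \<omega> \<nu> s) * (ennreal (tail \<omega> s powr (- ?q) * tail \<nu> s powr \<gamma>) * indicator {0..<r} s)) \<partial>lebesgue_on {0..<1})"
    proof (intro nn_integral_mono)
      fix s assume "s \<in> space (lebesgue_on {0..<1::real})"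
      then have s: "0 \<le> s" "s < 1" by (auto simp: space_restrict_space)
      show "ennreal (2 * s) * (ennreal (sigma_real p \<omega> \<nu> s * h s powr (- ?q)) * indicator ?R (r, s) * ennreal (kernel_mean \<omega> (r * s)))
          \<le> ennreal c * (ennreal (2 * s * sigma_real p \<omega> \<nu> s) * (ennreal (tail \<omega> s powr (- ?q) * tail \<nu> s powr \<gamma>) * indicator {0..<r} s))"
      proof (cases "s < r")
        case True
        have s0: "0 \<le> sigma_real p \<omega> \<nu> s" by (rule sigma_real_nonneg)
        have "1 / ?q * - ?q = - 1" using q by simp
        then have "h s powr (- ?q) = (tail \<omega> s powr (?q - 1) * tail \<nu> s powr (- \<gamma>)) powr (- 1)"
          unfolding h_def powr_powr by simp
        also have "\<dots> = tail \<omega> s powr ((?q - 1) * (- 1)) * tail \<nu> s powr (- \<gamma> * (- 1))"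
          by (simp only: powr_mult powr_powr powr_ge_zero)
        also have "\<dots> = tail \<omega> s powr (- (?q - 1)) * tail \<nu> s powr \<gamma>" by simp
        finally have hs: "h s powr (- ?q) = tail \<omega> s powr (- (?q - 1)) * tail \<nu> s powr \<gamma>" .
        have ts: "tail \<omega> s powr (- (?q - 1)) / tail \<omega> s = tail \<omega> s powr (- ?q)"
          using T[OF s] powr_diff[of "tail \<omega> s" "- (?q - 1)" 1] by simp
        have "2 * s * (sigma_real p \<omega> \<nu> s * h s powr (- ?q) * kernel_mean \<omega> (r * s))
            \<le> 2 * s * (sigma_real p \<omega> \<nu> s * h s powr (- ?q) * (c / tail \<omega> s))"
          using s s0 by (intro mult_left_mono kernel_mean_le_right r) auto
        also have "\<dots> = c * (2 * s * sigma_real p \<omega> \<nu> s * ((tail \<omega> s powr (- (?q - 1)) / tail \<omega> s) * tail \<nu> s powr \<gamma>))"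
          unfolding hs by simp
        finally have "ennreal (2 * s * (sigma_real p \<omega> \<nu> s * h s powr (- ?q) * kernel_mean \<omega> (r * s)))
            \<le> ennreal (c * (2 * s * sigma_real p \<omega> \<nu> s * (tail \<omega> s powr (- ?q) * tail \<nu> s powr \<gamma>)))"
          unfolding ts by (rule ennreal_leI)
        moreover have "ennreal (2 * s * (sigma_real p \<omega> \<nu> s * h s powr (- ?q) * kernel_mean \<omega> (r * s)))
            = ennreal (2 * s) * (ennreal (sigma_real p \<omega> \<nu> s * h s powr (- ?q)) * ennreal (kernel_mean \<omega> (r * s)))"
          using s s0 kernel_mean_nonneg[of \<omega> "r * s"] by (simp add: ennreal_mult)
        moreover have "ennreal (c * (2 * s * sigma_real p \<omega> \<nu> s * (tail \<omega> s powr (- ?q) * tail \<nu> s powr \<gamma>)))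
            = ennreal c * (ennreal (2 * s * sigma_real p \<omega> \<nu> s) * ennreal (tail \<omega> s powr (- ?q) * tail \<nu> s powr \<gamma>))"
          using c s s0 by (simp add: ennreal_mult)
        ultimately show ?thesis using True s by simp
      qed simp
    qed
    also have "\<dots> = ennreal c * (\<integral>\<^sup>+s. ennreal (2 * s * sigma_real p \<omega> \<nu> s) * (ennreal (tail \<omega> s powr (- ?q) * tail \<nu> s powr \<gamma>) * indicator {0..<r} s) \<partial>lebesgue_on {0..<1})"
      by (intro nn_integral_cmult) measurable
    also have "(\<integral>\<^sup>+s. ennreal (2 * s * sigma_real p \<omega> \<nu> s) * (ennreal (tail \<omega> s powr (- ?q) * tail \<nu> s powr \<gamma>) * indicator {0..<r} s) \<partial>lebesgue_on {0..<1})
        = (\<integral>\<^sup>+s. ennreal (tail \<omega> s powr (- ?q) * tail \<nu> s powr \<gamma>) * indicator {0..<r} s \<partial>sigma_measure p \<omega> \<nu>)"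
      unfolding sigma_measure_def by (intro nn_integral_density[symmetric]) measurable
    also have "\<dots> \<le> ennreal (2 * M powr ?q * e powr (- (2 * \<gamma>)) * A powr ?q / (1 - L powr (- \<gamma>)) * tail \<nu> r powr (- \<gamma>))"
      unfolding \<gamma>_def by (rule sigma_tail_integral_growth[OF A KL e r])
    finally have "(\<integral>\<^sup>+s. ennreal (sigma_real p \<omega> \<nu> s * h s powr (- ?q)) * indicator ?R (r, s) * ennreal (kernel_mean \<omega> (r * s)) \<partial>radial_measure)
        \<le> ennreal c * ennreal (2 * M powr ?q * e powr (- (2 * \<gamma>)) * A powr ?q / (1 - L powr (- \<gamma>)) * tail \<nu> r powr (- \<gamma>))"
      by (rule meta_mp) (rule mult_left_mono, simp_all)
    also have "\<dots> = ennreal (c * (2 * M powr ?q * e powr (- (2 * \<gamma>)) * A powr ?q / (1 - L powr (- \<gamma>)) * tail \<nu> r powr (- \<gamma>)))"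
      using c by (intro ennreal_mult'[symmetric]) auto
    also have "\<dots> = ennreal (D r)" by (simp add: D_def k2_def mult_ac)
    finally show "(\<integral>\<^sup>+s. ennreal (sigma_real p \<omega> \<nu> s * h s powr (- ?q)) * indicator ?R (r, s) * ennreal (kernel_mean \<omega> (r * s)) \<partial>radial_measure) \<le> ennreal (D r)" .
  next
    fix s :: real assume s: "0 \<le> s" "s < 1"
    note Ts = T[OF s]
    define b where "b = (k2 * M powr ?q) powr (p - 1) * (2 * c) / tail \<omega> s"
    have b: "0 < b" using k2 M0 c Ts by (simp add: b_def)
    have "(\<integral>\<^sup>+r. ennreal (\<nu> r * D r powr (p - 1)) * indicator ?R (r, s) * ennreal (kernel_mean \<omega> (s * r)) \<partial>radial_measure)
        = (\<integral>\<^sup>+r. ennreal (2 * r) * (ennreal (\<nu> r * D r powr (p - 1)) * indicator ?R (r, s) * ennreal (kernel_mean \<omega> (s * r))) \<partial>lebesgue_on {0..<1})"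
      by (rule nn_integral_radial_on) measurable
    also have "\<dots> \<le> (\<integral>\<^sup>+r. ennreal b * (ennreal (\<nu> r) * (ennreal (tail \<nu> r powr (- (1 / 2))) * indicator {s..<1} r)) \<partial>lebesgue_on {0..<1})"
    proof (intro nn_integral_mono)
      fix r assume "r \<in> space (lebesgue_on {0..<1::real})"
      then have r: "0 \<le> r" "r < 1" by (auto simp: space_restrict_space)
      have v0: "0 \<le> \<nu> r" by (rule radial_weight_nonneg[OF v r])
      show "ennreal (2 * r) * (ennreal (\<nu> r * D r powr (p - 1)) * indicator ?R (r, s) * ennreal (kernel_mean \<omega> (s * r)))
          \<le> ennreal b * (ennreal (\<nu> r) * (ennreal (tail \<nu> r powr (- (1 / 2))) * indicator {s..<1} r))"
      proof (cases "s < r")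
        case True
        have "- \<gamma> * (p - 1) = - (1 / 2)" using \<gamma>p by simp
        then have Dp: "D r powr (p - 1) = (k2 * M powr ?q) powr (p - 1) * tail \<nu> r powr (- (1 / 2))"
          unfolding D_def using k2 M0 T[OF r] by (simp only: powr_mult powr_powr mult_nonneg_nonneg less_imp_le powr_ge_zero)
        have "2 * r * (\<nu> r * D r powr (p - 1) * kernel_mean \<omega> (s * r)) \<le> 2 * 1 * (\<nu> r * D r powr (p - 1) * (c / tail \<omega> s))"
          using r v0 c Ts kernel_mean_nonneg by (intro mult_mono kernel_mean_le_left s) auto
        also have "\<dots> = b * (\<nu> r * tail \<nu> r powr (- (1 / 2)))"
          unfolding Dp b_def by simp
        finally have "ennreal (2 * r * (\<nu> r * D r powr (p - 1) * kernel_mean \<omega> (s * r)))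
            \<le> ennreal (b * (\<nu> r * tail \<nu> r powr (- (1 / 2))))" by (rule ennreal_leI)
        moreover have "ennreal (2 * r * (\<nu> r * D r powr (p - 1) * kernel_mean \<omega> (s * r)))
            = ennreal (2 * r) * (ennreal (\<nu> r * D r powr (p - 1)) * ennreal (kernel_mean \<omega> (s * r)))"
          using r v0 kernel_mean_nonneg[of \<omega> "s * r"] by (simp add: ennreal_mult)
        moreover have "ennreal (b * (\<nu> r * tail \<nu> r powr (- (1 / 2))))
            = ennreal b * (ennreal (\<nu> r) * ennreal (tail \<nu> r powr (- (1 / 2))))"
          using b v0 by (simp add: ennreal_mult)
        ultimately show ?thesis using True r by simp
      qed simp
    qed
    also have "\<dots> = ennreal b * (\<integral>\<^sup>+r. ennreal (\<nu> r) * (ennreal (tail \<nu> r powr (- (1 / 2))) * indicator {s..<1} r) \<partial>lebesgue_on {0..<1})"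
      by (intro nn_integral_cmult) measurable
    also have "(\<integral>\<^sup>+r. ennreal (\<nu> r) * (ennreal (tail \<nu> r powr (- (1 / 2))) * indicator {s..<1} r) \<partial>lebesgue_on {0..<1})
        = (\<integral>\<^sup>+r. ennreal (tail \<nu> r powr (- (1 / 2))) * indicator {s..<1} r \<partial>weight_measure \<nu>)"
      by (intro nn_integral_weight_measure_density[OF v, symmetric]) measurable
    also have "\<dots> \<le> ennreal (layer_const (1 / 2) * tail \<nu> s powr (1 - 1 / 2))"
      by (rule tail_power_integral) (use s v tail_pos[OF v] emeasure_weight_measure[OF v] in \<open>auto simp: sets_weight_measure\<close>)
    finally have "(\<integral>\<^sup>+r. ennreal (\<nu> r * D r powr (p - 1)) * indicator ?R (r, s) * ennreal (kernel_mean \<omega> (s * r)) \<partial>radial_measure)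
        \<le> ennreal b * ennreal (layer_const (1 / 2) * tail \<nu> s powr (1 - 1 / 2))"
      by (rule meta_mp) (rule mult_left_mono, simp_all)
    then have "(\<integral>\<^sup>+r. ennreal (\<nu> r * D r powr (p - 1)) * indicator ?R (r, s) * ennreal (kernel_mean \<omega> (s * r)) \<partial>radial_measure) * ennreal (h s powr p)
        \<le> ennreal b * ennreal (layer_const (1 / 2) * tail \<nu> s powr (1 - 1 / 2)) * ennreal (h s powr p)"
      by (intro mult_right_mono) auto
    also have "\<dots> = ennreal (b * (layer_const (1 / 2) * tail \<nu> s powr (1 - 1 / 2)) * h s powr p)"
      using b layer_const_pos[of "1 / 2"] by (simp add: ennreal_mult)
    also have "b * (layer_const (1 / 2) * tail \<nu> s powr (1 - 1 / 2)) * h s powr p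
        = (k2 * M powr ?q) powr (p - 1) * (2 * c * layer_const (1 / 2))"
    proof -
      have hp: "h s powr p = tail \<omega> s * tail \<nu> s powr (- (1 / 2))"
      proof -
        have 1: "1 / ?q * p = p - 1" using id(4) by simp
        have 2: "(?q - 1) * (p - 1) = 1" "- \<gamma> * (p - 1) = - (1 / 2)" using id(5) \<gamma>p by simp_all
        have "h s powr p = (tail \<omega> s powr (?q - 1) * tail \<nu> s powr (- \<gamma>)) powr (p - 1)"
          unfolding h_def powr_powr 1 ..
        also have "\<dots> = tail \<omega> s powr ((?q - 1) * (p - 1)) * tail \<nu> s powr (- \<gamma> * (p - 1))"
          by (simp only: powr_mult powr_powr powr_ge_zero)
        finally show ?thesis unfolding 2 using Ts by simp
      qed
      have one: "tail \<nu> s powr (1 - 1 / 2) * tail \<nu> s powr (- (1 / 2)) = 1" using Ts by (simp add: powr_add[symmetric])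
      have "b * (l * x) * (tail \<omega> s * y) = (k2 * M powr ?q) powr (p - 1) * (2 * c * l) * (x * y)" for l x y
        using Ts by (simp add: b_def)
      then show ?thesis unfolding hp by (simp only: one mult_1_right)
    qed
    finally show "(\<integral>\<^sup>+r. ennreal (\<nu> r * D r powr (p - 1)) * indicator ?R (r, s) * ennreal (kernel_mean \<omega> (s * r)) \<partial>radial_measure) * ennreal (h s powr p)
        \<le> ennreal ((k2 * M powr ?q) powr (p - 1) * (2 * c * layer_const (1 / 2)))" .
  qed
qed

end

section \<open>Constants depending only on the data of the weights\<close>

text \<open>By lower doubling, the \<nu>-mass between r' = 1 - K (1 - r) and r is at least (L - 1)
  tail \<nu> r, and on this interval tail \<omega> is comparable with tail \<omega> r. If r' < 1/2,
  then r stays away from 1, tail \<omega> r is at least a multiple of m, and the summand 1 is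
  enough.\<close>

lemma nu_mass_lower:
  assumes p: "1 < p" and C: "1 \<le> C" and K: "1 < K" and L: "1 < L" and m: "0 < m" "0 < m'"
  shows "\<exists>e>0. \<forall>\<omega> \<nu> M r. radial_weight \<omega> \<longrightarrow> upper_doubling_with C \<omega> \<longrightarrow> tail \<omega> 0 = m \<longrightarrow> radial_weight \<nu> \<longrightarrow>
    lower_doubling_with K L \<nu> \<longrightarrow> tail \<nu> 0 = m' \<longrightarrow> M_const p \<omega> \<nu> \<le> ennreal M \<longrightarrow> 0 \<le> M \<longrightarrow> 0 \<le> r \<longrightarrow> r < 1 \<longrightarrow>
    e * tail \<nu> r / tail \<omega> r powr p \<le> 1 + nu_mass p \<omega> \<nu> r"
proof -
  obtain A where A: "1 \<le> A" "\<And>\<omega> r t. radial_weight \<omega> \<Longrightarrow> upper_doubling_with C \<omega> \<Longrightarrow> 0 \<le> r \<Longrightarrow> r < 1 \<Longrightarrow> 0 \<le> t \<Longrightarrow> t < 1 \<Longrightarrow>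
      1 - r \<le> 2 * K * (1 - t) \<Longrightarrow> tail \<omega> r \<le> A * tail \<omega> t"
    using upper_doubling_ratio[of C "2 * K"] by blast
  \<comment> \<open>The first number serves r' \<ge> 1/2, where the factor s of the density costs
    1/2; the second serves r' < 1/2, with tail \<nu> r bounded by m'.\<close>
  define e where "e = min ((L - 1) / (2 * A powr p)) (1 / (m' * (A / m) powr p))"
  have e: "0 < e" using L A(1) m by (simp add: e_def)
  show ?thesis
  proof (intro exI[of _ e] conjI e allI impI)
    fix \<omega> \<nu> M and r :: real
    assume w: "radial_weight \<omega>" and Cw: "upper_doubling_with C \<omega>" and mw: "tail \<omega> 0 = m"
      and v: "radial_weight \<nu>" and KL: "lower_doubling_with K L \<nu>" and mv: "tail \<nu> 0 = m'"
      and M: "M_const p \<omega> \<nu> \<le> ennreal M" "0 \<le> M" and r: "0 \<le> r" "r < 1"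
    have T: "0 < tail \<omega> r" "0 < tail \<nu> r" using tail_pos w v r by auto
    have V0: "0 \<le> nu_mass p \<omega> \<nu> r" by (rule nu_mass_nonneg[OF p w v M])
    define r' where "r' = 1 - K * (1 - r)"
    show "e * tail \<nu> r / tail \<omega> r powr p \<le> 1 + nu_mass p \<omega> \<nu> r"
    proof (cases "1/2 \<le> r'")
      \<comment> \<open>Here K (1 - r) > 1/2, so the tails of \<omega> at 0 and at r may be compared
        directly.\<close>
      case False
      then have "1 - 0 \<le> 2 * K * (1 - r)" by (simp add: r'_def)
      then have "m \<le> A * tail \<omega> r" unfolding mw[symmetric] using r by (intro A(2) w Cw) auto
      then have "1 \<le> A / m * tail \<omega> r" using m by (simp add: field_simps)
      then have "1 powr p \<le> (A / m * tail \<omega> r) powr p" using p by (intro powr_mono2) auto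
      moreover have "(A / m * tail \<omega> r) powr p = (A / m) powr p * tail \<omega> r powr p"
        using A(1) m T by (intro powr_mult)
      ultimately have 1: "1 \<le> (A / m) powr p * tail \<omega> r powr p" by (simp only: powr_one_eq_one)
      have "e * tail \<nu> r \<le> 1 / (m' * (A / m) powr p) * m'"
        using e T m A(1) tail_antimono[OF v order_refl r] mv
        by (intro mult_mono) (auto simp: e_def)
      also have "\<dots> = 1 / (A / m) powr p" using m by simp
      also have "\<dots> \<le> tail \<omega> r powr p" using 1 A(1) m by (simp add: field_simps)
      finally have "e * tail \<nu> r / tail \<omega> r powr p \<le> 1" using T by simp
      then show ?thesis using V0 by simp
    next
      case True
      have "1 * (1 - r) \<le> K * (1 - r)" using K r by (intro mult_right_mono) auto
      also have "\<dots> = 1 - r'" by (simp add: r'_def)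
      finally have "r' \<le> r" by simp
      then have r': "0 \<le> r'" "r' \<le> r" "r' < 1" using True r by auto
      have T': "0 < tail \<omega> r'" "0 < tail \<nu> r'" using tail_pos w v r' by auto
      have TA: "tail \<omega> r' \<le> A * tail \<omega> r"
      proof -
        have "1 - r' = K * (1 - r)" by (simp add: r'_def)
        also have "\<dots> \<le> 2 * K * (1 - r)" using K r by (intro mult_right_mono) auto
        finally show ?thesis using r r' by (intro A(2) w Cw)
      qed
      have "1 - (1 - r') / K = r" using K by (simp add: r'_def field_simps)
      then have lo: "L * tail \<nu> r \<le> tail \<nu> r'"
        using KL r' unfolding lower_doubling_with_def by (metis atLeastLessThan_iff)
      interpret v: finite_measure "weight_measure \<nu>" by (rule finite_weight_measure[OF v])
      have I: "{r'..<r} \<in> sets (lebesgue_on {0..<1})" using r' r by (intro sets_lebesgue_on_Ico) auto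
      note [measurable] = radial_weight_measurable[OF v] I
      let ?x = "1 / (2 * tail \<omega> r' powr p)"
      have "ennreal (?x * measure (weight_measure \<nu>) {r'..<r}) = ennreal ?x * (\<integral>\<^sup>+s. indicator {r'..<r} s \<partial>weight_measure \<nu>)"
        using r' r by (simp add: Ico_sets_weight_measure v.emeasure_eq_measure flip: ennreal_mult')
      also have "\<dots> = ennreal ?x * (\<integral>\<^sup>+s. ennreal (\<nu> s) * indicator {r'..<r} s \<partial>lebesgue_on {0..<1})"
        using I by (subst nn_integral_weight_measure_density[OF v]) auto
      also have "\<dots> = (\<integral>\<^sup>+s. ennreal ?x * (ennreal (\<nu> s) * indicator {r'..<r} s) \<partial>lebesgue_on {0..<1})"
        by (intro nn_integral_cmult[symmetric]) measurable
      also have "\<dots> \<le> (\<integral>\<^sup>+s. ennreal (\<nu> s / tail \<omega> s powr p * s) * indicator {0..r} s \<partial>lebesgue_on {0..<1})"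
      proof (intro nn_integral_mono)
        fix s
        show "ennreal ?x * (ennreal (\<nu> s) * indicator {r'..<r} s) \<le> ennreal (\<nu> s / tail \<omega> s powr p * s) * indicator {0..r} s"
        proof (cases "s \<in> {r'..<r}")
          case s: True
          then have s': "0 \<le> s" "s < 1" "1/2 \<le> s" "s \<le> r" using r' r True by auto
          have v0: "0 \<le> \<nu> s" by (rule radial_weight_nonneg[OF v s'(1,2)])
          have Ts: "0 < tail \<omega> s" by (rule tail_pos[OF w s'(1,2)])
          have "tail \<omega> s powr p \<le> tail \<omega> r' powr p"
            using s s' r' p Ts tail_antimono[OF w r'(1), of s] by (intro powr_mono2) auto
          then have "\<nu> s / tail \<omega> r' powr p * (1 / 2) \<le> \<nu> s / tail \<omega> s powr p * s"
            using v0 s' Ts T' by (intro mult_mono divide_left_mono mult_pos_pos) auto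
          then have "?x * \<nu> s \<le> \<nu> s / tail \<omega> s powr p * s" by simp
          then show ?thesis using s s' v0 by (simp add: ennreal_mult'[symmetric] ennreal_leI)
        qed simp
      qed
      also have "\<dots> = emeasure (nu_measure p \<omega> \<nu>) {0..r}"
        unfolding nu_measure_def using r sets_lebesgue_on_Icc[of 0 r] nu_density_measurable[OF w v]
        by (intro emeasure_density[symmetric]) auto
      also have "\<dots> = ennreal (nu_mass p \<omega> \<nu> r)" by (rule emeasure_nu(2)[OF p w v M r])
      finally have 1: "?x * measure (weight_measure \<nu>) {r'..<r} \<le> nu_mass p \<omega> \<nu> r"
        using V0 by (simp add: ennreal_le_iff)
      have "(L - 1) * tail \<nu> r \<le> measure (weight_measure \<nu>) {r'..<r}"
        using tail_diff[OF v r'(1,2) r(2)] lo by (simp add: algebra_simps)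
      then have "?x * ((L - 1) * tail \<nu> r) \<le> ?x * measure (weight_measure \<nu>) {r'..<r}"
        using T' by (intro mult_left_mono) auto
      with 1 have 2: "?x * ((L - 1) * tail \<nu> r) \<le> nu_mass p \<omega> \<nu> r" by linarith
      have "tail \<omega> r' powr p \<le> (A * tail \<omega> r) powr p" using TA T' p by (intro powr_mono2) auto
      also have "\<dots> = A powr p * tail \<omega> r powr p" using A(1) T by (simp add: powr_mult)
      finally have 3: "1 / (2 * (A powr p * tail \<omega> r powr p)) \<le> ?x"
        using T T' A(1) by (intro divide_left_mono) auto
      have "e * tail \<nu> r / tail \<omega> r powr p \<le> (L - 1) / (2 * A powr p) * tail \<nu> r / tail \<omega> r powr p"
        using T by (intro divide_right_mono mult_right_mono) (auto simp: e_def)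
      also have "\<dots> = 1 / (2 * (A powr p * tail \<omega> r powr p)) * ((L - 1) * tail \<nu> r)" by simp
      also have "\<dots> \<le> ?x * ((L - 1) * tail \<nu> r)" using 3 L T by (intro mult_right_mono) auto
      also note 2
      finally show ?thesis by simp
    qed
  qed
qed

text \<open>Hoelder's inequality at the radius 1/2 bounds the \<sigma>-mass from below through tail
  \<omega> (1/2) \<ge> m / C and the mass m'. The lower bound for M is what turns the linear norm
  estimate into one with the exponent 2 - 1/p.\<close>

lemma M_lower:
  assumes p: "1 < p" and C: "1 \<le> C" and m: "0 < m" "0 < m'"
  shows "\<exists>e>0. \<forall>\<omega> \<nu> M. radial_weight \<omega> \<longrightarrow> upper_doubling_with C \<omega> \<longrightarrow> tail \<omega> 0 = m \<longrightarrow> radial_weight \<nu> \<longrightarrow>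
    tail \<nu> 0 = m' \<longrightarrow> M_const p \<omega> \<nu> \<le> ennreal M \<longrightarrow> 0 \<le> M \<longrightarrow> e \<le> M"
proof -
  note q = conj_exp_pos[OF p]
  \<comment> \<open>The value of the \<sigma>-mass for which Hoelder's inequality, with m / C and m'
    in place of the tails, is an equality.\<close>
  define s0 where "s0 = ((m / C) powr p / m') powr (1 / (p - 1))"
  have s0: "0 < s0" using m C by (simp add: s0_def)
  show ?thesis
  proof (intro exI[of _ "(s0 / 2) powr (1 / conj_exp p)"] conjI allI impI)
    show "0 < (s0 / 2) powr (1 / conj_exp p)" using s0 by simp
    fix \<omega> \<nu> M
    assume w: "radial_weight \<omega>" and Cw: "upper_doubling_with C \<omega>" and mw: "tail \<omega> 0 = m"
      and v: "radial_weight \<nu>" and mv: "tail \<nu> 0 = m'"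
      and M: "M_const p \<omega> \<nu> \<le> ennreal M" "0 \<le> M"
    let ?S = "sigma_mass p \<omega> \<nu> (1/2)"
    have S: "0 < ?S" by (rule sigma_mass_pos[OF p w v M]) auto
    have "m \<le> C * tail \<omega> (1/2)"
      using Cw bspec[of "{0..<1}" "\<lambda>r. tail \<omega> r \<le> C * tail \<omega> ((1 + r) / 2)" 0] mw
      by (simp add: upper_doubling_with_def)
    then have "m / C \<le> tail \<omega> (1/2)" using C by (simp add: field_simps)
    then have "(m / C) powr p \<le> tail \<omega> (1/2) powr p" using p m C by (intro powr_mono2) auto
    also have "\<dots> \<le> ?S powr (p - 1) * tail \<nu> (1/2)" using S by (intro tail_power_le[OF p w v M]) auto
    also have "\<dots> \<le> ?S powr (p - 1) * m'"
      unfolding mv[symmetric] by (intro mult_left_mono tail_antimono[OF v]) auto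
    finally have "(m / C) powr p / m' \<le> ?S powr (p - 1)" using m by (simp add: field_simps)
    then have "s0 \<le> (?S powr (p - 1)) powr (1 / (p - 1))"
      unfolding s0_def using p m by (intro powr_mono2) auto
    then have "s0 \<le> ?S" using p S by (simp add: powr_powr)
    then have "s0 powr (1 / conj_exp p) \<le> ?S powr (1 / conj_exp p)" using s0 q by (intro powr_mono2) auto
    also have "\<dots> \<le> 2 powr (1 / conj_exp p) * M * (1 + nu_mass p \<omega> \<nu> (1/2)) powr (- (1 / p))"
      by (rule sigma_mass_bound[OF p w v M]) auto
    also have "\<dots> \<le> 2 powr (1 / conj_exp p) * M * 1"
    proof (intro mult_left_mono)
      show "(1 + nu_mass p \<omega> \<nu> (1/2)) powr (- (1 / p)) \<le> 1"
        using powr_mono_neg[of 1 "1 + nu_mass p \<omega> \<nu> (1/2)" "1 / p"] nu_mass_nonneg[OF p w v M] p by simp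
    qed (use M in auto)
    finally show "(s0 / 2) powr (1 / conj_exp p) \<le> M" using s0 by (simp add: powr_divide field_simps)
  qed
qed

lemma epowr_measurable: "(\<lambda>x. epowr x a) \<in> borel_measurable borel"
  unfolding epowr_def by measurable

lemma epowr_add_le:
  assumes "0 < p" shows "epowr (x + y) p \<le> ennreal (2 powr p) * (epowr x p + epowr y p)"
proof -
  have *: "epowr (x + y) p \<le> ennreal (2 powr p) * (epowr x p + epowr y p)" if "x \<le> y" for x y
  proof (cases "y = top")
    case True then show ?thesis by (simp add: epowr_def ennreal_mult_top)
  next
    case False
    have "x + y \<le> ennreal 2 * y" using add_right_mono[OF that, of y] by (simp add: mult_2)
    then have "epowr (x + y) p \<le> epowr (ennreal 2 * y) p" using assms by (intro epowr_mono) auto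
    also have "\<dots> = ennreal (2 powr p) * epowr y p" using assms False by (intro epowr_mult) (auto simp: less_top)
    also have "\<dots> \<le> ennreal (2 powr p) * (epowr x p + epowr y p)" by (intro mult_left_mono) auto
    finally show ?thesis .
  qed
  show ?thesis using *[of x y] *[of y x] by (cases "x \<le> y") (auto simp: add.commute)
qed

text \<open>It suffices to bound the integral T of the moduli: finiteness of its weighted p-th power
  forces T z < top, hence convergence, for almost every z with \<nu> > 0, and T dominates the
  modulus of the operator everywhere.\<close>

lemma max_bergman_bounded_of_nn_bound:
  assumes p: "1 < p" and w: "radial_weight \<omega>" and v: "radial_weight \<nu>" and B: "0 \<le> B"
    and le: "\<And>f. f \<in> borel_measurable disc_area \<Longrightarrow>
      (\<integral>\<^sup>+z. ennreal (\<nu> (cmod z)) * epowr (\<integral>\<^sup>+\<zeta>. ennreal (cmod (f \<zeta>) * \<omega> (cmod \<zeta>)) * ennreal (cmod (bergman_kernel \<omega> z \<zeta>)) \<partial>disc_area) p \<partial>disc_area)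
      \<le> ennreal (B powr p) * (\<integral>\<^sup>+z. ennreal (cmod (f z) powr p * \<nu> (cmod z)) \<partial>disc_area)"
  shows "max_bergman_bounded_by p \<omega> \<nu> B"
  unfolding max_bergman_bounded_by_def
proof (intro conjI ballI)
  show "0 \<le> B" by fact
  fix f assume f: "f \<in> Lp_space p \<nu>"
  interpret d: finite_measure disc_area by (rule finite_measure_disc_area)
  interpret pair_sigma_finite disc_area disc_area ..
  note idm [measurable] = id_measurable_disc_area
  have comp: "(\<lambda>z. g (cmod z)) \<in> borel_measurable disc_area" if "g \<in> borel_measurable (lebesgue_on {0..<1})" for g :: "real \<Rightarrow> real"
    by (rule measurable_compose[OF measurable_cmod]) (use that in \<open>simp add: measurable_radial_iff\<close>)
  have fm [measurable]: "f \<in> borel_measurable disc_area" using f by (simp add: Lp_space_def)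
  note [measurable] = comp[OF radial_weight_measurable[OF w]] comp[OF radial_weight_measurable[OF v]]
  have im [measurable]: "(\<lambda>(z, \<zeta>). max_bergman_integrand \<omega> f z \<zeta>) \<in> borel_measurable (disc_area \<Otimes>\<^sub>M disc_area)"
    unfolding max_bergman_integrand_def by measurable
  define If where "If = (\<integral>\<^sup>+z. ennreal (cmod (f z) powr p * \<nu> (cmod z)) \<partial>disc_area)"
  have If: "If < top"
  proof (rule ccontr)
    assume "\<not> If < top"
    then have "Lp_norm p \<nu> f = top" by (simp add: Lp_norm_def If_def epowr_def less_top)
    then show False using f by (simp add: Lp_space_def)
  qed
  define T where "T z = (\<integral>\<^sup>+\<zeta>. ennreal (cmod (f \<zeta>) * \<omega> (cmod \<zeta>)) * ennreal (cmod (bergman_kernel \<omega> z \<zeta>)) \<partial>disc_area)" for z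
  have Tm [measurable]: "T \<in> borel_measurable disc_area" unfolding T_def by measurable
  have Tpm [measurable]: "(\<lambda>z. epowr (T z) p) \<in> borel_measurable disc_area"
    by (rule measurable_compose[OF Tm epowr_measurable])
  have TB: "(\<integral>\<^sup>+z. ennreal (\<nu> (cmod z)) * epowr (T z) p \<partial>disc_area) \<le> ennreal (B powr p) * If"
    unfolding T_def If_def by (rule le[OF fm])
  have Tn: "T z = (\<integral>\<^sup>+\<zeta>. ennreal (norm (max_bergman_integrand \<omega> f z \<zeta>)) \<partial>disc_area)" for z
    unfolding T_def max_bergman_integrand_def using radial_weight_nonneg[OF w]
    by (intro nn_integral_cong) (auto simp: norm_mult ennreal_mult mult_ac)
  have im1: "max_bergman_integrand \<omega> f z \<in> borel_measurable disc_area" for z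
    unfolding max_bergman_integrand_def by measurable
  have "(\<integral>\<^sup>+z. ennreal (\<nu> (cmod z)) * epowr (T z) p \<partial>disc_area) < top"
    using TB If by (auto intro: le_less_trans simp: ennreal_mult_less_top)
  then have "AE z in disc_area. ennreal (\<nu> (cmod z)) * epowr (T z) p \<noteq> \<infinity>"
    by (intro nn_integral_PInf_AE) auto
  then show "AE z in disc_area. 0 < \<nu> (cmod z) \<longrightarrow> integrable disc_area (max_bergman_integrand \<omega> f z)"
  proof (rule AE_mp[OF _ AE_I2], intro impI)
    fix z assume "ennreal (\<nu> (cmod z)) * epowr (T z) p \<noteq> \<infinity>" "0 < \<nu> (cmod z)"
    then have "T z < top" by (auto simp: epowr_def ennreal_mult_top less_top split: if_splits)
    then show "integrable disc_area (max_bergman_integrand \<omega> f z)"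
      using im1 by (intro integrableI_bounded) (simp_all add: Tn)
  qed
  have Pm: "max_bergman \<omega> f \<in> borel_measurable disc_area"
    unfolding max_bergman_def by (rule d.borel_measurable_lebesgue_integral) measurable
  have PT: "ennreal (cmod (max_bergman \<omega> f z)) \<le> T z" for z
  proof (cases "integrable disc_area (max_bergman_integrand \<omega> f z)")
    case True
    show ?thesis unfolding max_bergman_def Tn by (rule integral_norm_bound_ennreal[OF True])
  next
    \<comment> \<open>Where the integral does not converge, the operator has the default value 0,
      which T dominates as well.\<close>
    case False
    then show ?thesis unfolding max_bergman_def by (simp add: not_integrable_integral_eq)
  qed
  have "(\<integral>\<^sup>+z. ennreal (cmod (max_bergman \<omega> f z) powr p * \<nu> (cmod z)) \<partial>disc_area)
      \<le> (\<integral>\<^sup>+z. ennreal (\<nu> (cmod z)) * epowr (T z) p \<partial>disc_area)"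
  proof (rule nn_integral_mono)
    fix z assume z: "z \<in> space disc_area"
    have "ennreal (cmod (max_bergman \<omega> f z) powr p) = epowr (ennreal (cmod (max_bergman \<omega> f z))) p"
      by (simp add: epowr_ennreal)
    also have "\<dots> \<le> epowr (T z) p" using PT p by (intro epowr_mono) auto
    finally have "ennreal (\<nu> (cmod z)) * ennreal (cmod (max_bergman \<omega> f z) powr p) \<le> ennreal (\<nu> (cmod z)) * epowr (T z) p"
      by (intro mult_left_mono) auto
    then show "ennreal (cmod (max_bergman \<omega> f z) powr p * \<nu> (cmod z)) \<le> ennreal (\<nu> (cmod z)) * epowr (T z) p"
      using z radial_weight_nonneg[OF v] by (simp add: ennreal_mult mult.commute)
  qed
  also note TB
  finally have "epowr (\<integral>\<^sup>+z. ennreal (cmod (max_bergman \<omega> f z) powr p * \<nu> (cmod z)) \<partial>disc_area) (1 / p)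
      \<le> epowr (ennreal (B powr p) * If) (1 / p)"
    using p by (intro epowr_mono) auto
  also have "\<dots> = ennreal B * Lp_norm p \<nu> f"
    using p B If by (subst epowr_mult) (auto simp: powr_powr Lp_norm_def If_def)
  finally show le: "Lp_norm p \<nu> (max_bergman \<omega> f) \<le> ennreal B * Lp_norm p \<nu> f" by (simp add: Lp_norm_def)
  have "Lp_norm p \<nu> f < top" using f by (simp add: Lp_space_def)
  then have "ennreal B * Lp_norm p \<nu> f < top" by (simp add: ennreal_mult_less_top)
  with le have "Lp_norm p \<nu> (max_bergman \<omega> f) < top" by (rule le_less_trans)
  then show "max_bergman \<omega> f \<in> Lp_space p \<nu>" using Pm by (simp add: Lp_space_def)
qed

text \<open>The two Schur estimates are combined by (x + y)^p \<le> 2^p (x^p + y^p); the p-th root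
  of the result is linear in M. Here M is any positive real bound for \<open>M_const\<close>, so
  that its powers are ordinary real powers.\<close>

lemma max_bergman_bounded_by_M:
  assumes p: "1 < p"
  shows "\<exists>c>0. \<forall>\<omega> \<nu> M. D_class_with C K L m \<omega> \<longrightarrow> D_class_with C' K' L' m' \<nu> \<longrightarrow> M_const p \<omega> \<nu> \<le> ennreal M \<longrightarrow> 0 < M \<longrightarrow>
    max_bergman_bounded_by p \<omega> \<nu> (c * M)"
proof (cases "(\<exists>\<omega>. D_class_with C K L m \<omega>) \<and> (\<exists>\<nu>. D_class_with C' K' L' m' \<nu>)")
  \<comment> \<open>No pair of weights has these data. Otherwise the witnesses supply 1 \<le> C, 1 <
    K', 1 < L' and positive masses before the constants are chosen.\<close>
  case False
  then show ?thesis by (intro exI[of _ 1]) auto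
next
  case True
  then obtain \<omega>\<^sub>0 \<nu>\<^sub>0 where D0: "D_class_with C K L m \<omega>\<^sub>0" "D_class_with C' K' L' m' \<nu>\<^sub>0" by blast
  have C: "1 \<le> C" and K': "1 < K'" "1 < L'" and m: "0 < m" "0 < m'"
    using D0 tail_pos[of \<omega>\<^sub>0 0] tail_pos[of \<nu>\<^sub>0 0]
    by (auto simp: D_class_with_def upper_doubling_with_def lower_doubling_with_def)
  obtain c where c: "0 < c" "\<And>\<omega> x. radial_weight \<omega> \<Longrightarrow> upper_doubling_with C \<omega> \<Longrightarrow> lower_doubling_with K L \<omega> \<Longrightarrow>
      0 \<le> x \<Longrightarrow> x < 1 \<Longrightarrow> kernel_mean \<omega> x \<le> c / tail \<omega> x"
    using kernel_mean_upper[of C \<omega>\<^sub>0 K L] D0(1) unfolding D_class_with_def by blast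
  obtain A where A: "1 \<le> A" "\<And>\<omega> r t. radial_weight \<omega> \<Longrightarrow> upper_doubling_with C \<omega> \<Longrightarrow> 0 \<le> r \<Longrightarrow> r < 1 \<Longrightarrow> 0 \<le> t \<Longrightarrow> t < 1 \<Longrightarrow>
      1 - r \<le> K' * (1 - t) \<Longrightarrow> tail \<omega> r \<le> A * tail \<omega> t"
    using upper_doubling_ratio[of C K'] by blast
  obtain e where e: "0 < e" "\<And>\<omega> \<nu> M r. radial_weight \<omega> \<Longrightarrow> upper_doubling_with C \<omega> \<Longrightarrow> tail \<omega> 0 = m \<Longrightarrow> radial_weight \<nu> \<Longrightarrow>
    lower_doubling_with K' L' \<nu> \<Longrightarrow> tail \<nu> 0 = m' \<Longrightarrow> M_const p \<omega> \<nu> \<le> ennreal M \<Longrightarrow> 0 \<le> M \<Longrightarrow> 0 \<le> r \<Longrightarrow> r < 1 \<Longrightarrow>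
    e * tail \<nu> r / tail \<omega> r powr p \<le> 1 + nu_mass p \<omega> \<nu> r"
    using nu_mass_lower[OF p C K' m] by blast
  define \<gamma> where "\<gamma> = conj_exp p / (2 * p)"
  define B1 where "B1 = (c * layer_const (1 / p) * 2 powr (1 / conj_exp p)) powr (p - 1)
          * (2 * c * layer_const (1 / conj_exp p) * 2 powr (1 / conj_exp p))"
  define B2 where "B2 = (c * (2 * e powr (- (2 * \<gamma>)) * A powr conj_exp p / (1 - L' powr (- \<gamma>)))) powr (p - 1) * (2 * c * layer_const (1 / 2))"
  define B where "B = 2 powr p * (B1 + B2)"
  have B12: "0 < B1" "0 \<le> B2"
  proof -
    have "0 < layer_const (1 / p)" "0 < layer_const (1 / conj_exp p)" "0 < layer_const (1 / 2)"
      using p conj_exp_pos[OF p] by (auto intro!: layer_const_pos)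
    then show "0 < B1" "0 \<le> B2" using c by (auto simp: B1_def B2_def)
  qed
  have B: "0 < B" using B12 by (simp add: B_def)
  show ?thesis
  proof (intro exI[of _ "B powr (1 / p)"] conjI allI impI)
    show "0 < B powr (1 / p)" using B by simp
    fix \<omega> \<nu> M
    assume Dw: "D_class_with C K L m \<omega>" and Dv: "D_class_with C' K' L' m' \<nu>"
      and M: "M_const p \<omega> \<nu> \<le> ennreal M" "0 < M"
    have w: "radial_weight \<omega>" "upper_doubling_with C \<omega>" "lower_doubling_with K L \<omega>" "tail \<omega> 0 = m"
      and v: "radial_weight \<nu>" "lower_doubling_with K' L' \<nu>" "tail \<nu> 0 = m'"
      using Dw Dv by (auto simp: D_class_with_def)
    show "max_bergman_bounded_by p \<omega> \<nu> (B powr (1 / p) * M)"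
    proof (rule max_bergman_bounded_of_nn_bound[OF p w(1) v(1)])
      show "0 \<le> B powr (1 / p) * M" using M by simp
      fix f :: "complex \<Rightarrow> complex" assume f [measurable]: "f \<in> borel_measurable disc_area"
      interpret d: finite_measure disc_area by (rule finite_measure_disc_area)
      note idm [measurable] = id_measurable_disc_area
      have comp: "(\<lambda>z. g (cmod z)) \<in> borel_measurable disc_area" if "g \<in> borel_measurable (lebesgue_on {0..<1})" for g :: "real \<Rightarrow> real"
        by (rule measurable_compose[OF measurable_cmod]) (use that in \<open>simp add: measurable_radial_iff\<close>)
      note [measurable] = comp[OF radial_weight_measurable[OF w(1)]] comp[OF radial_weight_measurable[OF v(1)]]
      let ?If = "\<integral>\<^sup>+z. ennreal (cmod (f z) powr p * \<nu> (cmod z)) \<partial>disc_area"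
      define I where "I R z = (\<integral>\<^sup>+\<zeta>. ennreal (cmod (f \<zeta>) * \<omega> (cmod \<zeta>))
          * (ennreal (cmod (bergman_kernel \<omega> z \<zeta>)) * indicator R (cmod z, cmod \<zeta>)) \<partial>disc_area)" for R :: "(real \<times> real) set" and z
      let ?R1 = "{(r, s). r \<le> s} :: (real \<times> real) set" and ?R2 = "{(r, s). s < r} :: (real \<times> real) set"
      have Rm [measurable]: "?R1 \<in> sets (borel \<Otimes>\<^sub>M borel)" "?R2 \<in> sets (borel \<Otimes>\<^sub>M borel)"
      proof -
        have "{x \<in> space (borel \<Otimes>\<^sub>M borel). fst x \<le> (snd x :: real)} \<in> sets (borel \<Otimes>\<^sub>M borel)"
          "{x \<in> space (borel \<Otimes>\<^sub>M borel). snd x < (fst x :: real)} \<in> sets (borel \<Otimes>\<^sub>M borel)" by measurable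
        moreover have "{x \<in> space (borel \<Otimes>\<^sub>M borel). fst x \<le> (snd x :: real)} = ?R1"
          "{x \<in> space (borel \<Otimes>\<^sub>M borel). snd x < (fst x :: real)} = ?R2" by (auto simp: space_pair_measure)
        ultimately show "?R1 \<in> sets (borel \<Otimes>\<^sub>M borel)" "?R2 \<in> sets (borel \<Otimes>\<^sub>M borel)" by simp_all
      qed
      have Im: "I R \<in> borel_measurable disc_area" if [measurable]: "R \<in> sets (borel \<Otimes>\<^sub>M borel)" for R
        unfolding I_def by measurable
      have Ip [measurable]: "(\<lambda>z. epowr (I ?R1 z) p) \<in> borel_measurable disc_area" "(\<lambda>z. epowr (I ?R2 z) p) \<in> borel_measurable disc_area"
        by (rule measurable_compose[OF Im[OF Rm(1)] epowr_measurable], rule measurable_compose[OF Im[OF Rm(2)] epowr_measurable])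
      have split: "(\<integral>\<^sup>+\<zeta>. ennreal (cmod (f \<zeta>) * \<omega> (cmod \<zeta>)) * ennreal (cmod (bergman_kernel \<omega> z \<zeta>)) \<partial>disc_area) = I ?R1 z + I ?R2 z"
        if z: "z \<in> space disc_area" for z
        unfolding I_def by (subst nn_integral_add[symmetric]) (auto intro!: nn_integral_cong split: split_indicator)
      have o: "(\<integral>\<^sup>+z. ennreal (\<nu> (cmod z)) * epowr (I ?R1 z) p \<partial>disc_area) \<le> ennreal (B1 * M powr p) * ?If"
        unfolding I_def B1_def by (rule Schur_outer[OF p w(1) v(1) M c(1) c(2)[OF w(1,2,3)] f])
      have i: "(\<integral>\<^sup>+z. ennreal (\<nu> (cmod z)) * epowr (I ?R2 z) p \<partial>disc_area) \<le> ennreal (B2 * M powr p) * ?If"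
        unfolding I_def B2_def \<gamma>_def
        by (rule Schur_inner[OF p w(1) v(1) M c(1) c(2)[OF w(1,2,3)] A(1) A(2)[OF w(1,2)] v(2) e(1) e(2)[OF w(1,2,4) v M(1) less_imp_le[OF M(2)]] f])
      have "(\<integral>\<^sup>+z. ennreal (\<nu> (cmod z)) * epowr (\<integral>\<^sup>+\<zeta>. ennreal (cmod (f \<zeta>) * \<omega> (cmod \<zeta>)) * ennreal (cmod (bergman_kernel \<omega> z \<zeta>)) \<partial>disc_area) p \<partial>disc_area)
          \<le> (\<integral>\<^sup>+z. ennreal (2 powr p) * (ennreal (\<nu> (cmod z)) * epowr (I ?R1 z) p + ennreal (\<nu> (cmod z)) * epowr (I ?R2 z) p) \<partial>disc_area)"
      proof (rule nn_integral_mono)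
        fix z assume z: "z \<in> space disc_area"
        have "ennreal (\<nu> (cmod z)) * epowr (I ?R1 z + I ?R2 z) p \<le> ennreal (\<nu> (cmod z)) * (ennreal (2 powr p) * (epowr (I ?R1 z) p + epowr (I ?R2 z) p))"
          using p by (intro mult_left_mono epowr_add_le) auto
        also have "\<dots> = ennreal (2 powr p) * (ennreal (\<nu> (cmod z)) * epowr (I ?R1 z) p + ennreal (\<nu> (cmod z)) * epowr (I ?R2 z) p)"
          by (simp add: distrib_left mult_ac)
        finally show "ennreal (\<nu> (cmod z)) * epowr (\<integral>\<^sup>+\<zeta>. ennreal (cmod (f \<zeta>) * \<omega> (cmod \<zeta>)) * ennreal (cmod (bergman_kernel \<omega> z \<zeta>)) \<partial>disc_area) p \<le> \<dots>"
          unfolding split[OF z] .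
      qed
      also have "\<dots> = ennreal (2 powr p) * (\<integral>\<^sup>+z. ennreal (\<nu> (cmod z)) * epowr (I ?R1 z) p + ennreal (\<nu> (cmod z)) * epowr (I ?R2 z) p \<partial>disc_area)"
        by (intro nn_integral_cmult) measurable
      also have "\<dots> = ennreal (2 powr p) * ((\<integral>\<^sup>+z. ennreal (\<nu> (cmod z)) * epowr (I ?R1 z) p \<partial>disc_area) + (\<integral>\<^sup>+z. ennreal (\<nu> (cmod z)) * epowr (I ?R2 z) p \<partial>disc_area))"
        by (subst nn_integral_add) auto
      also have "\<dots> \<le> ennreal (2 powr p) * (ennreal (B1 * M powr p) * ?If + ennreal (B2 * M powr p) * ?If)"
        by (intro mult_left_mono add_mono o i) auto
      also have "\<dots> = ennreal (2 powr p) * (ennreal (B1 * M powr p) + ennreal (B2 * M powr p)) * ?If"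
        by (simp add: distrib_right mult.assoc)
      also have "ennreal (2 powr p) * (ennreal (B1 * M powr p) + ennreal (B2 * M powr p)) = ennreal (2 powr p * (B1 * M powr p + B2 * M powr p))"
        using B12 by (subst ennreal_plus[symmetric]) (auto simp: ennreal_mult')
      also have "2 powr p * (B1 * M powr p + B2 * M powr p) = (B powr (1 / p) * M) powr p"
        using B M p by (simp add: powr_mult powr_powr B_def algebra_simps)
      finally show "(\<integral>\<^sup>+z. ennreal (\<nu> (cmod z)) * epowr (\<integral>\<^sup>+\<zeta>. ennreal (cmod (f \<zeta>) * \<omega> (cmod \<zeta>)) * ennreal (cmod (bergman_kernel \<omega> z \<zeta>)) \<partial>disc_area) p \<partial>disc_area)
        \<le> ennreal ((B powr (1 / p) * M) powr p) * ?If" .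
    qed
  qed
qed

text \<open>The order matters. Upper doubling of \<omega>, assumed or obtained from that of \<nu>,
  provides the bounds for moments and kernel means on which the other three conditions rest; lower
  doubling of \<nu> also uses that of \<omega>.\<close>

lemma max_bergman_bounded_imp_D_class:
  assumes p: "1 < p" and w: "radial_weight \<omega>" and v: "radial_weight \<nu>" and D: "\<omega> \<in> D_hat \<or> \<nu> \<in> D_hat"
    and N: "max_bergman_bounded_by p \<omega> \<nu> N"
  shows "\<omega> \<in> D_class" "\<nu> \<in> D_class"
proof -
  obtain C where C: "upper_doubling_with C \<omega>"
    using D upper_doubling_omega[OF p w v N] unfolding D_hat_def by blast
  obtain K L where KL: "lower_doubling_with K L \<omega>" using lower_doubling_omega[OF p w v N C] by blast
  obtain C' where C': "upper_doubling_with C' \<nu>" using upper_doubling_nu[OF p w v N C] by blast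
  obtain K' L' where KL': "lower_doubling_with K' L' \<nu>" using lower_doubling_nu[OF p w v N C KL] by blast
  show "\<omega> \<in> D_class" "\<nu> \<in> D_class"
    using w v C C' KL KL' by (auto simp: D_class_def D_hat_def D_check_def)
qed

lemma M_const_finite:
  assumes p: "1 < p" and w: "radial_weight \<omega>" "upper_doubling_with C \<omega>" and v: "radial_weight \<nu>" "upper_doubling_with C' \<nu>"
    and N: "max_bergman_bounded_by p \<omega> \<nu> N"
  shows "M_const p \<omega> \<nu> < top"
proof -
  obtain c where "M_const p \<omega> \<nu> \<le> ennreal (c * N)"
    using M_const_le_norm[OF p, of C C' "tail \<omega> 0" "tail \<nu> 0"] w v N by blast
  then show ?thesis by (rule le_less_trans) simp
qed

theorem theorem21:
  fixes p :: real
  assumes "1 < p"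
  shows "(\<forall>\<omega> \<nu>. radial_weight \<omega> \<longrightarrow> radial_weight \<nu> \<longrightarrow> \<omega> \<in> D_hat \<or> \<nu> \<in> D_hat \<longrightarrow>
            (max_bergman_bounded p \<omega> \<nu> \<longleftrightarrow>
               M_const p \<omega> \<nu> < top \<and> \<omega> \<in> D_class \<and> \<nu> \<in> D_class)) \<and>
         (\<forall>C\<^sub>\<omega> K\<^sub>\<omega> L\<^sub>\<omega> m\<^sub>\<omega> C\<^sub>\<nu> K\<^sub>\<nu> L\<^sub>\<nu> m\<^sub>\<nu>. \<exists>c>0. \<forall>\<omega> \<nu>.
            D_class_with C\<^sub>\<omega> K\<^sub>\<omega> L\<^sub>\<omega> m\<^sub>\<omega> \<omega> \<longrightarrow> D_class_with C\<^sub>\<nu> K\<^sub>\<nu> L\<^sub>\<nu> m\<^sub>\<nu> \<nu> \<longrightarrow>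
            max_bergman_bounded p \<omega> \<nu> \<longrightarrow>
              M_const p \<omega> \<nu> \<le> ennreal c * max_bergman_norm p \<omega> \<nu> \<and>
              max_bergman_norm p \<omega> \<nu> \<le> ennreal c * epowr (M_const p \<omega> \<nu>) (2 - 1 / p))"
proof (intro conjI allI impI)
  note p = assms
  fix \<omega> \<nu>
  assume w: "radial_weight \<omega>" and v: "radial_weight \<nu>" and D: "\<omega> \<in> D_hat \<or> \<nu> \<in> D_hat"
  show "max_bergman_bounded p \<omega> \<nu> \<longleftrightarrow> M_const p \<omega> \<nu> < top \<and> \<omega> \<in> D_class \<and> \<nu> \<in> D_class"
  proof
    assume "max_bergman_bounded p \<omega> \<nu>"
    then obtain N where N: "max_bergman_bounded_by p \<omega> \<nu> N" by (auto simp: max_bergman_bounded_def)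
    note Dw = max_bergman_bounded_imp_D_class[OF p w v D N]
    then obtain C C' where "upper_doubling_with C \<omega>" "upper_doubling_with C' \<nu>"
      by (auto simp: D_class_def D_hat_def)
    then show "M_const p \<omega> \<nu> < top \<and> \<omega> \<in> D_class \<and> \<nu> \<in> D_class"
      using Dw M_const_finite[OF p w _ v _ N] by blast
  next
    assume *: "M_const p \<omega> \<nu> < top \<and> \<omega> \<in> D_class \<and> \<nu> \<in> D_class"
    then obtain C K L C' K' L' where "upper_doubling_with C \<omega>" "lower_doubling_with K L \<omega>"
      "upper_doubling_with C' \<nu>" "lower_doubling_with K' L' \<nu>"
      by (auto simp: D_class_def D_hat_def D_check_def)
    then have DD: "D_class_with C K L (tail \<omega> 0) \<omega>" "D_class_with C' K' L' (tail \<nu> 0) \<nu>"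
      using w v by (auto simp: D_class_with_def)
    \<comment> \<open>Adding 1 provides a positive real bound, as the sufficiency estimate
      requires.\<close>
    have "M_const p \<omega> \<nu> \<le> ennreal (enn2real (M_const p \<omega> \<nu>) + 1)"
      using * by (cases "M_const p \<omega> \<nu>") (auto intro: ennreal_leI)
    moreover have "0 < enn2real (M_const p \<omega> \<nu>) + 1" by (simp add: add_nonneg_pos)
    ultimately show "max_bergman_bounded p \<omega> \<nu>"
      using max_bergman_bounded_by_M[OF p, of C K L "tail \<omega> 0" C' K' L' "tail \<nu> 0"] DD
      unfolding max_bergman_bounded_def by blast
  qed
next
  note p = assms
  fix C K L m C' K' L' m'
  show "\<exists>c>0. \<forall>\<omega> \<nu>. D_class_with C K L m \<omega> \<longrightarrow> D_class_with C' K' L' m' \<nu> \<longrightarrow> max_bergman_bounded p \<omega> \<nu> \<longrightarrow>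
              M_const p \<omega> \<nu> \<le> ennreal c * max_bergman_norm p \<omega> \<nu> \<and>
              max_bergman_norm p \<omega> \<nu> \<le> ennreal c * epowr (M_const p \<omega> \<nu>) (2 - 1 / p)"
  proof (cases "(\<exists>\<omega>. D_class_with C K L m \<omega>) \<and> (\<exists>\<nu>. D_class_with C' K' L' m' \<nu>)")
    case False
    then show ?thesis by (intro exI[of _ 1]) auto
  next
    case True
    then obtain \<omega>\<^sub>0 \<nu>\<^sub>0 where D0: "D_class_with C K L m \<omega>\<^sub>0" "D_class_with C' K' L' m' \<nu>\<^sub>0" by blast
    have C: "1 \<le> C" and m: "0 < m" "0 < m'"
      using D0 tail_pos[of \<omega>\<^sub>0 0] tail_pos[of \<nu>\<^sub>0 0]
      by (auto simp: D_class_with_def upper_doubling_with_def)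
    obtain c1 where c1: "0 < c1" "\<And>\<omega> \<nu> N. radial_weight \<omega> \<Longrightarrow> radial_weight \<nu> \<Longrightarrow> upper_doubling_with C \<omega> \<Longrightarrow> upper_doubling_with C' \<nu> \<Longrightarrow>
        tail \<omega> 0 = m \<Longrightarrow> tail \<nu> 0 = m' \<Longrightarrow> max_bergman_bounded_by p \<omega> \<nu> N \<Longrightarrow> M_const p \<omega> \<nu> \<le> ennreal (c1 * N)"
      using M_const_le_norm[OF p, of C C' m m'] by blast
    obtain c2 where c2: "0 < c2" "\<And>\<omega> \<nu> M. D_class_with C K L m \<omega> \<Longrightarrow> D_class_with C' K' L' m' \<nu> \<Longrightarrow> M_const p \<omega> \<nu> \<le> ennreal M \<Longrightarrow> 0 < M \<Longrightarrow>
        max_bergman_bounded_by p \<omega> \<nu> (c2 * M)"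
      using max_bergman_bounded_by_M[OF p, of C K L m C' K' L' m'] by blast
    obtain e where e: "0 < e" "\<And>\<omega> \<nu> M. radial_weight \<omega> \<Longrightarrow> upper_doubling_with C \<omega> \<Longrightarrow> tail \<omega> 0 = m \<Longrightarrow> radial_weight \<nu> \<Longrightarrow>
        tail \<nu> 0 = m' \<Longrightarrow> M_const p \<omega> \<nu> \<le> ennreal M \<Longrightarrow> 0 \<le> M \<Longrightarrow> e \<le> M"
      using M_lower[OF p C m] by blast
    \<comment> \<open>Since M \<ge> e, M is at most e^(-(1 - 1/p)) M^(2 - 1/p); this factor converts
      the linear upper bound c2 M.\<close>
    define c where "c = c1 + c2 * e powr (- (1 - 1 / p))"
    have c: "0 < c" "c1 \<le> c" "c2 * e powr (- (1 - 1 / p)) \<le> c" using c1 c2 e by (auto simp: c_def add_pos_pos)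
    show ?thesis
    proof (intro exI[of _ c] conjI c(1) allI impI)
      fix \<omega> \<nu>
      assume Dw: "D_class_with C K L m \<omega>" and Dv: "D_class_with C' K' L' m' \<nu>" and b: "max_bergman_bounded p \<omega> \<nu>"
      have w: "radial_weight \<omega>" "upper_doubling_with C \<omega>" "tail \<omega> 0 = m"
        and v: "radial_weight \<nu>" "upper_doubling_with C' \<nu>" "tail \<nu> 0 = m'"
        using Dw Dv by (auto simp: D_class_with_def)
      have fin: "M_const p \<omega> \<nu> < top"
        using b M_const_finite[OF p w(1,2) v(1,2)] by (auto simp: max_bergman_bounded_def)
      then obtain M where M: "M_const p \<omega> \<nu> = ennreal M" "0 \<le> M" by (cases "M_const p \<omega> \<nu>") auto
      have eM: "e \<le> M" using M w v by (intro e(2)) auto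
      then have M0: "0 < M" using e(1) by linarith
      \<comment> \<open>The norm is an infimum over admissible bounds N, so the lower estimate is
        divided by c and proved for each N separately.\<close>
      have "ennreal (M / c) \<le> max_bergman_norm p \<omega> \<nu>"
        unfolding max_bergman_norm_def
      proof (rule INF_greatest)
        fix N assume "N \<in> {N. max_bergman_bounded_by p \<omega> \<nu> N}"
        then have N: "max_bergman_bounded_by p \<omega> \<nu> N" by simp
        then have N0: "0 \<le> N" by (simp add: max_bergman_bounded_by_def)
        have "ennreal M \<le> ennreal (c1 * N)" using c1(2)[OF w(1) v(1) w(2) v(2) w(3) v(3) N] M by simp
        then have "M \<le> c1 * N" using c1(1) N0 by (simp add: ennreal_le_iff)
        also have "\<dots> \<le> c * N" using c N0 by (intro mult_right_mono) auto
        finally show "ennreal (M / c) \<le> ennreal N" using c by (intro ennreal_leI) (simp add: field_simps)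
      qed
      then have "ennreal c * ennreal (M / c) \<le> ennreal c * max_bergman_norm p \<omega> \<nu>" by (intro mult_left_mono) auto
      moreover have "ennreal c * ennreal (M / c) = ennreal M"
        using c M0 by (simp add: ennreal_mult[symmetric])
      ultimately show "M_const p \<omega> \<nu> \<le> ennreal c * max_bergman_norm p \<omega> \<nu>" by (simp add: M)
      have "max_bergman_bounded_by p \<omega> \<nu> (c2 * M)" using M M0 by (intro c2(2) Dw Dv) auto
      then have "max_bergman_norm p \<omega> \<nu> \<le> ennreal (c2 * M)"
        unfolding max_bergman_norm_def by (intro INF_lower) simp
      also have "c2 * M \<le> c * M powr (2 - 1 / p)"
      proof -
        have "M = M powr (- (1 - 1 / p)) * M powr (2 - 1 / p)" using M0 by (simp add: powr_add[symmetric])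
        also have "\<dots> \<le> e powr (- (1 - 1 / p)) * M powr (2 - 1 / p)"
          using e(1) eM p by (intro mult_right_mono powr_mono_neg) auto
        finally have "c2 * M \<le> c2 * (e powr (- (1 - 1 / p)) * M powr (2 - 1 / p))" using c2 by (intro mult_left_mono) auto
        also have "\<dots> \<le> c * M powr (2 - 1 / p)" unfolding mult.assoc[symmetric] using c by (intro mult_right_mono) auto
        finally show ?thesis .
      qed
      then have "ennreal (c2 * M) \<le> ennreal (c * M powr (2 - 1 / p))" by (rule ennreal_leI)
      also have "\<dots> = ennreal c * epowr (M_const p \<omega> \<nu>) (2 - 1 / p)"
        using c M by (simp add: ennreal_mult epowr_ennreal)
      finally show "max_bergman_norm p \<omega> \<nu> \<le> ennreal c * epowr (M_const p \<omega> \<nu>) (2 - 1 / p)" .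
    qed
  qed
qed

end
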